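(* Let $G$ be a topological groupoid with Haar system $\lambda$, let $H$ be a closed wide subgroupoid of $G$, and let $\mu$ be a full equivariant measure system on $G/H$. Then $G/H$ admits a topological invariant mean (with respect to $\mu$) if and only if $G/H$ admits a topological approximate invariant density (with respect to $\mu$).
   Context: **Groupoids.** All groupoids are second countable, locally compact and Hausdorff topological groupoids. $G^0$ is the unit space, $r,d:G\to G^0$ are the range and domain maps, $x,y$ are composable iff $d(x)=r(y)$. $\lambda=\{\lambda^u\}_{u\in G^0}$ is a (left) Haar system on $G$, and $\lambda(f)(u)=\int_G f\,d\lambda^u$ for $f\in C_c(G)$. A subgroupoid $H\subseteq G$ is wide if it contains $G^0$; the closed wide subgroupoid $H$ is assumed to carry a Haar system $\lambda_H$. **The quotient $G/H$.** $G/H$ is the quotient of $G$ by $l\sim g\iff r(l)=r(g)$ and $l^{-1}g\in H$, with the quotient topology (locally compact Hausdorff). Put $r_{G^0}(xH)=r(x)$; $G$ acts on the left by $g\cdot xH=(gx)H$ when $d(g)=r(x)$. A full equivariant measure system $\mu=\{\mu^u\}_{u\in G^0}$ on $G/H$ is a family of positive Radon measures on $G/H$ with (i) $\operatorname{supp}\mu^u=r_{G^0}^{-1}(u)$; (ii) $u\mapsto\int f\,d\mu^u$ continuous for all $f\in C_c(G/H)$; (iii) $\int f(\gamma\cdot\omega)\,d\mu^{d(\gamma)}(\omega)=\int f(\omega)\,d\mu^{r(\gamma)}(\omega)$ for all $\gamma\in G$, $f\in C_c(G/H)$. **The space $\mathcal E$.** $\mathcal E=C_0(G^0,L^1(G/H,\mu))$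 is the completion of $C_c(G/H)$ in the norm $\|f\|_{\mu,1}=\sup_{u\in G^0}\int_{G/H}|f(\omega)|\,d\mu^u(\omega)$. For $f\in C_c(G)$, $L(f)$ is the bounded operator on $\mathcal E$ extending $L(f)\phi(xH)=\int_G f(y)\phi(y^{-1}xH)\,d\lambda^{r(x)}(y)$, $\phi\in C_c(G/H)$. The dual $\mathcal E^*$ is identified with the space of $\mu$-bounded complex Radon measures on $G/H$; $\nu\ge0$ refers to positivity of the measure. For $m\in\mathcal E^{**}$, $f*m$ is the image of $m$ under the double transpose of $L(f)$. For $k\in C_0(G^0)$, $\nu\in\mathcal E^*$, $m\in\mathcal E^{**}$, $g\in\mathcal E$: $(kg)(\omega)=k(r_{G^0}(\omega))g(\omega)$, $\langle k\cdot\nu,g\rangle=\nu(kg)$, $\langle k\cdot m,\nu\rangle=m(k\cdot\nu)$. For a probability measure $\eta$ on $G^0$, $\eta\circ\mu\in\mathcal E^*$ is given by $(\eta\circ\mu)(g)=\int_{G^0}\int_{G/H}g\,d\mu^u\,d\eta(u)$. **Topological invariant mean.** A topological invariant mean on $G/H$ with respect to $\mu$ is an element $m\in\mathcal E^{**}$ such that (1) $m(\nu)\ge0$ whenever $\nu\ge0$; (2) $m(\eta\circ\mu)=1$ for every probability measure $\eta$ on $G^0$; (3) $f*m=\lambda(f)\cdot m$ as functionals on $\mathcal E^*$, for every $f\in C_c(G)$. **Topological approximate invariant density.** A topological approximate invariant density on $G/H$ is a sequence $\{f_i\}_{i\in\mathbb N}$ of nonnegative functions in $C_c(G/H)$ such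 that (i) $\int_{G/H}f_i\,d\mu^u\le1$ for all $i$ and $u$; (ii) $\lim_i\int_{G/H}f_i\,d\mu^u=1$ uniformly on compact subsets of $G^0$; (iii) $\int_{G/H}|f_i(y^{-1}xH)-f_i(xH)|\,d\mu^{r(y)}(xH)\to0$ uniformly (in $y$) on compact subsets of $G$. *)

theory Defs
  imports "HOL-Analysis.Analysis"
begin

section \<open>Function spaces, Borel sets and Radon measures on an abstract topological space\<close>

text \<open>
  The quotient \<open>G/H\<close> is not a type, so every space is an abstract topology, and functions on it are
  total functions on the ambient type. A member of \<open>Cc X\<close> is required to vanish off the carrier, so
  that it is determined by its values on \<open>X\<close>.
\<close>

definition Cc :: "'a topology \<Rightarrow> ('a \<Rightarrow> 'b::real_normed_vector) set" where
  "Cc X = {f. continuous_map X euclidean f \<and>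
              compactin X (X closure_of {x \<in> topspace X. f x \<noteq> 0}) \<and>
              (\<forall>x. x \<notin> topspace X \<longrightarrow> f x = 0)}"

definition borel_of :: "'a topology \<Rightarrow> 'a measure" where
  "borel_of X = sigma (topspace X) {U. openin X U}"

definition radon_measure :: "'a topology \<Rightarrow> 'a measure \<Rightarrow> bool" where
  "radon_measure X M \<longleftrightarrow>
     sets M = sets (borel_of X) \<and>
     (\<forall>K. compactin X K \<longrightarrow> emeasure M K < \<infinity>) \<and>
     (\<forall>A \<in> sets M. emeasure M A = (INF U \<in> {U. openin X U \<and> A \<subseteq> U}. emeasure M U)) \<and>
     (\<forall>U. openin X U \<longrightarrow> emeasure M U = (SUP K \<in> {K. compactin X K \<and> K \<subseteq> U}. emeasure M K))"

definition measure_support :: "'a topology \<Rightarrow> 'a measure \<Rightarrow> 'a set" where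
  "measure_support X M = {x \<in> topspace X. \<forall>U. openin X U \<and> x \<in> U \<longrightarrow> emeasure M U > 0}"


section \<open>Duals of spaces of complex functions\<close>

text \<open>
  The space of bounded complex-linear functionals on a vector space \<open>V\<close> of complex-valued functions
  with norm \<open>N\<close>. Functionals are normalised to be \<open>0\<close> off \<open>V\<close>, so that equality of functionals on \<open>V\<close>
  is equality. Since functionals are themselves complex-valued functions, the construction can be
  iterated.
\<close>

definition dual :: "('a \<Rightarrow> complex) set \<Rightarrow> (('a \<Rightarrow> complex) \<Rightarrow> real) \<Rightarrow> (('a \<Rightarrow> complex) \<Rightarrow> complex) set"
  where
  "dual V N = {F.
     (\<forall>x\<in>V. \<forall>y\<in>V. F (\<lambda>a. x a + y a) = F x + F y) \<and>
     (\<forall>c. \<forall>x\<in>V. F (\<lambda>a. c * x a) = c * F x) \<and>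
     (\<exists>C. \<forall>x\<in>V. cmod (F x) \<le> C * N x) \<and>
     (\<forall>x. x \<notin> V \<longrightarrow> F x = 0)}"

definition dual_norm :: "('a \<Rightarrow> complex) set \<Rightarrow> (('a \<Rightarrow> complex) \<Rightarrow> real) \<Rightarrow> (('a \<Rightarrow> complex) \<Rightarrow> complex) \<Rightarrow> real"
  where
  "dual_norm V N F = (SUP x \<in> {x \<in> V. N x \<le> 1}. cmod (F x))"

definition transpose_on ::
  "('a \<Rightarrow> complex) set \<Rightarrow> (('a \<Rightarrow> complex) \<Rightarrow> ('a \<Rightarrow> complex)) \<Rightarrow>
   (('a \<Rightarrow> complex) \<Rightarrow> complex) \<Rightarrow> (('a \<Rightarrow> complex) \<Rightarrow> complex)" where
  "transpose_on V A F = (\<lambda>x. if x \<in> V then F (A x) else 0)"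


section \<open>Topological groupoids\<close>

text \<open>
  The carrier is the topological space of the topology \<open>top_of G\<close>; units are identified with elements
  of \<open>G\<close>. Products of non-composable elements and values off the carrier are unconstrained.
\<close>

record 'g groupoid =
  top_of :: "'g topology"
  rng :: "'g \<Rightarrow> 'g"
  src :: "'g \<Rightarrow> 'g"
  gmult :: "'g \<Rightarrow> 'g \<Rightarrow> 'g"
  ginv :: "'g \<Rightarrow> 'g"

abbreviation carr :: "'g groupoid \<Rightarrow> 'g set" where
  "carr G \<equiv> topspace (top_of G)"

definition units :: "'g groupoid \<Rightarrow> 'g set" where
  "units G = rng G ` carr G"

definition unit_top :: "'g groupoid \<Rightarrow> 'g topology" where
  "unit_top G = subtopology (top_of G) (units G)"

definition composable :: "'g groupoid \<Rightarrow> ('g \<times> 'g) set" where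
  "composable G = {(x, y). x \<in> carr G \<and> y \<in> carr G \<and> src G x = rng G y}"

definition fibre :: "'g groupoid \<Rightarrow> 'g \<Rightarrow> 'g set" where
  "fibre G u = {x \<in> carr G. rng G x = u}"

text \<open>Continuity of range and source follows from that of product and inverse.\<close>

locale topological_groupoid =
  fixes G :: "'g groupoid"
  assumes rng_closed: "x \<in> carr G \<Longrightarrow> rng G x \<in> carr G"
    and src_closed: "x \<in> carr G \<Longrightarrow> src G x \<in> carr G"
    and rng_rng: "x \<in> carr G \<Longrightarrow> rng G (rng G x) = rng G x"
    and src_rng: "x \<in> carr G \<Longrightarrow> src G (rng G x) = rng G x"
    and rng_src: "x \<in> carr G \<Longrightarrow> rng G (src G x) = src G x"
    and src_src: "x \<in> carr G \<Longrightarrow> src G (src G x) = src G x"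
    and mult_closed: "(x, y) \<in> composable G \<Longrightarrow> gmult G x y \<in> carr G"
    and rng_mult: "(x, y) \<in> composable G \<Longrightarrow> rng G (gmult G x y) = rng G x"
    and src_mult: "(x, y) \<in> composable G \<Longrightarrow> src G (gmult G x y) = src G y"
    and mult_assoc: "(x, y) \<in> composable G \<Longrightarrow> (y, z) \<in> composable G \<Longrightarrow>
          gmult G (gmult G x y) z = gmult G x (gmult G y z)"
    and unit_left: "x \<in> carr G \<Longrightarrow> gmult G (rng G x) x = x"
    and unit_right: "x \<in> carr G \<Longrightarrow> gmult G x (src G x) = x"
    and inv_closed: "x \<in> carr G \<Longrightarrow> ginv G x \<in> carr G"
    and rng_inv: "x \<in> carr G \<Longrightarrow> rng G (ginv G x) = src G x"
    and src_inv: "x \<in> carr G \<Longrightarrow> src G (ginv G x) = rng G x"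
    and inv_right: "x \<in> carr G \<Longrightarrow> gmult G x (ginv G x) = rng G x"
    and inv_left: "x \<in> carr G \<Longrightarrow> gmult G (ginv G x) x = src G x"
    and continuous_mult: "continuous_map
          (subtopology (prod_topology (top_of G) (top_of G)) (composable G)) (top_of G)
          (\<lambda>(x, y). gmult G x y)"
    and continuous_inv: "continuous_map (top_of G) (top_of G) (ginv G)"
    and second_countable_top: "second_countable (top_of G)"
    and locally_compact_top: "locally_compact_space (top_of G)"
    and Hausdorff_top: "Hausdorff_space (top_of G)"

text \<open>
  In the invariance condition \<open>gmult G x y\<close> is meaningful only for \<open>y\<close> in the fibre over
  \<open>src G x\<close>, which is where the measure lives; the integral is restricted to it since the integrand
  need not be measurable elsewhere.
\<close>

definition haar_system :: "'g groupoid \<Rightarrow> ('g \<Rightarrow> 'g measure) \<Rightarrow> bool" where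
  "haar_system G lam \<longleftrightarrow>
     (\<forall>u \<in> units G. radon_measure (top_of G) (lam u) \<and>
        measure_support (top_of G) (lam u) = fibre G u) \<and>
     (\<forall>f \<in> Cc (top_of G). continuous_map (unit_top G) euclidean
        (\<lambda>u. (LINT x|lam u. f x) :: complex)) \<and>
     (\<forall>x \<in> carr G. \<forall>f \<in> Cc (top_of G).
        (LINT y:fibre G (src G x)|lam (src G x). f (gmult G x y)) =
        ((LINT y|lam (rng G x). f y) :: complex))"

definition closed_wide_subgroupoid :: "'g groupoid \<Rightarrow> 'g set \<Rightarrow> bool" where
  "closed_wide_subgroupoid G H \<longleftrightarrow>
     closedin (top_of G) H \<and>
     units G \<subseteq> H \<and>
     (\<forall>x \<in> H. ginv G x \<in> H) \<and>
     (\<forall>x \<in> H. \<forall>y \<in> H. src G x = rng G y \<longrightarrow> gmult G x y \<in> H)"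

definition subgroupoid :: "'g groupoid \<Rightarrow> 'g set \<Rightarrow> 'g groupoid" where
  "subgroupoid G H = G\<lparr>top_of := subtopology (top_of G) H\<rparr>"


section \<open>The quotient\<close>

definition coset :: "'g groupoid \<Rightarrow> 'g set \<Rightarrow> 'g \<Rightarrow> 'g set" where
  "coset G H x = {y \<in> carr G. rng G x = rng G y \<and> gmult G (ginv G x) y \<in> H}"

definition cosets :: "'g groupoid \<Rightarrow> 'g set \<Rightarrow> 'g set set" where
  "cosets G H = coset G H ` carr G"

definition quot_top :: "'g groupoid \<Rightarrow> 'g set \<Rightarrow> 'g set topology" where
  "quot_top G H =
     topology (\<lambda>U. U \<subseteq> cosets G H \<and> openin (top_of G) {x \<in> carr G. coset G H x \<in> U})"

definition qrng :: "'g groupoid \<Rightarrow> 'g set \<Rightarrow> 'g" where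
  "qrng G w = the_elem (rng G ` w)"

definition qact :: "'g groupoid \<Rightarrow> 'g \<Rightarrow> 'g set \<Rightarrow> 'g set" where
  "qact G g w = gmult G g ` w"

definition qfibre :: "'g groupoid \<Rightarrow> 'g set \<Rightarrow> 'g \<Rightarrow> 'g set set" where
  "qfibre G H u = {w \<in> cosets G H. qrng G w = u}"

lemma openin_quot_top:
  "openin (quot_top G H) U \<longleftrightarrow>
     U \<subseteq> cosets G H \<and> openin (top_of G) {x \<in> carr G. coset G H x \<in> U}"
proof -
  have "istopology (\<lambda>U. U \<subseteq> cosets G H \<and> openin (top_of G) {x \<in> carr G. coset G H x \<in> U})"
    unfolding istopology_def
  proof (intro conjI allI impI; (elim conjE)?)
    fix S T
    assume "openin (top_of G) {x \<in> carr G. coset G H x \<in> S}"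
      and "openin (top_of G) {x \<in> carr G. coset G H x \<in> T}"
    then have "openin (top_of G)
        ({x \<in> carr G. coset G H x \<in> S} \<inter> {x \<in> carr G. coset G H x \<in> T})"
      by (rule openin_Int)
    also have "{x \<in> carr G. coset G H x \<in> S} \<inter> {x \<in> carr G. coset G H x \<in> T} =
        {x \<in> carr G. coset G H x \<in> S \<inter> T}" by auto
    finally show "openin (top_of G) {x \<in> carr G. coset G H x \<in> S \<inter> T}" .
  next
    fix \<K>
    assume K: "\<forall>K\<in>\<K>. K \<subseteq> cosets G H \<and> openin (top_of G) {x \<in> carr G. coset G H x \<in> K}"
    have "openin (top_of G) (\<Union>K\<in>\<K>. {x \<in> carr G. coset G H x \<in> K})"
      using K by (intro openin_Union) auto
    also have "(\<Union>K\<in>\<K>. {x \<in> carr G. coset G H x \<in> K}) =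
        {x \<in> carr G. coset G H x \<in> \<Union>\<K>}" by auto
    finally show "openin (top_of G) {x \<in> carr G. coset G H x \<in> \<Union>\<K>}" .
  qed auto
  then show ?thesis
    unfolding quot_top_def by (simp add: topology_inverse')
qed

lemma topspace_quot_top: "topspace (quot_top G H) = cosets G H"
proof -
  have "{x \<in> carr G. coset G H x \<in> cosets G H} = carr G"
    by (auto simp: cosets_def)
  then have "openin (quot_top G H) (cosets G H)"
    by (simp add: openin_quot_top)
  then show ?thesis
    by (meson openin_quot_top openin_subset openin_topspace subset_antisym)
qed

lemma (in topological_groupoid)
  assumes H: "closed_wide_subgroupoid G H" and x: "x \<in> carr G"
  shows mem_coset: "x \<in> coset G H x"
    and qrng_coset: "qrng G (coset G H x) = rng G x"
proof -
  have "src G x \<in> units G"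
    using x rng_src src_closed unfolding units_def by (metis imageI)
  with H x show *: "x \<in> coset G H x"
    unfolding coset_def closed_wide_subgroupoid_def by (auto simp: inv_left)
  have "rng G ` coset G H x = {rng G x}"
    using * by (auto simp: coset_def)
  then show "qrng G (coset G H x) = rng G x"
    by (simp add: qrng_def)
qed

lemma (in topological_groupoid) qact_coset:
  assumes g: "g \<in> carr G" and x: "x \<in> carr G" and gx: "src G g = rng G x"
  shows "qact G g (coset G H x) = coset G H (gmult G g x)"
proof -
  note comp = composable_def
  have gxc: "gmult G g x \<in> carr G" and rgx: "rng G (gmult G g x) = rng G g"
    using assms by (auto simp: comp intro: mult_closed rng_mult)
  have key: "gmult G (ginv G (gmult G g x)) (gmult G g y) = gmult G (ginv G x) y"
    if y: "y \<in> carr G" "rng G y = rng G x" for y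
  proof -
    let ?p = "gmult G g x" and ?q = "gmult G (ginv G x) y"
    have q: "?q \<in> carr G" "rng G ?q = src G x"
      using x y by (auto simp: comp inv_closed src_inv rng_inv intro!: mult_closed rng_mult[THEN trans])
    have "gmult G x ?q = gmult G (gmult G x (ginv G x)) y"
      using x y by (intro mult_assoc[symmetric]) (auto simp: comp inv_closed rng_inv src_inv)
    also have "\<dots> = y" using x y unit_left inv_right by metis
    finally have xq: "gmult G x ?q = y" .
    have sp: "src G ?p = src G x" using assms by (auto simp: comp intro!: src_mult[THEN trans])
    have "gmult G ?p ?q = gmult G g (gmult G x ?q)"
      using assms q by (intro mult_assoc) (auto simp: comp)
    then have pq: "gmult G g y = gmult G ?p ?q" by (simp add: xq)
    have "gmult G (ginv G ?p) (gmult G ?p ?q) = gmult G (gmult G (ginv G ?p) ?p) ?q"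
      using gxc q sp by (intro mult_assoc[symmetric]) (auto simp: comp inv_closed src_inv)
    also have "\<dots> = ?q" using gxc sp q unit_left inv_left by metis
    finally show ?thesis by (simp add: pq)
  qed
  show ?thesis
  proof (intro set_eqI iffI)
    fix z assume "z \<in> qact G g (coset G H x)"
    then obtain y where "y \<in> coset G H x" "z = gmult G g y"
      unfolding qact_def by auto
    then show "z \<in> coset G H (gmult G g x)"
      using g gx key[of y] rgx rng_mult[of g y] mult_closed[of g y]
      by (auto simp: coset_def comp)
  next
    fix z assume z: "z \<in> coset G H (gmult G g x)"
    define y where "y = gmult G (ginv G g) z"
    have zc: "z \<in> carr G" "rng G z = rng G g"
      using z rgx by (auto simp: coset_def)
    have gi: "ginv G g \<in> carr G" "src G (ginv G g) = rng G g" "rng G (ginv G g) = src G g"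
      using g by (auto simp: inv_closed src_inv rng_inv)
    have yc: "y \<in> carr G" "rng G y = rng G x"
      unfolding y_def using gi zc gx by (auto simp: comp intro!: mult_closed rng_mult[THEN trans])
    have "gmult G g y = gmult G (gmult G g (ginv G g)) z"
      unfolding y_def using g gi zc by (intro mult_assoc[symmetric]) (auto simp: comp)
    also have "\<dots> = z" using g zc unit_left inv_right by metis
    finally have gy: "gmult G g y = z" .
    have "y \<in> coset G H x"
      using z yc key[OF yc] gy by (auto simp: coset_def)
    then show "z \<in> qact G g (coset G H x)"
      unfolding qact_def using gy by blast
  qed
qed

definition full_equivariant_measure_system ::
  "'g groupoid \<Rightarrow> 'g set \<Rightarrow> ('g \<Rightarrow> 'g set measure) \<Rightarrow> bool" where
  "full_equivariant_measure_system G H mu \<longleftrightarrow>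
     (\<forall>u \<in> units G. radon_measure (quot_top G H) (mu u) \<and>
        measure_support (quot_top G H) (mu u) = qfibre G H u) \<and>
     (\<forall>f \<in> Cc (quot_top G H). continuous_map (unit_top G) euclidean
        (\<lambda>u. (LINT w|mu u. f w) :: complex)) \<and>
     (\<forall>g \<in> carr G. \<forall>f \<in> Cc (quot_top G H).
        (LINT w:qfibre G H (src G g)|mu (src G g). f (qact G g w)) =
        ((LINT w|mu (rng G g). f w) :: complex))"


section \<open>The space \<open>C\<^sub>0(G\<^sup>0, L\<^sup>1(G/H, \<mu>))\<close> and its duals\<close>

definition mu_norm :: "'g groupoid \<Rightarrow> ('g \<Rightarrow> 'g set measure) \<Rightarrow> ('g set \<Rightarrow> complex) \<Rightarrow> real" where
  "mu_norm G mu g = (SUP u \<in> units G. LINT w|mu u. cmod (g w))"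

text \<open>
  An element of the dual of \<open>\<E>\<close>, the completion of \<open>C\<^sub>c(G/H)\<close> in \<open>mu_norm\<close>, is
  a \<open>\<mu>\<close>-bounded complex Radon measure on \<open>G/H\<close>, that is, a linear functional on \<open>C\<^sub>c(G/H)\<close>
  bounded with respect to \<open>mu_norm\<close> (such a measure may have infinite total variation, hence need not
  be a complex-valued function on all Borel sets). As \<open>C\<^sub>c(G/H)\<close> is dense in \<open>\<E>\<close>, restriction is an
  isometric bijection from the dual of \<open>\<E>\<close> onto \<open>E_dual\<close>.
\<close>

definition E_dual :: "'g groupoid \<Rightarrow> 'g set \<Rightarrow> ('g \<Rightarrow> 'g set measure) \<Rightarrow>
    (('g set \<Rightarrow> complex) \<Rightarrow> complex) set" where
  "E_dual G H mu = dual (Cc (quot_top G H)) (mu_norm G mu)"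

definition E_bidual :: "'g groupoid \<Rightarrow> 'g set \<Rightarrow> ('g \<Rightarrow> 'g set measure) \<Rightarrow>
    ((('g set \<Rightarrow> complex) \<Rightarrow> complex) \<Rightarrow> complex) set" where
  "E_bidual G H mu = dual (E_dual G H mu) (dual_norm (Cc (quot_top G H)) (mu_norm G mu))"

definition positive_measure :: "'g groupoid \<Rightarrow> 'g set \<Rightarrow> (('g set \<Rightarrow> complex) \<Rightarrow> complex) \<Rightarrow> bool" where
  "positive_measure G H nu \<longleftrightarrow>
     (\<exists>M. radon_measure (quot_top G H) M \<and>
          (\<forall>g \<in> Cc (quot_top G H). nu g = (LINT w|M. g w)))"

definition haar_int :: "('g \<Rightarrow> 'g measure) \<Rightarrow> ('g \<Rightarrow> complex) \<Rightarrow> 'g \<Rightarrow> complex" where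
  "haar_int lam f u = (LINT x|lam u. f x)"

definition L_op :: "'g groupoid \<Rightarrow> ('g \<Rightarrow> 'g measure) \<Rightarrow> 'g set \<Rightarrow> ('g \<Rightarrow> complex) \<Rightarrow>
    ('g set \<Rightarrow> complex) \<Rightarrow> 'g set \<Rightarrow> complex" where
  "L_op G lam H f phi = (\<lambda>w. if w \<in> cosets G H
     then LINT y:fibre G (qrng G w)|lam (qrng G w). f y * phi (qact G (ginv G y) w)
     else 0)"

definition smult :: "'g groupoid \<Rightarrow> ('g \<Rightarrow> complex) \<Rightarrow> ('g set \<Rightarrow> complex) \<Rightarrow> 'g set \<Rightarrow> complex" where
  "smult G k g = (\<lambda>w. k (qrng G w) * g w)"

text \<open>
  \<open>conv_bidual\<close> is \<open>f * m\<close>, the double transpose of \<open>L(f)\<close> applied to \<open>m\<close>, and \<open>smult_bidual\<close> is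
  \<open>k \<cdot> m\<close>.
\<close>

definition conv_bidual :: "'g groupoid \<Rightarrow> ('g \<Rightarrow> 'g measure) \<Rightarrow> 'g set \<Rightarrow> ('g \<Rightarrow> 'g set measure) \<Rightarrow>
    ('g \<Rightarrow> complex) \<Rightarrow> ((('g set \<Rightarrow> complex) \<Rightarrow> complex) \<Rightarrow> complex) \<Rightarrow>
    (('g set \<Rightarrow> complex) \<Rightarrow> complex) \<Rightarrow> complex" where
  "conv_bidual G lam H mu f m =
     transpose_on (E_dual G H mu) (transpose_on (Cc (quot_top G H)) (L_op G lam H f)) m"

definition smult_bidual :: "'g groupoid \<Rightarrow> 'g set \<Rightarrow> ('g \<Rightarrow> 'g set measure) \<Rightarrow>
    ('g \<Rightarrow> complex) \<Rightarrow> ((('g set \<Rightarrow> complex) \<Rightarrow> complex) \<Rightarrow> complex) \<Rightarrow>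
    (('g set \<Rightarrow> complex) \<Rightarrow> complex) \<Rightarrow> complex" where
  "smult_bidual G H mu k m =
     transpose_on (E_dual G H mu) (transpose_on (Cc (quot_top G H)) (smult G k)) m"

definition unit_prob :: "'g groupoid \<Rightarrow> 'g measure \<Rightarrow> bool" where
  "unit_prob G eta \<longleftrightarrow> sets eta = sets (borel_of (unit_top G)) \<and> emeasure eta (space eta) = 1"

definition comp_measure :: "'g groupoid \<Rightarrow> 'g set \<Rightarrow> ('g \<Rightarrow> 'g set measure) \<Rightarrow> 'g measure \<Rightarrow>
    ('g set \<Rightarrow> complex) \<Rightarrow> complex" where
  "comp_measure G H mu eta = (\<lambda>g. if g \<in> Cc (quot_top G H) then (LINT u|eta. LINT w|mu u. g w) else 0)"


section \<open>Invariant means and approximate invariant densities\<close>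

definition topological_invariant_mean ::
  "'g groupoid \<Rightarrow> ('g \<Rightarrow> 'g measure) \<Rightarrow> 'g set \<Rightarrow> ('g \<Rightarrow> 'g set measure) \<Rightarrow>
   ((('g set \<Rightarrow> complex) \<Rightarrow> complex) \<Rightarrow> complex) \<Rightarrow> bool" where
  "topological_invariant_mean G lam H mu m \<longleftrightarrow>
     m \<in> E_bidual G H mu \<and>
     (\<forall>nu \<in> E_dual G H mu. positive_measure G H nu \<longrightarrow> m nu \<in> \<real>\<^sub>\<ge>\<^sub>0) \<and>
     (\<forall>eta. unit_prob G eta \<longrightarrow> m (comp_measure G H mu eta) = 1) \<and>
     (\<forall>f \<in> Cc (top_of G). conv_bidual G lam H mu f m = smult_bidual G H mu (haar_int lam f) m)"

definition topological_approximate_invariant_density ::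
  "'g groupoid \<Rightarrow> 'g set \<Rightarrow> ('g \<Rightarrow> 'g set measure) \<Rightarrow> (nat \<Rightarrow> 'g set \<Rightarrow> real) \<Rightarrow> bool" where
  "topological_approximate_invariant_density G H mu f \<longleftrightarrow>
     (\<forall>i. f i \<in> Cc (quot_top G H) \<and> (\<forall>w. f i w \<ge> 0)) \<and>
     (\<forall>i. \<forall>u \<in> units G. (LINT w|mu u. f i w) \<le> 1) \<and>
     (\<forall>K. compactin (unit_top G) K \<longrightarrow>
        uniform_limit K (\<lambda>i u. LINT w|mu u. f i w) (\<lambda>u. 1) sequentially) \<and>
     (\<forall>K. compactin (top_of G) K \<longrightarrow>
        uniform_limit K
          (\<lambda>i y. LINT w:qfibre G H (rng G y)|mu (rng G y). \<bar>f i (qact G (ginv G y) w) - f i w\<bar>)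
          (\<lambda>y. 0) sequentially)"

end

theory Submission
  imports Defs
begin

text \<open>
  Write \<open>X = G/H\<close> and, for \<open>h \<in> C\<^sub>c(G)\<close> and \<open>\<phi> \<in> C\<^sub>c(X)\<close>, let \<open>D\<^sub>h \<phi> = L(h)\<phi> - \<lambda>(h)\<phi>\<close> be the
  amount by which \<open>\<phi>\<close> fails to be invariant under averaging against \<open>h\<close>. One Fubini estimate
  (\<open>kernel_estimate\<close>) controls all operators of the form \<open>\<psi>(w) = \<integral> a(y) b(y,w) d\<lambda>\<^sup>u(y)\<close>: the
  \<open>L\<^sup>1(\<mu>\<^sup>u)\<close>-norm of \<open>\<psi>\<close> is at most \<open>\<integral>|a| d\<lambda>\<^sup>u\<close> times a bound for the \<open>L\<^sup>1(\<mu>\<^sup>u)\<close>-norms of the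
  slices \<open>b(y,-)\<close>. For \<open>b(y,w) = \<phi>(y\<^sup>-\<^sup>1 w)\<close> it bounds \<open>L(a)\<close> (by equivariance of \<open>\<mu>\<close>), and for
  \<open>b(y,w) = \<phi>(y\<^sup>-\<^sup>1 w) - \<phi>(w)\<close> it bounds \<open>D\<^sub>a \<phi>\<close> by the almost invariance of \<open>\<phi>\<close>.

  From a density to a mean (\<open>density_imp_mean\<close>): the evaluations \<open>\<nu> \<mapsto> \<nu>(f\<^sub>i)\<close> lie in the unit ball of
  \<open>\<E>\<^sup>*\<^sup>*\<close>, so by Tychonoff they have a pointwise cluster point \<open>m\<close>. Any linear relation that holds in the
  limit along \<open>i\<close> holds for \<open>m\<close>. Positivity is inherited directly, \<open>m(\<eta> \<circ> \<mu>) = 1\<close> follows by dominated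
  convergence, and \<open>f * m = \<lambda>(f) \<cdot> m\<close> because \<open>D\<^sub>f f\<^sub>i\<close> tends to \<open>0\<close> in norm.

  From a mean to a density: fix a compact set \<open>K\<close> of units and finitely many \<open>h \<in> C\<^sub>c(G)\<close>. The main step
  (\<open>approximate_invariance_core\<close>) finds \<open>\<phi> \<ge> 0\<close> in \<open>C\<^sub>c(X)\<close> whose fibre integrals \<open>\<mu>(\<phi>)\<close> are almost at
  most \<open>1\<close> everywhere and almost at least \<open>1\<close> on \<open>K\<close>, with all \<open>D\<^sub>h \<phi>\<close> small in norm. If there were none, a
  sum of sublinear expressions in \<open>\<phi>\<close> would be bounded below by some \<open>e > 0\<close> on the cone of all
  \<open>\<phi> \<ge> 0\<close>. The Mazur--Orlicz form of the Hahn--Banach theorem replaces each sublinear expression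
  by a linear one: positive functionals \<open>\<beta>\<close> and \<open>\<alpha>\<close> on bounded functions of the unit, and functionals
  \<open>\<nu>\<^sub>h\<close> bounded in the norm of \<open>\<E>\<close>. Since the cone is invariant under scaling, the lower bound splits:
  \<open>N(\<phi>) = \<beta>(\<mu>(\<phi>)) - \<alpha>(\<mu>(\<phi>)) + \<Sum>\<^sub>h \<nu>\<^sub>h(D\<^sub>h \<phi>)\<close> is a positive functional, and \<open>\<alpha>(1) - \<beta>(1) \<ge> e\<close>. The Riesz
  representation theorem turns \<open>\<alpha>\<close>, \<open>\<beta>\<close> and \<open>N\<close> into measures \<open>a\<close>, \<open>b\<close> and a positive element of
  \<open>\<E>\<^sup>*\<close>. An invariant mean annihilates \<open>\<nu>\<^sub>h \<circ> D\<^sub>h\<close>, so it maps \<open>N\<close> to \<open>b(G\<^sup>0) - a(G\<^sup>0)\<close>, which is negative.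
  This contradicts the positivity of the mean.

  It remains to pass from finitely many averages to translates that are uniform over a compact subset
  of \<open>G\<close> (\<open>mean_imp_almost_invariant\<close>). Take \<open>\<psi> = L(f)\<phi>\<close> with \<open>\<lambda>(f) = 1\<close> on a compact set of units.
  The translate of \<open>\<psi>\<close> by \<open>y\<close> is \<open>L(f\<^sub>y)\<phi>\<close> on the fibre, where \<open>f\<^sub>y\<close> is the left translate of \<open>f\<close>. When \<open>y\<close>
  ranges over a compact set, the \<open>f\<^sub>y\<close> are uniformly approximated by finitely many \<open>h\<close>
  (\<open>left_translates_net\<close>), and for those \<open>h\<close> it is known that \<open>L(h)\<phi>\<close> is close to \<open>\<lambda>(h)\<phi>\<close>, hence to \<open>\<phi>\<close>. A
  compact exhaustion of \<open>G\<close> and \<open>G\<^sup>0\<close> turns these functions into a sequence.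

  The Haar system of \<open>H\<close> enters through the topology of \<open>X\<close>: it makes the range map of \<open>H\<close> open, hence
  the quotient map open, and from this \<open>X\<close> is second countable, locally compact and Hausdorff and the
  action of \<open>G\<close> is continuous.
\<close>

section \<open>Continuous functions with compact support\<close>

lemma continuous_map_euclidean_iff_tendsto:
  "continuous_map X euclidean f \<longleftrightarrow> (\<forall>x\<in>topspace X. (f \<longlongrightarrow> f x) (atin X x))"
  by (simp add: continuous_map_atin)

lemma continuous_map_compose_euclidean:
  assumes "continuous_map X euclidean f" "continuous_on UNIV g"
  shows "continuous_map X euclidean (\<lambda>x. g (f x))"
  using continuous_map_compose[OF assms(1), of euclidean g] assms(2) by (simp add: o_def)

lemma continuous_map_euclidean_add:
  fixes f g :: "'a \<Rightarrow> 'b::real_normed_vector"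
  assumes "continuous_map X euclidean f" "continuous_map X euclidean g"
  shows "continuous_map X euclidean (\<lambda>x. f x + g x)"
  using assms by (auto simp: continuous_map_euclidean_iff_tendsto intro!: tendsto_intros)

lemma continuous_map_euclidean_diff:
  fixes f g :: "'a \<Rightarrow> 'b::real_normed_vector"
  assumes "continuous_map X euclidean f" "continuous_map X euclidean g"
  shows "continuous_map X euclidean (\<lambda>x. f x - g x)"
  using assms by (auto simp: continuous_map_euclidean_iff_tendsto intro!: tendsto_intros)

lemma continuous_map_euclidean_mult:
  fixes f g :: "'a \<Rightarrow> 'b::real_normed_algebra"
  assumes "continuous_map X euclidean f" "continuous_map X euclidean g"
  shows "continuous_map X euclidean (\<lambda>x. f x * g x)"
  using assms by (auto simp: continuous_map_euclidean_iff_tendsto intro!: tendsto_intros)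

text \<open>
  In a Hausdorff space a compact set is closed, so the closure that defines the support lies in any compact set
  off which the function vanishes. Supports therefore never have to be computed.
\<close>

lemma Cc_iff:
  assumes "Hausdorff_space X"
  shows "f \<in> Cc X \<longleftrightarrow> continuous_map X euclidean f \<and> (\<exists>K. compactin X K \<and> (\<forall>x. x \<notin> K \<longrightarrow> f x = 0))"
proof
  assume f: "f \<in> Cc X"
  let ?K = "X closure_of {x \<in> topspace X. f x \<noteq> 0}"
  have "compactin X ?K" using f by (simp add: Cc_def)
  moreover have "f x = 0" if "x \<notin> ?K" for x
  proof -
    have "{x \<in> topspace X. f x \<noteq> 0} \<subseteq> ?K" by (intro closure_of_subset) auto
    then show ?thesis using that f unfolding Cc_def by blast
  qed
  ultimately show "continuous_map X euclidean f \<and> (\<exists>K. compactin X K \<and> (\<forall>x. x \<notin> K \<longrightarrow> f x = 0))"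
    using f by (auto simp: Cc_def)
next
  assume "continuous_map X euclidean f \<and> (\<exists>K. compactin X K \<and> (\<forall>x. x \<notin> K \<longrightarrow> f x = 0))"
  then obtain K where f: "continuous_map X euclidean f" and K: "compactin X K" and 0: "\<And>x. x \<notin> K \<Longrightarrow> f x = 0"
    by blast
  have "closedin X K" using K assms by (simp add: compactin_imp_closedin)
  moreover have "{x \<in> topspace X. f x \<noteq> 0} \<subseteq> K" using 0 by auto
  ultimately have "X closure_of {x \<in> topspace X. f x \<noteq> 0} \<subseteq> K" by (simp add: closure_of_minimal)
  then have "compactin X (X closure_of {x \<in> topspace X. f x \<noteq> 0})"
    using K closed_compactin closedin_closure_of by blast
  moreover have "f x = 0" if "x \<notin> topspace X" for x
    using 0[of x] that K compactin_subset_topspace by blast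
  ultimately show "f \<in> Cc X" using f by (auto simp: Cc_def)
qed

lemma Cc_continuous: "f \<in> Cc X \<Longrightarrow> continuous_map X euclidean f"
  by (simp add: Cc_def)

lemma Cc_zero: "Hausdorff_space X \<Longrightarrow> (\<lambda>x. 0) \<in> Cc X"
  by (simp add: Cc_iff exI[of _ "{}"])

lemma Cc_dominated:
  assumes "Hausdorff_space X" "f \<in> Cc X" "continuous_map X euclidean g" "\<And>x. f x = 0 \<Longrightarrow> g x = 0"
  shows "g \<in> Cc X"
  using assms unfolding Cc_iff[OF assms(1)] by metis

lemma Cc_combine:
  assumes "Hausdorff_space X" "f \<in> Cc X" "g \<in> Cc X" "continuous_map X euclidean h"
    "\<And>x. f x = 0 \<Longrightarrow> g x = 0 \<Longrightarrow> h x = 0"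
  shows "h \<in> Cc X"
proof -
  obtain K L where "compactin X K" "compactin X L" "\<And>x. x \<notin> K \<Longrightarrow> f x = 0" "\<And>x. x \<notin> L \<Longrightarrow> g x = 0"
    using assms(2,3) unfolding Cc_iff[OF assms(1)] by metis
  then have "compactin X (K \<union> L)" "\<And>x. x \<notin> K \<union> L \<Longrightarrow> h x = 0"
    using assms(5) by (auto intro: compactin_Un)
  then show ?thesis using assms unfolding Cc_iff[OF assms(1)] by blast
qed

lemma Cc_add: "Hausdorff_space X \<Longrightarrow> f \<in> Cc X \<Longrightarrow> g \<in> Cc X \<Longrightarrow> (\<lambda>x. f x + g x) \<in> Cc X"
  by (rule Cc_combine[of X f g]) (auto intro: continuous_map_euclidean_add Cc_continuous)

lemma Cc_diff: "Hausdorff_space X \<Longrightarrow> f \<in> Cc X \<Longrightarrow> g \<in> Cc X \<Longrightarrow> (\<lambda>x. f x - g x) \<in> Cc X"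
  by (rule Cc_combine[of X f g]) (auto intro: continuous_map_euclidean_diff Cc_continuous)

lemma Cc_compose:
  "Hausdorff_space X \<Longrightarrow> f \<in> Cc X \<Longrightarrow> continuous_on UNIV g \<Longrightarrow> g 0 = 0 \<Longrightarrow> (\<lambda>x. g (f x)) \<in> Cc X"
  by (rule Cc_dominated[of X f]) (auto intro: continuous_map_compose_euclidean Cc_continuous)

lemma Cc_norm: "Hausdorff_space X \<Longrightarrow> f \<in> Cc X \<Longrightarrow> (\<lambda>x. norm (f x)) \<in> Cc X"
  by (rule Cc_compose) (auto intro: continuous_intros)

lemma Cc_abs: "Hausdorff_space X \<Longrightarrow> f \<in> Cc X \<Longrightarrow> (\<lambda>x. \<bar>f x :: real\<bar>) \<in> Cc X"
  using Cc_norm[of X f] by simp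

lemma Cc_of_real: "Hausdorff_space X \<Longrightarrow> f \<in> Cc X \<Longrightarrow> (\<lambda>x. complex_of_real (f x)) \<in> Cc X"
  by (rule Cc_compose[where g=complex_of_real]) (auto intro!: continuous_intros)

lemma Cc_Re: "Hausdorff_space X \<Longrightarrow> f \<in> Cc X \<Longrightarrow> (\<lambda>x. Re (f x)) \<in> Cc X"
  by (rule Cc_compose) (auto intro!: continuous_intros)

lemma Cc_Im: "Hausdorff_space X \<Longrightarrow> f \<in> Cc X \<Longrightarrow> (\<lambda>x. Im (f x)) \<in> Cc X"
  by (rule Cc_compose) (auto intro!: continuous_intros)

lemma Cc_scale:
  fixes f :: "'a \<Rightarrow> 'b::real_normed_algebra"
  shows "Hausdorff_space X \<Longrightarrow> f \<in> Cc X \<Longrightarrow> (\<lambda>x. c * f x) \<in> Cc X"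
  by (rule Cc_compose) (auto intro!: continuous_intros)

lemma Cc_mult:
  fixes f :: "'a \<Rightarrow> 'b::real_normed_algebra"
  assumes "Hausdorff_space X" "f \<in> Cc X" "continuous_map X euclidean k"
  shows "(\<lambda>x. k x * f x) \<in> Cc X"
  by (rule Cc_dominated[OF assms(1,2)]) (auto intro: continuous_map_euclidean_mult Cc_continuous assms)

lemma Cc_sum:
  assumes "Hausdorff_space X" "\<And>i. i \<in> I \<Longrightarrow> f i \<in> Cc X"
  shows "(\<lambda>x. \<Sum>i\<in>I. f i x) \<in> Cc X"
  using assms(2)
  by (induction I rule: infinite_finite_induct) (auto intro: Cc_zero Cc_add assms(1))

lemma Cc_bounded:
  fixes f :: "'a \<Rightarrow> 'b::real_normed_vector"
  assumes "Hausdorff_space X" "f \<in> Cc X"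
  obtains B where "B > 0" "\<And>x. norm (f x) \<le> B"
proof -
  obtain K where K: "compactin X K" "\<And>x. x \<notin> K \<Longrightarrow> f x = 0"
    using assms unfolding Cc_iff[OF assms(1)] by metis
  have "compactin euclidean (f ` K)"
    using K(1) Cc_continuous[OF assms(2)] by (rule image_compactin)
  then have "bounded (f ` K)" by (simp add: compact_imp_bounded)
  then obtain B where "B > 0" "\<And>x. x \<in> K \<Longrightarrow> norm (f x) \<le> B" unfolding bounded_pos by auto
  then show ?thesis using K(2) that by (metis less_imp_le norm_zero)
qed

locale LCH =
  fixes X :: "'a topology"
  assumes Haus: "Hausdorff_space X" and lc: "locally_compact_space X"
begin

lemma compact_nbhd_inside:
  assumes "compactin X K" "openin X U" "K \<subseteq> U"
  obtains V L where "openin X V" "compactin X L" "closedin X L" "K \<subseteq> V" "V \<subseteq> L" "L \<subseteq> U"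
proof -
  have "Hausdorff_space (subtopology X U)" "locally_compact_space (subtopology X U)"
    using assms Haus lc by (auto intro: Hausdorff_space_subtopology locally_compact_space_open_subset)
  moreover have "compactin (subtopology X U) K" using assms by (simp add: compactin_subtopology)
  ultimately obtain V L where "openin (subtopology X U) V" "compactin (subtopology X U) L" "K \<subseteq> V" "V \<subseteq> L"
    by (meson locally_compact_space_compact_closed_compact)
  then show ?thesis
    using that[of V L] assms(2) Haus
    by (auto simp: compactin_subtopology openin_open_subtopology compactin_imp_closedin)
qed

text \<open>
  Preimages of a closed set are closed in the closed set \<open>L\<close>, and a closed set containing \<open>0\<close> only contributes
  the further closed set \<open>topspace X - V\<close>.
\<close>

lemma continuous_extend_by_zero:
  fixes f :: "'a \<Rightarrow> 'b::real_normed_vector"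
  assumes "closedin X L" "openin X V" "V \<subseteq> L" "continuous_map (subtopology X L) euclidean f"
    "\<And>x. x \<in> L \<Longrightarrow> x \<notin> V \<Longrightarrow> f x = 0"
  shows "continuous_map X euclidean (\<lambda>x. if x \<in> L then f x else 0)"
  unfolding continuous_map_closedin
proof (intro conjI allI impI)
  fix C :: "'b set" assume C: "closedin euclidean C"
  have "closedin (subtopology X L) {x \<in> topspace (subtopology X L). f x \<in> C}"
    using assms(4) C by (rule closedin_continuous_map_preimage)
  then have 1: "closedin X {x \<in> topspace (subtopology X L). f x \<in> C}"
    using assms(1) closedin_trans_full by blast
  have L: "L \<subseteq> topspace X" using assms(1) closedin_subset by blast
  show "closedin X {x \<in> topspace X. (if x \<in> L then f x else 0) \<in> C}"
  proof (cases "0 \<in> C")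
    case True
    have "{x \<in> topspace X. (if x \<in> L then f x else 0) \<in> C} =
      {x \<in> topspace (subtopology X L). f x \<in> C} \<union> (topspace X - V)"
      using L assms(3,5) True by auto
    then show ?thesis using 1 assms(2) by (metis closedin_Un closedin_diff closedin_topspace)
  next
    case False
    then have "{x \<in> topspace X. (if x \<in> L then f x else 0) \<in> C} = {x \<in> topspace (subtopology X L). f x \<in> C}"
      using L by auto
    then show ?thesis using 1 by simp
  qed
qed simp

text \<open>
  Urysohn's lemma applies inside a compact neighbourhood \<open>L\<close> of \<open>K\<close>, which is normal. Asking the function
  to vanish on \<open>L - V\<close> makes its extension by zero continuous.
\<close>

lemma Cc_Urysohn:
  assumes K: "compactin X K" and U: "openin X U" "K \<subseteq> U"
  obtains f :: "'a \<Rightarrow> real" and L where "f \<in> Cc X" "\<And>x. 0 \<le> f x" "\<And>x. f x \<le> 1" "\<And>x. x \<in> K \<Longrightarrow> f x = 1"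
    "compactin X L" "L \<subseteq> U" "\<And>x. x \<notin> L \<Longrightarrow> f x = 0"
proof -
  obtain V L where VL: "openin X V" "compactin X L" "closedin X L" "K \<subseteq> V" "V \<subseteq> L" "L \<subseteq> U"
    using compact_nbhd_inside[OF assms] .
  let ?Y = "subtopology X L"
  have tL: "topspace ?Y = L" using VL(3) by (simp add: closedin_subset inf_absorb2)
  have "compact_space ?Y" "Hausdorff_space ?Y"
    using VL Haus by (auto simp: compact_space_subtopology Hausdorff_space_subtopology)
  then have n: "normal_space ?Y" by (simp add: compact_Hausdorff_or_regular_imp_normal_space)
  have cK: "closedin ?Y K"
    using K Haus VL by (intro closedin_subset_topspace) (auto simp: compactin_imp_closedin)
  have "openin ?Y V" using VL by (simp add: openin_subset_topspace_eq subset_openin_subtopology)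
  then have cV: "closedin ?Y (L - V)" using tL by (metis closedin_diff closedin_topspace)
  obtain f where f: "continuous_map ?Y (top_of_set {0..1::real}) f" "f ` (L - V) \<subseteq> {0}" "f ` K \<subseteq> {1}"
    using Urysohn_lemma[OF n cV cK, of 0 1] VL by (auto simp: disjnt_def)
  define g where "g = (\<lambda>x. if x \<in> L then f x else 0)"
  have fc: "continuous_map ?Y euclidean f" and f01: "\<And>x. x \<in> L \<Longrightarrow> f x \<in> {0..1}"
    using f(1) tL by (auto simp: continuous_map_in_subtopology)
  have "continuous_map X euclidean g" unfolding g_def
    by (rule continuous_extend_by_zero[OF VL(3,1,5) fc]) (use f(2) in auto)
  then have "g \<in> Cc X" using VL(2) unfolding Cc_iff[OF Haus] g_def by auto
  moreover have "g x = 1" if "x \<in> K" for x using that f(3) VL by (auto simp: g_def)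
  ultimately show ?thesis using that[of g L] VL f01 by (auto simp: g_def)
qed

text \<open>
  A locally compact Hausdorff space need not be normal, so Tietze's theorem is applied to the compact set
  \<open>S \<inter> L\<close> only, and the result is cut off by a bump function \<open>u\<close> that vanishes off \<open>L\<close> and is \<open>1\<close> on \<open>K\<close>.
\<close>

lemma Cc_Tietze_real:
  fixes h :: "'a \<Rightarrow> real"
  assumes S: "closedin X S" and h: "continuous_map (subtopology X S) euclidean h"
    and K: "compactin X K" "openin X U" "K \<subseteq> U" and 0: "\<And>x. x \<in> S \<Longrightarrow> x \<notin> K \<Longrightarrow> h x = 0"
  obtains g where "g \<in> Cc X" "\<And>x. x \<in> S \<Longrightarrow> g x = h x" "\<And>x. x \<notin> U \<Longrightarrow> g x = 0"
proof -
  obtain u :: "'a \<Rightarrow> real" and L where u: "u \<in> Cc X" "\<And>x. x \<in> K \<Longrightarrow> u x = 1" and L: "compactin X L" "L \<subseteq> U"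
    "\<And>x. x \<notin> L \<Longrightarrow> u x = 0"
    using Cc_Urysohn[OF K] by metis
  have "compactin X (S \<inter> L)" using S L(1) by (simp add: closed_Int_compactin)
  moreover have "continuous_map (subtopology X (S \<inter> L)) euclidean h"
    using continuous_map_from_subtopology_mono[OF h] by blast
  moreover have "completely_regular_space X"
    using locally_compact_regular_imp_completely_regular_space lc Haus by blast
  ultimately obtain g where g: "continuous_map X euclideanreal g" "\<And>x. x \<in> S \<inter> L \<Longrightarrow> g x = h x"
    using Tietze_extension_completely_regular[of X "S \<inter> L" UNIV h] by auto
  show ?thesis
  proof
    show "(\<lambda>x. g x * u x) \<in> Cc X" by (rule Cc_mult[OF Haus u(1) g(1)])
    show "g x * u x = h x" if "x \<in> S" for x
      using that g(2)[of x] L(3)[of x] u(2)[of x] 0[of x] K by (cases "x \<in> L"; cases "x \<in> K") (force)+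
    show "g x * u x = 0" if "x \<notin> U" for x using L that by auto
  qed
qed

lemma Cc_Tietze:
  fixes h :: "'a \<Rightarrow> complex"
  assumes S: "closedin X S" and h: "continuous_map (subtopology X S) euclidean h"
    and K: "compactin X K" "openin X U" "K \<subseteq> U" and 0: "\<And>x. x \<in> S \<Longrightarrow> x \<notin> K \<Longrightarrow> h x = 0"
  obtains g where "g \<in> Cc X" "\<And>x. x \<in> S \<Longrightarrow> g x = h x" "\<And>x. x \<notin> U \<Longrightarrow> g x = 0"
proof -
  have "continuous_map (subtopology X S) euclidean (\<lambda>x. Re (h x))" "continuous_map (subtopology X S) euclidean (\<lambda>x. Im (h x))"
    by (auto intro!: continuous_map_compose_euclidean[OF h] continuous_intros)
  note c = this
  obtain g1 where g1: "g1 \<in> Cc X" "\<And>x. x \<in> S \<Longrightarrow> g1 x = Re (h x)" "\<And>x. x \<notin> U \<Longrightarrow> g1 x = 0"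
    using Cc_Tietze_real[OF S c(1) K] 0 by auto
  obtain g2 where g2: "g2 \<in> Cc X" "\<And>x. x \<in> S \<Longrightarrow> g2 x = Im (h x)" "\<And>x. x \<notin> U \<Longrightarrow> g2 x = 0"
    using Cc_Tietze_real[OF S c(2) K] 0 by auto
  show ?thesis
  proof
    show "(\<lambda>x. complex_of_real (g1 x) + \<i> * complex_of_real (g2 x)) \<in> Cc X"
      by (intro Cc_add Cc_scale Cc_of_real Haus g1 g2)
  qed (use g1 g2 in \<open>auto simp: complex_eq_iff\<close>)
qed

text \<open>
  The members of a countable base that lie in compact sets still form a base. Enumerating them and
  taking partial unions of the surrounding compact sets gives the exhaustion, since a compact set is covered by
  finitely many members of the base.
\<close>

lemma compact_exhaustion:
  assumes "second_countable X"
  shows "\<exists>C :: nat \<Rightarrow> 'a set. (\<forall>n. compactin X (C n)) \<and> (\<forall>K. compactin X K \<longrightarrow> (\<exists>n. \<forall>i\<ge>n. K \<subseteq> C i))"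
proof -
  obtain \<B> where \<B>: "countable \<B>" "\<And>V. V \<in> \<B> \<Longrightarrow> openin X V" "\<And>U x. openin X U \<Longrightarrow> x \<in> U \<Longrightarrow> \<exists>V \<in> \<B>. x \<in> V \<and> V \<subseteq> U"
    using assms unfolding second_countable_def by metis
  define \<C> where "\<C> = insert {} {V \<in> \<B>. \<exists>K. compactin X K \<and> V \<subseteq> K}"
  have "countable \<C>" unfolding \<C>_def using \<B>(1) by (intro countable_insert countable_subset[OF _ \<B>(1)]) auto
  then have range: "range (from_nat_into \<C>) = \<C>" by (intro range_from_nat_into) (auto simp: \<C>_def)
  have "\<exists>K. compactin X K \<and> V \<subseteq> K" if "V \<in> \<C>" for V
    using that by (auto simp: \<C>_def intro: exI[of _ "{}"])
  then have "\<exists>K. compactin X K \<and> from_nat_into \<C> n \<subseteq> K" for n using range by blast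
  then obtain K where K: "\<And>n. compactin X (K n)" "\<And>n. from_nat_into \<C> n \<subseteq> K n" by metis
  show ?thesis
  proof (intro exI[of _ "\<lambda>n. \<Union>i\<le>n. K i"] conjI allI impI)
    show "compactin X (\<Union>i\<le>n. K i)" for n by (intro compactin_Union) (auto intro: K)
    fix L assume L: "compactin X L"
    have "\<exists>V\<in>\<C>. x \<in> V" if "x \<in> L" for x
    proof -
      have "x \<in> topspace X" using that compactin_subset_topspace[OF L] by auto
      then obtain U C where U: "openin X U" "compactin X C" "x \<in> U" "U \<subseteq> C"
        using lc unfolding locally_compact_space_def by metis
      obtain V where V: "V \<in> \<B>" "x \<in> V" "V \<subseteq> U" using \<B>(3)[OF U(1,3)] by auto
      have "V \<subseteq> C" using V(3) U(4) by (rule order_trans)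
      then have "V \<in> \<C>" unfolding \<C>_def using V(1) U(2) by auto
      then show ?thesis using V(2) by blast
    qed
    then have cover: "L \<subseteq> \<Union>\<C>" by blast
    have "openin X V" if "V \<in> \<C>" for V using that \<B>(2) by (auto simp: \<C>_def)
    from compactinD[OF L this cover] obtain \<F> where \<F>: "finite \<F>" "\<F> \<subseteq> \<C>" "L \<subseteq> \<Union>\<F>"
      by blast
    have "\<F> \<subseteq> from_nat_into \<C> ` UNIV" using \<F>(2) range by simp
    from finite_subset_image[OF \<F>(1) this]
    obtain J where J: "finite J" "\<F> = from_nat_into \<C> ` J" by blast
    obtain n where n: "J \<subseteq> {..n}" using finite_nat_iff_bounded_le[of J] J(1) by auto
    show "\<exists>n. \<forall>i\<ge>n. L \<subseteq> (\<Union>i\<le>i. K i)"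
    proof (intro exI[of _ n] allI impI subsetI)
      fix i x assume "n \<le> i" "x \<in> L"
      then obtain j where j: "j \<in> J" "x \<in> from_nat_into \<C> j" using \<F>(3) unfolding J(2) by auto
      then have "x \<in> K j" "j \<le> i" using K(2)[of j] n \<open>n \<le> i\<close> by auto
      then show "x \<in> (\<Union>i\<le>i. K i)" by auto
    qed
  qed
qed

end

section \<open>Borel measurability and Radon measures\<close>

lemma space_borel_of [simp]: "space (borel_of X) = topspace X"
  unfolding borel_of_def by (rule space_measure_of) (use openin_subset in blast)

lemma openin_sets_borel_of: "openin X U \<Longrightarrow> U \<in> sets (borel_of X)"
  unfolding borel_of_def by (subst sets_measure_of) (use openin_subset in \<open>auto intro: sigma_sets.Basic\<close>)

lemma closedin_sets_borel_of: 
  assumes "closedin X C" shows "C \<in> sets (borel_of X)"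
proof -
  have "space (borel_of X) - (topspace X - C) \<in> sets (borel_of X)"
    using assms by (intro sets.compl_sets openin_sets_borel_of) (simp add: closedin_def)
  moreover have "topspace X - (topspace X - C) = C" using closedin_subset[OF assms] by auto
  ultimately show ?thesis by simp
qed

lemma measurable_borel_of_continuous:
  assumes "continuous_map X euclidean f"
  shows "f \<in> borel_measurable (borel_of X)"
proof (rule borel_measurableI)
  fix S :: "'b set" assume "open S"
  then have "openin X {x \<in> topspace X. f x \<in> S}" using assms by (simp add: continuous_map_def)
  moreover have "f -` S \<inter> space (borel_of X) = {x \<in> topspace X. f x \<in> S}" by auto
  ultimately show "f -` S \<inter> space (borel_of X) \<in> sets (borel_of X)" by (simp add: openin_sets_borel_of)
qed

lemma radon_sets: "radon_measure X M \<Longrightarrow> sets M = sets (borel_of X)"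
  by (simp add: radon_measure_def)

lemma radon_space: "radon_measure X M \<Longrightarrow> space M = topspace X"
  by (metis radon_sets sets_eq_imp_space_eq space_borel_of)

lemma radon_measurable: "radon_measure X M \<Longrightarrow> continuous_map X euclidean f \<Longrightarrow> f \<in> borel_measurable M"
  using measurable_borel_of_continuous[of X f] measurable_cong_sets[OF radon_sets refl] by metis

lemma radon_compact_finite: "radon_measure X M \<Longrightarrow> compactin X K \<Longrightarrow> emeasure M K < \<infinity>"
  by (simp add: radon_measure_def)

lemma radon_integrable_bounded_support:
  fixes f :: "'a \<Rightarrow> 'b::{banach, second_countable_topology}"
  assumes M: "radon_measure X M" "Hausdorff_space X" and K: "compactin X K" "\<And>x. x \<in> space M \<Longrightarrow> x \<notin> K \<Longrightarrow> f x = 0"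
    and f: "f \<in> borel_measurable M" "\<And>x. x \<in> space M \<Longrightarrow> norm (f x) \<le> B"
  shows "integrable M f"
proof -
  have Ks: "K \<in> sets M" using K M by (simp add: radon_sets closedin_sets_borel_of compactin_imp_closedin)
  have "integrable M (\<lambda>x. B * indicator K x)"
    using Ks radon_compact_finite[OF M(1) K(1)] by (intro integrable_mult_right integrable_real_indicator) auto
  then show ?thesis
  proof (rule Bochner_Integration.integrable_bound)
    show "AE x in M. norm (f x) \<le> norm (B * indicator K x)"
    proof (rule AE_I2)
      fix x assume "x \<in> space M"
      then show "norm (f x) \<le> norm (B * indicator K x)"
        using K(2)[of x] f(2)[of x] by (cases "x \<in> K") auto
    qed
  qed (rule f)
qed

lemma radon_Cc_integrable:
  fixes f :: "'a \<Rightarrow> 'b::{banach, second_countable_topology}"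
  assumes "radon_measure X M" "Hausdorff_space X" "f \<in> Cc X"
  shows "integrable M f"
proof -
  obtain K where "compactin X K" "\<And>x. x \<notin> K \<Longrightarrow> f x = 0"
    using assms(3) unfolding Cc_iff[OF assms(2)] by metis
  moreover obtain B where "B > 0" "\<And>x. norm (f x) \<le> B" using Cc_bounded[OF assms(2,3)] by metis
  ultimately show ?thesis
    using radon_measurable[OF assms(1) Cc_continuous[OF assms(3)]]
    by (intro radon_integrable_bounded_support[OF assms(1,2)]) auto
qed

text \<open>
  The complement of the support is the union of all null open sets. It is open, and each of its compact
  subsets is covered by finitely many null sets, so it is null by inner regularity on open sets.
\<close>

lemma AE_measure_support:
  assumes M: "radon_measure X M"
  shows "AE x in M. x \<in> measure_support X M"
proof -
  define U where "U = \<Union>{V. openin X V \<and> emeasure M V = 0}"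
  have U: "openin X U" unfolding U_def by (intro openin_Union) auto
  have "emeasure M K = 0" if K: "compactin X K" "K \<subseteq> U" for K
  proof -
    obtain F where F: "finite F" "F \<subseteq> {V. openin X V \<and> emeasure M V = 0}" "K \<subseteq> \<Union>F"
      using K compactinD[OF K(1), of "{V. openin X V \<and> emeasure M V = 0}"] unfolding U_def by auto
    have "\<Union>F \<in> null_sets M" 
    proof (rule null_sets.finite_Union)
      show "F \<subseteq> null_sets M" using F(2) radon_sets[OF M] by (auto simp: null_sets_def openin_sets_borel_of)
    qed (use F in auto)
    then have "emeasure M K \<le> 0" by (metis F(3) emeasure_mono null_setsD1 null_setsD2)
    then show ?thesis by simp
  qed
  moreover have "emeasure M U = (SUP K \<in> {K. compactin X K \<and> K \<subseteq> U}. emeasure M K)"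
    using M U by (simp add: radon_measure_def)
  ultimately have "emeasure M U = 0"
    by (intro antisym) (metis (no_types, lifting) SUP_least mem_Collect_eq order_refl, simp)
  then have "U \<in> null_sets M" using U radon_sets[OF M] by (auto simp: null_sets_def openin_sets_borel_of)
  then show ?thesis
  proof (rule AE_I')
    show "{x \<in> space M. x \<notin> measure_support X M} \<subseteq> U"
      unfolding measure_support_def U_def radon_space[OF M] by (auto simp: zero_less_iff_neq_zero)
  qed
qed

text \<open>
  Fubini's theorem speaks about the product of two Borel algebras, continuity about the product topology.
  With countable bases every open set is a countable union of open rectangles, which reconciles the two.
\<close>

lemma openin_prod_sets_borel:
  assumes X: "second_countable X" and Y: "second_countable Y"
    and W: "openin (prod_topology X Y) W"
  shows "W \<in> sets (borel_of X \<Otimes>\<^sub>M borel_of Y)"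
proof -
  obtain A where A: "countable A" "\<And>V. V \<in> A \<Longrightarrow> openin X V" "\<And>U x. openin X U \<Longrightarrow> x \<in> U \<Longrightarrow> \<exists>V \<in> A. x \<in> V \<and> V \<subseteq> U"
    using X unfolding second_countable_def by metis
  obtain B where B: "countable B" "\<And>V. V \<in> B \<Longrightarrow> openin Y V" "\<And>U x. openin Y U \<Longrightarrow> x \<in> U \<Longrightarrow> \<exists>V \<in> B. x \<in> V \<and> V \<subseteq> U"
    using Y unfolding second_countable_def by metis
  let ?C = "{p \<in> A \<times> B. fst p \<times> snd p \<subseteq> W}"
  have "W = (\<Union>p\<in>?C. fst p \<times> snd p)"
  proof (intro equalityI subsetI)
    fix z assume "z \<in> W"
    then obtain U V where "openin X U" "openin Y V" "fst z \<in> U" "snd z \<in> V" "U \<times> V \<subseteq> W"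
      using W unfolding openin_prod_topology_alt by (metis prod.collapse)
    note UV = this
    obtain U' where U': "U' \<in> A" "fst z \<in> U'" "U' \<subseteq> U" using A(3)[OF UV(1,3)] by blast
    obtain V' where V': "V' \<in> B" "snd z \<in> V'" "V' \<subseteq> V" using B(3)[OF UV(2,4)] by blast
    have "(U', V') \<in> ?C" "z \<in> fst (U',V') \<times> snd (U',V')" using UV U' V' by (auto simp: mem_Times_iff)
    then show "z \<in> (\<Union>p\<in>?C. fst p \<times> snd p)" by blast
  qed auto
  also have "\<dots> \<in> sets (borel_of X \<Otimes>\<^sub>M borel_of Y)"
  proof (rule sets.countable_UN'')
    show "countable ?C" by (rule countable_subset[of _ "A \<times> B"]) (use A B in auto)
    show "(\<lambda>p. fst p \<times> snd p) p \<in> sets (borel_of X \<Otimes>\<^sub>M borel_of Y)" if "p \<in> ?C" for p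
      using that A B by (intro pair_measureI openin_sets_borel_of) auto
  qed
  finally show ?thesis .
qed

lemma borel_measurable_prod_closed:
  fixes F :: "'a \<times> 'b \<Rightarrow> 'c::real_normed_vector"
  assumes X: "second_countable X" and Y: "second_countable Y" and D: "closedin (prod_topology X Y) D"
    and F: "continuous_map (subtopology (prod_topology X Y) D) euclidean F"
  shows "(\<lambda>p. if p \<in> D then F p else 0) \<in> borel_measurable (borel_of X \<Otimes>\<^sub>M borel_of Y)"
proof (rule borel_measurableI)
  let ?P = "borel_of X \<Otimes>\<^sub>M borel_of Y"
  have sp: "space ?P = topspace X \<times> topspace Y" by (simp add: space_pair_measure)
  have "topspace (prod_topology X Y) - D \<in> sets ?P"
    using D by (intro openin_prod_sets_borel X Y) (simp add: closedin_def)
  then have "space ?P - (topspace (prod_topology X Y) - D) \<in> sets ?P" by blast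
  moreover have "D \<subseteq> topspace X \<times> topspace Y" using closedin_subset[OF D] by simp
  ultimately have Ds: "D \<in> sets ?P" by (simp add: sp double_diff)
  fix S :: "'c set" assume "open S"
  then have "openin (subtopology (prod_topology X Y) D) {p \<in> topspace (subtopology (prod_topology X Y) D). F p \<in> S}"
    using F by (simp add: continuous_map_def)
  then obtain W where W: "openin (prod_topology X Y) W"
     "{p \<in> topspace (subtopology (prod_topology X Y) D). F p \<in> S} = W \<inter> D"
    unfolding openin_subtopology by blast
  have WD: "W \<inter> D = {p \<in> D. F p \<in> S}" using W(2) closedin_subset[OF D] by auto
  have Ws: "W \<inter> D \<in> sets ?P" using openin_prod_sets_borel[OF X Y W(1)] Ds by blast
  have "(\<lambda>p. if p \<in> D then F p else 0) -` S \<inter> space ?P = (W \<inter> D) \<union> (if 0 \<in> S then space ?P - D else {})"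
    unfolding WD using \<open>D \<subseteq> topspace X \<times> topspace Y\<close> by (auto simp: sp split: if_splits)
  then show "(\<lambda>p. if p \<in> D then F p else 0) -` S \<inter> space ?P \<in> sets ?P"
    using Ws Ds by auto
qed

text \<open>
  By local compactness every point has a basic neighbourhood inside a compact set, so the basic open sets of
  finite measure form a countable cover.
\<close>

lemma radon_sigma_finite:
  assumes M: "radon_measure X M" and X: "second_countable X" "locally_compact_space X" "Hausdorff_space X"
  shows "sigma_finite_measure M"
proof -
  obtain A where A: "countable A" "\<And>V. V \<in> A \<Longrightarrow> openin X V" "\<And>U x. openin X U \<Longrightarrow> x \<in> U \<Longrightarrow> \<exists>V \<in> A. x \<in> V \<and> V \<subseteq> U"
    using X unfolding second_countable_def by metis
  let ?C = "{V \<in> A. emeasure M V \<noteq> \<infinity>}"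
  show ?thesis
  proof
    show "\<exists>C. countable C \<and> C \<subseteq> sets M \<and> \<Union>C = space M \<and> (\<forall>a\<in>C. emeasure M a \<noteq> \<infinity>)"
    proof (intro exI conjI)
      show "countable ?C" by (rule countable_subset[of _ A]) (use A in auto)
      show "?C \<subseteq> sets M" using A radon_sets[OF M] by (auto intro: openin_sets_borel_of)
      show "\<Union>?C = space M"
      proof (intro equalityI subsetI)
        fix x assume "x \<in> space M"
        then obtain U K where U: "openin X U" "compactin X K" "x \<in> U" "U \<subseteq> K"
          using X(2) unfolding locally_compact_space_def radon_space[OF M] by metis
        then obtain V where V: "V \<in> A" "x \<in> V" "V \<subseteq> U" using A by metis
        have "K \<in> sets M" using U(2) X(3) radon_sets[OF M] by (simp add: closedin_sets_borel_of compactin_imp_closedin)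
        then have "emeasure M V \<le> emeasure M K" using V U by (intro emeasure_mono) auto
        then have "emeasure M V < \<infinity>" using radon_compact_finite[OF M U(2)] by (rule le_less_trans)
        then show "x \<in> \<Union>?C" using V by auto
      qed (use A(2) radon_space[OF M] openin_subset in fastforce)
    qed auto
  qed
qed

section \<open>The Riesz representation theorem\<close>

lemma compactin_diff_openin:
  assumes "compactin X L" "openin X V" shows "compactin X (L - V)"
proof -
  have "compactin X ((topspace X - V) \<inter> L)"
    using assms by (intro closed_Int_compactin closedin_diff closedin_topspace)
  also have "(topspace X - V) \<inter> L = L - V" using compactin_subset_topspace[OF assms(1)] by auto
  finally show ?thesis .
qed

text \<open>
  The mass of an open set is the supremum of \<open>\<Lambda> f\<close> over the functions \<open>0 \<le> f \<le> 1\<close> with compact support in it.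
  Approximation from outside by open sets extends it to an outer measure, and Caratheodory's construction
  makes this a measure on the Borel sets.
\<close>

locale positive_functional = LCH X for X :: "'a topology" +
  fixes \<Lambda> :: "('a \<Rightarrow> real) \<Rightarrow> real"
  assumes add: "f \<in> Cc X \<Longrightarrow> g \<in> Cc X \<Longrightarrow> \<Lambda> (\<lambda>x. f x + g x) = \<Lambda> f + \<Lambda> g"
    and scale: "f \<in> Cc X \<Longrightarrow> \<Lambda> (\<lambda>x. c * f x) = c * \<Lambda> f"
    and pos: "f \<in> Cc X \<Longrightarrow> (\<And>x. 0 \<le> f x) \<Longrightarrow> 0 \<le> \<Lambda> f"
begin

lemma diff: "f \<in> Cc X \<Longrightarrow> g \<in> Cc X \<Longrightarrow> \<Lambda> (\<lambda>x. f x - g x) = \<Lambda> f - \<Lambda> g"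
  using add[of f "\<lambda>x. (-1) * g x"] scale[of g "-1"] Cc_scale[OF Haus, of g "-1"] by simp

lemma mono: "f \<in> Cc X \<Longrightarrow> g \<in> Cc X \<Longrightarrow> (\<And>x. f x \<le> g x) \<Longrightarrow> \<Lambda> f \<le> \<Lambda> g"
  using pos[of "\<lambda>x. g x - f x"] diff[of g f] Cc_diff[OF Haus, of g f] by simp

lemma sum: "(\<And>i. i \<in> I \<Longrightarrow> f i \<in> Cc X) \<Longrightarrow> \<Lambda> (\<lambda>x. \<Sum>i\<in>I. f i x) = (\<Sum>i\<in>I. \<Lambda> (f i))"
proof (induction I rule: infinite_finite_induct)
  case (insert i I)
  then show ?case by (simp add: add Cc_sum[OF Haus])
qed (use scale[of "\<lambda>x. 0" 0] Cc_zero[OF Haus] in auto)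

definition subordinate :: "'a set \<Rightarrow> ('a \<Rightarrow> real) set" where
  "subordinate U = {f \<in> Cc X. (\<forall>x. 0 \<le> f x \<and> f x \<le> 1) \<and>
     (\<exists>L. compactin X L \<and> L \<subseteq> U \<and> (\<forall>x. x \<notin> L \<longrightarrow> f x = 0))}"

definition open_mass :: "'a set \<Rightarrow> ennreal" where
  "open_mass U = (SUP f \<in> subordinate U. ennreal (\<Lambda> f))"

definition outer_mass :: "'a set \<Rightarrow> ennreal" where
  "outer_mass E = (INF U \<in> {U. openin X U \<and> E \<subseteq> U}. open_mass U)"

lemma subordinateD:
  assumes "f \<in> subordinate U"
  shows "f \<in> Cc X" "0 \<le> f x" "f x \<le> 1" "0 \<le> \<Lambda> f"
  using assms pos[of f] by (auto simp: subordinate_def)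

lemma subordinateE:
  assumes "f \<in> subordinate U"
  obtains L where "compactin X L" "L \<subseteq> U" "\<And>x. x \<notin> L \<Longrightarrow> f x = 0"
  using assms by (auto simp: subordinate_def)

lemma subordinateI:
  assumes "f \<in> Cc X" "\<And>x. 0 \<le> f x" "\<And>x. f x \<le> 1" "compactin X L" "L \<subseteq> U" "\<And>x. x \<notin> L \<Longrightarrow> f x = 0"
  shows "f \<in> subordinate U"
  using assms by (auto simp: subordinate_def)

lemma zero_subordinate: "(\<lambda>x. 0) \<in> subordinate U"
  using Cc_zero[OF Haus] by (auto simp: subordinate_def intro!: exI[of _ "{}"])

lemma open_mass_upper: "f \<in> subordinate U \<Longrightarrow> ennreal (\<Lambda> f) \<le> open_mass U"
  unfolding open_mass_def by (rule SUP_upper)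

lemma open_mass_mono: "U \<subseteq> V \<Longrightarrow> open_mass U \<le> open_mass V"
  unfolding open_mass_def by (rule SUP_subset_mono) (auto simp: subordinate_def)

lemma outer_mass_open: "openin X U \<Longrightarrow> outer_mass U = open_mass U"
  unfolding outer_mass_def by (rule antisym) (auto intro: INF_lower INF_greatest open_mass_mono)

lemma outer_mass_mono: "A \<subseteq> B \<Longrightarrow> outer_mass A \<le> outer_mass B"
  unfolding outer_mass_def by (rule INF_superset_mono) auto

lemma outer_mass_le: "openin X U \<Longrightarrow> E \<subseteq> U \<Longrightarrow> outer_mass E \<le> open_mass U"
  unfolding outer_mass_def by (rule INF_lower) auto

text \<open>
  A function \<open>h\<close> supported in \<open>U\<close> that is \<open>1\<close> near the part of the support of \<open>f\<close> outside \<open>V\<close> splits \<open>f\<close> into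
  \<open>f h\<close>, which is subordinate to \<open>U\<close>, and \<open>f - f h\<close>, which is subordinate to \<open>V\<close>.
\<close>

lemma open_mass_Un:
  assumes U: "openin X U" and V: "openin X V"
  shows "open_mass (U \<union> V) \<le> open_mass U + open_mass V"
  unfolding open_mass_def[of "U \<union> V"]
proof (rule SUP_least)
  fix f assume f: "f \<in> subordinate (U \<union> V)"
  obtain L where L: "compactin X L" "L \<subseteq> U \<union> V" "\<And>x. x \<notin> L \<Longrightarrow> f x = 0"
    using subordinateE[OF f] by metis
  note fD = subordinateD[OF f]
  have "compactin X (L - V)" using L(1) V by (rule compactin_diff_openin)
  moreover have "L - V \<subseteq> U" using L by auto
  ultimately obtain W C where WC: "openin X W" "compactin X C" "L - V \<subseteq> W" "W \<subseteq> C" "C \<subseteq> U"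
    using compact_nbhd_inside[OF _ U] by metis
  obtain h :: "'a \<Rightarrow> real" and K where h: "h \<in> Cc X" "\<And>x. 0 \<le> h x" "\<And>x. h x \<le> 1" "\<And>x. x \<in> C \<Longrightarrow> h x = 1"
    "compactin X K" "K \<subseteq> U" "\<And>x. x \<notin> K \<Longrightarrow> h x = 0"
    using Cc_Urysohn[OF WC(2) U WC(5)] by metis
  let ?f1 = "\<lambda>x. f x * h x" and ?f2 = "\<lambda>x. f x - f x * h x"
  have c1: "?f1 \<in> Cc X" by (rule Cc_mult[OF Haus h(1) Cc_continuous[OF fD(1)]])
  have c2: "?f2 \<in> Cc X" by (rule Cc_diff[OF Haus fD(1) c1])
  have "?f1 \<in> subordinate U"
    using c1 fD(2,3) h by (intro subordinateI[of _ K]) (auto intro!: mult_le_one)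
  moreover have "?f2 \<in> subordinate V"
    unfolding subordinate_def
  proof (intro CollectI conjI allI c2 exI)
    fix x
    show "0 \<le> f x - f x * h x" using fD(2)[of x] h(3)[of x] by (simp add: mult_left_le)
    have "0 \<le> f x * h x" using fD(2)[of x] h(2)[of x] by simp
    then show "f x - f x * h x \<le> 1" using fD(3)[of x] by linarith
    show "compactin X (L - W)"
      using L(1) WC(1) by (rule compactin_diff_openin)
    show "L - W \<subseteq> V" using WC(3) by auto
    show "x \<notin> L - W \<longrightarrow> f x - f x * h x = 0" using L(3)[of x] h(4)[of x] WC(4) by auto
  qed
  moreover have "\<Lambda> f = \<Lambda> ?f1 + \<Lambda> ?f2" using add[OF c1 c2] by simp
  ultimately show "ennreal (\<Lambda> f) \<le> open_mass U + open_mass V"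
    using add_mono[OF open_mass_upper open_mass_upper, of ?f1 U ?f2 V] subordinateD(4)[of ?f1 U] subordinateD(4)[of ?f2 V]
    by (simp add: ennreal_plus)
qed

lemma open_mass_UN_finite:
  assumes "\<And>i::nat. openin X (U i)"
  shows "open_mass (\<Union>i<n. U i) \<le> (\<Sum>i<n. open_mass (U i))"
proof (induction n)
  case 0
  have "f = (\<lambda>x. 0)" if "f \<in> subordinate {}" for f using that by (auto simp: subordinate_def)
  then have "open_mass {} \<le> 0" unfolding open_mass_def using scale[OF Cc_zero[OF Haus], of 0] 
    by (intro SUP_least) auto
  then show ?case by simp
next
  case (Suc n)
  have "open_mass ((\<Union>i<n. U i) \<union> U n) \<le> open_mass (\<Union>i<n. U i) + open_mass (U n)"
    using assms by (intro open_mass_Un) auto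
  also have "\<dots> \<le> (\<Sum>i<n. open_mass (U i)) + open_mass (U n)" using Suc by (intro add_mono) auto
  finally show ?case by (simp add: lessThan_Suc Un_commute add.commute)
qed

lemma open_mass_UN:
  assumes U: "\<And>i::nat. openin X (U i)"
  shows "open_mass (\<Union>i. U i) \<le> (\<Sum>i. open_mass (U i))"
  unfolding open_mass_def[of "\<Union>i. U i"]
proof (rule SUP_least)
  fix f assume f: "f \<in> subordinate (\<Union>i. U i)"
  obtain L where L: "compactin X L" "L \<subseteq> (\<Union>i. U i)" "\<And>x. x \<notin> L \<Longrightarrow> f x = 0"
    using subordinateE[OF f] by metis
  obtain F where F: "finite F" "F \<subseteq> range U" "L \<subseteq> \<Union>F"
    using compactinD[OF L(1), of "range U"] L(2) U by auto
  then obtain I where I: "finite I" "L \<subseteq> (\<Union>i\<in>I. U i)"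
    using finite_subset_image[OF F(1,2)] by blast
  obtain n where "I \<subseteq> {..<n}" using I(1) finite_nat_iff_bounded by blast
  then have "L \<subseteq> (\<Union>i<n. U i)" using I(2) by blast
  then have "f \<in> subordinate (\<Union>i<n. U i)" using subordinateD[OF f] L by (intro subordinateI[of f L]) auto
  then have "ennreal (\<Lambda> f) \<le> open_mass (\<Union>i<n. U i)" by (rule open_mass_upper)
  also have "\<dots> \<le> (\<Sum>i<n. open_mass (U i))" by (rule open_mass_UN_finite[OF U])
  also have "\<dots> \<le> (\<Sum>i. open_mass (U i))" by (rule sum_le_suminf) auto
  finally show "ennreal (\<Lambda> f) \<le> (\<Sum>i. open_mass (U i))" .
qed

lemma outer_mass_close:
  assumes "e > 0" "E \<subseteq> topspace X"
  obtains U where "openin X U" "E \<subseteq> U" "open_mass U \<le> outer_mass E + e"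
proof (cases "outer_mass E = \<infinity>")
  case True
  then show ?thesis using that[of "topspace X"] assms by auto
next
  case False
  then have "outer_mass E < outer_mass E + e" using assms(1) by (simp add: ennreal_add_left_cancel_less)
  then show ?thesis using that unfolding outer_mass_def[of E] INF_less_iff by (metis (mono_tags, lifting) less_imp_le mem_Collect_eq)
qed

lemma outer_mass_countably_subadditive:
  assumes A: "\<And>i::nat. A i \<subseteq> topspace X"
  shows "outer_mass (\<Union>i. A i) \<le> (\<Sum>i. outer_mass (A i))"
proof (rule ennreal_le_epsilon)
  fix e :: real assume "0 < e"
  have "\<exists>U. openin X U \<and> A i \<subseteq> U \<and> open_mass U \<le> outer_mass (A i) + ennreal e * ennreal ((1/2)^Suc i)" for i
  proof -
    have "ennreal e * ennreal ((1/2)^Suc i) \<noteq> 0" using \<open>0 < e\<close> by simp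
    then have "0 < ennreal e * ennreal ((1/2)^Suc i)" unfolding zero_less_iff_neq_zero .
    from outer_mass_close[OF this A, of i] show ?thesis by blast
  qed
  then obtain U where U: "\<And>i. openin X (U i)" "\<And>i. A i \<subseteq> U i"
    "\<And>i. open_mass (U i) \<le> outer_mass (A i) + ennreal e * ennreal ((1/2)^Suc i)" by metis
  have "outer_mass (\<Union>i. A i) \<le> open_mass (\<Union>i. U i)"
    using U by (intro outer_mass_le) auto
  also have "\<dots> \<le> (\<Sum>i. open_mass (U i))" by (rule open_mass_UN[OF U(1)])
  also have "\<dots> \<le> (\<Sum>i. outer_mass (A i) + ennreal e * ennreal ((1/2)^Suc i))"
    by (intro suminf_le U) auto
  also have "\<dots> = (\<Sum>i. outer_mass (A i)) + (\<Sum>i. ennreal e * ennreal ((1/2)^Suc i))"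
    by (rule suminf_add[symmetric]) auto
  also have "(\<Sum>i. ennreal e * ennreal ((1/2)^Suc i)) = ennreal e"
    unfolding ennreal_suminf_cmult by (subst suminf_ennreal_eq[OF zero_le_power power_half_series]) auto
  finally show "outer_mass (\<Union>i. A i) \<le> (\<Sum>i. outer_mass (A i)) + ennreal e" .
qed

lemma outer_mass_empty: "outer_mass {} = 0"
proof -
  have "open_mass {} \<le> 0" using open_mass_UN_finite[of "\<lambda>_. {}" 0] by simp
  then show ?thesis using outer_mass_open[of "{}"] by simp
qed

text \<open>
  This is the Caratheodory condition for the open set \<open>U\<close>. If \<open>f\<close> is subordinate to \<open>V \<inter> U\<close> with support in \<open>L\<close>
  and \<open>g\<close> is subordinate to \<open>V - L\<close>, then the supports are disjoint and \<open>f + g\<close> is subordinate to \<open>V\<close>. The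
  inequality follows by taking the supremum first over \<open>g\<close> and then over \<open>f\<close>.
\<close>

lemma outer_mass_split:
  assumes U: "openin X U" and E: "E \<subseteq> topspace X"
  shows "outer_mass (U \<inter> E) + outer_mass ((topspace X - U) \<inter> E) \<le> outer_mass E"
  unfolding outer_mass_def[of E]
proof (rule INF_greatest)
  fix V assume "V \<in> {U. openin X U \<and> E \<subseteq> U}"
  then have V: "openin X V" "E \<subseteq> V" by auto
  have "outer_mass (U \<inter> E) + outer_mass ((topspace X - U) \<inter> E) \<le> open_mass (V \<inter> U) + outer_mass (V - U)"
    using V U by (intro add_mono outer_mass_le outer_mass_mono) auto
  also have "\<dots> = (SUP f \<in> subordinate (V \<inter> U). ennreal (\<Lambda> f) + outer_mass (V - U))"
    unfolding open_mass_def using zero_subordinate by (subst ennreal_SUP_add_left) auto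
  also have "\<dots> \<le> open_mass V"
  proof (rule SUP_least)
    fix f assume f: "f \<in> subordinate (V \<inter> U)"
    note fD = subordinateD[OF f]
    obtain L where L: "compactin X L" "L \<subseteq> V \<inter> U" "\<And>x. x \<notin> L \<Longrightarrow> f x = 0"
    using subordinateE[OF f] by metis
    have "openin X (V - L)" using V(1) L(1) Haus by (simp add: compactin_imp_closedin openin_diff)
    then have "ennreal (\<Lambda> f) + outer_mass (V - U) \<le> ennreal (\<Lambda> f) + open_mass (V - L)"
      using L by (intro add_mono outer_mass_le) auto
    also have "\<dots> = (SUP g \<in> subordinate (V - L). ennreal (\<Lambda> f) + ennreal (\<Lambda> g))"
      unfolding open_mass_def using zero_subordinate by (subst ennreal_SUP_add_right) auto
    also have "\<dots> \<le> open_mass V"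
    proof (rule SUP_least)
      fix g assume g: "g \<in> subordinate (V - L)"
      note gD = subordinateD[OF g]
      obtain K where K: "compactin X K" "K \<subseteq> V - L" "\<And>x. x \<notin> K \<Longrightarrow> g x = 0"
    using subordinateE[OF g] by metis
      have "f x + g x \<le> 1" for x
        using K(2) K(3)[of x] L(3)[of x] fD(3)[of x] gD(3)[of x] by (cases "x \<in> L") fastforce+
      then have "(\<lambda>x. f x + g x) \<in> subordinate V"
        using fD gD K L Cc_add[OF Haus fD(1) gD(1)]
        by (intro subordinateI[of _ "K \<union> L"]) (auto intro: compactin_Un)
      then have "ennreal (\<Lambda> (\<lambda>x. f x + g x)) \<le> open_mass V" by (rule open_mass_upper)
      then show "ennreal (\<Lambda> f) + ennreal (\<Lambda> g) \<le> open_mass V"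
        using fD(4) gD(4) by (simp add: add[OF fD(1) gD(1)])
    qed
    finally show "ennreal (\<Lambda> f) + outer_mass (V - U) \<le> open_mass V" .
  qed
  finally show "outer_mass (U \<inter> E) + outer_mass ((topspace X - U) \<inter> E) \<le> open_mass V" .
qed

definition representing_measure :: "'a measure" where
  "representing_measure = measure_of (topspace X) {U. openin X U} outer_mass"

lemma sets_representing_measure: "sets representing_measure = sets (borel_of X)"
  unfolding representing_measure_def borel_of_def using openin_subset
  by (subst (1 2) sets_measure_of) auto

lemma emeasure_representing_measure:
  assumes "A \<in> sets (borel_of X)"
  shows "emeasure representing_measure A = outer_mass A"
proof -
  let ?P = "Pow (topspace X)" and ?B = "sigma_sets (topspace X) {U. openin X U}"
  have osub: "{U. openin X U} \<subseteq> ?P" using openin_subset by auto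
  have B: "sets (borel_of X) = ?B" unfolding borel_of_def using osub by (rule sets_measure_of)
  interpret P: sigma_algebra "topspace X" ?P by (rule sigma_algebra_Pow)
  have oms: "outer_measure_space ?P outer_mass"
    unfolding outer_measure_space_def
  proof (intro conjI)
    show "positive ?P outer_mass" by (simp add: positive_def outer_mass_empty)
    show "increasing ?P outer_mass" by (simp add: increasing_def outer_mass_mono)
    show "countably_subadditive ?P outer_mass"
      unfolding countably_subadditive_def by (auto intro!: outer_mass_countably_subadditive)
  qed
  define L where "L = lambda_system (topspace X) ?P outer_mass"
  have ms: "measure_space (topspace X) L outer_mass"
    unfolding L_def by (rule P.caratheodory_lemma[OF oms])
  then interpret L: sigma_algebra "topspace X" L by (simp add: measure_space_def)
  have "{U. openin X U} \<subseteq> L"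
  proof
    fix U assume "U \<in> {U. openin X U}"
    then have U: "openin X U" by simp
    show "U \<in> L" unfolding L_def lambda_system_def
    proof (intro CollectI conjI ballI)
      show "U \<in> ?P" using U osub by auto
      fix E assume E: "E \<in> ?P"
      have "outer_mass E \<le> outer_mass (U \<inter> E) + outer_mass ((topspace X - U) \<inter> E)"
      proof -
        let ?A = "\<lambda>i::nat. if i = 0 then U \<inter> E else if i = 1 then (topspace X - U) \<inter> E else {}"
        have "outer_mass (\<Union>i. ?A i) \<le> (\<Sum>i. outer_mass (?A i))"
          using E by (intro outer_mass_countably_subadditive) auto
        also have "(\<Sum>i. outer_mass (?A i)) = (\<Sum>i<2. outer_mass (?A i))"
          by (rule suminf_finite) (auto simp: outer_mass_empty)
        also have "\<dots> = outer_mass (U \<inter> E) + outer_mass ((topspace X - U) \<inter> E)"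
          by (simp add: numeral_2_eq_2)
        also have "(\<Union>i. ?A i) = E" using E by (auto split: if_splits)
        finally show ?thesis .
      qed
      then show "outer_mass (U \<inter> E) + outer_mass ((topspace X - U) \<inter> E) = outer_mass E"
        using outer_mass_split[OF U] E by (intro antisym) auto
    qed
  qed
  then have BL: "?B \<subseteq> L" by (rule L.sigma_sets_subset)
  have ca: "countably_additive L outer_mass" using ms by (simp add: measure_space_def)
  show ?thesis
  proof (rule emeasure_measure_of[OF representing_measure_def osub])
    show "positive (sets representing_measure) outer_mass" by (simp add: positive_def outer_mass_empty)
    show "countably_additive (sets representing_measure) outer_mass"
      using ca BL unfolding countably_additive_def sets_representing_measure B by blast
    show "A \<in> sets representing_measure" using assms by (simp add: sets_representing_measure)
  qed
qed

text \<open>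
  For \<open>a < 1\<close> the set \<open>{f > a}\<close> is an open neighbourhood of \<open>K\<close>, and every function subordinate to it is at most
  \<open>f / a\<close>.
\<close>

lemma outer_mass_le_functional:
  assumes K: "compactin X K" and f: "f \<in> Cc X" "\<And>x. 0 \<le> f x" "\<And>x. x \<in> K \<Longrightarrow> 1 \<le> f x"
  shows "outer_mass K \<le> ennreal (\<Lambda> f)"
proof (rule ennreal_le_epsilon)
  have *: "outer_mass K \<le> ennreal (\<Lambda> f / a)" if a: "0 < a" "a < 1" for a
  proof -
    let ?U = "{x \<in> topspace X. f x \<in> {a<..}}"
    have U: "openin X ?U" using Cc_continuous[OF f(1)] by (rule openin_continuous_map_preimage) auto
    have "outer_mass K \<le> open_mass ?U"
    proof (rule outer_mass_le[OF U])
      show "K \<subseteq> ?U"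
      proof
        fix x assume "x \<in> K"
        then show "x \<in> ?U" using compactin_subset_topspace[OF K] f(3)[of x] a by auto
      qed
    qed
    also have "\<dots> \<le> ennreal (\<Lambda> f / a)" unfolding open_mass_def
    proof (rule SUP_least)
      fix g assume g: "g \<in> subordinate ?U"
      note gD = subordinateD[OF g]
      have "g x \<le> (1/a) * f x" for x
      proof (cases "x \<in> ?U")
        case True
        have "a * g x \<le> a * 1" using gD(3)[of x] a by (intro mult_left_mono) auto
        also have "\<dots> \<le> f x" using True by simp
        finally have "a * g x \<le> f x" .
        then show ?thesis using a by (simp add: field_simps)
      next
        case False
        then have "g x = 0" using subordinateE[OF g] by (metis subsetD)
        then show ?thesis using f(2)[of x] a by simp
      qed
      then have "\<Lambda> g \<le> \<Lambda> (\<lambda>x. (1/a) * f x)" by (intro mono gD Cc_scale Haus f)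
      then show "ennreal (\<Lambda> g) \<le> ennreal (\<Lambda> f / a)" using scale[OF f(1), of "1/a"] by (simp add: ennreal_leI)
    qed
    finally show ?thesis .
  qed
  fix e :: real assume e: "0 < e"
  have L: "0 \<le> \<Lambda> f" using pos f by blast
  \<comment> \<open>a value of \<open>a\<close> with \<open>\<Lambda> f / a \<le> \<Lambda> f + e\<close>; the maximum
      keeps it positive when \<open>\<Lambda> f = 0\<close>\<close>
  define a where "a = max (1/2) (\<Lambda> f / (\<Lambda> f + e))"
  have a: "0 < a" "a < 1" using L e by (auto simp: a_def)
  have "\<Lambda> f / (\<Lambda> f + e) \<le> a" by (simp add: a_def)
  then have "\<Lambda> f \<le> a * (\<Lambda> f + e)" using L e by (simp add: field_simps)
  then have "\<Lambda> f / a \<le> \<Lambda> f + e" using a by (simp add: field_simps)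
  then have "ennreal (\<Lambda> f / a) \<le> ennreal (\<Lambda> f) + ennreal e" using L e by (metis ennreal_leI ennreal_plus less_imp_le)
  then show "outer_mass K \<le> ennreal (\<Lambda> f) + ennreal e" using *[OF a] by (rule order_trans[rotated])
qed

lemma functional_le_outer_mass:
  assumes K: "compactin X K" and f: "f \<in> Cc X" "\<And>x. 0 \<le> f x" "\<And>x. f x \<le> 1" "\<And>x. x \<notin> K \<Longrightarrow> f x = 0"
  shows "ennreal (\<Lambda> f) \<le> outer_mass K"
  unfolding outer_mass_def
proof (rule INF_greatest)
  fix U assume "U \<in> {U. openin X U \<and> K \<subseteq> U}"
  then have "f \<in> subordinate U" using assms by (intro subordinateI[of f K]) auto
  then show "ennreal (\<Lambda> f) \<le> open_mass U" by (rule open_mass_upper)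
qed

lemma compactin_borel: "compactin X K \<Longrightarrow> K \<in> sets (borel_of X)"
  by (simp add: Haus closedin_sets_borel_of compactin_imp_closedin)

lemma outer_mass_compact_finite:
  assumes "compactin X K" shows "outer_mass K < \<infinity>"
proof -
  obtain f :: "'a \<Rightarrow> real" where "f \<in> Cc X" "\<And>x. 0 \<le> f x" "\<And>x. x \<in> K \<Longrightarrow> f x = 1"
    using Cc_Urysohn[OF assms openin_topspace compactin_subset_topspace[OF assms]] by metis
  then have "outer_mass K \<le> ennreal (\<Lambda> f)" by (intro outer_mass_le_functional assms) auto
  then show ?thesis using ennreal_less_top infinity_ennreal_def le_less_trans by metis
qed

lemma radon_representing_measure: "radon_measure X representing_measure"
  unfolding radon_measure_def
proof (intro conjI allI impI ballI)
  show "sets representing_measure = sets (borel_of X)" by (rule sets_representing_measure)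
  show "emeasure representing_measure K < \<infinity>" if "compactin X K" for K
    using that by (simp add: emeasure_representing_measure compactin_borel outer_mass_compact_finite del: infinity_ennreal_def)
  show "emeasure representing_measure A = (INF U \<in> {U. openin X U \<and> A \<subseteq> U}. emeasure representing_measure U)"
    if "A \<in> sets representing_measure" for A
    using that by (auto simp: emeasure_representing_measure sets_representing_measure openin_sets_borel_of
      outer_mass_open outer_mass_def[of A] intro!: INF_cong)
  show "emeasure representing_measure U = (SUP K \<in> {K. compactin X K \<and> K \<subseteq> U}. emeasure representing_measure K)"
    if U: "openin X U" for U
  proof (rule antisym)
    have "emeasure representing_measure U = open_mass U"
      using U by (simp add: emeasure_representing_measure openin_sets_borel_of outer_mass_open)
    also have "\<dots> \<le> (SUP K \<in> {K. compactin X K \<and> K \<subseteq> U}. emeasure representing_measure K)"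
      unfolding open_mass_def
    proof (rule SUP_least)
      fix f assume f: "f \<in> subordinate U"
      obtain L where L: "compactin X L" "L \<subseteq> U" "\<And>x. x \<notin> L \<Longrightarrow> f x = 0"
    using subordinateE[OF f] by metis
      have "ennreal (\<Lambda> f) \<le> emeasure representing_measure L"
        using functional_le_outer_mass[OF L(1)] subordinateD[OF f] L
        by (simp add: emeasure_representing_measure compactin_borel)
      then show "ennreal (\<Lambda> f) \<le> (SUP K \<in> {K. compactin X K \<and> K \<subseteq> U}. emeasure representing_measure K)"
        using L by (intro SUP_upper2[of L]) auto
    qed
    finally show "emeasure representing_measure U \<le> (SUP K \<in> {K. compactin X K \<and> K \<subseteq> U}. emeasure representing_measure K)" .
    show "(SUP K \<in> {K. compactin X K \<and> K \<subseteq> U}. emeasure representing_measure K) \<le> emeasure representing_measure U"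
      using U by (intro SUP_least emeasure_mono) (auto simp: sets_representing_measure openin_sets_borel_of)
  qed
qed

text \<open>
  Both \<open>\<Lambda> f\<close> and the integral of \<open>f\<close> lie between the masses of \<open>K'\<close> and of \<open>K\<close>.
\<close>

lemma functional_close_to_integral:
  assumes K: "compactin X K" "compactin X K'" and f: "f \<in> Cc X" "\<And>x. 0 \<le> f x" "\<And>x. f x \<le> 1" "\<And>x. x \<notin> K \<Longrightarrow> f x = 0"
    "\<And>x. x \<in> K' \<Longrightarrow> f x = 1"
  shows "\<bar>\<Lambda> f - (LINT x|representing_measure. f x)\<bar> \<le> measure representing_measure K - measure representing_measure K'"
proof -
  let ?M = "representing_measure"
  have fin: "emeasure ?M K < \<infinity>" "emeasure ?M K' < \<infinity>"
    using K radon_compact_finite radon_representing_measure by blast+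
  have s: "K \<in> sets ?M" "K' \<in> sets ?M" using K by (auto simp: sets_representing_measure compactin_borel)
  have L: "0 \<le> \<Lambda> f" using pos f by blast
  have "ennreal (measure ?M K') \<le> ennreal (\<Lambda> f)"
    using outer_mass_le_functional[OF K(2) f(1,2)] f(5) s fin
    by (simp add: emeasure_eq_ennreal_measure[symmetric] emeasure_representing_measure K compactin_borel)
  then have 1: "measure ?M K' \<le> \<Lambda> f" using L by simp
  have "ennreal (\<Lambda> f) \<le> ennreal (measure ?M K)"
    using functional_le_outer_mass[OF K(1) f(1-4)] s fin
    by (simp add: emeasure_eq_ennreal_measure[symmetric] emeasure_representing_measure K compactin_borel)
  then have 2: "\<Lambda> f \<le> measure ?M K" by simp
  have i: "integrable ?M f" "integrable ?M (indicator K :: _ \<Rightarrow> real)" "integrable ?M (indicator K' :: _ \<Rightarrow> real)"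
    using s fin radon_Cc_integrable[OF radon_representing_measure Haus f(1)] by auto
  have "(LINT x|?M. indicator K' x) \<le> (LINT x|?M. f x)"
    using f by (intro integral_mono i) (auto simp: indicator_def)
  then have 3: "measure ?M K' \<le> (LINT x|?M. f x)" using s fin by simp
  have "(LINT x|?M. f x) \<le> (LINT x|?M. indicator K x)"
    using f by (intro integral_mono i) (auto simp: indicator_def)
  then have 4: "(LINT x|?M. f x) \<le> measure ?M K" using s fin by simp
  show ?thesis using 1 2 3 4 by linarith
qed

text \<open>
  The layer cake decomposition: \<open>n f\<close> is the sum of the slices \<open>\<phi> k\<close>, obtained by clamping \<open>n f - k\<close> to \<open>[0,1]\<close>.
  Slice \<open>k\<close> is \<open>1\<close> where \<open>n f \<ge> k + 1\<close> and vanishes where \<open>n f < k\<close>, so \<open>\<Lambda>\<close> and the integral differ on it by at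
  most the mass of \<open>C k - C (Suc k)\<close>. These masses telescope, and the total error for \<open>f\<close> is at most the mass
  of \<open>K\<close> divided by \<open>n\<close>.
\<close>

lemma functional_eq_integral_unit:
  assumes f: "f \<in> Cc X" "\<And>x. 0 \<le> f x" "\<And>x. f x \<le> 1"
  shows "\<Lambda> f = (LINT x|representing_measure. f x)"
proof -
  let ?M = "representing_measure"
  obtain K where K: "compactin X K" "\<And>x. x \<notin> K \<Longrightarrow> f x = 0"
    using f(1) unfolding Cc_iff[OF Haus] by metis
  have *: "\<bar>\<Lambda> f - (LINT x|?M. f x)\<bar> \<le> measure ?M K / real n" if n: "n > 0" for n :: nat
  proof -
    define \<phi> where "\<phi> = (\<lambda>k::nat. \<lambda>x. min (max (real n * f x - real k) 0) 1)"
    define C where "C = (\<lambda>k::nat. {x \<in> K. real k \<le> real n * f x})"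
    have Ks: "K \<subseteq> topspace X" using K compactin_subset_topspace by blast
    have C: "compactin X (C k)" for k
    proof -
      have "closedin X {x \<in> topspace X. f x \<in> {real k / real n ..}}"
        using Cc_continuous[OF f(1)] by (rule closedin_continuous_map_preimage) auto
      then have "compactin X ({x \<in> topspace X. f x \<in> {real k / real n ..}} \<inter> K)"
        using K(1) by (rule closed_Int_compactin)
      also have "{x \<in> topspace X. f x \<in> {real k / real n ..}} \<inter> K = C k"
        using n Ks by (auto simp: C_def field_simps)
      finally show ?thesis .
    qed
    have \<phi>c: "\<phi> k \<in> Cc X" for k unfolding \<phi>_def
      by (rule Cc_compose[OF Haus f(1)]) (auto intro!: continuous_intros)
    have bound: "\<bar>\<Lambda> (\<phi> k) - (LINT x|?M. \<phi> k x)\<bar> \<le> measure ?M (C k) - measure ?M (C (Suc k))" for k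
    proof (rule functional_close_to_integral[OF C C \<phi>c])
      fix x
      show "0 \<le> \<phi> k x" "\<phi> k x \<le> 1" by (auto simp: \<phi>_def)
      show "\<phi> k x = 0" if "x \<notin> C k" using that K(2)[of x] by (cases "x \<in> K") (auto simp: \<phi>_def C_def)
      show "\<phi> k x = 1" if "x \<in> C (Suc k)" using that by (auto simp: \<phi>_def C_def)
    qed
    have clamp: "(\<Sum>k<m. min (max (t - real k) 0) 1) = min (max t 0) (real m)" for t m
      by (induction m) (auto simp: min_def max_def)
    have fsum: "real n * f x = (\<Sum>k<n. \<phi> k x)" for x
      unfolding \<phi>_def clamp using f(2,3)[of x] n by (simp add: mult_left_le)
    have "real n * \<Lambda> f = (\<Sum>k<n. \<Lambda> (\<phi> k))"
      using scale[OF f(1), of "real n"] sum[of "{..<n}" \<phi>] \<phi>c by (simp add: fsum)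
    moreover have "real n * (LINT x|?M. f x) = (\<Sum>k<n. (LINT x|?M. \<phi> k x))"
    proof -
      have "real n * (LINT x|?M. f x) = (LINT x|?M. (\<Sum>k<n. \<phi> k x))"
        unfolding fsum[symmetric] by simp
      also have "\<dots> = (\<Sum>k<n. (LINT x|?M. \<phi> k x))"
        by (rule Bochner_Integration.integral_sum) (rule radon_Cc_integrable[OF radon_representing_measure Haus \<phi>c])
      finally show ?thesis .
    qed
    ultimately have "real n * \<bar>\<Lambda> f - (LINT x|?M. f x)\<bar> = \<bar>\<Sum>k<n. \<Lambda> (\<phi> k) - (LINT x|?M. \<phi> k x)\<bar>"
    proof -
      assume "real n * \<Lambda> f = (\<Sum>k<n. \<Lambda> (\<phi> k))" "real n * (LINT x|?M. f x) = (\<Sum>k<n. (LINT x|?M. \<phi> k x))"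
      then have "real n * (\<Lambda> f - (LINT x|?M. f x)) = (\<Sum>k<n. \<Lambda> (\<phi> k) - (LINT x|?M. \<phi> k x))"
        by (simp add: sum_subtractf right_diff_distrib)
      then show ?thesis by (metis abs_mult abs_of_nat)
    qed
    also have "\<dots> \<le> (\<Sum>k<n. \<bar>\<Lambda> (\<phi> k) - (LINT x|?M. \<phi> k x)\<bar>)" by (rule sum_abs)
    also have "\<dots> \<le> (\<Sum>k<n. measure ?M (C k) - measure ?M (C (Suc k)))" by (rule sum_mono) (rule bound)
    also have "\<dots> = measure ?M (C 0) - measure ?M (C n)" by (rule sum_lessThan_telescope')
    also have "\<dots> \<le> measure ?M (C 0)" by simp
    also have "C 0 = K" using f(2) by (auto simp: C_def)
    finally show ?thesis using n by (simp add: field_simps)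
  qed
  have "\<bar>\<Lambda> f - (LINT x|?M. f x)\<bar> \<le> 0"
  proof (rule LIMSEQ_le_const)
    show "(\<lambda>n. measure ?M K / real n) \<longlonglongrightarrow> 0" by (rule lim_const_over_n)
    show "\<exists>N. \<forall>n\<ge>N. \<bar>\<Lambda> f - (LINT x|?M. f x)\<bar> \<le> measure ?M K / real n" using * by (intro exI[of _ 1]) auto
  qed
  then show ?thesis by simp
qed

lemma functional_eq_integral:
  assumes f: "f \<in> Cc X"
  shows "\<Lambda> f = (LINT x|representing_measure. f x)"
proof -
  let ?M = "representing_measure"
  have nonneg: "\<Lambda> g = (LINT x|?M. g x)" if g: "g \<in> Cc X" "\<And>x. 0 \<le> g x" for g
  proof -
    obtain B where B: "B > 0" "\<And>x. norm (g x) \<le> B" using Cc_bounded[OF Haus g(1)] by metis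
    have "g x / B \<le> 1" for x using B(1) B(2)[of x] by simp
    then have "\<Lambda> (\<lambda>x. (1/B) * g x) = (LINT x|?M. (1/B) * g x)"
      using g B by (intro functional_eq_integral_unit Cc_scale Haus) auto
    then show ?thesis using scale[OF g(1), of "1/B"] B(1) by (simp add: field_simps)
  qed
  let ?p = "\<lambda>x. max (f x) 0" and ?n = "\<lambda>x. max (- f x) 0"
  have c: "?p \<in> Cc X" "?n \<in> Cc X"
    by (rule Cc_compose[OF Haus f]; auto intro!: continuous_intros)+
  have "\<Lambda> f = \<Lambda> (\<lambda>x. ?p x - ?n x)" by (rule arg_cong[of _ _ \<Lambda>]) (auto simp: fun_eq_iff max_def)
  also have "\<dots> = (LINT x|?M. ?p x) - (LINT x|?M. ?n x)"
    unfolding diff[OF c] by (simp add: nonneg c)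
  also have "\<dots> = (LINT x|?M. ?p x - ?n x)"
    by (intro Bochner_Integration.integral_diff[symmetric] radon_Cc_integrable[OF radon_representing_measure Haus] c)
  also have "(\<lambda>x. ?p x - ?n x) = f" by (auto simp: fun_eq_iff max_def)
  finally show ?thesis .
qed

text \<open>
  The total mass is the supremum of the masses of compact sets, each of which is bounded by \<open>\<Lambda>\<close> of a
  Urysohn function.
\<close>

lemma representing_measure_le:
  assumes "\<And>k. k \<in> Cc X \<Longrightarrow> (\<And>x. 0 \<le> k x) \<Longrightarrow> (\<And>x. k x \<le> 1) \<Longrightarrow> \<Lambda> k \<le> c"
  shows "emeasure representing_measure (topspace X) \<le> ennreal c"
proof -
  have "emeasure representing_measure (topspace X) = (SUP K \<in> {K. compactin X K \<and> K \<subseteq> topspace X}. emeasure representing_measure K)"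
    using radon_representing_measure unfolding radon_measure_def by blast
  also have "\<dots> \<le> ennreal c"
  proof (rule SUP_least)
    fix K assume "K \<in> {K. compactin X K \<and> K \<subseteq> topspace X}"
    then have K: "compactin X K" "K \<subseteq> topspace X" by auto
    obtain f :: "'a \<Rightarrow> real" where f: "f \<in> Cc X" "\<And>x. 0 \<le> f x" "\<And>x. f x \<le> 1" "\<And>x. x \<in> K \<Longrightarrow> f x = 1"
      using Cc_Urysohn[OF K(1) openin_topspace K(2)] by metis
    have "emeasure representing_measure K = outer_mass K"
      by (rule emeasure_representing_measure[OF compactin_borel[OF K(1)]])
    also have "\<dots> \<le> ennreal (\<Lambda> f)" by (rule outer_mass_le_functional[OF K(1) f(1,2)]) (simp add: f(4))
    also have "\<dots> \<le> ennreal c" using assms[OF f(1-3)] by (rule ennreal_leI)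
    finally show "emeasure representing_measure K \<le> ennreal c" .
  qed
  finally show ?thesis .
qed

end

section \<open>Hahn--Banach\<close>

text \<open>
  Subspaces are sets of functions with pointwise operations, so that the spaces \<open>C\<^sub>c(X)\<close>, which are not
  types, can serve as domains of functionals.
\<close>

definition fun_subspace :: "('x \<Rightarrow> real) set \<Rightarrow> bool" where
  "fun_subspace V \<longleftrightarrow> (\<lambda>x. 0) \<in> V \<and> (\<forall>f\<in>V. \<forall>g\<in>V. (\<lambda>x. f x + g x) \<in> V) \<and>
     (\<forall>c. \<forall>f\<in>V. (\<lambda>x. c * f x) \<in> V)"

definition sublinear_on :: "('x \<Rightarrow> real) set \<Rightarrow> (('x \<Rightarrow> real) \<Rightarrow> real) \<Rightarrow> bool" where
  "sublinear_on V p \<longleftrightarrow> (\<forall>f\<in>V. \<forall>g\<in>V. p (\<lambda>x. f x + g x) \<le> p f + p g) \<and>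
     (\<forall>c\<ge>0. \<forall>f\<in>V. p (\<lambda>x. c * f x) \<le> c * p f)"

definition linear_fun_on :: "('x \<Rightarrow> real) set \<Rightarrow> (('x \<Rightarrow> real) \<Rightarrow> real) \<Rightarrow> bool" where
  "linear_fun_on V l \<longleftrightarrow> (\<forall>f\<in>V. \<forall>g\<in>V. l (\<lambda>x. f x + g x) = l f + l g) \<and>
     (\<forall>c. \<forall>f\<in>V. l (\<lambda>x. c * f x) = c * l f)"

lemma fun_subspaceD:
  assumes "fun_subspace V"
  shows "(\<lambda>x. 0) \<in> V" "f \<in> V \<Longrightarrow> g \<in> V \<Longrightarrow> (\<lambda>x. f x + g x) \<in> V" "f \<in> V \<Longrightarrow> (\<lambda>x. c * f x) \<in> V"
    "f \<in> V \<Longrightarrow> (\<lambda>x. - f x) \<in> V" "f \<in> V \<Longrightarrow> g \<in> V \<Longrightarrow> (\<lambda>x. f x - g x) \<in> V"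
proof -
  show 1: "(\<lambda>x. 0) \<in> V" "f \<in> V \<Longrightarrow> g \<in> V \<Longrightarrow> (\<lambda>x. f x + g x) \<in> V" "f \<in> V \<Longrightarrow> (\<lambda>x. c * f x) \<in> V" for f g c
    using assms by (auto simp: fun_subspace_def)
  show 2: "(\<lambda>x. - f x) \<in> V" if "f \<in> V" for f using 1(3)[OF that, of "-1"] by simp
  show "f \<in> V \<Longrightarrow> g \<in> V \<Longrightarrow> (\<lambda>x. f x - g x) \<in> V"
    using 1(2)[OF _ 2, of f g] by simp
qed

lemma sublinear_onD:
  assumes "sublinear_on V p"
  shows "f \<in> V \<Longrightarrow> g \<in> V \<Longrightarrow> p (\<lambda>x. f x + g x) \<le> p f + p g"
    "c \<ge> 0 \<Longrightarrow> f \<in> V \<Longrightarrow> p (\<lambda>x. c * f x) \<le> c * p f"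
  using assms by (auto simp: sublinear_on_def)

lemma sublinear_on_zero:
  assumes "fun_subspace V" "sublinear_on V p"
  shows "p (\<lambda>x. 0) = 0"
  using sublinear_onD(2)[OF assms(2), of 0 "\<lambda>x. 0"] sublinear_onD(1)[OF assms(2), of "\<lambda>x. 0" "\<lambda>x. 0"]
    fun_subspaceD(1)[OF assms(1)] by simp

lemma sublinear_on_neg:
  assumes "fun_subspace V" "sublinear_on V p" "f \<in> V"
  shows "- p (\<lambda>x. - f x) \<le> p f"
  using sublinear_onD(1)[OF assms(2,3) fun_subspaceD(4)[OF assms(1,3)]] sublinear_on_zero[OF assms(1,2)] by simp

lemma linear_fun_onD:
  assumes "linear_fun_on V l"
  shows "f \<in> V \<Longrightarrow> g \<in> V \<Longrightarrow> l (\<lambda>x. f x + g x) = l f + l g" "f \<in> V \<Longrightarrow> l (\<lambda>x. c * f x) = c * l f"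
  using assms by (auto simp: linear_fun_on_def)

lemma linear_fun_on_combination:
  assumes "fun_subspace V" "linear_fun_on V l" "f \<in> V" "g \<in> V"
  shows "l (\<lambda>x. u * f x + v * g x) = u * l f + v * l g"
proof -
  have "l (\<lambda>x. u * f x + v * g x) = l (\<lambda>x. u * f x) + l (\<lambda>x. v * g x)"
    by (rule linear_fun_onD(1)[OF assms(2) fun_subspaceD(3)[OF assms(1,3)] fun_subspaceD(3)[OF assms(1,4)]])
  then show ?thesis using linear_fun_onD(2)[OF assms(2,3)] linear_fun_onD(2)[OF assms(2,4)] by simp
qed

text \<open>
  A way to lower a sublinear functional: \<open>B\<close> is a convex cone of pairs of a vector and a price, and \<open>q f\<close> is
  the least value of \<open>p\<close> after adding a vector to \<open>f\<close> and paying its price. The condition that \<open>p b + r\<close> is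
  never negative keeps the infimum finite. With the ray of one vector this gives the linearity of minimal sublinear
  functionals, and with the cone over a convex set it gives the Mazur--Orlicz theorem.
\<close>

lemma sublinear_on_cone_inf:
  fixes B :: "(('x \<Rightarrow> real) \<times> real) set"
  assumes V: "fun_subspace V" and p: "sublinear_on V p" and ne: "B \<noteq> {}"
    and BV: "\<And>b r. (b, r) \<in> B \<Longrightarrow> b \<in> V"
    and add: "\<And>b r b' r'. (b, r) \<in> B \<Longrightarrow> (b', r') \<in> B \<Longrightarrow> ((\<lambda>x. b x + b' x), r + r') \<in> B"
    and scale: "\<And>b r c. (b, r) \<in> B \<Longrightarrow> c \<ge> 0 \<Longrightarrow> ((\<lambda>x. c * b x), c * r) \<in> B"
    and low: "\<And>b r. (b, r) \<in> B \<Longrightarrow> 0 \<le> p b + r"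
  defines "q \<equiv> (\<lambda>f. if f \<in> V then INF (b, r) \<in> B. p (\<lambda>x. f x + b x) + r else 0)"
  shows "sublinear_on V q" "\<And>f b r. f \<in> V \<Longrightarrow> (b, r) \<in> B \<Longrightarrow> q f \<le> p (\<lambda>x. f x + b x) + r"
    "\<And>f. f \<in> V \<Longrightarrow> q f \<le> p f"
proof -
  note VD = fun_subspaceD[OF V]
  have bdd: "bdd_below ((\<lambda>(b, r). p (\<lambda>x. f x + b x) + r) ` B)" if f: "f \<in> V" for f
  proof (rule bdd_belowI)
    fix y assume "y \<in> (\<lambda>(b, r). p (\<lambda>x. f x + b x) + r) ` B"
    then obtain b r where br: "(b, r) \<in> B" "y = p (\<lambda>x. f x + b x) + r" by auto
    have "p (\<lambda>x. (f x + b x) + - f x) \<le> p (\<lambda>x. f x + b x) + p (\<lambda>x. - f x)"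
      using br f BV by (intro sublinear_onD(1)[OF p] VD) auto
    then show "- p (\<lambda>x. - f x) \<le> y" using low[OF br(1)] br(2) by simp
  qed
  show le: "q f \<le> p (\<lambda>x. f x + b x) + r" if "f \<in> V" "(b, r) \<in> B" for f b r
    unfolding q_def using that cINF_lower[OF bdd[OF that(1)] that(2)] by simp
  have ge: "z \<le> q f" if "f \<in> V" "\<And>b r. (b, r) \<in> B \<Longrightarrow> z \<le> p (\<lambda>x. f x + b x) + r" for f z
    unfolding q_def using that ne by (auto intro!: cINF_greatest)
  have 0: "((\<lambda>x. 0), 0) \<in> B" using ne scale[of _ _ 0] by fastforce
  show "q f \<le> p f" if "f \<in> V" for f using le[OF that 0] by simp
  show "sublinear_on V q" unfolding sublinear_on_def
  proof (intro conjI ballI allI impI)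
    fix f g assume f: "f \<in> V" and g: "g \<in> V"
    have *: "q (\<lambda>x. f x + g x) \<le> (p (\<lambda>x. f x + b x) + r) + (p (\<lambda>x. g x + b' x) + r')"
      if "(b, r) \<in> B" "(b', r') \<in> B" for b r b' r'
    proof -
      have "q (\<lambda>x. f x + g x) \<le> p (\<lambda>x. (f x + g x) + (b x + b' x)) + (r + r')"
        by (rule le[OF VD(2)[OF f g] add[OF that]])
      also have "(\<lambda>x. (f x + g x) + (b x + b' x)) = (\<lambda>x. (f x + b x) + (g x + b' x))" by (simp add: algebra_simps)
      also have "p \<dots> \<le> p (\<lambda>x. f x + b x) + p (\<lambda>x. g x + b' x)"
        using that BV f g by (intro sublinear_onD(1)[OF p] VD) auto
      finally show ?thesis by simp
    qed
    have "q (\<lambda>x. f x + g x) - (p (\<lambda>x. f x + b x) + r) \<le> q g" if "(b, r) \<in> B" for b r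
      using *[OF that] by (intro ge g) (simp add: algebra_simps)
    then have "q (\<lambda>x. f x + g x) - q g \<le> q f"
      by (intro ge f) (simp add: algebra_simps)
    then show "q (\<lambda>x. f x + g x) \<le> q f + q g" by simp
  next
    fix c :: real and f assume c: "0 \<le> c" and f: "f \<in> V"
    show "q (\<lambda>x. c * f x) \<le> c * q f"
    proof (cases "c = 0")
      case True
      then show ?thesis using le[OF VD(1) 0] sublinear_on_zero[OF V p] by simp
    next
      case False
      then have c: "c > 0" using c by simp
      have "q (\<lambda>x. c * f x) / c \<le> q f"
      proof (intro ge f)
        fix b r assume b: "(b, r) \<in> B"
        have "q (\<lambda>x. c * f x) \<le> p (\<lambda>x. c * f x + c * b x) + c * r"
          using c b f by (intro le VD scale) auto
        also have "(\<lambda>x. c * f x + c * b x) = (\<lambda>x. c * (f x + b x))" by (simp add: algebra_simps)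
        also have "p \<dots> \<le> c * p (\<lambda>x. f x + b x)"
          using c b f BV by (intro sublinear_onD(2)[OF p] VD) auto
        finally show "q (\<lambda>x. c * f x) / c \<le> p (\<lambda>x. f x + b x) + r" using c by (simp add: field_simps)
      qed
      then show ?thesis using c by (simp add: field_simps)
    qed
  qed
qed

text \<open>
  The infimum of a chain of sublinear functionals below \<open>p\<close> is sublinear, so Zorn's lemma gives a minimal
  one, \<open>q\<close>. Lowering \<open>q\<close> along the ray of \<open>v\<close> with price \<open>- q v\<close> cannot change it, which says that
  \<open>q f + q v \<le> q (f + v)\<close>. Hence \<open>q\<close> is additive, and a sublinear additive functional is linear.
\<close>

lemma hahn_banach_sublinear:
  assumes V: "fun_subspace V" and p: "sublinear_on V p"
  obtains l where "linear_fun_on V l" "\<And>f. f \<in> V \<Longrightarrow> l f \<le> p f"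
proof -
  note VD = fun_subspaceD[OF V]
  \<comment> \<open>The value \<open>0\<close> off \<open>V\<close> makes functionals that agree on \<open>V\<close> equal, as minimality requires.\<close>
  let ?S = "{q. sublinear_on V q \<and> (\<forall>f\<in>V. q f \<le> p f) \<and> (\<forall>f. f \<notin> V \<longrightarrow> q f = 0)}"
  have "\<exists>m\<in>?S. \<forall>a\<in>?S. a \<le> m \<longrightarrow> a = m"
  proof (rule predicate_Zorn)
    show "partial_order_on ?S (relation_of (\<lambda>x y. y \<le> x) ?S)"
      by (rule partial_order_on_relation_ofI) auto
    fix C assume C: "C \<in> Chains (relation_of (\<lambda>x y. y \<le> x) ?S)"
    then have CS: "C \<subseteq> ?S" and ch: "\<And>a b. a \<in> C \<Longrightarrow> b \<in> C \<Longrightarrow> a \<le> b \<or> b \<le> a"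
      by (auto simp: Chains_def relation_of_def)
    show "\<exists>u\<in>?S. \<forall>a\<in>C. u \<le> a"
    proof (cases "C = {}")
      case True
      have "(\<lambda>f. if f \<in> V then p f else 0) \<in> ?S"
        using p VD by (auto simp: sublinear_on_def)
      then show ?thesis using True by blast
    next
      case False
      have CD: "sublinear_on V q" "\<And>f. f \<in> V \<Longrightarrow> q f \<le> p f" "\<And>f. f \<notin> V \<Longrightarrow> q f = 0" if "q \<in> C" for q
        using CS that by auto
      define u where "u = (\<lambda>f. if f \<in> V then INF q\<in>C. q f else 0)"
      have bdd: "bdd_below ((\<lambda>q. q f) ` C)" if f: "f \<in> V" for f
      proof (rule bdd_belowI)
        fix y assume "y \<in> (\<lambda>q. q f) ` C"
        then obtain q where q: "q \<in> C" "y = q f" by auto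
        show "- p (\<lambda>x. - f x) \<le> y"
          using sublinear_on_neg[OF V CD(1)[OF q(1)] f] CD(2)[OF q(1) VD(4)[OF f]] q(2) by simp
      qed
      have le: "u f \<le> q f" if "f \<in> V" "q \<in> C" for f q
        unfolding u_def using that cINF_lower[OF bdd[OF that(1)] that(2)] by simp
      have ge: "z \<le> u f" if "f \<in> V" "\<And>q. q \<in> C \<Longrightarrow> z \<le> q f" for f z
        unfolding u_def using that False by (auto intro!: cINF_greatest)
      have "sublinear_on V u" unfolding sublinear_on_def
      proof (intro conjI ballI allI impI)
        fix f g assume f: "f \<in> V" and g: "g \<in> V"
        have *: "u (\<lambda>x. f x + g x) \<le> q f + q' g" if qq: "q \<in> C" "q' \<in> C" for q q'
        proof -
          obtain r where r: "r \<in> C" "r \<le> q" "r \<le> q'"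
            using ch[OF qq] qq by (metis order_refl)
          have "u (\<lambda>x. f x + g x) \<le> r (\<lambda>x. f x + g x)" by (rule le[OF VD(2)[OF f g] r(1)])
          also have "\<dots> \<le> r f + r g" using sublinear_onD(1)[OF CD(1)[OF r(1)] f g] .
          also have "\<dots> \<le> q f + q' g" using r(2,3) by (auto simp: le_fun_def intro: add_mono)
          finally show ?thesis .
        qed
        have "u (\<lambda>x. f x + g x) - q f \<le> u g" if "q \<in> C" for q
          using *[OF that] by (intro ge g) (simp add: algebra_simps)
        then have "u (\<lambda>x. f x + g x) - u g \<le> u f"
          by (intro ge f) (simp add: algebra_simps)
        then show "u (\<lambda>x. f x + g x) \<le> u f + u g" by simp
      next
        fix c :: real and f assume c: "0 \<le> c" and f: "f \<in> V"
        have *: "u (\<lambda>x. c * f x) \<le> c * q f" if "q \<in> C" for q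
          using le[OF VD(3)[OF f] that] sublinear_onD(2)[OF CD(1)[OF that] c f] by (rule order_trans)
        show "u (\<lambda>x. c * f x) \<le> c * u f"
        proof (cases "c = 0")
          case True
          then show ?thesis using * False by auto
        next
          case False
          then have c: "c > 0" using c by simp
          have "u (\<lambda>x. c * f x) / c \<le> u f"
            using * c by (intro ge f) (simp add: field_simps)
          then show ?thesis using c by (simp add: field_simps)
        qed
      qed
      moreover have "\<forall>f\<in>V. u f \<le> p f" 
      proof
        fix f assume f: "f \<in> V"
        obtain q where "q \<in> C" using False by blast
        then show "u f \<le> p f" using le[OF f, of q] CD(2)[of q f] f by simp
      qed
      ultimately have "u \<in> ?S" by (auto simp: u_def)
      moreover have "\<forall>a\<in>C. u \<le> a"
      proof (intro ballI le_funI)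
        fix a f assume "a \<in> C"
        then show "u f \<le> a f" using le[of f a] CD(3)[of a f] by (cases "f \<in> V") (auto simp: u_def)
      qed
      ultimately show ?thesis by blast
    qed
  qed
  then obtain q where q: "sublinear_on V q" "\<And>f. f \<in> V \<Longrightarrow> q f \<le> p f" "\<And>f. f \<notin> V \<Longrightarrow> q f = 0"
    and min: "\<And>a. a \<in> ?S \<Longrightarrow> a \<le> q \<Longrightarrow> a = q" by auto
  have sup: "q f + q v \<le> q (\<lambda>x. f x + v x)" if f: "f \<in> V" and v: "v \<in> V" for f v
  proof -
    define B where "B = {(b, r). \<exists>t\<ge>0. b = (\<lambda>x. t * v x) \<and> r = - t * q v}"
    define u where "u = (\<lambda>f. if f \<in> V then INF (b, r) \<in> B. q (\<lambda>x. f x + b x) + r else 0)"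
    have Badd: "((\<lambda>x. b x + b' x), r + r') \<in> B" if "(b, r) \<in> B" "(b', r') \<in> B" for b r b' r'
    proof -
      from that obtain t t' where "t \<ge> 0" "t' \<ge> 0" "b = (\<lambda>x. t * v x)" "b' = (\<lambda>x. t' * v x)" "r = - t * q v" "r' = - t' * q v"
        by (auto simp: B_def)
      then show ?thesis unfolding B_def by (auto intro!: exI[of _ "t + t'"] simp: algebra_simps)
    qed
    have Bscale: "((\<lambda>x. c * b x), c * r) \<in> B" if "(b, r) \<in> B" "c \<ge> 0" for b r c
    proof -
      from that obtain t where "t \<ge> 0" "b = (\<lambda>x. t * v x)" "r = - t * q v" by (auto simp: B_def)
      then show ?thesis unfolding B_def using that(2) by (auto intro!: exI[of _ "c * t"] simp: algebra_simps)
    qed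
    have low: "0 \<le> q b + r" if "(b, r) \<in> B" for b r
    proof -
      from that obtain t where t: "t \<ge> 0" "b = (\<lambda>x. t * v x)" "r = - t * q v" by (auto simp: B_def)
      show ?thesis
      proof (cases "t = 0")
        case True then show ?thesis using t sublinear_on_zero[OF V q(1)] by simp
      next
        case False
        have "q (\<lambda>x. (1/t) * (t * v x)) \<le> (1/t) * q (\<lambda>x. t * v x)"
          using t v by (intro sublinear_onD(2)[OF q(1)] VD) auto
        then show ?thesis using False t by (simp add: field_simps)
      qed
    qed
    have B1: "((\<lambda>x. v x), - q v) \<in> B" "B \<noteq> {}" unfolding B_def by (auto intro!: exI[of _ 1])
    have BV: "(b, r) \<in> B \<Longrightarrow> b \<in> V" for b r using v by (auto simp: B_def intro: VD)
    have 1: "sublinear_on V u" unfolding u_def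
      by (rule sublinear_on_cone_inf(1)[OF V q(1) B1(2) BV Badd Bscale low])
    have 2: "u f \<le> q f" if "f \<in> V" for f unfolding u_def
      by (rule sublinear_on_cone_inf(3)[OF V q(1) B1(2) BV Badd Bscale low that])
    have 3: "u f \<le> q (\<lambda>x. f x + v x) + - q v" unfolding u_def
      by (rule sublinear_on_cone_inf(2)[OF V q(1) B1(2) BV Badd Bscale low f B1(1)])
    have "u = q"
    proof (rule min)
      have "u f \<le> p f" if "f \<in> V" for f using 2[OF that] q(2)[OF that] by simp
      moreover have "u f = 0" if "f \<notin> V" for f using that by (simp add: u_def)
      ultimately show "u \<in> ?S" using 1 by blast
      show "u \<le> q" using 2 q(3) by (auto simp: le_fun_def u_def)
    qed
    then show ?thesis using 3 by simp
  qed
  have addq: "q (\<lambda>x. f x + g x) = q f + q g" if "f \<in> V" "g \<in> V" for f g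
    using sup[OF that] sublinear_onD(1)[OF q(1) that] by simp
  have neg: "q (\<lambda>x. - f x) = - q f" if "f \<in> V" for f
    using addq[OF that VD(4)[OF that]] sublinear_on_zero[OF V q(1)] by simp
  have pos: "q (\<lambda>x. c * f x) = c * q f" if f: "f \<in> V" and c: "c \<ge> 0" for c f
  proof -
    have "q (\<lambda>x. c * (- f x)) \<le> c * q (\<lambda>x. - f x)" by (intro sublinear_onD(2)[OF q(1)] VD f c)
    then have "- q (\<lambda>x. c * f x) \<le> - (c * q f)" using neg[OF VD(3)[OF f]] neg[OF f] by simp
    then show ?thesis using sublinear_onD(2)[OF q(1) c f] by simp
  qed
  have "q (\<lambda>x. c * f x) = c * q f" if f: "f \<in> V" for c f
  proof (cases "c \<ge> 0")
    case False
    then have "q (\<lambda>x. (- c) * f x) = (- c) * q f" by (intro pos f) auto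
    then show ?thesis using neg[OF VD(3)[OF f, of c]] by simp
  qed (rule pos[OF f])
  then have "linear_fun_on V q" using addq by (auto simp: linear_fun_on_def)
  then show ?thesis using that q(2) by blast
qed

text \<open>
  A lower bound for the convex expression \<open>P (T a) + R a\<close> over the convex set \<open>A\<close> survives when \<open>P\<close> is replaced
  by a suitable linear functional below it: lower \<open>P\<close> along the cone generated by the vectors \<open>T a\<close> with price
  \<open>R a - e\<close>, and take a linear functional below the result. The remainder \<open>R\<close> is left alone, so that several
  sublinear summands can be replaced one after the other.
\<close>

lemma mazur_orlicz:
  fixes A :: "('y \<Rightarrow> real) set" and T :: "('y \<Rightarrow> real) \<Rightarrow> 'x \<Rightarrow> real"
  assumes V: "fun_subspace V" and P: "sublinear_on V P" and ne: "A \<noteq> {}"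
    and conv: "\<And>a b u v. a \<in> A \<Longrightarrow> b \<in> A \<Longrightarrow> 0 \<le> u \<Longrightarrow> 0 \<le> v \<Longrightarrow> u + v = 1 \<Longrightarrow> (\<lambda>y. u * a y + v * b y) \<in> A"
    and TV: "\<And>a. a \<in> A \<Longrightarrow> T a \<in> V"
    and T: "\<And>a b u v. a \<in> A \<Longrightarrow> b \<in> A \<Longrightarrow> 0 \<le> u \<Longrightarrow> 0 \<le> v \<Longrightarrow> u + v = 1 \<Longrightarrow>
        T (\<lambda>y. u * a y + v * b y) = (\<lambda>x. u * T a x + v * T b x)"
    and R: "\<And>a b u v. a \<in> A \<Longrightarrow> b \<in> A \<Longrightarrow> 0 \<le> u \<Longrightarrow> 0 \<le> v \<Longrightarrow> u + v = 1 \<Longrightarrow>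
        R (\<lambda>y. u * a y + v * b y) \<le> u * R a + v * R b"
    and low: "\<And>a. a \<in> A \<Longrightarrow> e \<le> P (T a) + R a"
  obtains l where "linear_fun_on V l" "\<And>f. f \<in> V \<Longrightarrow> l f \<le> P f" "\<And>a. a \<in> A \<Longrightarrow> e \<le> l (T a) + R a"
proof -
  note VD = fun_subspaceD[OF V]
  define B where "B = {(b, s). \<exists>t\<ge>0. \<exists>a\<in>A. b = (\<lambda>x. t * T a x) \<and> t * R a - t * e \<le> s}"
  define u where "u = (\<lambda>f. if f \<in> V then INF (b, r) \<in> B. P (\<lambda>x. f x + b x) + r else 0)"
  have Badd: "((\<lambda>x. b x + b' x), r + r') \<in> B" if "(b, r) \<in> B" "(b', r') \<in> B" for b r b' r'
  proof -
    from that obtain t t' a a' where t: "t \<ge> 0" "t' \<ge> 0" and a: "a \<in> A" "a' \<in> A"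
      and b: "b = (\<lambda>x. t * T a x)" "b' = (\<lambda>x. t' * T a' x)" "t * R a - t * e \<le> r" "t' * R a' - t' * e \<le> r'"
      by (auto simp: B_def)
    show ?thesis
    proof (cases "t + t' = 0")
      case True
      then have "t = 0" "t' = 0" using t by auto
      then show ?thesis using b a unfolding B_def by (auto intro!: exI[of _ 0])
    next
      case False
      define s where "s = t + t'"
      have s: "s > 0" using False t by (simp add: s_def)
      have uv: "0 \<le> t / s" "0 \<le> t' / s" "t / s + t' / s = 1"
        using s t by (auto simp: add_divide_distrib[symmetric] s_def)
      let ?c = "\<lambda>y. t / s * a y + t' / s * a' y"
      have c: "?c \<in> A" by (rule conv[OF a uv])
      have "(\<lambda>x. b x + b' x) = (\<lambda>x. s * T ?c x)"
        unfolding T[OF a uv] b using s by (auto simp: fun_eq_iff field_simps)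
      moreover have "s * R ?c \<le> t * R a + t' * R a'"
      proof -
        have "s * R ?c \<le> s * (t / s * R a + t' / s * R a')" using R[OF a uv] s by simp
        also have "\<dots> = t * R a + t' * R a'" using s by (simp add: field_simps)
        finally show ?thesis .
      qed
      then have "s * R ?c - s * e \<le> r + r'" using b(3,4) by (simp add: s_def algebra_simps)
      ultimately show ?thesis unfolding B_def using c s
        by (intro CollectI case_prodI exI[of _ s] bexI[of _ ?c] conjI) auto
    qed
  qed
  have Bscale: "((\<lambda>x. c * b x), c * r) \<in> B" if "(b, r) \<in> B" "c \<ge> 0" for b r c
  proof -
    from that obtain t a where t: "t \<ge> 0" "a \<in> A" "b = (\<lambda>x. t * T a x)" "t * R a - t * e \<le> r" by (auto simp: B_def)
    have "c * (t * R a - t * e) \<le> c * r" using t that by (intro mult_left_mono)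
    then show ?thesis unfolding B_def using that(2) t
      by (auto intro!: exI[of _ "c * t"] bexI[of _ a] simp: algebra_simps)
  qed
  have low': "0 \<le> P b + r" if "(b, r) \<in> B" for b r
  proof -
    from that obtain t a where t: "t \<ge> 0" "a \<in> A" "b = (\<lambda>x. t * T a x)" "t * R a - t * e \<le> r" by (auto simp: B_def)
    show ?thesis
    proof (cases "t = 0")
      case True then show ?thesis using t sublinear_on_zero[OF V P] by simp
    next
      case False
      have "P (\<lambda>x. (1/t) * (t * T a x)) \<le> (1/t) * P (\<lambda>x. t * T a x)"
        using t TV by (intro sublinear_onD(2)[OF P] VD) auto
      then have "t * P (T a) \<le> P b" using False t by (simp add: field_simps)
      moreover have "t * e \<le> t * (P (T a) + R a)" using low[OF t(2)] t(1) by (rule mult_left_mono)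
      ultimately show ?thesis using t by (simp add: algebra_simps)
    qed
  qed
  obtain a0 where "a0 \<in> A" using ne by blast
  then have "(\<lambda>x. 0 * T a0 x, 0 * R a0 - 0 * e) \<in> B" unfolding B_def by blast
  then have ne': "B \<noteq> {}" by blast
  have BV: "(b, r) \<in> B \<Longrightarrow> b \<in> V" for b r using TV by (auto simp: B_def intro: VD)
  have ci1: "sublinear_on V u" unfolding u_def
    by (rule sublinear_on_cone_inf(1)[OF V P ne' BV Badd Bscale low'])
  have ci2: "u f \<le> P (\<lambda>x. f x + b x) + r" if "f \<in> V" "(b, r) \<in> B" for f b r unfolding u_def
    by (rule sublinear_on_cone_inf(2)[OF V P ne' BV Badd Bscale low' that])
  have ci3: "u f \<le> P f" if "f \<in> V" for f unfolding u_def
    by (rule sublinear_on_cone_inf(3)[OF V P ne' BV Badd Bscale low' that])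
  obtain l where l: "linear_fun_on V l" "\<And>f. f \<in> V \<Longrightarrow> l f \<le> u f"
    using hahn_banach_sublinear[OF V ci1] by blast
  show ?thesis
  proof
    show "linear_fun_on V l" by (rule l)
    show "l f \<le> P f" if "f \<in> V" for f using l(2)[OF that] ci3[OF that] by simp
    show "e \<le> l (T a) + R a" if a: "a \<in> A" for a
    proof -
      have "(T a, R a - e) \<in> B" unfolding B_def using a by (auto intro!: exI[of _ 1])
      then have "u (\<lambda>x. - T a x) \<le> P (\<lambda>x. - T a x + T a x) + (R a - e)"
        by (intro ci2 VD TV a)
      then have "l (\<lambda>x. - T a x) \<le> R a - e"
        using l(2)[OF VD(4)[OF TV[OF a]]] sublinear_on_zero[OF V P] by simp
      moreover have "l (\<lambda>x. (-1) * T a x) = (-1) * l (T a)"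
        using l(1) TV[OF a] unfolding linear_fun_on_def by blast
      ultimately show ?thesis by simp
    qed
  qed
qed

text \<open>
  One summand at a time is replaced by a linear functional; the others are part of the convex remainder \<open>R\<close>.
\<close>

lemma mazur_orlicz_sum:
  fixes A :: "('y \<Rightarrow> real) set" and T :: "'j \<Rightarrow> ('y \<Rightarrow> real) \<Rightarrow> 'x \<Rightarrow> real"
  assumes V: "fun_subspace V" and P: "sublinear_on V P" and ne: "A \<noteq> {}"
    and conv: "\<And>a b u v. a \<in> A \<Longrightarrow> b \<in> A \<Longrightarrow> 0 \<le> u \<Longrightarrow> 0 \<le> v \<Longrightarrow> u + v = 1 \<Longrightarrow> (\<lambda>y. u * a y + v * b y) \<in> A"
    and J: "finite J"
    and TV: "\<And>j a. j \<in> J \<Longrightarrow> a \<in> A \<Longrightarrow> T j a \<in> V"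
    and T: "\<And>j a b u v. j \<in> J \<Longrightarrow> a \<in> A \<Longrightarrow> b \<in> A \<Longrightarrow> 0 \<le> u \<Longrightarrow> 0 \<le> v \<Longrightarrow> u + v = 1 \<Longrightarrow>
        T j (\<lambda>y. u * a y + v * b y) = (\<lambda>x. u * T j a x + v * T j b x)"
    and R: "\<And>a b u v. a \<in> A \<Longrightarrow> b \<in> A \<Longrightarrow> 0 \<le> u \<Longrightarrow> 0 \<le> v \<Longrightarrow> u + v = 1 \<Longrightarrow>
        R (\<lambda>y. u * a y + v * b y) \<le> u * R a + v * R b"
    and low: "\<And>a. a \<in> A \<Longrightarrow> e \<le> (\<Sum>j\<in>J. P (T j a)) + R a"
  shows "\<exists>l. (\<forall>j\<in>J. linear_fun_on V (l j) \<and> (\<forall>f\<in>V. l j f \<le> P f)) \<and> (\<forall>a\<in>A. e \<le> (\<Sum>j\<in>J. l j (T j a)) + R a)"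
  using J TV T R low
proof (induction J arbitrary: R rule: finite_induct)
  case empty
  then show ?case by simp
next
  case (insert i J)
  note TVi = insert.prems(1) and Ti = insert.prems(2) and Ri = insert.prems(3)
  have convex: "P (T j (\<lambda>y. u * a y + v * b y)) \<le> u * P (T j a) + v * P (T j b)"
    if "j \<in> insert i J" "a \<in> A" "b \<in> A" "0 \<le> u" "0 \<le> v" "u + v = 1" for j a b u v
  proof -
    have "P (T j (\<lambda>y. u * a y + v * b y)) = P (\<lambda>x. u * T j a x + v * T j b x)" using Ti[OF that] by simp
    also have "\<dots> \<le> P (\<lambda>x. u * T j a x) + P (\<lambda>x. v * T j b x)"
      using that by (intro sublinear_onD(1)[OF P] fun_subspaceD(3)[OF V] TVi)
    also have "\<dots> \<le> u * P (T j a) + v * P (T j b)"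
      using that by (intro add_mono sublinear_onD(2)[OF P] TVi)
    finally show ?thesis .
  qed
  obtain l where l: "linear_fun_on V l" "\<And>f. f \<in> V \<Longrightarrow> l f \<le> P f"
     "\<And>a. a \<in> A \<Longrightarrow> e \<le> l (T i a) + ((\<Sum>j\<in>J. P (T j a)) + R a)"
  proof (rule mazur_orlicz[OF V P ne conv, where T = "T i" and R = "\<lambda>a. (\<Sum>j\<in>J. P (T j a)) + R a" and e = e])
    show "(\<Sum>j\<in>J. P (T j (\<lambda>y. u * a y + v * b y))) + R (\<lambda>y. u * a y + v * b y)
       \<le> u * ((\<Sum>j\<in>J. P (T j a)) + R a) + v * ((\<Sum>j\<in>J. P (T j b)) + R b)"
      if "a \<in> A" "b \<in> A" "0 \<le> u" "0 \<le> v" "u + v = 1" for a b u v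
    proof -
      have "(\<Sum>j\<in>J. P (T j (\<lambda>y. u * a y + v * b y))) \<le> (\<Sum>j\<in>J. u * P (T j a) + v * P (T j b))"
        using that by (intro sum_mono convex) auto
      then show ?thesis using Ri[OF that] by (simp add: sum.distrib sum_distrib_left distrib_left)
    qed
    show "e \<le> P (T i a) + ((\<Sum>j\<in>J. P (T j a)) + R a)" if "a \<in> A" for a
      using insert.prems(4)[OF that] insert.hyps by (simp add: add.assoc)
  qed (use TVi Ti in auto)
  have lT: "l (T i (\<lambda>y. u * a y + v * b y)) = u * l (T i a) + v * l (T i b)"
    if "a \<in> A" "b \<in> A" "0 \<le> u" "0 \<le> v" "u + v = 1" for a b u v
    using l(1) TVi[OF insertI1] that fun_subspaceD(3)[OF V] unfolding Ti[OF insertI1 that] linear_fun_on_def by simp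
  have "\<exists>l'. (\<forall>j\<in>J. linear_fun_on V (l' j) \<and> (\<forall>f\<in>V. l' j f \<le> P f)) \<and>
      (\<forall>a\<in>A. e \<le> (\<Sum>j\<in>J. l' j (T j a)) + (l (T i a) + R a))"
  proof (rule insert.IH)
    show "l (T i (\<lambda>y. u * a y + v * b y)) + R (\<lambda>y. u * a y + v * b y) \<le> u * (l (T i a) + R a) + v * (l (T i b) + R b)"
      if "a \<in> A" "b \<in> A" "0 \<le> u" "0 \<le> v" "u + v = 1" for a b u v
      using lT[OF that] Ri[OF that] by (simp add: distrib_left)
    show "e \<le> (\<Sum>j\<in>J. P (T j a)) + (l (T i a) + R a)" if "a \<in> A" for a using l(3)[OF that] by simp
  qed (use TVi Ti in auto)
  then obtain l' where l': "\<forall>j\<in>J. linear_fun_on V (l' j) \<and> (\<forall>f\<in>V. l' j f \<le> P f)"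
      "\<forall>a\<in>A. e \<le> (\<Sum>j\<in>J. l' j (T j a)) + (l (T i a) + R a)" by blast
  have eq: "(\<Sum>j\<in>J. (l'(i := l)) j (T j a)) = (\<Sum>j\<in>J. l' j (T j a))" for a
    using insert.hyps by (intro sum.cong) auto
  show ?case
  proof (intro exI[of _ "l'(i := l)"] conjI ballI)
    show "(l'(i := l)) j f \<le> P f" if "j \<in> insert i J" "f \<in> V" for j f
      using l' l(2) that by (cases "j = i"; simp)
    show "linear_fun_on V ((l'(i := l)) j)" if "j \<in> insert i J" for j
      using l' l(1) that by (cases "j = i"; simp)
    show "e \<le> (\<Sum>j\<in>insert i J. (l'(i := l)) j (T j a)) + R a" if "a \<in> A" for a
      using l'(2) that insert.hyps eq[of a] by (simp add: algebra_simps)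
  qed
qed

text \<open>
  The domain has to contain the constant function \<open>1\<close>, which \<open>C\<^sub>c\<close> does not in general, and boundedness makes
  the suprema that dominate the functionals finite.
\<close>

definition bounded_fun_on :: "'x set \<Rightarrow> ('x \<Rightarrow> real) set" where
  "bounded_fun_on U = {k. \<exists>C. \<forall>u\<in>U. \<bar>k u\<bar> \<le> C}"

lemma fun_subspace_bounded: "fun_subspace (bounded_fun_on U)"
  unfolding fun_subspace_def
proof (intro conjI ballI allI)
  show "(\<lambda>x. 0) \<in> bounded_fun_on U" by (auto simp: bounded_fun_on_def)
  fix f assume "f \<in> bounded_fun_on U"
  then obtain C where C: "\<And>u. u \<in> U \<Longrightarrow> \<bar>f u\<bar> \<le> C" by (auto simp: bounded_fun_on_def)
  show "(\<lambda>x. c * f x) \<in> bounded_fun_on U" for c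
    using C by (auto simp: bounded_fun_on_def abs_mult intro!: exI[of _ "\<bar>c\<bar> * C"] mult_left_mono)
  fix g assume "g \<in> bounded_fun_on U"
  then obtain D where D: "\<And>u. u \<in> U \<Longrightarrow> \<bar>g u\<bar> \<le> D" by (auto simp: bounded_fun_on_def)
  have "\<bar>f u + g u\<bar> \<le> C + D" if "u \<in> U" for u using C[OF that] D[OF that] by linarith
  then show "(\<lambda>x. f x + g x) \<in> bounded_fun_on U" by (auto simp: bounded_fun_on_def)
qed

text \<open>
  The positive part makes every linear functional below \<open>sup_pos K\<close> positive and carried by \<open>K\<close>.
\<close>

definition sup_pos :: "'x set \<Rightarrow> ('x \<Rightarrow> real) \<Rightarrow> real" where
  "sup_pos K k = (SUP u\<in>K. max (k u) 0)"

lemma sup_pos_upper: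
  assumes "k \<in> bounded_fun_on U" "K \<subseteq> U" "u \<in> K"
  shows "max (k u) 0 \<le> sup_pos K k"
proof -
  obtain C where C: "\<And>u. u \<in> U \<Longrightarrow> \<bar>k u\<bar> \<le> C" using assms(1) by (auto simp: bounded_fun_on_def)
  have "bdd_above ((\<lambda>u. max (k u) 0) ` K)"
  proof (rule bdd_aboveI2)
    fix u assume "u \<in> K"
    then have "\<bar>k u\<bar> \<le> C" using C assms(2) by auto
    then show "max (k u) 0 \<le> C" by (auto simp: bounded_fun_on_def)
  qed
  then show ?thesis unfolding sup_pos_def by (rule cSUP_upper[OF assms(3)])
qed

lemma sup_pos_least: "K \<noteq> {} \<Longrightarrow> 0 \<le> c \<Longrightarrow> (\<And>u. u \<in> K \<Longrightarrow> k u \<le> c) \<Longrightarrow> sup_pos K k \<le> c"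
  unfolding sup_pos_def by (rule cSUP_least) auto

lemma sublinear_sup_pos:
  assumes K: "K \<noteq> {}" "K \<subseteq> U"
  shows "sublinear_on (bounded_fun_on U) (sup_pos K)"
  unfolding sublinear_on_def
proof (intro conjI ballI allI impI)
  fix f assume f: "f \<in> bounded_fun_on U"
  obtain u0 where u0: "u0 \<in> K" using K by blast
  have f0: "0 \<le> sup_pos K f" using sup_pos_upper[OF f K(2) u0] by simp
  show "sup_pos K (\<lambda>x. c * f x) \<le> c * sup_pos K f" if c: "0 \<le> c" for c
  proof (rule sup_pos_least[OF K(1)])
    fix u assume "u \<in> K"
    then have "f u \<le> sup_pos K f" using sup_pos_upper[OF f K(2)] by fastforce
    then show "c * f u \<le> c * sup_pos K f" using c by (rule mult_left_mono)
  qed (use c f0 in simp)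
  fix g assume g: "g \<in> bounded_fun_on U"
  have g0: "0 \<le> sup_pos K g" using sup_pos_upper[OF g K(2) u0] by simp
  show "sup_pos K (\<lambda>x. f x + g x) \<le> sup_pos K f + sup_pos K g"
  proof (rule sup_pos_least[OF K(1)])
    fix u assume u: "u \<in> K"
    show "f u + g u \<le> sup_pos K f + sup_pos K g"
      using sup_pos_upper[OF f K(2) u] sup_pos_upper[OF g K(2) u] by linarith
  qed (use f0 g0 in simp)
qed

section \<open>Topology of the groupoid and of the quotient\<close>

lemma radon_support_integral_pos:
  fixes f :: "'a \<Rightarrow> real"
  assumes M: "radon_measure X M" and X: "Hausdorff_space X"
    and f: "f \<in> Cc X" "\<And>x. 0 \<le> f x" and x: "x \<in> measure_support X M" "0 < f x"
  shows "0 < (LINT x|M. f x)"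
proof (rule ccontr)
  assume "\<not> 0 < (LINT x|M. f x)"
  moreover have "0 \<le> (LINT x|M. f x)" using f by (intro integral_nonneg_AE) auto
  ultimately have "(LINT x|M. f x) = 0" by simp
  then have "AE x in M. f x = 0"
    using integral_nonneg_eq_0_iff_AE[OF radon_Cc_integrable[OF M X f(1)]] f(2) by auto
  moreover define V where "V = {x \<in> topspace X. f x \<in> {0<..}}"
  have V: "openin X V" unfolding V_def using Cc_continuous[OF f(1)]
    by (rule openin_continuous_map_preimage) auto
  ultimately have "AE x in M. x \<notin> V" by (auto simp: V_def)
  moreover have "{x \<in> space M. \<not> x \<notin> V} = V" by (auto simp: V_def radon_space[OF M])
  moreover have "V \<in> sets M" using V radon_sets[OF M] by (simp add: openin_sets_borel_of)
  ultimately have "emeasure M V = 0" using AE_iff_measurable[of V M "\<lambda>x. x \<notin> V"] by blast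
  moreover have "x \<in> V" using x by (auto simp: V_def measure_support_def)
  ultimately show False using x(1) V unfolding measure_support_def by force
qed

lemma openin_prodE:
  assumes "openin (prod_topology X Y) W" "(x, y) \<in> W"
  obtains U V where "openin X U" "openin Y V" "x \<in> U" "y \<in> V" "U \<times> V \<subseteq> W"
proof -
  have "\<forall>x y. (x, y) \<in> W \<longrightarrow> (\<exists>U V. openin X U \<and> openin Y V \<and> x \<in> U \<and> y \<in> V \<and> U \<times> V \<subseteq> W)"
    using assms(1) openin_prod_topology_alt[of X Y W] by simp
  from this[rule_format, OF assms(2)] show ?thesis using that by auto
qed

context topological_groupoid
begin

lemma composable_iff: "(x, y) \<in> composable G \<longleftrightarrow> x \<in> carr G \<and> y \<in> carr G \<and> src G x = rng G y"
  by (simp add: composable_def)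

lemma units_iff: "u \<in> units G \<longleftrightarrow> u \<in> carr G \<and> rng G u = u"
  unfolding units_def using rng_closed rng_rng by force

lemma rng_units: "x \<in> carr G \<Longrightarrow> rng G x \<in> units G"
  by (simp add: units_iff rng_closed rng_rng)

lemma src_units: "x \<in> carr G \<Longrightarrow> src G x \<in> units G"
  by (simp add: units_iff src_closed rng_src)

lemma units_carr: "u \<in> units G \<Longrightarrow> u \<in> carr G"
  by (simp add: units_iff)

lemma rng_unit: "u \<in> units G \<Longrightarrow> rng G u = u"
  by (simp add: units_iff)

lemma mult_carr: "x \<in> carr G \<Longrightarrow> y \<in> carr G \<Longrightarrow> src G x = rng G y \<Longrightarrow> gmult G x y \<in> carr G"
  by (rule mult_closed) (simp add: composable_iff)

lemma rng_mult': "x \<in> carr G \<Longrightarrow> y \<in> carr G \<Longrightarrow> src G x = rng G y \<Longrightarrow> rng G (gmult G x y) = rng G x"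
  by (rule rng_mult) (simp add: composable_iff)

lemma src_mult': "x \<in> carr G \<Longrightarrow> y \<in> carr G \<Longrightarrow> src G x = rng G y \<Longrightarrow> src G (gmult G x y) = src G y"
  by (rule src_mult) (simp add: composable_iff)

lemma assoc': "x \<in> carr G \<Longrightarrow> y \<in> carr G \<Longrightarrow> z \<in> carr G \<Longrightarrow> src G x = rng G y \<Longrightarrow> src G y = rng G z \<Longrightarrow>
   gmult G (gmult G x y) z = gmult G x (gmult G y z)"
  by (rule mult_assoc) (simp_all add: composable_iff)

lemmas groupoid_simps = rng_closed src_closed rng_rng src_rng rng_src src_src mult_carr rng_mult' src_mult'
  inv_closed rng_inv src_inv inv_right inv_left unit_left unit_right

lemma inv_mult_cancel:
  "x \<in> carr G \<Longrightarrow> y \<in> carr G \<Longrightarrow> src G x = rng G y \<Longrightarrow> gmult G (ginv G x) (gmult G x y) = y"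
  using assoc'[of "ginv G x" x y] by (simp add: groupoid_simps)

lemma mult_inv_cancel:
  "x \<in> carr G \<Longrightarrow> y \<in> carr G \<Longrightarrow> rng G x = rng G y \<Longrightarrow> gmult G x (gmult G (ginv G x) y) = y"
  using assoc'[of x "ginv G x" y] by (simp add: groupoid_simps)

lemma inv_inv:
  assumes "x \<in> carr G" shows "ginv G (ginv G x) = x"
proof -
  have "gmult G (ginv G (ginv G x)) (gmult G (ginv G x) x) = x"
    using assms by (intro inv_mult_cancel) (auto simp: groupoid_simps)
  then show ?thesis using assms unit_right[of "ginv G (ginv G x)"] by (simp add: groupoid_simps)
qed

lemma inv_mult:
  assumes "x \<in> carr G" "y \<in> carr G" "src G x = rng G y"
  shows "ginv G (gmult G x y) = gmult G (ginv G y) (ginv G x)"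
proof -
  let ?z = "gmult G (ginv G y) (ginv G x)"
  have z: "?z \<in> carr G" "rng G ?z = src G y" using assms by (auto simp: groupoid_simps)
  have "gmult G (gmult G x y) ?z = gmult G x (gmult G y ?z)"
    using assms z by (intro assoc') (auto simp: groupoid_simps)
  also have "gmult G y ?z = ginv G x"
    using mult_inv_cancel[of y "ginv G x"] assms by (simp add: groupoid_simps)
  also have "gmult G x (ginv G x) = rng G x" using assms by (simp add: groupoid_simps)
  finally have 1: "gmult G (gmult G x y) ?z = rng G x" .
  have "gmult G (ginv G (gmult G x y)) (gmult G (gmult G x y) ?z) = ?z"
    using assms z by (intro inv_mult_cancel) (auto simp: groupoid_simps)
  then show ?thesis using unit_right[of "ginv G (gmult G x y)"] assms unfolding 1 by (simp add: groupoid_simps)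
qed

lemma continuous_mult':
  assumes "continuous_map Y (top_of G) f" "continuous_map Y (top_of G) g"
    "\<And>y. y \<in> topspace Y \<Longrightarrow> src G (f y) = rng G (g y)"
  shows "continuous_map Y (top_of G) (\<lambda>y. gmult G (f y) (g y))"
proof -
  have "continuous_map Y (subtopology (prod_topology (top_of G) (top_of G)) (composable G)) (\<lambda>y. (f y, g y))"
    using assms continuous_map_funspace[OF assms(1)] continuous_map_funspace[OF assms(2)]
    by (auto simp: continuous_map_in_subtopology composable_iff intro!: continuous_map_pairedI)
  from continuous_map_compose[OF this continuous_mult] show ?thesis by (simp add: o_def)
qed

lemma continuous_inv':
  "continuous_map Y (top_of G) f \<Longrightarrow> continuous_map Y (top_of G) (\<lambda>y. ginv G (f y))"
  using continuous_map_compose[OF _ continuous_inv, of Y f] by (simp add: o_def)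

lemma continuous_rng: "continuous_map (top_of G) (top_of G) (rng G)"
proof -
  have "continuous_map (top_of G) (top_of G) (\<lambda>x. gmult G x (ginv G x))"
    by (intro continuous_mult' continuous_inv) (auto simp: groupoid_simps)
  then show ?thesis by (rule continuous_map_eq) (simp add: inv_right)
qed

lemma continuous_src: "continuous_map (top_of G) (top_of G) (src G)"
proof -
  have "continuous_map (top_of G) (top_of G) (\<lambda>x. gmult G (ginv G x) x)"
    by (intro continuous_mult' continuous_inv) (auto simp: groupoid_simps)
  then show ?thesis by (rule continuous_map_eq) (simp add: inv_left)
qed

lemma continuous_rng_unit: "continuous_map (top_of G) (unit_top G) (rng G)"
  unfolding unit_top_def using continuous_rng rng_units by (auto simp: continuous_map_in_subtopology)

lemma continuous_src_unit: "continuous_map (top_of G) (unit_top G) (src G)"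
  unfolding unit_top_def using continuous_src src_units by (auto simp: continuous_map_in_subtopology)

lemma units_closed: "closedin (top_of G) (units G)"
proof -
  have "closedin (top_of G) {x \<in> carr G. rng G x = id x}"
    by (rule closedin_continuous_maps_eq[OF Hausdorff_top continuous_rng]) simp
  moreover have "{x \<in> carr G. rng G x = id x} = units G" by (auto simp: units_iff)
  ultimately show ?thesis by simp
qed

lemma topspace_unit: "topspace (unit_top G) = units G"
  unfolding unit_top_def using units_carr by auto

lemma fibre_closed: "u \<in> units G \<Longrightarrow> closedin (top_of G) (fibre G u)"
proof -
  assume u: "u \<in> units G"
  have "closedin (top_of G) {u}"
    using u Hausdorff_top units_carr by (simp add: closedin_Hausdorff_singleton)
  from closedin_continuous_map_preimage[OF continuous_rng this] show ?thesis by (simp add: fibre_def)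
qed

sublocale GX: LCH "top_of G"
  by standard (rule Hausdorff_top locally_compact_top)+

sublocale UX: LCH "unit_top G"
  unfolding unit_top_def
  by standard (auto intro: Hausdorff_space_subtopology Hausdorff_top locally_compact_space_closed_subset locally_compact_top units_closed)

end

locale groupoid_quotient = topological_groupoid G for G :: "'g groupoid" +
  fixes H :: "'g set" and lam lamH :: "'g \<Rightarrow> 'g measure" and mu :: "'g \<Rightarrow> 'g set measure"
  assumes haar: "haar_system G lam"
    and subgrp: "closed_wide_subgroupoid G H"
    and haarH: "haar_system (subgroupoid G H) lamH"
    and meas: "full_equivariant_measure_system G H mu"
begin

lemma H_closed: "closedin (top_of G) H" and units_H: "units G \<subseteq> H"
  and inv_H: "x \<in> H \<Longrightarrow> ginv G x \<in> H" and mult_H: "x \<in> H \<Longrightarrow> y \<in> H \<Longrightarrow> src G x = rng G y \<Longrightarrow> gmult G x y \<in> H"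
  and H_carr: "x \<in> H \<Longrightarrow> x \<in> carr G"
  using subgrp closedin_subset unfolding closed_wide_subgroupoid_def by blast+

lemma coset_eq_iff:
  assumes x: "x \<in> carr G" and y: "y \<in> carr G"
  shows "coset G H x = coset G H y \<longleftrightarrow> rng G x = rng G y \<and> gmult G (ginv G x) y \<in> H"
proof
  assume "coset G H x = coset G H y"
  then have "y \<in> coset G H x" using mem_coset[OF subgrp y] by simp
  then show "rng G x = rng G y \<and> gmult G (ginv G x) y \<in> H" by (auto simp: coset_def)
next
  assume xy: "rng G x = rng G y \<and> gmult G (ginv G x) y \<in> H"
  let ?h = "gmult G (ginv G x) y"
  have h: "?h \<in> H" "?h \<in> carr G" "rng G ?h = src G x" "src G ?h = src G y"
    using xy x y by (auto simp: groupoid_simps)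
  have yx: "y = gmult G x ?h" using mult_inv_cancel[of x y] xy x y by simp
  have invh: "ginv G ?h \<in> H" using h inv_H by blast
  have *: "gmult G (ginv G x) z = gmult G ?h (gmult G (ginv G y) z)" if "z \<in> carr G" "rng G z = rng G x" for z
  proof -
    have "gmult G ?h (gmult G (ginv G y) z) = gmult G (ginv G x) (gmult G y (gmult G (ginv G y) z))"
      using x y xy that by (intro assoc') (auto simp: groupoid_simps)
    then show ?thesis using mult_inv_cancel[of y z] y xy that by simp
  qed
  have **: "gmult G (ginv G y) z = gmult G (ginv G ?h) (gmult G (ginv G x) z)" if "z \<in> carr G" "rng G z = rng G x" for z
    using *[OF that] inv_mult_cancel[of ?h "gmult G (ginv G y) z"] h that x y xy by (simp add: groupoid_simps)
  show "coset G H x = coset G H y"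
  proof (intro set_eqI iffI)
    fix z assume "z \<in> coset G H x"
    then have z: "z \<in> carr G" "rng G z = rng G x" "gmult G (ginv G x) z \<in> H" by (auto simp: coset_def)
    have "gmult G (ginv G ?h) (gmult G (ginv G x) z) \<in> H"
      using z x h by (intro mult_H[OF invh]) (auto simp: groupoid_simps)
    then show "z \<in> coset G H y" using z xy **[OF z(1,2)] by (auto simp: coset_def)
  next
    fix z assume "z \<in> coset G H y"
    then have z: "z \<in> carr G" "rng G z = rng G x" "gmult G (ginv G y) z \<in> H" using xy by (auto simp: coset_def)
    have "gmult G ?h (gmult G (ginv G y) z) \<in> H"
      using z x y xy h by (intro mult_H[OF h(1)]) (auto simp: groupoid_simps)
    then show "z \<in> coset G H x" using z xy *[OF z(1,2)] by (auto simp: coset_def)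
  qed
qed

lemma coset_mult_H:
  assumes "x \<in> carr G" "h \<in> H" "src G x = rng G h"
  shows "coset G H (gmult G x h) = coset G H x"
proof -
  have h: "h \<in> carr G" by (rule H_carr[OF assms(2)])
  have "rng G x = rng G (gmult G x h) \<and> gmult G (ginv G x) (gmult G x h) \<in> H"
    using assms h inv_mult_cancel[of x h] by (simp add: rng_mult')
  then show ?thesis using coset_eq_iff[OF assms(1) mult_carr[OF assms(1) h assms(3)]] by simp
qed

lemma coset_cosets: "x \<in> carr G \<Longrightarrow> coset G H x \<in> cosets G H"
  by (simp add: cosets_def)

lemma cosetsE: assumes "w \<in> cosets G H" obtains x where "x \<in> carr G" "w = coset G H x"
  using assms by (auto simp: cosets_def)

lemma qrng_units: "w \<in> cosets G H \<Longrightarrow> qrng G w \<in> units G"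
  by (metis cosetsE qrng_coset[OF subgrp] rng_units)

lemma qact_cosets: "g \<in> carr G \<Longrightarrow> w \<in> cosets G H \<Longrightarrow> src G g = qrng G w \<Longrightarrow> qact G g w \<in> cosets G H"
  by (metis cosetsE qrng_coset[OF subgrp] qact_coset coset_cosets mult_carr)

lemma qrng_qact: "g \<in> carr G \<Longrightarrow> w \<in> cosets G H \<Longrightarrow> src G g = qrng G w \<Longrightarrow> qrng G (qact G g w) = rng G g"
  by (metis cosetsE qrng_coset[OF subgrp] qact_coset rng_mult' mult_carr)

lemma qact_qact:
  assumes "g \<in> carr G" "k \<in> carr G" "w \<in> cosets G H" "src G g = rng G k" "src G k = qrng G w"
  shows "qact G g (qact G k w) = qact G (gmult G g k) w"
  using assms(3)
proof (rule cosetsE)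
  fix x assume x: "x \<in> carr G" "w = coset G H x"
  then show ?thesis using assms
    by (simp add: qrng_coset[OF subgrp] qact_coset groupoid_simps assoc')
qed

text \<open>
  This is where a Haar system on \<open>H\<close> is used. For \<open>h \<in> B \<inter> H\<close> take \<open>f \<ge> 0\<close> in \<open>C\<^sub>c(H)\<close> with \<open>f h = 1\<close> that vanishes
  off \<open>B\<close>. Its integrals over the range fibres of \<open>H\<close> depend continuously on the unit, are positive at the range of
  \<open>h\<close> by fullness of the supports, and vanish at every unit whose fibre misses \<open>B\<close>.
\<close>

lemma H_range_open:
  assumes B: "openin (top_of G) B"
  shows "openin (unit_top G) (rng G ` (B \<inter> H))"
proof -
  let ?K = "subgroupoid G H" and ?T = "subtopology (top_of G) H"
  have top: "top_of ?K = ?T" "rng ?K = rng G" by (simp_all add: subgroupoid_def)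
  have carr: "carr ?K = H" using H_carr by (auto simp: subgroupoid_def)
  have units: "units ?K = units G"
  proof -
    have "rng G ` H = units G"
    proof (intro set_eqI iffI)
      fix u assume "u \<in> units G"
      then show "u \<in> rng G ` H" using units_H rng_unit[of u] by (metis imageI subsetD)
    qed (use rng_units H_carr in auto)
    then show ?thesis using carr top by (simp add: units_def)
  qed
  have ut: "unit_top ?K = unit_top G"
    unfolding unit_top_def units top subtopology_subtopology using units_H by (simp add: inf_absorb2)
  interpret T: LCH ?T
    by standard (auto intro: Hausdorff_space_subtopology Hausdorff_top locally_compact_space_closed_subset locally_compact_top H_closed)
  show ?thesis
  proof (subst openin_subopen, intro ballI)
    fix u assume "u \<in> rng G ` (B \<inter> H)"
    then obtain h where h: "h \<in> B" "h \<in> H" "u = rng G h" by auto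
    have hc: "h \<in> carr G" using h H_carr by simp
    have uu: "u \<in> units G" using h rng_units hc by simp
    have oB: "openin ?T (H \<inter> B)" using B by (simp add: openin_subtopology_Int2)
    obtain f :: "'g \<Rightarrow> real" and L where f: "f \<in> Cc ?T" "\<And>x. 0 \<le> f x" "f h = 1" "L \<subseteq> H \<inter> B" "\<And>x. x \<notin> L \<Longrightarrow> f x = 0"
    proof -
      have "compactin ?T {h}" "{h} \<subseteq> H \<inter> B" using h hc by auto
      from T.Cc_Urysohn[OF this(1) oB this(2)] that show ?thesis by (metis singletonI)
    qed
    define F where "F = (\<lambda>v. LINT x|lamH v. f x)"
    have "continuous_map (unit_top ?K) euclidean (\<lambda>v. (LINT x|lamH v. complex_of_real (f x)))"
      using haarH Cc_of_real[OF T.Haus f(1)] unfolding haar_system_def top by blast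
    then have "continuous_map (unit_top G) euclidean (\<lambda>v. Re (LINT x|lamH v. complex_of_real (f x)))"
      unfolding ut by (rule continuous_map_compose_euclidean) (auto intro!: continuous_intros)
    then have F: "continuous_map (unit_top G) euclidean F" by (simp add: F_def)
    have rad: "radon_measure ?T (lamH v)" "measure_support ?T (lamH v) = {x \<in> H. rng G x = v}" if "v \<in> units G" for v
      using haarH that unfolding haar_system_def units top fibre_def carr by (auto dest: H_carr)
    define W where "W = {v \<in> topspace (unit_top G). F v \<in> {0<..}}"
    have "openin (unit_top G) W" unfolding W_def using F by (rule openin_continuous_map_preimage) auto
    moreover have "u \<in> W"
      unfolding W_def F_def topspace_unit using uu rad[OF uu] h f
      by (auto intro!: radon_support_integral_pos[OF _ T.Haus, of _ _ h])
    moreover have "W \<subseteq> rng G ` (B \<inter> H)"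
    proof
      fix v assume v: "v \<in> W"
      then have vu: "v \<in> units G" by (simp add: W_def topspace_unit)
      show "v \<in> rng G ` (B \<inter> H)"
      proof (rule ccontr)
        assume "v \<notin> rng G ` (B \<inter> H)"
        then have "f x = 0" if "x \<in> {x \<in> H. rng G x = v}" for x using that f(4,5) by blast
        then have "AE x in lamH v. f x = 0"
          using AE_measure_support[OF rad(1)[OF vu]] rad(2)[OF vu] by (auto elim!: AE_mp)
        then have "F v = 0" unfolding F_def by (rule integral_eq_zero_AE)
        then show False using v by (simp add: W_def)
      qed
    qed
    ultimately show "\<exists>T. openin (unit_top G) T \<and> u \<in> T \<and> T \<subseteq> rng G ` (B \<inter> H)" by blast
  qed
qed

lemma topspace_quot [simp]: "topspace (quot_top G H) = cosets G H"
  by (rule topspace_quot_top)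

lemma continuous_coset: "continuous_map (top_of G) (quot_top G H) (coset G H)"
  unfolding continuous_map_def topspace_quot openin_quot_top using coset_cosets by blast

text \<open>
  If \<open>x\<close> is equivalent to \<open>y = x h\<close> in \<open>V\<close>, continuity of multiplication gives neighbourhoods \<open>A\<close> of \<open>x\<close> and \<open>B\<close> of \<open>h\<close>
  with products in \<open>V\<close>. Every \<open>z \<in> A\<close> whose source is the range of an element of \<open>B \<inter> H\<close> is then equivalent to
  a point of \<open>V\<close>, and these \<open>z\<close> form an open set because the range map of \<open>H\<close> is open.
\<close>

lemma open_coset: "open_map (top_of G) (quot_top G H) (coset G H)"
  unfolding open_map_def
proof (intro allI impI)
  fix V assume V: "openin (top_of G) V"
  have Vc: "V \<subseteq> carr G" using V openin_subset by blast
  let ?S = "{x \<in> carr G. coset G H x \<in> coset G H ` V}"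
  have "openin (top_of G) ?S"
  proof (subst openin_subopen, intro ballI)
    fix x assume "x \<in> ?S"
    then obtain y where x: "x \<in> carr G" and y: "y \<in> V" "coset G H x = coset G H y" by auto
    have yc: "y \<in> carr G" using y Vc by auto
    let ?h = "gmult G (ginv G x) y"
    have xy: "rng G x = rng G y" "?h \<in> H" using y coset_eq_iff[OF x yc] by auto
    have h: "?h \<in> carr G" "rng G ?h = src G x" "gmult G x ?h = y"
      using x yc xy by (auto simp: groupoid_simps mult_inv_cancel)
    let ?P = "subtopology (prod_topology (top_of G) (top_of G)) (composable G)"
    have "openin ?P {z \<in> topspace ?P. (\<lambda>(x, y). gmult G x y) z \<in> V}"
      using continuous_mult V by (rule openin_continuous_map_preimage)
    then obtain W where W: "openin (prod_topology (top_of G) (top_of G)) W"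
      "{z \<in> topspace ?P. (\<lambda>(x, y). gmult G x y) z \<in> V} = W \<inter> composable G"
      unfolding openin_subtopology by blast
    have "(x, ?h) \<in> {z \<in> topspace ?P. (\<lambda>(x, y). gmult G x y) z \<in> V}"
      using x h y by (auto simp: composable_iff)
    then have "(x, ?h) \<in> W" unfolding W by blast
    then obtain A B where AB: "openin (top_of G) A" "openin (top_of G) B" "x \<in> A" "?h \<in> B" "A \<times> B \<subseteq> W"
      using openin_prodE[OF W(1)] by metis
    let ?A = "A \<inter> {z \<in> carr G. src G z \<in> rng G ` (B \<inter> H)}"
    have "openin (top_of G) ?A"
      using openin_continuous_map_preimage[OF continuous_src_unit H_range_open[OF AB(2)]] AB(1) by (rule openin_Int[rotated])
    moreover have "x \<in> ?A" using AB(3,4) x h(2) xy(2) by (auto intro!: image_eqI[of _ _ ?h])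
    moreover have "?A \<subseteq> ?S"
    proof
      fix z assume z: "z \<in> ?A"
      then obtain k where k: "k \<in> B" "k \<in> H" "src G z = rng G k" by auto
      have "(z, k) \<in> W \<inter> composable G" using z k AB(5) H_carr[OF k(2)] by (auto simp: composable_iff)
      then have "gmult G z k \<in> V" unfolding W(2)[symmetric] by auto
      moreover have "coset G H (gmult G z k) = coset G H z" using z k by (intro coset_mult_H) auto
      ultimately show "z \<in> ?S" using z by (metis (mono_tags, lifting) IntE image_eqI mem_Collect_eq)
    qed
    ultimately show "\<exists>T. openin (top_of G) T \<and> x \<in> T \<and> T \<subseteq> ?S" by blast
  qed
  moreover have "coset G H ` V \<subseteq> cosets G H" using Vc coset_cosets by blast
  ultimately show "openin (quot_top G H) (coset G H ` V)" by (simp add: openin_quot_top)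
qed

lemma coset_image: "coset G H ` carr G = topspace (quot_top G H)"
  unfolding topspace_quot cosets_def ..

lemma quotient_coset: "quotient_map (top_of G) (quot_top G H) (coset G H)"
  by (rule continuous_open_imp_quotient_map[OF continuous_coset open_coset coset_image])

lemma second_countable_quot: "second_countable (quot_top G H)"
  by (rule second_countable_open_map_image[OF continuous_coset open_coset coset_image second_countable_top])

text \<open>
  An open quotient of a space by a closed equivalence relation is Hausdorff, and the relation is closed
  because \<open>H\<close> is.
\<close>

lemma Hausdorff_quot: "Hausdorff_space (quot_top G H)"
  unfolding Hausdorff_space_def
proof (intro allI impI)
  fix w v assume wv: "w \<in> topspace (quot_top G H) \<and> v \<in> topspace (quot_top G H) \<and> w \<noteq> v"
  then have "w \<in> cosets G H" "v \<in> cosets G H" by auto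
  then obtain x y where x: "x \<in> carr G" "w = coset G H x" and y: "y \<in> carr G" "v = coset G H y"
    unfolding cosets_def by blast
  let ?P = "prod_topology (top_of G) (top_of G)"
  let ?D = "{z \<in> topspace ?P. rng G (fst z) = rng G (snd z)}"
  let ?R = "{z \<in> topspace ?P. coset G H (fst z) = coset G H (snd z)}"
  have c: "continuous_map ?P (top_of G) (\<lambda>z. rng G (fst z))" "continuous_map ?P (top_of G) (\<lambda>z. rng G (snd z))"
    using continuous_map_compose[OF continuous_map_fst continuous_rng] continuous_map_compose[OF continuous_map_snd continuous_rng]
    by (simp_all add: o_def)
  have D: "closedin ?P ?D" by (rule closedin_continuous_maps_eq[OF Hausdorff_top c])
  have "continuous_map (subtopology ?P ?D) (top_of G) (\<lambda>z. gmult G (ginv G (fst z)) (snd z))"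
    by (intro continuous_mult' continuous_inv' continuous_map_from_subtopology continuous_map_fst continuous_map_snd)
       (auto simp: groupoid_simps)
  then have "closedin (subtopology ?P ?D) {z \<in> topspace (subtopology ?P ?D). gmult G (ginv G (fst z)) (snd z) \<in> H}"
    using H_closed by (rule closedin_continuous_map_preimage)
  moreover have "{z \<in> topspace (subtopology ?P ?D). gmult G (ginv G (fst z)) (snd z) \<in> H} = ?R"
  proof (rule set_eqI)
    fix z show "z \<in> {z \<in> topspace (subtopology ?P ?D). gmult G (ginv G (fst z)) (snd z) \<in> H} \<longleftrightarrow> z \<in> ?R"
    proof (cases "fst z \<in> carr G \<and> snd z \<in> carr G")
      case True
      then show ?thesis using coset_eq_iff[of "fst z" "snd z"] by (simp add: mem_Times_iff)
    next
      case False
      then have "z \<notin> topspace ?P" by (simp add: mem_Times_iff)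
      then show ?thesis by simp
    qed
  qed
  ultimately have "closedin (subtopology ?P ?D) ?R" by simp
  then have "closedin ?P ?R" using D by (rule closedin_trans_full)
  then have op: "openin ?P (topspace ?P - ?R)" by (simp add: closedin_def)
  have "(x, y) \<in> topspace ?P - ?R" using x y wv by simp
  then obtain A B where AB: "openin (top_of G) A" "openin (top_of G) B" "x \<in> A" "y \<in> B" "A \<times> B \<subseteq> topspace ?P - ?R"
    by (rule openin_prodE[OF op])
  have "openin (quot_top G H) (coset G H ` A)" "openin (quot_top G H) (coset G H ` B)"
    using open_coset AB unfolding open_map_def by auto
  moreover have "w \<in> coset G H ` A" "v \<in> coset G H ` B" using x y AB by auto
  moreover have "disjnt (coset G H ` A) (coset G H ` B)"
    using AB(5) openin_subset[OF AB(1)] openin_subset[OF AB(2)] by (fastforce simp: disjnt_iff)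
  ultimately show "\<exists>U V. openin (quot_top G H) U \<and> openin (quot_top G H) V \<and> w \<in> U \<and> v \<in> V \<and> disjnt U V" by blast
qed

lemma locally_compact_quot: "locally_compact_space (quot_top G H)"
  by (rule locally_compact_space_continuous_open_map_image[OF continuous_coset open_coset coset_image locally_compact_top])

sublocale QX: LCH "quot_top G H"
  by standard (rule Hausdorff_quot locally_compact_quot)+

lemma continuous_qrng: "continuous_map (quot_top G H) (unit_top G) (qrng G)"
proof (rule continuous_compose_quotient_map[OF quotient_coset])
  show "continuous_map (top_of G) (unit_top G) (qrng G \<circ> coset G H)"
    by (rule continuous_map_eq[OF continuous_rng_unit]) (simp add: qrng_coset[OF subgrp])
qed

text \<open>
  The product of the identity with the open quotient map is open, and it restricts to a quotient map from the
  composable pairs onto the pairs on which the action is defined. Continuity of the action is therefore continuity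
  of multiplication.
\<close>

lemma continuous_qact:
  assumes a: "continuous_map Y (top_of G) a" and b: "continuous_map Y (quot_top G H) b"
    and ab: "\<And>y. y \<in> topspace Y \<Longrightarrow> src G (a y) = qrng G (b y)"
  shows "continuous_map Y (quot_top G H) (\<lambda>y. qact G (a y) (b y))"
proof -
  let ?PG = "prod_topology (top_of G) (top_of G)" and ?PX = "prod_topology (top_of G) (quot_top G H)"
  let ?q = "\<lambda>z. (fst z, coset G H (snd z))"
  let ?D = "{z. fst z \<in> carr G \<and> snd z \<in> cosets G H \<and> src G (fst z) = qrng G (snd z)}"
  have op: "open_map ?PG ?PX ?q" unfolding open_map_def
  proof (intro allI impI)
    fix W assume W: "openin ?PG W"
    show "openin ?PX (?q ` W)" unfolding openin_prod_topology_alt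
    proof (intro allI impI)
      fix g w assume "(g, w) \<in> ?q ` W"
      then obtain x where x: "(g, x) \<in> W" "w = coset G H x" by auto
      then obtain A B where AB: "openin (top_of G) A" "openin (top_of G) B" "g \<in> A" "x \<in> B" "A \<times> B \<subseteq> W"
        using openin_prodE[OF W] by metis
      have "openin (quot_top G H) (coset G H ` B)" using open_coset AB unfolding open_map_def by auto
      moreover have "A \<times> coset G H ` B \<subseteq> ?q ` W" using AB(5) by (force simp: image_iff)
      ultimately show "\<exists>U V. openin (top_of G) U \<and> openin (quot_top G H) V \<and> g \<in> U \<and> w \<in> V \<and> U \<times> V \<subseteq> ?q ` W"
        using AB x by blast
    qed
  qed
  have "{z \<in> topspace ?PG. ?q z \<in> ?D} = composable G"
    by (auto simp: composable_iff coset_cosets qrng_coset[OF subgrp])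
  from open_map_restriction[OF op this] have op2: "open_map (subtopology ?PG (composable G)) (subtopology ?PX ?D) ?q" .
  have tc: "topspace (subtopology ?PG (composable G)) = composable G" by (auto simp: composable_iff)
  have tD: "topspace (subtopology ?PX ?D) = ?D" by auto
  have q: "quotient_map (subtopology ?PG (composable G)) (subtopology ?PX ?D) ?q"
  proof (rule continuous_open_imp_quotient_map[OF _ op2])
    have "continuous_map ?PG ?PX ?q"
      using continuous_map_compose[OF continuous_map_snd continuous_coset]
      by (intro continuous_map_pairedI continuous_map_fst) (simp add: o_def)
    then show "continuous_map (subtopology ?PG (composable G)) (subtopology ?PX ?D) ?q"
      by (auto simp: continuous_map_in_subtopology composable_iff coset_cosets qrng_coset[OF subgrp] intro: continuous_map_from_subtopology)
    show "?q ` topspace (subtopology ?PG (composable G)) = topspace (subtopology ?PX ?D)"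
      unfolding tc tD
    proof (intro set_eqI iffI)
      fix z assume "z \<in> ?D"
      then obtain x where "x \<in> carr G" "snd z = coset G H x" "fst z \<in> carr G" "src G (fst z) = qrng G (snd z)"
        by (auto elim: cosetsE)
      then show "z \<in> ?q ` composable G"
        by (intro image_eqI[of _ _ "(fst z, x)"]) (auto simp: composable_iff qrng_coset[OF subgrp] prod_eq_iff)
    qed (auto simp: composable_iff coset_cosets qrng_coset[OF subgrp])
  qed
  have "continuous_map (subtopology ?PX ?D) (quot_top G H) (\<lambda>z. qact G (fst z) (snd z))"
  proof (rule continuous_compose_quotient_map[OF q])
    have "continuous_map (subtopology ?PG (composable G)) (quot_top G H) (coset G H \<circ> (\<lambda>(x, y). gmult G x y))"
      using continuous_mult continuous_coset by (rule continuous_map_compose)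
    then show "continuous_map (subtopology ?PG (composable G)) (quot_top G H) ((\<lambda>z. qact G (fst z) (snd z)) \<circ> ?q)"
      by (rule continuous_map_eq) (auto simp: composable_iff qact_coset)
  qed
  note act = this
  have "continuous_map Y (subtopology ?PX ?D) (\<lambda>y. (a y, b y))"
    using a b ab continuous_map_funspace[OF a] continuous_map_funspace[OF b]
    by (auto simp: continuous_map_in_subtopology intro!: continuous_map_pairedI)
  from continuous_map_compose[OF this act] show ?thesis by (simp add: o_def)
qed

end

section \<open>Continuous families of measures on the fibres of a map\<close>

text \<open>
  Both the Haar system, over the range map of \<open>G\<close>, and the measures \<open>\<mu>\<close>, over the map from \<open>G/H\<close> to the units,
  are of this kind.
\<close>

locale fibred_measures = Z: LCH Z for Z :: "'a topology" +
  fixes B :: "'b topology" and p :: "'a \<Rightarrow> 'b" and M :: "'b \<Rightarrow> 'a measure"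
  assumes base_Hausdorff: "Hausdorff_space B"
    and proj: "continuous_map Z B p"
    and countable_base: "second_countable Z"
    and radon: "u \<in> topspace B \<Longrightarrow> radon_measure Z (M u)"
    and supp: "u \<in> topspace B \<Longrightarrow> measure_support Z (M u) = {x \<in> topspace Z. p x = u}"
    and cont_complex: "f \<in> Cc Z \<Longrightarrow> continuous_map B euclidean (\<lambda>u. (LINT x|M u. f x) :: complex)"
begin

definition fib :: "'b \<Rightarrow> 'a set" where "fib u = {x \<in> topspace Z. p x = u}"

lemma fib_closed: "u \<in> topspace B \<Longrightarrow> closedin Z (fib u)"
  unfolding fib_def
  using closedin_continuous_map_preimage[OF proj, of "{u}"] base_Hausdorff
  by (simp add: closedin_Hausdorff_singleton)

lemma fib_sets: "u \<in> topspace B \<Longrightarrow> fib u \<in> sets (M u)"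
  using closedin_sets_borel_of[OF fib_closed] radon_sets[OF radon] by blast

lemma AE_fib: "u \<in> topspace B \<Longrightarrow> AE x in M u. x \<in> fib u"
  using AE_measure_support[OF radon] supp unfolding fib_def by metis

lemma sigma_finite: "u \<in> topspace B \<Longrightarrow> sigma_finite_measure (M u)"
  using radon_sigma_finite[OF radon countable_base Z.lc Z.Haus] .

lemma integrable_Cc:
  fixes f :: "'a \<Rightarrow> 'c::{banach, second_countable_topology}"
  shows "u \<in> topspace B \<Longrightarrow> f \<in> Cc Z \<Longrightarrow> integrable (M u) f"
  by (rule radon_Cc_integrable[OF radon Z.Haus])

lemma cont_real:
  assumes "f \<in> Cc Z" shows "continuous_map B euclidean (\<lambda>u. (LINT x|M u. f x) :: real)"
proof -
  have "continuous_map B euclidean (\<lambda>u. Re (LINT x|M u. complex_of_real (f x)))"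
    by (rule continuous_map_compose_euclidean[OF cont_complex[OF Cc_of_real[OF Z.Haus assms]]])
       (auto intro!: continuous_intros)
  then show ?thesis by simp
qed

lemma integral_off_support:
  fixes f :: "'a \<Rightarrow> 'c::{banach, second_countable_topology}"
  assumes "u \<in> topspace B" "\<And>x. x \<in> fib u \<Longrightarrow> f x = 0"
  shows "(LINT x|M u. f x) = 0"
proof (rule integral_eq_zero_AE)
  show "AE x in M u. f x = 0" using AE_fib[OF assms(1)] by eventually_elim (rule assms(2))
qed

lemma integral_Cc:
  fixes f :: "'a \<Rightarrow> 'c::{banach, second_countable_topology}"
  assumes f: "f \<in> Cc Z" and c: "continuous_map B euclidean (\<lambda>u. LINT x|M u. f x)"
  shows "(\<lambda>u. if u \<in> topspace B then LINT x|M u. f x else 0) \<in> Cc B"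
proof -
  obtain K where K: "compactin Z K" "\<And>x. x \<notin> K \<Longrightarrow> f x = 0"
    using f unfolding Cc_iff[OF Z.Haus] by metis
  have "compactin B (p ` K)" using K(1) proj by (rule image_compactin)
  moreover have "(LINT x|M u. f x) = 0" if "u \<in> topspace B" "u \<notin> p ` K" for u
  proof (rule integral_off_support[OF that(1)])
    fix x assume "x \<in> fib u"
    then have "x \<notin> K" using that(2) by (auto simp: fib_def)
    then show "f x = 0" by (rule K(2))
  qed
  moreover have "continuous_map B euclidean (\<lambda>u. if u \<in> topspace B then LINT x|M u. f x else 0)"
    by (rule continuous_map_eq[OF c]) simp
  ultimately show ?thesis unfolding Cc_iff[OF base_Hausdorff] by auto
qed

lemma integral_Cc_real: "f \<in> Cc Z \<Longrightarrow> (\<lambda>u. if u \<in> topspace B then (LINT x|M u. f x) :: real else 0) \<in> Cc B"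
  by (rule integral_Cc[OF _ cont_real])

lemma integral_norm_bounded:
  fixes f :: "'a \<Rightarrow> 'c::{banach, second_countable_topology}"
  assumes "f \<in> Cc Z"
  obtains C where "C > 0" "\<And>u. u \<in> topspace B \<Longrightarrow> (LINT x|M u. norm (f x)) \<le> C"
proof -
  have n: "(\<lambda>x. norm (f x)) \<in> Cc Z" by (rule Cc_norm[OF Z.Haus assms])
  obtain C where C: "C > 0" "\<And>u. norm (if u \<in> topspace B then (LINT x|M u. norm (f x)) else 0) \<le> C"
    using Cc_bounded[OF base_Hausdorff integral_Cc_real[OF n]] by metis
  show ?thesis
  proof (rule that[OF C(1)])
    fix u assume "u \<in> topspace B"
    then show "(LINT x|M u. norm (f x)) \<le> C" using C(2)[of u] by simp
  qed
qed

text \<open>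
  Integrands built from the groupoid operations are meaningful on a single fibre only. Extending them to
  members of \<open>C\<^sub>c\<close> gives access to all facts about such functions.
\<close>

lemma fibre_extension:
  fixes h :: "'a \<Rightarrow> complex"
  assumes u: "u \<in> topspace B" and h: "continuous_map (subtopology Z (fib u)) euclidean h"
    and K: "compactin Z K" "\<And>x. x \<in> fib u \<Longrightarrow> x \<notin> K \<Longrightarrow> h x = 0"
  obtains g where "g \<in> Cc Z" "\<And>x. x \<in> fib u \<Longrightarrow> g x = h x"
  using Z.Cc_Tietze[OF fib_closed[OF u] h K(1) openin_topspace compactin_subset_topspace[OF K(1)] K(2)] by metis

lemma fibre_integral_eq:
  fixes h g :: "'a \<Rightarrow> 'c::{banach, second_countable_topology}"
  assumes u: "u \<in> topspace B" and g: "g \<in> Cc Z" "\<And>x. x \<in> fib u \<Longrightarrow> g x = h x"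
  shows "(LINT x:fib u|M u. h x) = (LINT x|M u. g x)" "set_integrable (M u) (fib u) h"
proof -
  have eq: "(\<lambda>x. indicator (fib u) x *\<^sub>R h x) = (\<lambda>x. indicator (fib u) x *\<^sub>R g x)"
    using g(2) by (auto simp: indicator_def fun_eq_iff)
  have gm: "g \<in> borel_measurable (M u)" using integrable_Cc[OF u g(1)] by auto
  have i: "integrable (M u) (\<lambda>x. indicator (fib u) x *\<^sub>R g x)"
    using integrable_Cc[OF u g(1)] fib_sets[OF u] by (rule integrable_mult_indicator[rotated])
  then show "set_integrable (M u) (fib u) h" by (simp add: set_integrable_def eq)
  have "(LINT x|M u. indicator (fib u) x *\<^sub>R g x) = (LINT x|M u. g x)"
  proof (rule integral_cong_AE)
    show "AE x in M u. indicator (fib u) x *\<^sub>R g x = g x"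
      using AE_fib[OF u] by eventually_elim simp
  qed (use i gm in auto)
  then show "(LINT x:fib u|M u. h x) = (LINT x|M u. g x)" by (simp add: set_lebesgue_integral_def eq)
qed

text \<open>
  Freeze the parameter at \<open>y0\<close> and extend \<open>F(y0, -)\<close> to \<open>h \<in> C\<^sub>c\<close>. The integral of \<open>h\<close> over the fibre of \<open>y\<close> is
  continuous in \<open>y\<close> by assumption, and the tube lemma shows that \<open>F(y, -)\<close> is uniformly close to \<open>h\<close> on the
  fibre of \<open>y\<close> when \<open>y\<close> is near \<open>y0\<close>. A bump function \<open>\<kappa>\<close>, equal to \<open>1\<close> on a compact set off which both vanish,
  turns the uniform bound into a bound for integrals.
\<close>

lemma continuous_parametric_integral:
  fixes F :: "'y \<times> 'a \<Rightarrow> complex"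
  assumes s: "continuous_map Y B s"
    and F: "continuous_map (subtopology (prod_topology Y Z) {(y, z). y \<in> topspace Y \<and> z \<in> fib (s y)}) euclidean F"
    and K: "compactin Z K" "\<And>y z. y \<in> topspace Y \<Longrightarrow> z \<in> fib (s y) \<Longrightarrow> z \<notin> K \<Longrightarrow> F (y, z) = 0"
  shows "continuous_map Y euclidean (\<lambda>y. LINT z:fib (s y)|M (s y). F (y, z))"
  unfolding continuous_map_euclidean_iff_tendsto
proof
  fix y0 assume y0: "y0 \<in> topspace Y"
  let ?D = "{(y, z). y \<in> topspace Y \<and> z \<in> fib (s y)}"
  let ?P = "prod_topology Y Z"
  let ?I = "\<lambda>y. LINT z:fib (s y)|M (s y). F (y, z)"
  have sB: "s y \<in> topspace B" if "y \<in> topspace Y" for y using s that continuous_map_funspace by blast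
  have slice: "continuous_map (subtopology Z (fib (s y))) euclidean (\<lambda>z. F (y, z))" if y: "y \<in> topspace Y" for y
  proof -
    have "continuous_map (subtopology Z (fib (s y))) (subtopology ?P ?D) (\<lambda>z. (y, z))"
      using y by (auto simp: continuous_map_in_subtopology intro!: continuous_map_pairedI)
    from continuous_map_compose[OF this F] show ?thesis by (simp add: o_def)
  qed
  have ext: "\<exists>g. g \<in> Cc Z \<and> (\<forall>z\<in>fib (s y). g z = F (y, z))" if y: "y \<in> topspace Y" for y
    using fibre_extension[OF sB[OF y] slice[OF y] K(1)] K(2)[OF y] by metis
  obtain h where h: "h \<in> Cc Z" "\<And>z. z \<in> fib (s y0) \<Longrightarrow> h z = F (y0, z)" using ext[OF y0] by blast
  obtain Kh where Kh: "compactin Z Kh" "\<And>z. z \<notin> Kh \<Longrightarrow> h z = 0" using h(1) unfolding Cc_iff[OF Z.Haus] by metis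
  define L where "L = K \<union> Kh"
  have L: "compactin Z L" unfolding L_def using K(1) Kh(1) by (rule compactin_Un)
  obtain \<kappa> :: "'a \<Rightarrow> real" where \<kappa>: "\<kappa> \<in> Cc Z" "\<And>z. 0 \<le> \<kappa> z" "\<And>z. z \<in> L \<Longrightarrow> \<kappa> z = 1"
    using Z.Cc_Urysohn[OF L openin_topspace compactin_subset_topspace[OF L]] by metis
  obtain C where C: "C > 0" "\<And>u. u \<in> topspace B \<Longrightarrow> (LINT x|M u. norm (\<kappa> x)) \<le> C"
    using integral_norm_bounded[OF \<kappa>(1)] by metis
  have I0: "?I y0 = (LINT z|M (s y0). h z)" by (rule fibre_integral_eq[OF sB[OF y0] h])
  have hlim: "((\<lambda>y. LINT z|M (s y). h z) \<longlongrightarrow> (LINT z|M (s y0). h z)) (atin Y y0)"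
    using continuous_map_compose[OF s cont_complex[OF h(1)]] y0
    by (simp add: o_def continuous_map_euclidean_iff_tendsto)
  show "(?I \<longlongrightarrow> ?I y0) (atin Y y0)"
    unfolding I0
  proof (rule tendstoI)
    fix e :: real assume e: "e > 0"
    define d where "d = e / (2 * C)"
    have d: "d > 0" using e C(1) by (simp add: d_def)
    let ?E = "\<lambda>q. F q - h (snd q)"
    have Ec: "continuous_map (subtopology ?P ?D) euclidean ?E"
    proof (rule continuous_map_euclidean_diff[OF F])
      have "continuous_map ?P euclidean (\<lambda>q. h (snd q))"
        using continuous_map_compose[OF continuous_map_snd Cc_continuous[OF h(1)]] by (simp add: o_def)
      then show "continuous_map (subtopology ?P ?D) euclidean (\<lambda>q. h (snd q))"
        by (rule continuous_map_from_subtopology)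
    qed
    have "openin (subtopology ?P ?D) {q \<in> topspace (subtopology ?P ?D). ?E q \<in> ball 0 d}"
      using Ec by (rule openin_continuous_map_preimage) auto
    then obtain W where W: "openin ?P W" "{q \<in> topspace (subtopology ?P ?D). ?E q \<in> ball 0 d} = W \<inter> ?D"
      unfolding openin_subtopology by blast
    have "closedin ?P {q \<in> topspace ?P. s (fst q) = p (snd q)}"
      using continuous_map_compose[OF continuous_map_fst s] continuous_map_compose[OF continuous_map_snd proj]
      by (intro closedin_continuous_maps_eq[OF base_Hausdorff]) (simp_all add: o_def)
    moreover have "{q \<in> topspace ?P. s (fst q) = p (snd q)} = ?D" by (auto simp: fib_def)
    ultimately have Dcl: "closedin ?P ?D" by simp
    \<comment> \<open>The estimate is only required on the closed set \<open>?D\<close>; adding its complement gives a set that is open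
        in the whole product, as the tube lemma needs.\<close>
    define W' where "W' = W \<union> (topspace ?P - ?D)"
    have W': "openin ?P W'" unfolding W'_def by (intro openin_Un W(1) openin_diff Dcl openin_topspace)
    have "{y0} \<times> L \<subseteq> W'"
    proof
      fix q assume "q \<in> {y0} \<times> L"
      then obtain z where q: "q = (y0, z)" "z \<in> L" by auto
      have z: "z \<in> topspace Z" using q(2) compactin_subset_topspace[OF L] by auto
      show "q \<in> W'"
      proof (cases "z \<in> fib (s y0)")
        case True
        then have "q \<in> {q \<in> topspace (subtopology ?P ?D). ?E q \<in> ball 0 d}"
          using q y0 z h(2)[OF True] d by simp
        then show ?thesis unfolding W(2) W'_def by blast
      next
        case False
        then show ?thesis using q y0 z by (simp add: W'_def)
      qed
    qed
    then obtain V V' where V: "openin Y V" "y0 \<in> V" "L \<subseteq> V'" "V \<times> V' \<subseteq> W'"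
      using tube_lemma_right[OF W' L y0] by metis
    have close: "dist (?I y) (LINT z|M (s y). h z) \<le> d * C" if yV: "y \<in> V" for y
    proof -
      have y: "y \<in> topspace Y" using yV V(1) openin_subset by blast
      obtain g where g: "g \<in> Cc Z" "\<And>z. z \<in> fib (s y) \<Longrightarrow> g z = F (y, z)" using ext[OF y] by blast
      have le: "norm (g z - h z) \<le> d * norm (\<kappa> z)" if z: "z \<in> fib (s y)" for z
      proof (cases "z \<in> L")
        case True
        have "(y, z) \<in> W'" using V yV True by auto
        then have "(y, z) \<in> W \<inter> ?D" using z y by (auto simp: W'_def)
        then have "norm (F (y, z) - h z) < d" unfolding W(2)[symmetric] by simp
        then show ?thesis using g(2)[OF z] \<kappa>(3)[OF True] by simp
      next
        case False
        then have "F (y, z) = 0" "h z = 0" using K(2)[OF y z] Kh(2) by (auto simp: L_def)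
        then show ?thesis using g(2)[OF z] d by simp
      qed
      have "?I y - (LINT z|M (s y). h z) = (LINT z|M (s y). g z - h z)"
        using fibre_integral_eq(1)[OF sB[OF y] g] integrable_Cc[OF sB[OF y] g(1)] integrable_Cc[OF sB[OF y] h(1)]
        by simp
      then have "dist (?I y) (LINT z|M (s y). h z) = norm (LINT z|M (s y). g z - h z)" by (simp add: dist_norm)
      also have "\<dots> \<le> (LINT z|M (s y). norm (g z - h z))" by (rule integral_norm_bound)
      also have "\<dots> \<le> (LINT z|M (s y). d * norm (\<kappa> z))"
      proof (rule integral_mono_AE)
        show "AE z in M (s y). norm (g z - h z) \<le> d * norm (\<kappa> z)"
          using AE_fib[OF sB[OF y]] by eventually_elim (rule le)
        show "integrable (M (s y)) (\<lambda>z. norm (g z - h z))"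
          by (intro integrable_Cc[OF sB[OF y]] Cc_norm Cc_diff Z.Haus g h)
        show "integrable (M (s y)) (\<lambda>z. d * norm (\<kappa> z))"
          by (intro integrable_Cc[OF sB[OF y]] Cc_scale Cc_norm Z.Haus \<kappa>)
      qed
      also have "\<dots> \<le> d * C" using C(2)[OF sB[OF y]] d by simp
      finally show ?thesis .
    qed
    have dC: "d * C = e / 2" using C(1) by (simp add: d_def)
    have "eventually (\<lambda>y. dist (LINT z|M (s y). h z) (LINT z|M (s y0). h z) < e / 2) (atin Y y0)"
      using hlim e by (intro tendstoD) auto
    moreover have "eventually (\<lambda>y. y \<in> V) (atin Y y0)"
      using V(1,2) y0 by (auto simp: eventually_atin)
    ultimately show "eventually (\<lambda>y. dist (?I y) (LINT z|M (s y0). h z) < e) (atin Y y0)"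
    proof eventually_elim
      case (elim y)
      then show ?case using dC close[of y] dist_triangle[of "?I y" "LINT z|M (s y0). h z" "LINT z|M (s y). h z"] by simp
    qed
  qed
qed

end

section \<open>Integration on the groupoid and on the quotient\<close>

context groupoid_quotient
begin

sublocale L: fibred_measures "top_of G" "unit_top G" "rng G" lam
proof
  show "radon_measure (top_of G) (lam u)" "measure_support (top_of G) (lam u) = {x \<in> carr G. rng G x = u}"
    if "u \<in> topspace (unit_top G)" for u
    using haar that unfolding haar_system_def topspace_unit fibre_def by auto
  show "continuous_map (unit_top G) euclidean (\<lambda>u. (LINT x|lam u. f x) :: complex)" if "f \<in> Cc (top_of G)" for f
    using haar that unfolding haar_system_def by auto
qed (rule UX.Haus continuous_rng_unit second_countable_top)+

sublocale Q: fibred_measures "quot_top G H" "unit_top G" "qrng G" mu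
proof
  show "radon_measure (quot_top G H) (mu u)" 
    "measure_support (quot_top G H) (mu u) = {x \<in> topspace (quot_top G H). qrng G x = u}"
    if "u \<in> topspace (unit_top G)" for u
    using meas that unfolding full_equivariant_measure_system_def topspace_unit topspace_quot qfibre_def by auto
  show "continuous_map (unit_top G) euclidean (\<lambda>u. (LINT x|mu u. f x) :: complex)" if "f \<in> Cc (quot_top G H)" for f
    using meas that unfolding full_equivariant_measure_system_def by auto
qed (rule UX.Haus continuous_qrng second_countable_quot)+

lemma L_fib: "L.fib u = fibre G u" by (simp add: L.fib_def fibre_def)

lemma Q_fib: "Q.fib u = qfibre G H u" by (simp add: Q.fib_def qfibre_def)

text \<open>
  The same nine facts, in the same order, for the fibres of \<open>G\<close> and of \<open>G/H\<close>.
\<close>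

lemmas L_rules = L.fib_closed L.fib_sets L.AE_fib L.sigma_finite L.integrable_Cc L.fibre_extension
  L.fibre_integral_eq L.radon
lemmas haar_fib = L_rules[unfolded L_fib topspace_unit]
lemmas Q_rules = Q.fib_closed Q.fib_sets Q.AE_fib Q.sigma_finite Q.integrable_Cc Q.fibre_extension
  Q.fibre_integral_eq Q.radon
lemmas quot_fib = Q_rules[unfolded Q_fib topspace_unit]

lemma act_inv_act:
  "y \<in> carr G \<Longrightarrow> w \<in> cosets G H \<Longrightarrow> src G y = qrng G w \<Longrightarrow> qact G (ginv G y) (qact G y w) = w"
proof (erule cosetsE)
  fix x assume "y \<in> carr G" "src G y = qrng G w" "x \<in> carr G" "w = coset G H x"
  then show ?thesis by (simp add: qrng_coset[OF subgrp] qact_coset groupoid_simps inv_mult_cancel)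
qed

lemma act_act_inv:
  assumes "y \<in> carr G" "w \<in> cosets G H" "rng G y = qrng G w"
  shows "qact G y (qact G (ginv G y) w) = w"
  using act_inv_act[of "ginv G y" w] assms inv_closed[of y] src_inv[of y] inv_inv[of y] by simp

lemma act_inv_qfibre:
  assumes y: "y \<in> carr G" and w: "w \<in> qfibre G H (rng G y)"
  shows "qact G (ginv G y) w \<in> qfibre G H (src G y)"
proof -
  have w: "w \<in> cosets G H" "src G (ginv G y) = qrng G w" using w src_inv[OF y] by (auto simp: qfibre_def)
  show ?thesis
    using qact_cosets[OF inv_closed[OF y] w] qrng_qact[OF inv_closed[OF y] w] rng_inv[OF y] by (simp add: qfibre_def)
qed

lemma continuous_translate:
  assumes "continuous_map (quot_top G H) euclidean \<phi>"
  shows "continuous_map (subtopology (prod_topology (top_of G) (quot_top G H))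
      {(y, w). y \<in> carr G \<and> w \<in> cosets G H \<and> rng G y = qrng G w}) euclidean (\<lambda>q. \<phi> (qact G (ginv G (fst q)) (snd q)))"
proof -
  let ?S = "subtopology (prod_topology (top_of G) (quot_top G H)) {(y, w). y \<in> carr G \<and> w \<in> cosets G H \<and> rng G y = qrng G w}"
  have "continuous_map ?S (quot_top G H) (\<lambda>q. qact G (ginv G (fst q)) (snd q))"
    by (intro continuous_qact continuous_inv' continuous_map_from_subtopology continuous_map_fst continuous_map_snd)
       (auto simp: groupoid_simps)
  from continuous_map_compose[OF this assms] show ?thesis by (simp add: o_def)
qed

lemma compact_action_image:
  assumes K: "compactin (top_of G) K" and C: "compactin (quot_top G H) C"
  shows "compactin (quot_top G H) {qact G y v | y v. y \<in> K \<and> v \<in> C \<and> src G y = qrng G v}"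
proof -
  let ?P = "prod_topology (top_of G) (quot_top G H)"
  let ?D = "{q \<in> topspace ?P. src G (fst q) = qrng G (snd q)}"
  have D: "closedin ?P ?D"
    using continuous_map_compose[OF continuous_map_fst continuous_src_unit] continuous_map_compose[OF continuous_map_snd continuous_qrng]
    by (intro closedin_continuous_maps_eq[OF UX.Haus]) (simp_all add: o_def)
  have "compactin ?P (?D \<inter> (K \<times> C))"
    using K C D by (intro closed_Int_compactin) (simp_all add: compactin_Times)
  then have "compactin (subtopology ?P ?D) (?D \<inter> (K \<times> C))" by (simp add: compactin_subtopology)
  moreover have "continuous_map (subtopology ?P ?D) (quot_top G H) (\<lambda>q. qact G (fst q) (snd q))"
    by (intro continuous_qact continuous_map_from_subtopology continuous_map_fst continuous_map_snd) auto
  ultimately have "compactin (quot_top G H) ((\<lambda>q. qact G (fst q) (snd q)) ` (?D \<inter> (K \<times> C)))"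
    by (rule image_compactin)
  moreover have "(\<lambda>q. qact G (fst q) (snd q)) ` (?D \<inter> (K \<times> C)) = {qact G y v | y v. y \<in> K \<and> v \<in> C \<and> src G y = qrng G v}"
    using compactin_subset_topspace[OF K] compactin_subset_topspace[OF C] by (force simp: image_iff)
  ultimately show ?thesis by simp
qed

text \<open>
  The translate is continuous on the fibre and vanishes there off the compact set \<open>y \<cdot> C\<close>, where \<open>C\<close> contains the
  support of \<open>\<phi>\<close>.
\<close>

lemma translate_extension:
  fixes \<phi> :: "'g set \<Rightarrow> complex"
  assumes y: "y \<in> carr G" and \<phi>: "\<phi> \<in> Cc (quot_top G H)"
  obtains g where "g \<in> Cc (quot_top G H)" "\<And>w. w \<in> qfibre G H (rng G y) \<Longrightarrow> g w = \<phi> (qact G (ginv G y) w)"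
proof -
  obtain C where C: "compactin (quot_top G H) C" "\<And>v. v \<notin> C \<Longrightarrow> \<phi> v = 0"
    using \<phi> unfolding Cc_iff[OF QX.Haus] by metis
  let ?S = "subtopology (quot_top G H) (qfibre G H (rng G y))"
  have "continuous_map ?S (quot_top G H) (\<lambda>w. qact G (ginv G y) w)"
    using y by (intro continuous_qact continuous_map_from_subtopology continuous_map_id[unfolded id_def])
      (auto simp: groupoid_simps qfibre_def)
  from continuous_map_compose[OF this Cc_continuous[OF \<phi>]]
  have c: "continuous_map ?S euclidean (\<lambda>w. \<phi> (qact G (ginv G y) w))" by (simp add: o_def)
  have "compactin (top_of G) {y}" using y by simp
  from compact_action_image[OF this C(1)]
  have K: "compactin (quot_top G H) {qact G y' v | y' v. y' \<in> {y} \<and> v \<in> C \<and> src G y' = qrng G v}" .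
  show ?thesis
  proof (rule quot_fib(6)[OF rng_units[OF y] c K])
    fix w assume w: "w \<in> qfibre G H (rng G y)" "w \<notin> {qact G y' v | y' v. y' \<in> {y} \<and> v \<in> C \<and> src G y' = qrng G v}"
    let ?v = "qact G (ginv G y) w"
    have v: "qact G y ?v = w" "qrng G ?v = src G y"
      using w(1) y act_act_inv[of y w] act_inv_qfibre[OF y w(1)] by (auto simp: qfibre_def)
    have "?v \<notin> C"
    proof
      assume "?v \<in> C"
      then show False using w(2) v by (metis (mono_tags, lifting) mem_Collect_eq singletonI)
    qed
    then show "\<phi> ?v = 0" by (rule C(2))
  qed (rule that)
qed

text \<open>
  Equivariance of \<open>\<mu>\<close> for the inverse of \<open>y\<close>, applied to \<open>|\<phi>|\<close>. The left side is a nonnegative integral because this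
  is the form in which it occurs after an exchange of integrals.
\<close>

lemma translate_nn_integral:
  fixes \<phi> :: "'g set \<Rightarrow> complex"
  assumes y: "y \<in> carr G" and \<phi>: "\<phi> \<in> Cc (quot_top G H)"
  shows "(\<integral>\<^sup>+w. indicator (qfibre G H (rng G y)) w * ennreal (norm (\<phi> (qact G (ginv G y) w))) \<partial>mu (rng G y))
    = ennreal (LINT w|mu (src G y). norm (\<phi> w))"
proof -
  let ?u = "rng G y" and ?S = "qfibre G H (rng G y)"
  let ?n = "\<lambda>w. complex_of_real (norm (\<phi> w))"
  have n: "?n \<in> Cc (quot_top G H)" by (intro Cc_of_real Cc_norm QX.Haus \<phi>)
  obtain g where g: "g \<in> Cc (quot_top G H)" "\<And>w. w \<in> ?S \<Longrightarrow> g w = ?n (qact G (ginv G y) w)"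
    using translate_extension[OF y n] by metis
  have i: "integrable (mu ?u) (\<lambda>w. indicator ?S w *\<^sub>R ?n (qact G (ginv G y) w))"
    using quot_fib(8)[OF rng_units[OF y] g] by (simp add: set_integrable_def)
  have "\<forall>g\<in>carr G. \<forall>f \<in> Cc (quot_top G H).
     (LINT w:qfibre G H (src G g)|mu (src G g). f (qact G g w)) = ((LINT w|mu (rng G g). f w) :: complex)"
    using meas unfolding full_equivariant_measure_system_def by (elim conjE)
  from bspec[OF bspec[OF this inv_closed[OF y]] n]
  have "(LINT w:qfibre G H (src G (ginv G y))|mu (src G (ginv G y)). ?n (qact G (ginv G y) w)) = (LINT w|mu (rng G (ginv G y)). ?n w)" .
  then have "(LINT w|mu ?u. indicator ?S w *\<^sub>R ?n (qact G (ginv G y) w)) = (LINT w|mu (src G y). ?n w)"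
    using y by (simp add: groupoid_simps set_lebesgue_integral_def)
  then have "(LINT w|mu ?u. complex_of_real (indicator ?S w * norm (\<phi> (qact G (ginv G y) w)))) = (LINT w|mu (src G y). ?n w)"
    by (simp add: scaleR_conv_of_real)
  then have eq: "(LINT w|mu ?u. indicator ?S w * norm (\<phi> (qact G (ginv G y) w))) = (LINT w|mu (src G y). norm (\<phi> w))"
    unfolding integral_complex_of_real by (simp only: of_real_eq_iff)
  have i2: "integrable (mu ?u) (\<lambda>w. indicator ?S w * norm (\<phi> (qact G (ginv G y) w)))"
    using integrable_norm[OF i] by (simp add: norm_mult)
  have "(\<integral>\<^sup>+w. indicator ?S w * ennreal (norm (\<phi> (qact G (ginv G y) w))) \<partial>mu ?u)
      = (\<integral>\<^sup>+w. ennreal (indicator ?S w * norm (\<phi> (qact G (ginv G y) w))) \<partial>mu ?u)"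
    by (intro nn_integral_cong) (auto simp: indicator_def)
  also have "\<dots> = ennreal (LINT w|mu ?u. indicator ?S w * norm (\<phi> (qact G (ginv G y) w)))"
    by (intro nn_integral_eq_integral i2) auto
  finally show ?thesis unfolding eq .
qed

lemma kernel_extension:
  fixes f :: "'g \<Rightarrow> complex" and \<phi> :: "'g set \<Rightarrow> complex"
  assumes f: "f \<in> Cc (top_of G)" and \<phi>: "continuous_map (quot_top G H) euclidean \<phi>" and w: "w \<in> cosets G H"
  obtains g where "g \<in> Cc (top_of G)" "\<And>y. y \<in> fibre G (qrng G w) \<Longrightarrow> g y = f y * \<phi> (qact G (ginv G y) w)"
proof -
  let ?S = "subtopology (top_of G) (fibre G (qrng G w))"
  obtain K where K: "compactin (top_of G) K" "\<And>y. y \<notin> K \<Longrightarrow> f y = 0"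
    using f unfolding Cc_iff[OF GX.Haus] by metis
  have "continuous_map ?S (quot_top G H) (\<lambda>y. qact G (ginv G y) w)"
    using w by (intro continuous_qact continuous_inv' continuous_map_from_subtopology continuous_map_id[unfolded id_def])
      (auto simp: groupoid_simps fibre_def)
  from continuous_map_compose[OF this \<phi>]
  have "continuous_map ?S euclidean (\<lambda>y. \<phi> (qact G (ginv G y) w))" by (simp add: o_def)
  then have c: "continuous_map ?S euclidean (\<lambda>y. f y * \<phi> (qact G (ginv G y) w))"
    by (rule continuous_map_euclidean_mult[OF continuous_map_from_subtopology[OF Cc_continuous[OF f]]])
  show ?thesis
    using haar_fib(6)[OF qrng_units[OF w] c K(1)] K(2) that by (metis mult_zero_left)
qed

lemma kernel_integrable:
  fixes f :: "'g \<Rightarrow> complex" and \<phi> :: "'g set \<Rightarrow> complex"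
  assumes f: "f \<in> Cc (top_of G)" and \<phi>: "continuous_map (quot_top G H) euclidean \<phi>" and w: "w \<in> cosets G H"
  shows "set_integrable (lam (qrng G w)) (fibre G (qrng G w)) (\<lambda>y. f y * \<phi> (qact G (ginv G y) w))"
proof -
  obtain g where "g \<in> Cc (top_of G)" "\<And>y. y \<in> fibre G (qrng G w) \<Longrightarrow> g y = f y * \<phi> (qact G (ginv G y) w)"
    using kernel_extension[OF f \<phi> w] by metis
  then show ?thesis by (rule haar_fib(8)[OF qrng_units[OF w]])
qed

text \<open>
  Continuity is an instance of the continuity of parametric integrals, and \<open>L(f)\<phi>\<close> vanishes off the compact set of all
  \<open>y \<cdot> v\<close> with \<open>y\<close> in the support of \<open>f\<close> and \<open>v\<close> in that of \<open>\<phi>\<close>.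
\<close>

lemma L_op_Cc:
  assumes f: "f \<in> Cc (top_of G)" and \<phi>: "\<phi> \<in> Cc (quot_top G H)"
  shows "L_op G lam H f \<phi> \<in> Cc (quot_top G H)"
proof -
  obtain K where K: "compactin (top_of G) K" "\<And>y. y \<notin> K \<Longrightarrow> f y = 0"
    using f unfolding Cc_iff[OF GX.Haus] by metis
  obtain C where C: "compactin (quot_top G H) C" "\<And>v. v \<notin> C \<Longrightarrow> \<phi> v = 0"
    using \<phi> unfolding Cc_iff[OF QX.Haus] by metis
  let ?F = "\<lambda>q. f (snd q) * \<phi> (qact G (ginv G (snd q)) (fst q))"
  let ?D = "{(w, y). w \<in> topspace (quot_top G H) \<and> y \<in> L.fib (qrng G w)}"
  let ?S = "subtopology (prod_topology (quot_top G H) (top_of G)) ?D"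
  have "continuous_map ?S (quot_top G H) (\<lambda>q. qact G (ginv G (snd q)) (fst q))"
    by (intro continuous_qact continuous_inv' continuous_map_from_subtopology continuous_map_fst continuous_map_snd)
       (auto simp: groupoid_simps L.fib_def)
  from continuous_map_compose[OF this Cc_continuous[OF \<phi>]]
  have 1: "continuous_map ?S euclidean (\<lambda>q. \<phi> (qact G (ginv G (snd q)) (fst q)))" by (simp add: o_def)
  have "continuous_map (prod_topology (quot_top G H) (top_of G)) euclidean (\<lambda>q. f (snd q))"
    using continuous_map_compose[OF continuous_map_snd Cc_continuous[OF f]] by (simp add: o_def)
  then have "continuous_map ?S euclidean ?F"
    by (intro continuous_map_euclidean_mult 1 continuous_map_from_subtopology)
  from L.continuous_parametric_integral[OF continuous_qrng this K(1)]
  have "continuous_map (quot_top G H) euclidean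
      (\<lambda>w. LINT y:fibre G (qrng G w)|lam (qrng G w). f y * \<phi> (qact G (ginv G y) w))"
    using K(2) by (simp add: L_fib)
  then have c: "continuous_map (quot_top G H) euclidean (L_op G lam H f \<phi>)"
    by (rule continuous_map_eq) (simp add: L_op_def)
  have "L_op G lam H f \<phi> w = 0" if w: "w \<notin> {qact G y v | y v. y \<in> K \<and> v \<in> C \<and> src G y = qrng G v}" for w
  proof (cases "w \<in> cosets G H")
    case True
    have "f y * \<phi> (qact G (ginv G y) w) = 0" if y: "y \<in> fibre G (qrng G w)" for y
    proof (rule ccontr)
      let ?v = "qact G (ginv G y) w"
      have yc: "y \<in> carr G" "rng G y = qrng G w" using y by (auto simp: fibre_def)
      then have "w \<in> qfibre G H (rng G y)" using True by (simp add: qfibre_def)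
      from act_inv_qfibre[OF yc(1) this] have "qrng G ?v = src G y" by (simp add: qfibre_def)
      moreover have "qact G y ?v = w" using act_act_inv[OF yc(1) True yc(2)] .
      moreover assume "f y * \<phi> ?v \<noteq> 0"
      then have "y \<in> K" "?v \<in> C" using K(2) C(2) by (metis mult_zero_left, metis mult_zero_right)
      ultimately have "w \<in> {qact G y v | y v. y \<in> K \<and> v \<in> C \<and> src G y = qrng G v}"
        by (metis (mono_tags, lifting) mem_Collect_eq)
      then show False using w by simp
    qed
    then have "(\<lambda>y. indicator (fibre G (qrng G w)) y *\<^sub>R (f y * \<phi> (qact G (ginv G y) w))) = (\<lambda>y. 0)"
      by (auto simp: fun_eq_iff indicator_def)
    then show ?thesis using True by (simp add: L_op_def set_lebesgue_integral_def)
  qed (simp add: L_op_def)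
  then show ?thesis
    unfolding Cc_iff[OF QX.Haus] by (intro conjI exI[of _ "{qact G y v | y v. y \<in> K \<and> v \<in> C \<and> src G y = qrng G v}"]
      c compact_action_image[OF K(1) C(1)] allI impI)
qed

text \<open>
  Take absolute values inside the integral and exchange the order of integration. The kernel \<open>b\<close> is left general
  because it will be both a translate of a function and the difference between a function and its translate.
\<close>

lemma kernel_estimate:
  fixes a :: "'g \<Rightarrow> complex" and b :: "'g \<times> 'g set \<Rightarrow> complex" and \<psi> :: "'g set \<Rightarrow> complex"
  assumes u: "u \<in> units G" and a: "a \<in> Cc (top_of G)"
    and b: "continuous_map (subtopology (prod_topology (top_of G) (quot_top G H)) (fibre G u \<times> qfibre G H u)) euclidean b"
    and c: "0 \<le> c" "\<And>y. y \<in> fibre G u \<Longrightarrow> a y \<noteq> 0 \<Longrightarrow>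
        (\<integral>\<^sup>+w. indicator (qfibre G H u) w * ennreal (norm (b (y, w))) \<partial>mu u) \<le> ennreal c"
    and \<psi>: "\<psi> \<in> Cc (quot_top G H)" "\<And>w. w \<in> qfibre G H u \<Longrightarrow> \<psi> w = (LINT y:fibre G u|lam u. a y * b (y, w))"
  shows "(LINT w|mu u. norm (\<psi> w)) \<le> c * (LINT y|lam u. norm (a y))"
proof -
  let ?D = "fibre G u \<times> qfibre G H u"
  let ?P = "prod_topology (top_of G) (quot_top G H)"
  \<comment> \<open>\<open>b\<close> is known only on the product of the two fibres, so the integrand is extended by zero.\<close>
  define F where "F = (\<lambda>q. if q \<in> ?D then a (fst q) * b q else 0)"
  have D: "closedin ?P ?D"
    using haar_fib(1)[OF u] quot_fib(1)[OF u] by (simp add: closedin_prod_Times_iff)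
  have "continuous_map ?P euclidean (\<lambda>q. a (fst q))"
    using continuous_map_compose[OF continuous_map_fst Cc_continuous[OF a]] by (simp add: o_def)
  then have "continuous_map (subtopology ?P ?D) euclidean (\<lambda>q. a (fst q) * b q)"
    by (intro continuous_map_euclidean_mult b continuous_map_from_subtopology)
  from borel_measurable_prod_closed[OF second_countable_top second_countable_quot D this]
  have "F \<in> borel_measurable (borel_of (top_of G) \<Otimes>\<^sub>M borel_of (quot_top G H))" by (simp add: F_def)
  also have "borel_measurable (borel_of (top_of G) \<Otimes>\<^sub>M borel_of (quot_top G H)) = borel_measurable (lam u \<Otimes>\<^sub>M mu u)"
    using radon_sets[OF haar_fib(9)[OF u]] radon_sets[OF quot_fib(9)[OF u]]
    by (intro measurable_cong_sets sets_pair_measure_cong refl) auto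
  finally have F: "F \<in> borel_measurable (lam u \<Otimes>\<^sub>M mu u)" .
  interpret l: sigma_finite_measure "lam u" by (rule haar_fib(4)[OF u])
  interpret m: sigma_finite_measure "mu u" by (rule quot_fib(4)[OF u])
  interpret pair_sigma_finite "lam u" "mu u" ..
  have \<psi>i: "integrable (mu u) (\<lambda>w. norm (\<psi> w))"
    by (intro quot_fib(5)[OF u] Cc_norm QX.Haus \<psi>(1))
  have ai: "integrable (lam u) (\<lambda>y. norm (a y))"
    by (intro haar_fib(5)[OF u] Cc_norm GX.Haus a)
  have "ennreal (LINT w|mu u. norm (\<psi> w)) = (\<integral>\<^sup>+w. ennreal (norm (\<psi> w)) \<partial>mu u)"
    by (rule nn_integral_eq_integral[symmetric, OF \<psi>i]) auto
  also have "\<dots> \<le> (\<integral>\<^sup>+w. (\<integral>\<^sup>+y. ennreal (norm (F (y, w))) \<partial>lam u) \<partial>mu u)"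
  proof (rule nn_integral_mono_AE)
    show "AE w in mu u. ennreal (norm (\<psi> w)) \<le> (\<integral>\<^sup>+y. ennreal (norm (F (y, w))) \<partial>lam u)"
      using quot_fib(3)[OF u]
    proof eventually_elim
      case (elim w)
      have eq: "(\<lambda>y. indicator (fibre G u) y *\<^sub>R (a y * b (y, w))) = (\<lambda>y. F (y, w))"
        using elim by (auto simp: F_def fun_eq_iff indicator_def)
      have "\<psi> w = (LINT y|lam u. F (y, w))"
        using \<psi>(2)[OF elim] by (simp add: set_lebesgue_integral_def eq)
      then show ?case
        using integral_norm_bound_ennreal[of "lam u" "\<lambda>y. F (y, w)"]
        by (cases "integrable (lam u) (\<lambda>y. F (y, w))") (auto simp: not_integrable_integral_eq)
    qed
  qed
  also have "\<dots> = (\<integral>\<^sup>+y. (\<integral>\<^sup>+w. ennreal (norm (F (y, w))) \<partial>mu u) \<partial>lam u)"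
    by (rule Fubini') (use F in measurable)
  also have "\<dots> \<le> (\<integral>\<^sup>+y. ennreal c * ennreal (norm (a y)) \<partial>lam u)"
  proof (rule nn_integral_mono_AE)
    show "AE y in lam u. (\<integral>\<^sup>+w. ennreal (norm (F (y, w))) \<partial>mu u) \<le> ennreal c * ennreal (norm (a y))"
      using haar_fib(3)[OF u]
    proof eventually_elim
      case (elim y)
      show ?case
      proof (cases "a y = 0")
        case True
        then have "norm (F (y, w)) = 0" for w by (simp add: F_def)
        then show ?thesis by simp
      next
        case False
        have eq: "ennreal (norm (F (y, w))) = ennreal (norm (a y)) * (indicator (qfibre G H u) w * ennreal (norm (b (y, w))))" for w
          using elim by (auto simp: F_def indicator_def norm_mult ennreal_mult)
        \<comment> \<open>Slices of the jointly measurable \<open>F\<close> are measurable; dividing by \<open>|a y|\<close> recovers those of \<open>b\<close>.\<close>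
        have m: "(\<lambda>w. indicator (qfibre G H u) w * ennreal (norm (b (y, w)))) \<in> borel_measurable (mu u)"
        proof -
          have "(\<lambda>w. F (y, w)) \<in> borel_measurable (mu u)"
            by (rule measurable_Pair2[OF F]) (use elim in \<open>simp add: radon_space[OF haar_fib(9)[OF u]] fibre_def\<close>)
          then have 1: "(\<lambda>w. ennreal (norm (F (y, w)) / norm (a y))) \<in> borel_measurable (mu u)" by simp
          have 2: "ennreal (norm (F (y, w)) / norm (a y)) = indicator (qfibre G H u) w * ennreal (norm (b (y, w)))" for w
            using elim False by (cases "w \<in> qfibre G H u") (simp_all add: F_def norm_mult)
          show ?thesis using 1 unfolding 2 .
        qed
        have "(\<integral>\<^sup>+w. ennreal (norm (F (y, w))) \<partial>mu u) = ennreal (norm (a y)) * (\<integral>\<^sup>+w. indicator (qfibre G H u) w * ennreal (norm (b (y, w))) \<partial>mu u)"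
          unfolding eq using m by (rule nn_integral_cmult)
        also have "\<dots> \<le> ennreal (norm (a y)) * ennreal c"
          using c(2)[OF elim False] by (rule mult_left_mono) simp
        finally show ?thesis by (simp add: mult.commute)
      qed
    qed
  qed
  also have "\<dots> = ennreal c * (\<integral>\<^sup>+y. ennreal (norm (a y)) \<partial>lam u)"
    using ai by (intro nn_integral_cmult) auto
  also have "(\<integral>\<^sup>+y. ennreal (norm (a y)) \<partial>lam u) = ennreal (LINT y|lam u. norm (a y))"
    by (rule nn_integral_eq_integral[OF ai]) auto
  also have "ennreal c * ennreal (LINT y|lam u. norm (a y)) = ennreal (c * (LINT y|lam u. norm (a y)))"
    using c(1) by (simp add: ennreal_mult)
  finally show ?thesis using c(1) by (subst (asm) ennreal_le_iff) (auto intro!: mult_nonneg_nonneg)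
qed

end

section \<open>Bounded functionals\<close>

text \<open>
  Suprema over the units behave as expected only if there are units. The empty groupoid is treated
  separately.
\<close>

locale inhabited_groupoid_quotient = groupoid_quotient +
  assumes units_nonempty: "units G \<noteq> {}"
begin

lemma mu_norm_upper:
  assumes "\<phi> \<in> Cc (quot_top G H)" "u \<in> units G"
  shows "(LINT w|mu u. cmod (\<phi> w)) \<le> mu_norm G mu \<phi>"
proof -
  obtain C where C: "C > 0" "\<And>u. u \<in> topspace (unit_top G) \<Longrightarrow> (LINT x|mu u. norm (\<phi> x)) \<le> C"
    using Q.integral_norm_bounded[OF assms(1)] by metis
  have "bdd_above ((\<lambda>u. LINT w|mu u. cmod (\<phi> w)) ` units G)"
    using C(2) topspace_unit by (intro bdd_aboveI2) auto
  then show ?thesis unfolding mu_norm_def by (rule cSUP_upper[OF assms(2)])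
qed

lemma mu_norm_least:
  "(\<And>u. u \<in> units G \<Longrightarrow> (LINT w|mu u. cmod (\<phi> w)) \<le> c) \<Longrightarrow> mu_norm G mu \<phi> \<le> c"
  unfolding mu_norm_def by (rule cSUP_least[OF units_nonempty])

lemma mu_norm_nonneg:
  assumes "\<phi> \<in> Cc (quot_top G H)" shows "0 \<le> mu_norm G mu \<phi>"
proof -
  obtain u where u: "u \<in> units G" using units_nonempty by blast
  have "0 \<le> (LINT w|mu u. cmod (\<phi> w))" by simp
  also have "\<dots> \<le> mu_norm G mu \<phi>" by (rule mu_norm_upper[OF assms u])
  finally show ?thesis .
qed

lemma E_dualD:
  assumes "\<nu> \<in> E_dual G H mu"
  shows "\<phi> \<in> Cc (quot_top G H) \<Longrightarrow> \<psi> \<in> Cc (quot_top G H) \<Longrightarrow> \<nu> (\<lambda>w. \<phi> w + \<psi> w) = \<nu> \<phi> + \<nu> \<psi>"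
    and "\<phi> \<in> Cc (quot_top G H) \<Longrightarrow> \<nu> (\<lambda>w. c * \<phi> w) = c * \<nu> \<phi>"
    and "\<phi> \<notin> Cc (quot_top G H) \<Longrightarrow> \<nu> \<phi> = 0"
  using assms unfolding E_dual_def dual_def by auto

lemma E_dual_diff:
  assumes "\<nu> \<in> E_dual G H mu" "\<phi> \<in> Cc (quot_top G H)" "\<psi> \<in> Cc (quot_top G H)"
  shows "\<nu> (\<lambda>w. \<phi> w - \<psi> w) = \<nu> \<phi> - \<nu> \<psi>"
proof -
  have "\<nu> (\<lambda>w. \<phi> w + (-1) * \<psi> w) = \<nu> \<phi> + \<nu> (\<lambda>w. (-1) * \<psi> w)"
    by (intro E_dualD(1)[OF assms(1)] Cc_scale QX.Haus assms)
  also have "\<nu> (\<lambda>w. (-1) * \<psi> w) = (-1) * \<nu> \<psi>" by (rule E_dualD(2)[OF assms(1,3)])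
  finally show ?thesis by simp
qed

lemma E_dual_bound:
  assumes "\<nu> \<in> E_dual G H mu"
  obtains C where "C > 0" "\<And>\<phi>. \<phi> \<in> Cc (quot_top G H) \<Longrightarrow> cmod (\<nu> \<phi>) \<le> C * mu_norm G mu \<phi>"
proof -
  obtain C where C: "\<And>\<phi>. \<phi> \<in> Cc (quot_top G H) \<Longrightarrow> cmod (\<nu> \<phi>) \<le> C * mu_norm G mu \<phi>"
  proof -
    have "\<exists>C. \<forall>\<phi>\<in>Cc (quot_top G H). cmod (\<nu> \<phi>) \<le> C * mu_norm G mu \<phi>"
      using assms unfolding E_dual_def dual_def by simp
    then show ?thesis using that by blast
  qed
  show ?thesis
  proof
    show "max C 1 > 0" by simp
    fix \<phi> :: "'a set \<Rightarrow> complex" assume \<phi>: "\<phi> \<in> Cc (quot_top G H)"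
    have "C * mu_norm G mu \<phi> \<le> max C 1 * mu_norm G mu \<phi>"
      using mu_norm_nonneg[OF \<phi>] by (intro mult_right_mono) auto
    then show "cmod (\<nu> \<phi>) \<le> max C 1 * mu_norm G mu \<phi>" using C[OF \<phi>] by simp
  qed
qed

lemma E_dualI:
  assumes "\<And>\<phi> \<psi>. \<phi> \<in> Cc (quot_top G H) \<Longrightarrow> \<psi> \<in> Cc (quot_top G H) \<Longrightarrow> \<nu> (\<lambda>w. \<phi> w + \<psi> w) = \<nu> \<phi> + \<nu> \<psi>"
    and "\<And>c \<phi>. \<phi> \<in> Cc (quot_top G H) \<Longrightarrow> \<nu> (\<lambda>w. c * \<phi> w) = c * \<nu> \<phi>"
    and "\<And>\<phi>. \<phi> \<in> Cc (quot_top G H) \<Longrightarrow> cmod (\<nu> \<phi>) \<le> C * mu_norm G mu \<phi>"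
    and "\<And>\<phi>. \<phi> \<notin> Cc (quot_top G H) \<Longrightarrow> \<nu> \<phi> = 0"
  shows "\<nu> \<in> E_dual G H mu"
  using assms unfolding E_dual_def dual_def by blast

lemma E_dual_add:
  assumes "\<nu> \<in> E_dual G H mu" "\<nu>' \<in> E_dual G H mu"
  shows "(\<lambda>\<phi>. \<nu> \<phi> + \<nu>' \<phi>) \<in> E_dual G H mu"
proof -
  obtain C where C: "\<And>\<phi>. \<phi> \<in> Cc (quot_top G H) \<Longrightarrow> cmod (\<nu> \<phi>) \<le> C * mu_norm G mu \<phi>"
    using E_dual_bound[OF assms(1)] by metis
  obtain C' where C': "\<And>\<phi>. \<phi> \<in> Cc (quot_top G H) \<Longrightarrow> cmod (\<nu>' \<phi>) \<le> C' * mu_norm G mu \<phi>"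
    using E_dual_bound[OF assms(2)] by metis
  show ?thesis
  proof (rule E_dualI[where C = "C + C'"])
    fix \<phi> :: "'a set \<Rightarrow> complex" assume \<phi>: "\<phi> \<in> Cc (quot_top G H)"
    show "cmod (\<nu> \<phi> + \<nu>' \<phi>) \<le> (C + C') * mu_norm G mu \<phi>"
      using norm_triangle_ineq[of "\<nu> \<phi>" "\<nu>' \<phi>"] C[OF \<phi>] C'[OF \<phi>] by (simp add: distrib_right)
  qed (simp_all add: E_dualD[OF assms(1)] E_dualD[OF assms(2)] algebra_simps)
qed

lemma E_dual_scale:
  assumes "\<nu> \<in> E_dual G H mu"
  shows "(\<lambda>\<phi>. c * \<nu> \<phi>) \<in> E_dual G H mu"
proof -
  obtain C where C: "\<And>\<phi>. \<phi> \<in> Cc (quot_top G H) \<Longrightarrow> cmod (\<nu> \<phi>) \<le> C * mu_norm G mu \<phi>"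
    using E_dual_bound[OF assms(1)] by metis
  show ?thesis
  proof (rule E_dualI[where C = "cmod c * C"])
    fix \<phi> :: "'a set \<Rightarrow> complex" assume \<phi>: "\<phi> \<in> Cc (quot_top G H)"
    show "cmod (c * \<nu> \<phi>) \<le> cmod c * C * mu_norm G mu \<phi>"
      using mult_left_mono[OF C[OF \<phi>], of "cmod c"] by (simp add: norm_mult mult.assoc)
  qed (simp_all add: E_dualD[OF assms(1)] algebra_simps)
qed

lemma zero_E_dual: "(\<lambda>\<phi>. 0) \<in> E_dual G H mu"
  by (rule E_dualI[where C = 0]) auto

lemma dual_norm_upper:
  assumes \<nu>: "\<nu> \<in> E_dual G H mu" and \<phi>: "\<phi> \<in> Cc (quot_top G H)" "mu_norm G mu \<phi> \<le> 1"
  shows "cmod (\<nu> \<phi>) \<le> dual_norm (Cc (quot_top G H)) (mu_norm G mu) \<nu>"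
proof -
  obtain C where C: "C > 0" "\<And>\<phi>. \<phi> \<in> Cc (quot_top G H) \<Longrightarrow> cmod (\<nu> \<phi>) \<le> C * mu_norm G mu \<phi>"
    using E_dual_bound[OF \<nu>] by metis
  have "bdd_above ((\<lambda>x. cmod (\<nu> x)) ` {x \<in> Cc (quot_top G H). mu_norm G mu x \<le> 1})"
  proof (rule bdd_aboveI2)
    fix x assume "x \<in> {x \<in> Cc (quot_top G H). mu_norm G mu x \<le> 1}"
    then have x: "x \<in> Cc (quot_top G H)" "mu_norm G mu x \<le> 1" by auto
    have "cmod (\<nu> x) \<le> C * mu_norm G mu x" by (rule C(2)[OF x(1)])
    also have "\<dots> \<le> C * 1" using x(2) C(1) by (intro mult_left_mono) auto
    finally show "cmod (\<nu> x) \<le> C" by simp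
  qed
  then show ?thesis unfolding dual_norm_def by (rule cSUP_upper[rotated]) (use \<phi> in simp)
qed

lemma transpose_in_E_dual:
  assumes \<nu>: "\<nu> \<in> E_dual G H mu"
    and A: "\<And>\<phi>. \<phi> \<in> Cc (quot_top G H) \<Longrightarrow> A \<phi> \<in> Cc (quot_top G H)"
    and add: "\<And>\<phi> \<psi>. \<phi> \<in> Cc (quot_top G H) \<Longrightarrow> \<psi> \<in> Cc (quot_top G H) \<Longrightarrow> A (\<lambda>w. \<phi> w + \<psi> w) = (\<lambda>w. A \<phi> w + A \<psi> w)"
    and scale: "\<And>c \<phi>. \<phi> \<in> Cc (quot_top G H) \<Longrightarrow> A (\<lambda>w. c * \<phi> w) = (\<lambda>w. c * A \<phi> w)"
    and bound: "\<And>\<phi>. \<phi> \<in> Cc (quot_top G H) \<Longrightarrow> mu_norm G mu (A \<phi>) \<le> B * mu_norm G mu \<phi>"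
  shows "transpose_on (Cc (quot_top G H)) A \<nu> \<in> E_dual G H mu"
proof -
  obtain C where C: "C > 0" "\<And>\<phi>. \<phi> \<in> Cc (quot_top G H) \<Longrightarrow> cmod (\<nu> \<phi>) \<le> C * mu_norm G mu \<phi>"
    using E_dual_bound[OF \<nu>] by metis
  show ?thesis
  proof (rule E_dualI[where C = "C * B"])
    fix \<phi> :: "'a set \<Rightarrow> complex" assume \<phi>: "\<phi> \<in> Cc (quot_top G H)"
    have "cmod (\<nu> (A \<phi>)) \<le> C * mu_norm G mu (A \<phi>)" by (rule C(2)[OF A[OF \<phi>]])
    also have "\<dots> \<le> C * (B * mu_norm G mu \<phi>)" using bound[OF \<phi>] C(1) by (intro mult_left_mono) auto
    finally show "cmod (transpose_on (Cc (quot_top G H)) A \<nu> \<phi>) \<le> C * B * mu_norm G mu \<phi>"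
      using \<phi> by (simp add: transpose_on_def mult.assoc)
    show "transpose_on (Cc (quot_top G H)) A \<nu> (\<lambda>w. c * \<phi> w) = c * transpose_on (Cc (quot_top G H)) A \<nu> \<phi>" for c
      using \<phi> Cc_scale[OF QX.Haus \<phi>, of c] scale[OF \<phi>] E_dualD(2)[OF \<nu> A[OF \<phi>]]
      by (simp add: transpose_on_def)
    fix \<psi> :: "'a set \<Rightarrow> complex" assume \<psi>: "\<psi> \<in> Cc (quot_top G H)"
    show "transpose_on (Cc (quot_top G H)) A \<nu> (\<lambda>w. \<phi> w + \<psi> w) =
        transpose_on (Cc (quot_top G H)) A \<nu> \<phi> + transpose_on (Cc (quot_top G H)) A \<nu> \<psi>"
      using \<phi> \<psi> Cc_add[OF QX.Haus \<phi> \<psi>] add[OF \<phi> \<psi>] E_dualD(1)[OF \<nu> A[OF \<phi>] A[OF \<psi>]]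
      by (simp add: transpose_on_def)
  qed (simp add: transpose_on_def)
qed

lemma L_op_add:
  assumes f: "f \<in> Cc (top_of G)" and \<phi>: "\<phi> \<in> Cc (quot_top G H)" and \<psi>: "\<psi> \<in> Cc (quot_top G H)"
  shows "L_op G lam H f (\<lambda>w. \<phi> w + \<psi> w) = (\<lambda>w. L_op G lam H f \<phi> w + L_op G lam H f \<psi> w)"
proof
  fix w
  show "L_op G lam H f (\<lambda>w. \<phi> w + \<psi> w) w = L_op G lam H f \<phi> w + L_op G lam H f \<psi> w"
    using kernel_integrable[OF f Cc_continuous[OF \<phi>], of w] kernel_integrable[OF f Cc_continuous[OF \<psi>], of w]
    by (cases "w \<in> cosets G H") (simp_all add: L_op_def distrib_left set_integral_add)
qed

lemma L_op_scale:
  "L_op G lam H f (\<lambda>w. c * \<phi> w) = (\<lambda>w. c * L_op G lam H f \<phi> w)"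
proof
  fix w
  show "L_op G lam H f (\<lambda>w. c * \<phi> w) w = c * L_op G lam H f \<phi> w"
  proof (cases "w \<in> cosets G H")
    case True
    have "(LINT y:fibre G (qrng G w)|lam (qrng G w). f y * (c * \<phi> (qact G (ginv G y) w))) =
      (LINT y:fibre G (qrng G w)|lam (qrng G w). c * (f y * \<phi> (qact G (ginv G y) w)))"
      by (simp add: mult.left_commute)
    also have "\<dots> = c * (LINT y:fibre G (qrng G w)|lam (qrng G w). f y * \<phi> (qact G (ginv G y) w))"
      by simp
    finally show ?thesis using True by (simp add: L_op_def)
  qed (simp add: L_op_def)
qed

text \<open>
  The slice of the kernel at \<open>y\<close> is a translate of \<open>\<phi>\<close>, whose \<open>L\<^sup>1\<close>-norm on the fibre over \<open>u\<close> is by equivariance the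
  norm of \<open>\<phi>\<close> on another fibre.
\<close>

lemma kernel_bound:
  fixes a :: "'a \<Rightarrow> complex" and \<phi> \<psi> :: "'a set \<Rightarrow> complex"
  assumes u: "u \<in> units G" and a: "a \<in> Cc (top_of G)" and \<phi>: "\<phi> \<in> Cc (quot_top G H)"
    and \<psi>: "\<psi> \<in> Cc (quot_top G H)"
      "\<And>w. w \<in> qfibre G H u \<Longrightarrow> \<psi> w = (LINT y:fibre G u|lam u. a y * \<phi> (qact G (ginv G y) w))"
  shows "(LINT w|mu u. cmod (\<psi> w)) \<le> mu_norm G mu \<phi> * (LINT y|lam u. cmod (a y))"
proof (rule kernel_estimate[OF u a _ mu_norm_nonneg[OF \<phi>] _ \<psi>(1), where b = "\<lambda>q. \<phi> (qact G (ginv G (fst q)) (snd q))"])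
  show "continuous_map (subtopology (prod_topology (top_of G) (quot_top G H)) (fibre G u \<times> qfibre G H u)) euclidean
     (\<lambda>q. \<phi> (qact G (ginv G (fst q)) (snd q)))"
    using continuous_translate[OF Cc_continuous[OF \<phi>]]
    by (rule continuous_map_from_subtopology_mono) (auto simp: fibre_def qfibre_def)
  fix y assume "y \<in> fibre G u"
  then have y: "y \<in> carr G" "rng G y = u" by (auto simp: fibre_def)
  show "(\<integral>\<^sup>+w. indicator (qfibre G H u) w * ennreal (cmod (\<phi> (qact G (ginv G (fst (y, w))) (snd (y, w))))) \<partial>mu u)
      \<le> ennreal (mu_norm G mu \<phi>)"
    using translate_nn_integral[OF y(1) \<phi>] mu_norm_upper[OF \<phi> src_units[OF y(1)]] y(2) by (simp add: ennreal_leI)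
qed (use \<psi>(2) in simp)

lemma L_op_fibre:
  "w \<in> qfibre G H u \<Longrightarrow> L_op G lam H f \<phi> w = (LINT y:fibre G u|lam u. f y * \<phi> (qact G (ginv G y) w))"
  by (auto simp: L_op_def qfibre_def)

lemma L_op_bound:
  assumes "u \<in> units G" "f \<in> Cc (top_of G)" "\<phi> \<in> Cc (quot_top G H)"
  shows "(LINT w|mu u. cmod (L_op G lam H f \<phi> w)) \<le> mu_norm G mu \<phi> * (LINT y|lam u. cmod (f y))"
  by (rule kernel_bound[OF assms L_op_Cc[OF assms(2,3)] L_op_fibre])

lemma smult_Cc:
  assumes k: "continuous_map (unit_top G) euclidean k" and \<phi>: "\<phi> \<in> Cc (quot_top G H)"
  shows "smult G k \<phi> \<in> Cc (quot_top G H)"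
proof -
  have "continuous_map (quot_top G H) euclidean (\<lambda>w. k (qrng G w))"
    using continuous_map_compose[OF continuous_qrng k] by (simp add: o_def)
  then show ?thesis unfolding smult_def by (rule Cc_mult[OF QX.Haus \<phi>])
qed

lemma continuous_haar_int: "f \<in> Cc (top_of G) \<Longrightarrow> continuous_map (unit_top G) euclidean (haar_int lam f)"
  unfolding haar_int_def by (rule L.cont_complex)

lemma haar_int_bound:
  assumes "f \<in> Cc (top_of G)"
  obtains B where "B > 0" "\<And>u. u \<in> units G \<Longrightarrow> (LINT y|lam u. cmod (f y)) \<le> B"
     "\<And>u. u \<in> units G \<Longrightarrow> cmod (haar_int lam f u) \<le> B"
proof -
  obtain B where B: "B > 0" "\<And>u. u \<in> topspace (unit_top G) \<Longrightarrow> (LINT y|lam u. cmod (f y)) \<le> B"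
    using L.integral_norm_bounded[OF assms] by metis
  show ?thesis
  proof (rule that[OF B(1)])
    fix u assume u: "u \<in> units G"
    show 1: "(LINT y|lam u. cmod (f y)) \<le> B" using B(2) u by (simp add: topspace_unit)
    have "cmod (haar_int lam f u) \<le> (LINT y|lam u. cmod (f y))"
      unfolding haar_int_def by (rule integral_norm_bound)
    then show "cmod (haar_int lam f u) \<le> B" using 1 by simp
  qed
qed

lemma transpose_L_op:
  assumes "\<nu> \<in> E_dual G H mu" and f: "f \<in> Cc (top_of G)"
  shows "transpose_on (Cc (quot_top G H)) (L_op G lam H f) \<nu> \<in> E_dual G H mu"
proof -
  obtain B where B: "B > 0" "\<And>u. u \<in> units G \<Longrightarrow> (LINT y|lam u. cmod (f y)) \<le> B"
     "\<And>u. u \<in> units G \<Longrightarrow> cmod (haar_int lam f u) \<le> B"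
    using haar_int_bound[OF f] by metis
  show ?thesis
  proof (rule transpose_in_E_dual[where B = B, OF assms(1) L_op_Cc[OF f] L_op_add[OF f] L_op_scale])
    fix \<phi> :: "'a set \<Rightarrow> complex" assume \<phi>: "\<phi> \<in> Cc (quot_top G H)"
    show "mu_norm G mu (L_op G lam H f \<phi>) \<le> B * mu_norm G mu \<phi>"
    proof (rule mu_norm_least)
      fix u assume u: "u \<in> units G"
      have "(LINT w|mu u. cmod (L_op G lam H f \<phi> w)) \<le> mu_norm G mu \<phi> * (LINT y|lam u. cmod (f y))"
        by (rule L_op_bound[OF u f \<phi>])
      also have "\<dots> \<le> mu_norm G mu \<phi> * B" using mu_norm_nonneg[OF \<phi>] B(2)[OF u] by (rule mult_left_mono[rotated])
      finally show "(LINT w|mu u. cmod (L_op G lam H f \<phi> w)) \<le> B * mu_norm G mu \<phi>" by (simp add: mult.commute)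
    qed
  qed
qed

lemma transpose_smult:
  assumes "\<nu> \<in> E_dual G H mu" and k: "continuous_map (unit_top G) euclidean k"
    and B: "\<And>u. u \<in> units G \<Longrightarrow> cmod (k u) \<le> B"
  shows "transpose_on (Cc (quot_top G H)) (smult G k) \<nu> \<in> E_dual G H mu"
proof (rule transpose_in_E_dual[where B = B, OF assms(1) smult_Cc[OF k]])
  fix \<phi> :: "'a set \<Rightarrow> complex" assume \<phi>: "\<phi> \<in> Cc (quot_top G H)"
  show "mu_norm G mu (smult G k \<phi>) \<le> B * mu_norm G mu \<phi>"
  proof (rule mu_norm_least)
    fix u assume u: "u \<in> units G"
    have B0: "0 \<le> B" by (rule order_trans[OF norm_ge_zero B[OF u]])
    have "(LINT w|mu u. cmod (smult G k \<phi> w)) \<le> (LINT w|mu u. B * cmod (\<phi> w))"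
    proof (rule integral_mono_AE)
      show "integrable (mu u) (\<lambda>w. cmod (smult G k \<phi> w))"
        by (intro quot_fib(5)[OF u] Cc_norm QX.Haus smult_Cc k \<phi>)
      show "integrable (mu u) (\<lambda>w. B * cmod (\<phi> w))"
        by (intro quot_fib(5)[OF u] Cc_scale Cc_norm QX.Haus \<phi>)
      show "AE w in mu u. cmod (smult G k \<phi> w) \<le> B * cmod (\<phi> w)"
        using quot_fib(3)[OF u]
      proof eventually_elim
        case (elim w)
        then show ?case using B[OF u] by (auto simp: smult_def norm_mult qfibre_def intro: mult_right_mono)
      qed
    qed
    also have "\<dots> \<le> B * mu_norm G mu \<phi>" using mu_norm_upper[OF \<phi> u] B0 by (simp add: mult_left_mono)
    finally show "(LINT w|mu u. cmod (smult G k \<phi> w)) \<le> B * mu_norm G mu \<phi>" .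
  qed
qed (auto simp: smult_def algebra_simps)

text \<open>
  On the fibre over \<open>u\<close> the difference \<open>L(f)\<phi> - \<lambda>(f)\<phi>\<close> is the integral of \<open>f(y) (\<phi>(y\<^sup>-\<^sup>1 w) - \<phi>(w))\<close> over \<open>y\<close>.
\<close>

lemma L_op_defect_bound:
  fixes f :: "'a \<Rightarrow> complex" and \<phi> :: "'a set \<Rightarrow> complex"
  assumes u: "u \<in> units G" and f: "f \<in> Cc (top_of G)" and \<phi>: "\<phi> \<in> Cc (quot_top G H)"
    and c: "0 \<le> c" "\<And>y. y \<in> fibre G u \<Longrightarrow> f y \<noteq> 0 \<Longrightarrow>
      (\<integral>\<^sup>+w. indicator (qfibre G H u) w * ennreal (cmod (\<phi> (qact G (ginv G y) w) - \<phi> w)) \<partial>mu u) \<le> ennreal c"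
  shows "(LINT w|mu u. cmod (L_op G lam H f \<phi> w - smult G (haar_int lam f) \<phi> w)) \<le> c * (LINT y|lam u. cmod (f y))"
proof (rule kernel_estimate[OF u f _ c(1), where b = "\<lambda>q. \<phi> (qact G (ginv G (fst q)) (snd q)) - \<phi> (snd q)"])
  let ?S = "subtopology (prod_topology (top_of G) (quot_top G H)) (fibre G u \<times> qfibre G H u)"
  have 1: "continuous_map ?S euclidean (\<lambda>q. \<phi> (qact G (ginv G (fst q)) (snd q)))"
    using continuous_translate[OF Cc_continuous[OF \<phi>]]
    by (rule continuous_map_from_subtopology_mono) (auto simp: fibre_def qfibre_def)
  have "continuous_map (prod_topology (top_of G) (quot_top G H)) euclidean (\<lambda>q. \<phi> (snd q))"
    using continuous_map_compose[OF continuous_map_snd Cc_continuous[OF \<phi>]] by (simp add: o_def)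
  then show "continuous_map ?S euclidean (\<lambda>q. \<phi> (qact G (ginv G (fst q)) (snd q)) - \<phi> (snd q))"
    by (rule continuous_map_euclidean_diff[OF 1 continuous_map_from_subtopology])
  show "(\<lambda>w. L_op G lam H f \<phi> w - smult G (haar_int lam f) \<phi> w) \<in> Cc (quot_top G H)"
    by (intro Cc_diff QX.Haus L_op_Cc smult_Cc continuous_haar_int f \<phi>)
  fix w assume w: "w \<in> qfibre G H u"
  then have wc: "w \<in> cosets G H" "qrng G w = u" by (auto simp: qfibre_def)
  have i1: "set_integrable (lam u) (fibre G u) (\<lambda>y. f y * \<phi> (qact G (ginv G y) w))"
    using kernel_integrable[OF f Cc_continuous[OF \<phi>] wc(1)] wc(2) by simp
  have i2: "set_integrable (lam u) (fibre G u) (\<lambda>y. f y * \<phi> w)"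
    using haar_fib(8)[OF u f] by simp
  have "(LINT y:fibre G u|lam u. f y * (\<phi> (qact G (ginv G y) w) - \<phi> w)) =
     (LINT y:fibre G u|lam u. f y * \<phi> (qact G (ginv G y) w)) - (LINT y:fibre G u|lam u. f y * \<phi> w)"
    using i1 i2 by (simp add: right_diff_distrib set_integral_diff)
  also have "(LINT y:fibre G u|lam u. f y * \<phi> w) = (LINT y|lam u. f y) * \<phi> w"
    using haar_fib(7)[OF u f, of f] by simp
  finally show "L_op G lam H f \<phi> w - smult G (haar_int lam f) \<phi> w =
      (LINT y:fibre G u|lam u. f y * (\<phi> (qact G (ginv G (fst (y, w))) (snd (y, w))) - \<phi> (snd (y, w))))"
    using L_op_fibre[OF w] wc(2) by (simp add: smult_def haar_int_def)
qed (use c(2) in simp)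

lemma translate_diff_nn_integral:
  fixes f :: "'a set \<Rightarrow> real"
  assumes y: "y \<in> carr G" and f: "f \<in> Cc (quot_top G H)"
  shows "(\<integral>\<^sup>+w. indicator (qfibre G H (rng G y)) w *
       ennreal (cmod (complex_of_real (f (qact G (ginv G y) w)) - complex_of_real (f w))) \<partial>mu (rng G y))
    = ennreal (LINT w:qfibre G H (rng G y)|mu (rng G y). \<bar>f (qact G (ginv G y) w) - f w\<bar>)"
proof -
  let ?u = "rng G y" and ?S = "qfibre G H (rng G y)"
  let ?c = "\<lambda>w. complex_of_real (f w)"
  have n: "?c \<in> Cc (quot_top G H)" by (intro Cc_of_real QX.Haus f)
  obtain g where g: "g \<in> Cc (quot_top G H)" "\<And>w. w \<in> ?S \<Longrightarrow> g w = ?c (qact G (ginv G y) w)"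
    using translate_extension[OF y n] by metis
  have "(\<lambda>w. cmod (g w - ?c w)) \<in> Cc (quot_top G H)" by (intro Cc_norm Cc_diff QX.Haus g n)
  then have "set_integrable (mu ?u) ?S (\<lambda>w. \<bar>f (qact G (ginv G y) w) - f w\<bar>)"
    by (rule quot_fib(8)[OF rng_units[OF y]]) (use g(2) in \<open>simp flip: of_real_diff\<close>)
  then have i: "integrable (mu ?u) (\<lambda>w. indicator ?S w * \<bar>f (qact G (ginv G y) w) - f w\<bar>)"
    by (simp add: set_integrable_def)
  have "(\<integral>\<^sup>+w. indicator ?S w * ennreal (cmod (?c (qact G (ginv G y) w) - ?c w)) \<partial>mu ?u)
     = (\<integral>\<^sup>+w. ennreal (indicator ?S w * \<bar>f (qact G (ginv G y) w) - f w\<bar>) \<partial>mu ?u)"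
    by (intro nn_integral_cong) (auto simp: indicator_def simp flip: of_real_diff)
  also have "\<dots> = ennreal (LINT w|mu ?u. indicator ?S w * \<bar>f (qact G (ginv G y) w) - f w\<bar>)"
    by (intro nn_integral_eq_integral i) auto
  finally show ?thesis by (simp add: set_lebesgue_integral_def)
qed

lemma comp_measure_integrable:
  assumes eta: "finite_measure eta" "sets eta = sets (borel_of (unit_top G))" and \<phi>: "\<phi> \<in> Cc (quot_top G H)"
  shows "integrable eta (\<lambda>u. (LINT w|mu u. \<phi> w) :: complex)"
proof -
  interpret finite_measure eta by (rule eta)
  have sp: "space eta = units G" using sets_eq_imp_space_eq[OF eta(2)] topspace_unit by simp
  show ?thesis
  proof (rule integrable_const_bound[where B = "mu_norm G mu \<phi>"])
    show "(\<lambda>u. LINT w|mu u. \<phi> w) \<in> borel_measurable eta"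
      using measurable_borel_of_continuous[OF Q.cont_complex[OF \<phi>]] measurable_cong_sets[OF eta(2) refl] by blast
    show "AE u in eta. cmod (LINT w|mu u. \<phi> w) \<le> mu_norm G mu \<phi>"
    proof (rule AE_I2)
      fix u assume "u \<in> space eta"
      then have "(LINT w|mu u. cmod (\<phi> w)) \<le> mu_norm G mu \<phi>" using mu_norm_upper[OF \<phi>] sp by simp
      then show "cmod (LINT w|mu u. \<phi> w) \<le> mu_norm G mu \<phi>" by (rule order_trans[OF integral_norm_bound])
    qed
  qed
qed

lemma comp_measure_dual:
  assumes eta: "finite_measure eta" "sets eta = sets (borel_of (unit_top G))"
  shows "comp_measure G H mu eta \<in> E_dual G H mu"
proof (rule E_dualI[where C = "measure eta (space eta)"])
  interpret finite_measure eta by (rule eta)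
  have sp: "space eta = units G" using sets_eq_imp_space_eq[OF eta(2)] topspace_unit by simp
  fix \<phi> :: "'a set \<Rightarrow> complex" assume \<phi>: "\<phi> \<in> Cc (quot_top G H)"
  note i\<phi> = comp_measure_integrable[OF eta \<phi>]
  show "comp_measure G H mu eta (\<lambda>w. c * \<phi> w) = c * comp_measure G H mu eta \<phi>" for c
    using \<phi> Cc_scale[OF QX.Haus \<phi>, of c] by (simp add: comp_measure_def)
  have "cmod (LINT u|eta. LINT w|mu u. \<phi> w) \<le> (LINT u|eta. cmod (LINT w|mu u. \<phi> w))" by (rule integral_norm_bound)
  also have "\<dots> \<le> (LINT u|eta. mu_norm G mu \<phi>)"
  proof (rule integral_mono[OF integrable_norm[OF i\<phi>]])
    fix u assume "u \<in> space eta"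
    then have "(LINT w|mu u. cmod (\<phi> w)) \<le> mu_norm G mu \<phi>" using mu_norm_upper[OF \<phi>] sp by simp
    then show "cmod (LINT w|mu u. \<phi> w) \<le> mu_norm G mu \<phi>" by (rule order_trans[OF integral_norm_bound])
  qed simp
  finally show "cmod (comp_measure G H mu eta \<phi>) \<le> measure eta (space eta) * mu_norm G mu \<phi>"
    using \<phi> by (simp add: comp_measure_def mult.commute)
  fix \<psi> :: "'a set \<Rightarrow> complex" assume \<psi>: "\<psi> \<in> Cc (quot_top G H)"
  have "(LINT u|eta. LINT w|mu u. \<phi> w + \<psi> w) = (LINT u|eta. (LINT w|mu u. \<phi> w) + (LINT w|mu u. \<psi> w))"
    using quot_fib(5)[OF _ \<phi>] quot_fib(5)[OF _ \<psi>] sp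
    by (intro Bochner_Integration.integral_cong refl Bochner_Integration.integral_add) auto
  then show "comp_measure G H mu eta (\<lambda>w. \<phi> w + \<psi> w) = comp_measure G H mu eta \<phi> + comp_measure G H mu eta \<psi>"
    using \<phi> \<psi> Cc_add[OF QX.Haus \<phi> \<psi>] i\<phi> comp_measure_integrable[OF eta \<psi>] by (simp add: comp_measure_def)
qed (simp add: comp_measure_def)

end

section \<open>From a density to a mean\<close>

text \<open>
  The functions live in a product of discs of radius \<open>D \<nu>\<close>, which is compact by Tychonoff's theorem.
\<close>

lemma bounded_pointwise_cluster_point:
  fixes e :: "nat \<Rightarrow> 'x \<Rightarrow> complex"
  assumes e: "\<And>i \<nu>. \<nu> \<in> I \<Longrightarrow> cmod (e i \<nu>) \<le> D \<nu>"
  obtains m where "\<And>\<nu>. \<nu> \<in> I \<Longrightarrow> cmod (m \<nu>) \<le> D \<nu>"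
    "\<And>F N \<epsilon>. finite F \<Longrightarrow> F \<subseteq> I \<Longrightarrow> 0 < \<epsilon> \<Longrightarrow> \<exists>i\<ge>N. \<forall>\<nu>\<in>F. cmod (m \<nu> - e i \<nu>) < \<epsilon>"
proof -
  define Y where "Y = product_topology (\<lambda>\<nu>. top_of_set (cball (0::complex) (D \<nu>))) I"
  have Y: "topspace Y = PiE I (\<lambda>\<nu>. cball 0 (D \<nu>))" by (simp add: Y_def)
  have cY: "compact_space Y" unfolding Y_def compact_space_product_topology
    by (simp add: compact_space_subtopology)
  define E where "E = (\<lambda>i. restrict (e i) I)"
  have EY: "E i \<in> topspace Y" for i using e by (auto simp: Y E_def)
  let ?C = "\<lambda>n. Y closure_of (E ` {n..})"
  have "(\<Inter>n. ?C n) \<noteq> {}"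
  proof (rule compact_space_imp_nest[OF cY])
    show "closedin Y (?C n)" for n by simp
    show "?C n \<noteq> {}" for n
      using EY closure_of_subset[of "E ` {n..}" Y] by force
    show "decseq ?C" by (intro decseq_SucI closure_of_mono image_mono) auto
  qed
  then obtain m where m: "\<And>n. m \<in> ?C n" by blast
  have mY: "m \<in> topspace Y" using m[of 0] by (simp add: in_closure_of)
  show ?thesis
  proof (rule that)
    show "cmod (m \<nu>) \<le> D \<nu>" if "\<nu> \<in> I" for \<nu>
      using mY that by (auto simp: Y PiE_iff)
    fix F :: "'x set" and N :: nat and \<epsilon> :: real
    assume F: "finite F" "F \<subseteq> I" "0 < \<epsilon>"
    define W where "W = topspace Y \<inter> (\<Inter>\<nu>\<in>F. {x \<in> topspace Y. x \<nu> \<in> ball (m \<nu>) \<epsilon>})"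
    have "openin Y {x \<in> topspace Y. x \<nu> \<in> ball (m \<nu>) \<epsilon>}" if "\<nu> \<in> F" for \<nu>
    proof (rule openin_continuous_map_preimage)
      show "continuous_map Y euclidean (\<lambda>x. x \<nu>)"
      proof -
        have "continuous_map Y (top_of_set (cball (0::complex) (D \<nu>))) (\<lambda>x. x \<nu>)"
          unfolding Y_def using that F(2) by (intro continuous_map_product_projection) auto
        then show ?thesis by (simp add: continuous_map_in_subtopology)
      qed
    qed simp
    then have W: "openin Y W" unfolding W_def using F(1)
      by (cases "F = {}") (auto intro!: openin_Int openin_INT)
    have "m \<in> W" using mY F(3) by (auto simp: W_def)
    then obtain x where x: "x \<in> W" "x \<in> E ` {N..}"
      using m[of N] W unfolding in_closure_of by blast
    then obtain i where "i \<ge> N" "x = E i" by auto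
    moreover have "cmod (m \<nu> - e i \<nu>) < \<epsilon>" if "\<nu> \<in> F" for \<nu>
    proof -
      have "E i \<nu> \<in> ball (m \<nu>) \<epsilon>" using x(1) that \<open>x = E i\<close> by (auto simp: W_def)
      then show ?thesis using that F(2) by (auto simp: E_def dist_norm)
    qed
    ultimately show "\<exists>i\<ge>N. \<forall>\<nu>\<in>F. cmod (m \<nu> - e i \<nu>) < \<epsilon>" by blast
  qed
qed

text \<open>
  A cluster point is approximated at finitely many arguments by one and the same \<open>e i\<close>, with \<open>i\<close> arbitrarily large.
  So limits of fixed finite linear combinations of values are attained by the cluster point.
\<close>

lemma cluster_point_combination:
  fixes e :: "nat \<Rightarrow> 'x \<Rightarrow> complex" and m :: "'x \<Rightarrow> complex" and c :: "'j \<Rightarrow> complex"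
  assumes m: "\<And>F N \<epsilon>. finite F \<Longrightarrow> F \<subseteq> I \<Longrightarrow> 0 < \<epsilon> \<Longrightarrow> \<exists>i\<ge>N. \<forall>\<nu>\<in>F. cmod (m \<nu> - e i \<nu>) < \<epsilon>"
    and J: "finite J" "\<And>j. j \<in> J \<Longrightarrow> \<nu> j \<in> I"
    and lim: "(\<lambda>i. \<Sum>j\<in>J. c j * e i (\<nu> j)) \<longlonglongrightarrow> l"
  shows "(\<Sum>j\<in>J. c j * m (\<nu> j)) = l"
proof -
  define S where "S = (\<Sum>j\<in>J. cmod (c j)) + 1"
  have S: "S > 0" unfolding S_def by (intro add_nonneg_pos sum_nonneg) auto
  have "cmod ((\<Sum>j\<in>J. c j * m (\<nu> j)) - l) \<le> 0"
  proof (rule field_le_epsilon)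
    fix \<epsilon> :: real assume \<epsilon>: "0 < \<epsilon>"
    obtain N where N: "\<And>i. i \<ge> N \<Longrightarrow> cmod ((\<Sum>j\<in>J. c j * e i (\<nu> j)) - l) < \<epsilon> / 2"
      using LIMSEQ_D[OF lim, of "\<epsilon> / 2"] \<epsilon> by auto
    obtain i where i: "i \<ge> N" "\<And>\<mu>. \<mu> \<in> \<nu> ` J \<Longrightarrow> cmod (m \<mu> - e i \<mu>) < \<epsilon> / (2 * S)"
      using m[of "\<nu> ` J" "\<epsilon> / (2 * S)" N] J \<epsilon> S by auto
    have "cmod ((\<Sum>j\<in>J. c j * m (\<nu> j)) - (\<Sum>j\<in>J. c j * e i (\<nu> j))) = cmod (\<Sum>j\<in>J. c j * (m (\<nu> j) - e i (\<nu> j)))"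
      by (simp add: sum_subtractf right_diff_distrib)
    also have "\<dots> \<le> (\<Sum>j\<in>J. cmod (c j) * (\<epsilon> / (2 * S)))"
    proof (rule sum_norm_le)
      fix j assume "j \<in> J"
      then have "cmod (m (\<nu> j) - e i (\<nu> j)) \<le> \<epsilon> / (2 * S)" by (intro less_imp_le i(2)) simp
      then show "cmod (c j * (m (\<nu> j) - e i (\<nu> j))) \<le> cmod (c j) * (\<epsilon> / (2 * S))"
        unfolding norm_mult by (rule mult_left_mono) simp
    qed
    also have "\<dots> = (\<Sum>j\<in>J. cmod (c j)) * (\<epsilon> / (2 * S))" by (rule sum_distrib_right[symmetric])
    also have "\<dots> \<le> S * (\<epsilon> / (2 * S))" using \<epsilon> S by (intro mult_right_mono) (auto simp: S_def)
    also have "\<dots> = \<epsilon> / 2" using S by simp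
    finally have "cmod ((\<Sum>j\<in>J. c j * m (\<nu> j)) - (\<Sum>j\<in>J. c j * e i (\<nu> j))) \<le> \<epsilon> / 2" .
    moreover have "cmod ((\<Sum>j\<in>J. c j * m (\<nu> j)) - l) \<le>
      cmod ((\<Sum>j\<in>J. c j * m (\<nu> j)) - (\<Sum>j\<in>J. c j * e i (\<nu> j))) + cmod ((\<Sum>j\<in>J. c j * e i (\<nu> j)) - l)"
      by (rule order_trans[OF _ norm_triangle_ineq]) simp
    ultimately show "cmod ((\<Sum>j\<in>J. c j * m (\<nu> j)) - l) \<le> 0 + \<epsilon>" using N[OF i(1)] by linarith
  qed
  then show ?thesis by simp
qed

context inhabited_groupoid_quotient
begin

lemma smult_bidual_apply:
  "\<nu> \<in> E_dual G H mu \<Longrightarrow> smult_bidual G H mu k m \<nu> = m (transpose_on (Cc (quot_top G H)) (smult G k) \<nu>)"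
  by (simp add: smult_bidual_def transpose_on_def[of "E_dual G H mu"])

lemma conv_bidual_apply:
  "\<nu> \<in> E_dual G H mu \<Longrightarrow> conv_bidual G lam H mu f m \<nu> = m (transpose_on (Cc (quot_top G H)) (L_op G lam H f) \<nu>)"
  by (simp add: conv_bidual_def transpose_on_def[of "E_dual G H mu"])

text \<open>
  The mean is a cluster point of the evaluations at the members of the density. Linearity, the
  normalisation and the invariance are instances of \<open>cluster_point_combination\<close>.
\<close>

lemma density_imp_mean:
  assumes dens: "topological_approximate_invariant_density G H mu f"
  shows "\<exists>m. topological_invariant_mean G lam H mu m"
proof -
  let ?X = "quot_top G H" and ?E = "E_dual G H mu"
  let ?D = "dual_norm (Cc ?X) (mu_norm G mu)"
  define fc where "fc = (\<lambda>i w. complex_of_real (f i w))"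
  have f: "f i \<in> Cc ?X" "\<And>w. 0 \<le> f i w" "\<And>u. u \<in> units G \<Longrightarrow> (LINT w|mu u. f i w) \<le> 1" for i
    using dens unfolding topological_approximate_invariant_density_def by blast+
  have total: "uniform_limit K (\<lambda>i u. LINT w|mu u. f i w) (\<lambda>u. 1) sequentially" if "compactin (unit_top G) K" for K
    using dens that unfolding topological_approximate_invariant_density_def by blast
  have inv: "uniform_limit K
          (\<lambda>i y. LINT w:qfibre G H (rng G y)|mu (rng G y). \<bar>f i (qact G (ginv G y) w) - f i w\<bar>)
          (\<lambda>y. 0) sequentially" if "compactin (top_of G) K" for K
    using dens that unfolding topological_approximate_invariant_density_def by blast
  have fc: "fc i \<in> Cc ?X" for i unfolding fc_def by (intro Cc_of_real QX.Haus f)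
  have fc1: "mu_norm G mu (fc i) \<le> 1" for i
    by (rule mu_norm_least) (use f in \<open>simp add: fc_def\<close>)
  obtain x where x: "\<And>\<nu>. \<nu> \<in> ?E \<Longrightarrow> cmod (x \<nu>) \<le> ?D \<nu>"
    and xlim: "\<And>F N \<epsilon>. finite F \<Longrightarrow> F \<subseteq> ?E \<Longrightarrow> 0 < \<epsilon> \<Longrightarrow> \<exists>i\<ge>N. \<forall>\<nu>\<in>F. cmod (x \<nu> - \<nu> (fc i)) < \<epsilon>"
    using bounded_pointwise_cluster_point[of ?E "\<lambda>i \<nu>. \<nu> (fc i)" ?D] dual_norm_upper[OF _ fc fc1] by metis
  define m where "m = (\<lambda>\<nu>. if \<nu> \<in> ?E then x \<nu> else 0)"
  have lim1: "m \<nu> = l" if "\<nu> \<in> ?E" "(\<lambda>i. \<nu> (fc i)) \<longlonglongrightarrow> l" for \<nu> l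
    using cluster_point_combination[where e = "\<lambda>i \<nu>. \<nu> (fc i)" and J = "{()}" and c = "\<lambda>_. 1" and \<nu> = "\<lambda>_. \<nu>" and m = x and I = ?E and l = l]
      xlim that by (simp add: m_def)
  have lim2: "m \<nu> = m \<nu>'" if "\<nu> \<in> ?E" "\<nu>' \<in> ?E" "(\<lambda>i. \<nu> (fc i) - \<nu>' (fc i)) \<longlonglongrightarrow> 0" for \<nu> \<nu>'
    using cluster_point_combination[where e = "\<lambda>i \<nu>. \<nu> (fc i)" and J = "UNIV" and c = "\<lambda>b. if b then 1 else -1"
       and \<nu> = "\<lambda>b. if b then \<nu> else \<nu>'" and m = x and I = ?E and l = 0]
      xlim that by (simp add: m_def UNIV_bool)
  have madd: "m (\<lambda>\<phi>. \<nu> \<phi> + \<nu>' \<phi>) = m \<nu> + m \<nu>'" if "\<nu> \<in> ?E" "\<nu>' \<in> ?E" for \<nu> \<nu>'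
  proof -
    define c where "c = (\<lambda>j::nat. if j = 0 then 1 else - 1 :: complex)"
    define n where "n = (\<lambda>j::nat. if j = 0 then (\<lambda>\<phi>. \<nu> \<phi> + \<nu>' \<phi>) else if j = 1 then \<nu> else \<nu>')"
    have "(\<Sum>j\<in>{0, 1, 2}. c j * x (n j)) = 0"
    proof (rule cluster_point_combination[where e = "\<lambda>i \<nu>. \<nu> (fc i)" and I = ?E and m = x and \<nu> = n and c = c])
      show "n j \<in> ?E" for j using that E_dual_add[OF that] by (simp add: n_def)
      show "(\<lambda>i. \<Sum>j\<in>{0, 1, 2}. c j * (\<lambda>i \<nu>. \<nu> (fc i)) i (n j)) \<longlonglongrightarrow> 0"
        by (simp add: c_def n_def)
    next
      show "\<exists>i\<ge>N. \<forall>\<nu>\<in>F. cmod (x \<nu> - \<nu> (fc i)) < \<epsilon>" if "finite F" "F \<subseteq> ?E" "0 < \<epsilon>" for F N \<epsilon>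
        by (rule xlim[OF that])
    qed simp
    then have "x (\<lambda>\<phi>. \<nu> \<phi> + \<nu>' \<phi>) + (- x \<nu> - x \<nu>') = 0" by (simp add: c_def n_def)
    then have "x (\<lambda>\<phi>. \<nu> \<phi> + \<nu>' \<phi>) = x \<nu> + x \<nu>'" by algebra
    then show ?thesis using that E_dual_add[OF that] by (simp add: m_def)
  qed
  have mscale: "m (\<lambda>\<phi>. c * \<nu> \<phi>) = c * m \<nu>" if "\<nu> \<in> ?E" for \<nu> c
    using cluster_point_combination[where e = "\<lambda>i \<nu>. \<nu> (fc i)" and J = "UNIV" and c = "\<lambda>b. if b then 1 else - c"
       and \<nu> = "\<lambda>b. if b then (\<lambda>\<phi>. c * \<nu> \<phi>) else \<nu>" and m = x and I = ?E and l = 0]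
      xlim that E_dual_scale[OF that] by (simp add: m_def UNIV_bool)
  have "m \<in> E_bidual G H mu"
    unfolding E_bidual_def dual_def
  proof (intro CollectI conjI ballI allI impI exI[of _ 1])
    show "cmod (m \<nu>) \<le> 1 * ?D \<nu>" if "\<nu> \<in> ?E" for \<nu> using x that by (simp add: m_def)
  qed (auto simp: madd mscale, simp add: m_def)
  \<comment> \<open>Nonnegative reals form a closed set, and \<open>\<nu>(f\<^sub>i)\<close> is such a number for every \<open>i\<close>.\<close>
  moreover have "m \<nu> \<in> \<real>\<^sub>\<ge>\<^sub>0" if \<nu>: "\<nu> \<in> ?E" "positive_measure G H \<nu>" for \<nu>
  proof (rule ccontr)
    assume "m \<nu> \<notin> \<real>\<^sub>\<ge>\<^sub>0"
    then have "m \<nu> \<in> - \<real>\<^sub>\<ge>\<^sub>0" by simp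
    moreover have "open (- \<real>\<^sub>\<ge>\<^sub>0 :: complex set)" using closed_nonneg_Reals_complex by (simp add: open_Compl)
    ultimately obtain \<epsilon> where \<epsilon>: "\<epsilon> > 0" "ball (m \<nu>) \<epsilon> \<subseteq> - \<real>\<^sub>\<ge>\<^sub>0" unfolding open_contains_ball by blast
    obtain i where i: "cmod (x \<nu> - \<nu> (fc i)) < \<epsilon>" using xlim[of "{\<nu>}" \<epsilon> 0] \<nu> \<epsilon> by auto
    obtain M where M: "\<And>g. g \<in> Cc ?X \<Longrightarrow> \<nu> g = (LINT w|M. g w)"
      using \<nu>(2) unfolding positive_measure_def by blast
    have "\<nu> (fc i) = complex_of_real (LINT w|M. f i w)"
      using M[OF fc] by (simp add: fc_def)
    moreover have "0 \<le> (LINT w|M. f i w)" using f(2) by (intro integral_nonneg_AE) auto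
    ultimately have "\<nu> (fc i) \<in> \<real>\<^sub>\<ge>\<^sub>0" by simp
    moreover have "\<nu> (fc i) \<in> ball (m \<nu>) \<epsilon>" using i \<nu> by (simp add: m_def dist_norm)
    ultimately show False using \<epsilon>(2) by blast
  qed
  \<comment> \<open>The fibre integrals of \<open>f\<^sub>i\<close> are at most \<open>1\<close> and tend to \<open>1\<close>: dominated convergence.\<close>
  moreover have "m (comp_measure G H mu eta) = 1" if eta: "unit_prob G eta" for eta
  proof -
    have se: "sets eta = sets (borel_of (unit_top G))" and e1: "emeasure eta (space eta) = 1"
      using eta by (auto simp: unit_prob_def)
    have fin: "finite_measure eta" by standard (simp add: e1)
    interpret finite_measure eta by (rule fin)
    have sp: "space eta = units G" using sets_eq_imp_space_eq[OF se] topspace_unit by simp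
    have meas: "(\<lambda>u. LINT w|mu u. f i w) \<in> borel_measurable eta" for i
      using measurable_borel_of_continuous[OF Q.cont_real[OF f(1)]] measurable_cong_sets[OF se refl] by blast
    have ptw: "(\<lambda>i. LINT w|mu u. f i w) \<longlonglongrightarrow> 1" if u: "u \<in> units G" for u
    proof -
      have "compactin (unit_top G) {u}" using u by (simp add: topspace_unit)
      from tendsto_uniform_limitI[OF total[OF this], of u] show ?thesis by simp
    qed
    have "(\<lambda>i. LINT u|eta. LINT w|mu u. f i w) \<longlonglongrightarrow> (LINT u|eta. 1)"
    proof (rule integral_dominated_convergence[where w = "\<lambda>_. 1"])
      show "AE u in eta. (\<lambda>i. LINT w|mu u. f i w) \<longlonglongrightarrow> 1" using ptw sp by (intro AE_I2) auto
      show "AE u in eta. norm (LINT w|mu u. f i w) \<le> 1" for i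
      proof (rule AE_I2)
        fix u assume "u \<in> space eta"
        moreover have "0 \<le> (LINT w|mu u. f i w)" using f(2) by (intro integral_nonneg_AE) auto
        ultimately show "norm (LINT w|mu u. f i w) \<le> 1" using f(3)[of u i] sp by simp
      qed
    qed (use meas in auto)
    then have lim: "(\<lambda>i. LINT u|eta. LINT w|mu u. f i w) \<longlonglongrightarrow> 1" using e1 by (simp add: measure_def)
    have "comp_measure G H mu eta (fc i) = complex_of_real (LINT u|eta. LINT w|mu u. f i w)" for i
    proof -
      have "comp_measure G H mu eta (fc i) = (LINT u|eta. complex_of_real (LINT w|mu u. f i w))"
        using fc[of i] unfolding comp_measure_def by (simp add: fc_def)
      then show ?thesis by simp
    qed
    then have "(\<lambda>i. comp_measure G H mu eta (fc i)) \<longlonglongrightarrow> 1" using tendsto_of_real[OF lim] by simp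
    then show ?thesis by (rule lim1[OF comp_measure_dual[OF fin se]])
  qed
  \<comment> \<open>For \<open>y\<close> in the support of \<open>g\<close> the translates of \<open>f\<^sub>i\<close> are eventually close to \<open>f\<^sub>i\<close>, so
      \<open>L(g) f\<^sub>i - \<lambda>(g) f\<^sub>i\<close> tends to \<open>0\<close> in norm and hence under every \<open>\<nu>\<close>.\<close>
  moreover have "conv_bidual G lam H mu g m = smult_bidual G H mu (haar_int lam g) m" if g: "g \<in> Cc (top_of G)" for g
  proof
    fix \<nu>
    show "conv_bidual G lam H mu g m \<nu> = smult_bidual G H mu (haar_int lam g) m \<nu>"
    proof (cases "\<nu> \<in> ?E")
      case False
      then show ?thesis by (simp add: conv_bidual_def smult_bidual_def transpose_on_def)
    next
      case True
      obtain B where B: "B > 0" "\<And>u. u \<in> units G \<Longrightarrow> (LINT y|lam u. cmod (g y)) \<le> B"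
          "\<And>u. u \<in> units G \<Longrightarrow> cmod (haar_int lam g u) \<le> B"
        using haar_int_bound[OF g] by metis
      obtain C where C: "C > 0" "\<And>\<phi>. \<phi> \<in> Cc ?X \<Longrightarrow> cmod (\<nu> \<phi>) \<le> C * mu_norm G mu \<phi>"
        using E_dual_bound[OF True] by metis
      obtain K where K: "compactin (top_of G) K" "\<And>y. y \<notin> K \<Longrightarrow> g y = 0"
        using g unfolding Cc_iff[OF GX.Haus] by metis
      let ?s = "smult G (haar_int lam g)" and ?L = "L_op G lam H g"
      have sC: "?s (fc i) \<in> Cc ?X" for i by (intro smult_Cc continuous_haar_int g fc)
      have LC: "?L (fc i) \<in> Cc ?X" for i by (intro L_op_Cc g fc)
      have "(\<lambda>i. \<nu> (?L (fc i)) - \<nu> (?s (fc i))) \<longlonglongrightarrow> 0"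
      proof (rule LIMSEQ_I)
        fix r :: real assume r: "0 < r"
        define \<epsilon> where "\<epsilon> = r / (2 * C * B)"
        have \<epsilon>: "\<epsilon> > 0" using r B(1) C(1) by (simp add: \<epsilon>_def)
        obtain N where N: "\<And>i y. i \<ge> N \<Longrightarrow> y \<in> K \<Longrightarrow>
            \<bar>LINT w:qfibre G H (rng G y)|mu (rng G y). \<bar>f i (qact G (ginv G y) w) - f i w\<bar>\<bar> < \<epsilon>"
          using uniform_limitD[OF inv[OF K(1)] \<epsilon>] unfolding eventually_sequentially by auto
        show "\<exists>N. \<forall>i\<ge>N. cmod (\<nu> (?L (fc i)) - \<nu> (?s (fc i)) - 0) < r"
        proof (intro exI allI impI)
          fix i assume i: "i \<ge> N"
          let ?\<psi> = "\<lambda>w. ?L (fc i) w - ?s (fc i) w"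
          have \<psi>: "?\<psi> \<in> Cc ?X" by (intro Cc_diff QX.Haus LC sC)
          have "mu_norm G mu ?\<psi> \<le> \<epsilon> * B"
          proof (rule mu_norm_least)
            fix u assume u: "u \<in> units G"
            have "(LINT w|mu u. cmod (?\<psi> w)) \<le> \<epsilon> * (LINT y|lam u. cmod (g y))"
            proof (rule L_op_defect_bound[OF u g fc])
              show "0 \<le> \<epsilon>" using \<epsilon> by simp
              fix y assume y: "y \<in> fibre G u" "g y \<noteq> 0"
              then have yc: "y \<in> carr G" "rng G y = u" "y \<in> K" using K(2) by (auto simp: fibre_def)
              show "(\<integral>\<^sup>+w. indicator (qfibre G H u) w * ennreal (cmod (fc i (qact G (ginv G y) w) - fc i w)) \<partial>mu u) \<le> ennreal \<epsilon>"
                using translate_diff_nn_integral[OF yc(1) f(1)] N[OF i yc(3)] unfolding fc_def yc(2)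
                by (simp add: ennreal_leI)
            qed
            also have "\<dots> \<le> \<epsilon> * B" using B(2)[OF u] \<epsilon> by simp
            finally show "(LINT w|mu u. cmod (?\<psi> w)) \<le> \<epsilon> * B" .
          qed
          then have "C * mu_norm G mu ?\<psi> \<le> C * (\<epsilon> * B)" using C(1) by simp
          then have "cmod (\<nu> ?\<psi>) \<le> C * (\<epsilon> * B)" using C(2)[OF \<psi>] by simp
          also have "\<dots> = r / 2" using C(1) B(1) by (simp add: \<epsilon>_def)
          also have "\<dots> < r" using r by simp
          finally show "cmod (\<nu> (?L (fc i)) - \<nu> (?s (fc i)) - 0) < r"
            using E_dual_diff[OF True LC sC] by simp
        qed
      qed
      note diff = this
      have tr: "transpose_on (Cc ?X) ?s \<nu> \<in> ?E"
        by (rule transpose_smult[OF True continuous_haar_int[OF g] B(3)])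
      from diff have "(\<lambda>i. transpose_on (Cc ?X) ?L \<nu> (fc i) - transpose_on (Cc ?X) ?s \<nu> (fc i)) \<longlonglongrightarrow> 0"
        using fc by (simp add: transpose_on_def)
      then have "m (transpose_on (Cc ?X) ?L \<nu>) = m (transpose_on (Cc ?X) ?s \<nu>)"
        by (rule lim2[OF transpose_L_op[OF True g] tr])
      then show ?thesis using True by (simp add: conv_bidual_apply smult_bidual_apply)
    qed
  qed
  ultimately show ?thesis unfolding topological_invariant_mean_def by blast
qed

end

section \<open>Functions of integral one on a compact set of units\<close>

context groupoid_quotient
begin

lemma unit_in_fibre: "u \<in> units G \<Longrightarrow> u \<in> fibre G u"
  by (simp add: fibre_def units_carr rng_unit)

text \<open>
  Start from a bump function \<open>g\<close> that is \<open>1\<close> on \<open>C\<close>. Its fibre integral \<open>F\<close> is continuous, and it is positive on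
  \<open>C\<close> because a unit lies in the support of the measure over it. Dividing \<open>g\<close> by \<open>max F c\<close>, where \<open>c > 0\<close> is a lower
  bound of \<open>F\<close> on \<open>C\<close>, normalises it over \<open>C\<close> without exceeding \<open>1\<close> elsewhere.
\<close>

lemma normalized_function:
  assumes C: "compactin (unit_top G) C"
  obtains f :: "'g \<Rightarrow> real" where "f \<in> Cc (top_of G)" "\<And>x. 0 \<le> f x"
    "\<And>u. u \<in> units G \<Longrightarrow> (LINT x|lam u. f x) \<le> 1" "\<And>u. u \<in> C \<Longrightarrow> (LINT x|lam u. f x) = 1"
proof -
  have CU: "C \<subseteq> units G" using compactin_subset_topspace[OF C] by (simp add: topspace_unit)
  have CT: "compactin (top_of G) C" using C by (simp add: unit_top_def compactin_subtopology)
  obtain g :: "'g \<Rightarrow> real" where g: "g \<in> Cc (top_of G)" "\<And>x. 0 \<le> g x" "\<And>x. x \<in> C \<Longrightarrow> g x = 1"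
    using GX.Cc_Urysohn[OF CT openin_topspace compactin_subset_topspace[OF CT]] by metis
  define F where "F = (\<lambda>u. LINT x|lam u. g x)"
  have F: "continuous_map (unit_top G) euclidean F" unfolding F_def by (rule L.cont_real[OF g(1)])
  have Fpos: "0 < F u" if u: "u \<in> C" for u
  proof -
    have uu: "u \<in> units G" using u CU by auto
    have "u \<in> measure_support (top_of G) (lam u)"
      using L.supp[unfolded topspace_unit, OF uu] unit_in_fibre[OF uu] by (simp add: fibre_def)
    then show ?thesis unfolding F_def
      using radon_support_integral_pos[OF haar_fib(9)[OF uu] GX.Haus g(1,2)] g(3)[OF u] by simp
  qed
  obtain c where c: "c > 0" "\<And>u. u \<in> C \<Longrightarrow> c \<le> F u"
  proof (cases "C = {}")
    case True then show ?thesis using that[of 1] by simp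
  next
    case False
    have "compact (F ` C)" using image_compactin[OF C F] by simp
    then obtain t where "t \<in> F ` C" "\<And>s. s \<in> F ` C \<Longrightarrow> t \<le> s"
      using compact_attains_inf[of "F ` C"] False by auto
    then show ?thesis using that[of t] Fpos by auto
  qed
  have F0: "0 \<le> F u" for u unfolding F_def using g(2) by simp
  define k where "k = (\<lambda>x. inverse (max (F (rng G x)) c))"
  have "continuous_map (top_of G) euclidean (\<lambda>x. F (rng G x))"
    using continuous_map_compose[OF continuous_rng_unit F] by (simp add: o_def)
  then have k: "continuous_map (top_of G) euclidean k"
    using c(1) unfolding k_def continuous_map_euclidean_iff_tendsto
    by (intro ballI tendsto_inverse tendsto_max) auto
  have int: "(LINT x|lam u. k x * g x) = F u / max (F u) c" if u: "u \<in> units G" for u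
  proof -
    have "(LINT x|lam u. k x * g x) = (LINT x|lam u. inverse (max (F u) c) * g x)"
    proof (rule integral_cong_AE)
      show "AE x in lam u. k x * g x = inverse (max (F u) c) * g x"
        using haar_fib(3)[OF u] by eventually_elim (simp add: k_def fibre_def)
      show "(\<lambda>x. k x * g x) \<in> borel_measurable (lam u)"
        by (rule borel_measurable_integrable[OF haar_fib(5)[OF u Cc_mult[OF GX.Haus g(1) k]]])
      show "(\<lambda>x. inverse (max (F u) c) * g x) \<in> borel_measurable (lam u)"
        by (rule borel_measurable_integrable[OF haar_fib(5)[OF u Cc_scale[OF GX.Haus g(1)]]])
    qed
    also have "\<dots> = F u / max (F u) c" by (simp add: F_def divide_inverse mult.commute)
    finally show ?thesis .
  qed
  show ?thesis
  proof (rule that)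
    show "(\<lambda>x. k x * g x) \<in> Cc (top_of G)" by (rule Cc_mult[OF GX.Haus g(1) k])
    show "0 \<le> k x * g x" for x using g(2) c(1) by (simp add: k_def)
    show "(LINT x|lam u. k x * g x) \<le> 1" if "u \<in> units G" for u
      unfolding int[OF that] using c(1) by (simp add: field_simps max_def)
    show "(LINT x|lam u. k x * g x) = 1" if "u \<in> C" for u
    proof -
      have "u \<in> units G" "max (F u) c = F u" using that CU c(2)[OF that] by auto
      then show ?thesis using int[of u] Fpos[OF that] by simp
    qed
  qed
qed

end

section \<open>From a mean to approximately invariant functions\<close>

abbreviation cplx :: "('x \<Rightarrow> real) \<Rightarrow> 'x \<Rightarrow> complex" where
  "cplx f \<equiv> (\<lambda>x. complex_of_real (f x))"

context inhabited_groupoid_quotient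
begin

lemma L_op_real:
  "L_op G lam H (cplx h) (cplx \<phi>) w = complex_of_real (Re (L_op G lam H (cplx h) (cplx \<phi>) w))"
proof (cases "w \<in> cosets G H")
  case True
  have "L_op G lam H (cplx h) (cplx \<phi>) w =
      (LINT y:fibre G (qrng G w)|lam (qrng G w). complex_of_real (h y * \<phi> (qact G (ginv G y) w)))"
    using True by (simp add: L_op_def)
  then show ?thesis unfolding set_integral_complex_of_real by simp
qed (simp add: L_op_def)

text \<open>
  The expression is real valued for real arguments, so taking the real part discards nothing. It produces a
  real function, to which the separation argument applies.
\<close>

definition defect :: "('a \<Rightarrow> real) \<Rightarrow> ('a set \<Rightarrow> real) \<Rightarrow> 'a set \<Rightarrow> real" where
  "defect h \<phi> w = Re (L_op G lam H (cplx h) (cplx \<phi>) w - smult G (haar_int lam (cplx h)) (cplx \<phi>) w)"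

lemma defect_complex:
  "L_op G lam H (cplx h) (cplx \<phi>) w - smult G (haar_int lam (cplx h)) (cplx \<phi>) w = complex_of_real (defect h \<phi> w)"
proof -
  have "smult G (haar_int lam (cplx h)) (cplx \<phi>) w = complex_of_real ((LINT x|lam (qrng G w). h x) * \<phi> w)"
    by (simp add: smult_def haar_int_def)
  then show ?thesis unfolding defect_def by (subst (1 2) L_op_real) (simp only: of_real_diff[symmetric] Re_complex_of_real)
qed

lemma defect_Cc: "h \<in> Cc (top_of G) \<Longrightarrow> \<phi> \<in> Cc (quot_top G H) \<Longrightarrow> defect h \<phi> \<in> Cc (quot_top G H)"
  unfolding defect_def
  by (intro Cc_Re QX.Haus Cc_diff L_op_Cc smult_Cc continuous_haar_int Cc_of_real GX.Haus)

lemma defect_linear: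
  assumes h: "h \<in> Cc (top_of G)" and \<phi>: "\<phi> \<in> Cc (quot_top G H)" and \<psi>: "\<psi> \<in> Cc (quot_top G H)"
  shows "defect h (\<lambda>w. u * \<phi> w + v * \<psi> w) = (\<lambda>w. u * defect h \<phi> w + v * defect h \<psi> w)"
proof
  fix w
  have c: "cplx h \<in> Cc (top_of G)" "cplx \<phi> \<in> Cc (quot_top G H)" "cplx \<psi> \<in> Cc (quot_top G H)"
    by (intro Cc_of_real QX.Haus GX.Haus h \<phi> \<psi>)+
  have "L_op G lam H (cplx h) (\<lambda>w. of_real u * cplx \<phi> w + of_real v * cplx \<psi> w) =
     (\<lambda>w. of_real u * L_op G lam H (cplx h) (cplx \<phi>) w + of_real v * L_op G lam H (cplx h) (cplx \<psi>) w)"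
    by (subst L_op_add[OF c(1)]) (intro Cc_scale QX.Haus c, intro Cc_scale QX.Haus c, simp only: L_op_scale)
  note Lc = this
  have L: "L_op G lam H (cplx h) (cplx (\<lambda>w. u * \<phi> w + v * \<psi> w)) w =
     of_real u * L_op G lam H (cplx h) (cplx \<phi>) w + of_real v * L_op G lam H (cplx h) (cplx \<psi>) w"
    unfolding of_real_add of_real_mult by (rule fun_cong[OF Lc])
  let ?k = "haar_int lam (cplx h)"
  have S: "smult G ?k (cplx (\<lambda>w. u * \<phi> w + v * \<psi> w)) w = of_real u * smult G ?k (cplx \<phi>) w + of_real v * smult G ?k (cplx \<psi>) w"
    by (simp add: smult_def algebra_simps)
  have "complex_of_real (defect h (\<lambda>w. u * \<phi> w + v * \<psi> w) w) =
      of_real u * (L_op G lam H (cplx h) (cplx \<phi>) w - smult G ?k (cplx \<phi>) w)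
      + of_real v * (L_op G lam H (cplx h) (cplx \<psi>) w - smult G ?k (cplx \<psi>) w)"
    by (rule trans[OF defect_complex[symmetric]]) (rule trans[OF arg_cong2[OF L S, of minus]], simp add: algebra_simps)
  also have "\<dots> = complex_of_real (u * defect h \<phi> w + v * defect h \<psi> w)"
    unfolding defect_complex by simp
  finally have "complex_of_real (defect h (\<lambda>w. u * \<phi> w + v * \<psi> w) w) = complex_of_real (u * defect h \<phi> w + v * defect h \<psi> w)" .
  then show "defect h (\<lambda>w. u * \<phi> w + v * \<psi> w) w = u * defect h \<phi> w + v * defect h \<psi> w"
    by (simp only: of_real_eq_iff)
qed

lemma fun_subspace_Cc: "fun_subspace (Cc (quot_top G H))"
  unfolding fun_subspace_def by (auto intro: Cc_zero Cc_add Cc_scale QX.Haus)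

lemma sublinear_mu_norm: "sublinear_on (Cc (quot_top G H)) (\<lambda>\<psi>. mu_norm G mu (cplx \<psi>))"
  unfolding sublinear_on_def
proof (intro conjI ballI allI impI)
  fix \<phi> :: "'a set \<Rightarrow> real" assume \<phi>: "\<phi> \<in> Cc (quot_top G H)"
  have c\<phi>: "cplx \<phi> \<in> Cc (quot_top G H)" by (intro Cc_of_real QX.Haus \<phi>)
  show "mu_norm G mu (cplx (\<lambda>x. c * \<phi> x)) \<le> c * mu_norm G mu (cplx \<phi>)" if c: "0 \<le> c" for c
  proof (rule mu_norm_least)
    fix u assume u: "u \<in> units G"
    have "(LINT w|mu u. cmod (cplx (\<lambda>x. c * \<phi> x) w)) = c * (LINT w|mu u. cmod (cplx \<phi> w))"
      using c by (simp add: norm_mult)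
    also have "\<dots> \<le> c * mu_norm G mu (cplx \<phi>)" using mu_norm_upper[OF c\<phi> u] c by (rule mult_left_mono)
    finally show "(LINT w|mu u. cmod (cplx (\<lambda>x. c * \<phi> x) w)) \<le> c * mu_norm G mu (cplx \<phi>)" .
  qed
  fix \<psi> :: "'a set \<Rightarrow> real" assume \<psi>: "\<psi> \<in> Cc (quot_top G H)"
  have c\<psi>: "cplx \<psi> \<in> Cc (quot_top G H)" by (intro Cc_of_real QX.Haus \<psi>)
  show "mu_norm G mu (cplx (\<lambda>x. \<phi> x + \<psi> x)) \<le> mu_norm G mu (cplx \<phi>) + mu_norm G mu (cplx \<psi>)"
  proof (rule mu_norm_least)
    fix u assume u: "u \<in> units G"
    have i: "integrable (mu u) (\<lambda>w. \<bar>\<phi> w\<bar>)" "integrable (mu u) (\<lambda>w. \<bar>\<psi> w\<bar>)" "integrable (mu u) (\<lambda>w. \<bar>\<phi> w + \<psi> w\<bar>)"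
      by (intro quot_fib(5)[OF u] Cc_abs Cc_add QX.Haus \<phi> \<psi>)+
    have "(LINT w|mu u. \<bar>\<phi> w + \<psi> w\<bar>) \<le> (LINT w|mu u. \<bar>\<phi> w\<bar> + \<bar>\<psi> w\<bar>)"
      by (intro integral_mono i Bochner_Integration.integrable_add) auto
    also have "\<dots> = (LINT w|mu u. \<bar>\<phi> w\<bar>) + (LINT w|mu u. \<bar>\<psi> w\<bar>)" by (rule Bochner_Integration.integral_add[OF i(1,2)])
    finally show "(LINT w|mu u. cmod (cplx (\<lambda>x. \<phi> x + \<psi> x) w)) \<le> mu_norm G mu (cplx \<phi>) + mu_norm G mu (cplx \<psi>)"
      using mu_norm_upper[OF c\<phi> u] mu_norm_upper[OF c\<psi> u] by (simp flip: of_real_add)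
  qed
qed

text \<open>
  Separation produces real functionals, while the dual of \<open>\<E>\<close> consists of complex ones.
\<close>

definition complexify :: "(('a set \<Rightarrow> real) \<Rightarrow> real) \<Rightarrow> ('a set \<Rightarrow> complex) \<Rightarrow> complex" where
  "complexify \<nu> g = (if g \<in> Cc (quot_top G H) then
     complex_of_real (\<nu> (\<lambda>w. Re (g w))) + \<i> * complex_of_real (\<nu> (\<lambda>w. Im (g w))) else 0)"

text \<open>
  Real and imaginary part of \<open>g\<close> have norm at most that of \<open>g\<close>, which bounds the complexification by twice
  the norm.
\<close>

lemma complexify_dual:
  assumes lin: "linear_fun_on (Cc (quot_top G H)) \<nu>"
    and le: "\<And>\<psi>. \<psi> \<in> Cc (quot_top G H) \<Longrightarrow> \<nu> \<psi> \<le> mu_norm G mu (cplx \<psi>)"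
  shows "complexify \<nu> \<in> E_dual G H mu"
    and "\<psi> \<in> Cc (quot_top G H) \<Longrightarrow> complexify \<nu> (cplx \<psi>) = complex_of_real (\<nu> \<psi>)"
proof -
  have add: "\<nu> (\<lambda>w. f w + g w) = \<nu> f + \<nu> g" and scale: "\<nu> (\<lambda>w. c * f w) = c * \<nu> f"
    if "f \<in> Cc (quot_top G H)" "g \<in> Cc (quot_top G H)" for f g c
    using lin that unfolding linear_fun_on_def by auto
  have zero: "\<nu> (\<lambda>w. 0) = 0" using scale[OF Cc_zero[OF QX.Haus] Cc_zero[OF QX.Haus], of 0] by simp
  show "complexify \<nu> (cplx \<psi>) = complex_of_real (\<nu> \<psi>)" if "\<psi> \<in> Cc (quot_top G H)"
    using Cc_of_real[OF QX.Haus that] by (simp add: complexify_def zero)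
  have abs: "\<bar>\<nu> \<psi>\<bar> \<le> mu_norm G mu (cplx \<psi>)" if \<psi>: "\<psi> \<in> Cc (quot_top G H)" for \<psi>
  proof -
    have "(\<lambda>w. (-1) * \<psi> w) \<in> Cc (quot_top G H)" by (intro Cc_scale QX.Haus \<psi>)
    from le[OF this] have "- \<nu> \<psi> \<le> mu_norm G mu (cplx (\<lambda>w. (-1) * \<psi> w))" using scale[OF \<psi> \<psi>, of "-1"] by simp
    also have "\<dots> = mu_norm G mu (cplx \<psi>)" by (simp add: mu_norm_def)
    finally show ?thesis using le[OF \<psi>] by simp
  qed
  have part: "\<bar>\<nu> (\<lambda>w. r (g w))\<bar> \<le> mu_norm G mu g"
    if g: "g \<in> Cc (quot_top G H)" and r: "(\<lambda>w. r (g w)) \<in> Cc (quot_top G H)" "\<And>z. \<bar>r z\<bar> \<le> cmod z"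
    for g :: "'a set \<Rightarrow> complex" and r :: "complex \<Rightarrow> real"
  proof -
    have "mu_norm G mu (cplx (\<lambda>w. r (g w))) \<le> mu_norm G mu g"
    proof (rule mu_norm_least)
      fix u assume u: "u \<in> units G"
      have "(LINT w|mu u. \<bar>r (g w)\<bar>) \<le> (LINT w|mu u. cmod (g w))"
        by (intro integral_mono quot_fib(5)[OF u] Cc_abs Cc_norm QX.Haus g r)
      then show "(LINT w|mu u. cmod (cplx (\<lambda>w. r (g w)) w)) \<le> mu_norm G mu g"
        using mu_norm_upper[OF g u] by simp
    qed
    then show ?thesis using abs[OF r(1)] by simp
  qed
  show "complexify \<nu> \<in> E_dual G H mu"
  proof (rule E_dualI[where C = 2])
    fix g :: "'a set \<Rightarrow> complex" assume g: "g \<in> Cc (quot_top G H)"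
    have R: "(\<lambda>w. Re (g w)) \<in> Cc (quot_top G H)" and I: "(\<lambda>w. Im (g w)) \<in> Cc (quot_top G H)"
      by (intro Cc_Re Cc_Im QX.Haus g)+
    show "cmod (complexify \<nu> g) \<le> 2 * mu_norm G mu g"
    proof -
      have "cmod (complexify \<nu> g) \<le> \<bar>\<nu> (\<lambda>w. Re (g w))\<bar> + \<bar>\<nu> (\<lambda>w. Im (g w))\<bar>"
        using g norm_triangle_ineq[of "complex_of_real (\<nu> (\<lambda>w. Re (g w)))" "\<i> * complex_of_real (\<nu> (\<lambda>w. Im (g w)))"]
        by (simp add: complexify_def norm_mult)
      then show ?thesis using part[OF g R abs_Re_le_cmod] part[OF g I abs_Im_le_cmod] by linarith
    qed
    show "complexify \<nu> (\<lambda>w. c * g w) = c * complexify \<nu> g" for c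
    proof -
      have "\<nu> (\<lambda>w. Re c * Re (g w) + (- Im c) * Im (g w)) = Re c * \<nu> (\<lambda>w. Re (g w)) + (- Im c) * \<nu> (\<lambda>w. Im (g w))"
        using add[OF Cc_scale[OF QX.Haus R, of "Re c"] Cc_scale[OF QX.Haus I, of "- Im c"]] scale[OF R R, of "Re c"] scale[OF I I, of "- Im c"] by simp
      moreover have "\<nu> (\<lambda>w. Re c * Im (g w) + Im c * Re (g w)) = Re c * \<nu> (\<lambda>w. Im (g w)) + Im c * \<nu> (\<lambda>w. Re (g w))"
        using add[OF Cc_scale[OF QX.Haus I, of "Re c"] Cc_scale[OF QX.Haus R, of "Im c"]] scale[OF I I, of "Re c"] scale[OF R R, of "Im c"] by simp
      ultimately show ?thesis
        using g Cc_scale[OF QX.Haus g, of c] by (simp add: complexify_def complex_eq_iff)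
    qed
    fix f :: "'a set \<Rightarrow> complex" assume f: "f \<in> Cc (quot_top G H)"
    have R': "(\<lambda>w. Re (f w)) \<in> Cc (quot_top G H)" and I': "(\<lambda>w. Im (f w)) \<in> Cc (quot_top G H)"
      by (intro Cc_Re Cc_Im QX.Haus f)+
    show "complexify \<nu> (\<lambda>w. g w + f w) = complexify \<nu> g + complexify \<nu> f"
      using g f Cc_add[OF QX.Haus g f] add[OF R R'] add[OF I I'] by (simp add: complexify_def distrib_left)
  qed (simp add: complexify_def)
qed

lemma E_dual_integral_eq:
  assumes \<Phi>: "\<Phi> \<in> E_dual G H mu" and M: "radon_measure (quot_top G H) M"
    and eq: "\<And>\<phi>. \<phi> \<in> Cc (quot_top G H) \<Longrightarrow> \<Phi> (cplx \<phi>) = complex_of_real (LINT w|M. \<phi> w)"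
    and g: "g \<in> Cc (quot_top G H)"
  shows "\<Phi> g = (LINT w|M. g w)"
proof -
  have R: "(\<lambda>w. Re (g w)) \<in> Cc (quot_top G H)" and I: "(\<lambda>w. Im (g w)) \<in> Cc (quot_top G H)"
    by (intro Cc_Re Cc_Im QX.Haus g)+
  have "\<Phi> g = \<Phi> (\<lambda>w. cplx (\<lambda>w. Re (g w)) w + \<i> * cplx (\<lambda>w. Im (g w)) w)" by (simp flip: complex_eq)
  also have "\<dots> = \<Phi> (cplx (\<lambda>w. Re (g w))) + \<i> * \<Phi> (cplx (\<lambda>w. Im (g w)))"
    using E_dualD(1)[OF \<Phi> Cc_of_real[OF QX.Haus R] Cc_scale[OF QX.Haus Cc_of_real[OF QX.Haus I], of \<i>]]
      E_dualD(2)[OF \<Phi> Cc_of_real[OF QX.Haus I], of \<i>] by simp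
  also have "\<dots> = complex_of_real (LINT w|M. Re (g w)) + \<i> * complex_of_real (LINT w|M. Im (g w))"
    by (simp only: eq[OF R] eq[OF I])
  also have "\<dots> = (LINT w|M. g w)"
    using radon_Cc_integrable[OF M QX.Haus g] by (simp add: complex_eq_iff)
  finally show ?thesis .
qed

lemma mean_linear:
  assumes "m \<in> E_bidual G H mu"
  shows "\<nu> \<in> E_dual G H mu \<Longrightarrow> \<nu>' \<in> E_dual G H mu \<Longrightarrow> m (\<lambda>\<phi>. \<nu> \<phi> + \<nu>' \<phi>) = m \<nu> + m \<nu>'"
    and "\<nu> \<in> E_dual G H mu \<Longrightarrow> m (\<lambda>\<phi>. c * \<nu> \<phi>) = c * m \<nu>"
  using assms unfolding E_bidual_def dual_def by auto

lemma mean_sum: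
  assumes m: "m \<in> E_bidual G H mu" and J: "finite J" "\<And>j. j \<in> J \<Longrightarrow> F j \<in> E_dual G H mu"
  shows "(\<lambda>\<phi>. \<Sum>j\<in>J. F j \<phi>) \<in> E_dual G H mu \<and> m (\<lambda>\<phi>. \<Sum>j\<in>J. F j \<phi>) = (\<Sum>j\<in>J. m (F j))"
  using J
proof (induction J rule: finite_induct)
  case empty
  show ?case using zero_E_dual mean_linear(2)[OF m zero_E_dual, of 0] by simp
next
  case (insert i J)
  then show ?case using E_dual_add[of "F i" "\<lambda>\<phi>. \<Sum>j\<in>J. F j \<phi>"] mean_linear(1)[OF m, of "F i" "\<lambda>\<phi>. \<Sum>j\<in>J. F j \<phi>"]
    by simp
qed

text \<open>
  Rescaling reduces a finite measure to a probability measure; this allows the measures provided by the Riesz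
  theorem to be fed to a mean.
\<close>

lemma mean_comp_measure:
  assumes m: "topological_invariant_mean G lam H mu m"
    and eta: "finite_measure eta" "sets eta = sets (borel_of (unit_top G))"
  shows "m (comp_measure G H mu eta) = complex_of_real (measure eta (space eta))"
proof -
  interpret finite_measure eta by (rule eta)
  have mb: "m \<in> E_bidual G H mu" and prob: "\<And>eta. unit_prob G eta \<Longrightarrow> m (comp_measure G H mu eta) = 1"
    using m unfolding topological_invariant_mean_def by auto
  let ?c = "measure eta (space eta)"
  show ?thesis
  proof (cases "?c = 0")
    case True
    then have "emeasure eta (space eta) = 0" by (simp add: emeasure_eq_measure)
    then have ae: "AE u in eta. P u" for P by (intro AE_I[of _ _ "space eta"]) auto
    have "comp_measure G H mu eta = (\<lambda>\<phi>. 0)"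
      by (rule ext) (simp add: comp_measure_def integral_eq_zero_AE[OF ae])
    then show ?thesis using True mean_linear(2)[OF mb zero_E_dual, of 0] by simp
  next
    case False
    then have c: "?c > 0" by (simp add: zero_less_measure_iff)
    define eta' where "eta' = density eta (\<lambda>u. ennreal (1 / ?c))"
    have se: "sets eta' = sets (borel_of (unit_top G))" by (simp add: eta'_def eta(2))
    have "emeasure eta' (space eta') = ennreal (1 / ?c) * emeasure eta (space eta)"
      unfolding eta'_def by (subst emeasure_density) (auto simp: nn_integral_cmult_indicator)
    also have "\<dots> = 1" using c by (simp add: emeasure_eq_measure ennreal_mult[symmetric])
    finally have up: "unit_prob G eta'" using se by (simp add: unit_prob_def)
    have fin': "finite_measure eta'" using up by (intro finite_measureI) (simp add: unit_prob_def)
    have "comp_measure G H mu eta = (\<lambda>\<phi>. complex_of_real ?c * comp_measure G H mu eta' \<phi>)"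
    proof
      fix \<phi>
      show "comp_measure G H mu eta \<phi> = complex_of_real ?c * comp_measure G H mu eta' \<phi>"
      proof (cases "\<phi> \<in> Cc (quot_top G H)")
        case True
        have "(LINT u|eta'. LINT w|mu u. \<phi> w) = (LINT u|eta. (1 / ?c) *\<^sub>R (LINT w|mu u. \<phi> w))"
          unfolding eta'_def
          using borel_measurable_integrable[OF comp_measure_integrable[OF eta True]] c
          by (intro integral_density) auto
        then show ?thesis using True c by (simp add: comp_measure_def scaleR_conv_of_real)
      qed (simp add: comp_measure_def)
    qed
    then show ?thesis using mean_linear(2)[OF mb comp_measure_dual[OF fin' se], of "complex_of_real ?c"] prob[OF up]
      by simp
  qed
qed

text \<open>
  The three summands measure the excess of the fibre integrals of \<open>\<phi>\<close> over \<open>1\<close>, their deficit on \<open>K\<close>, and the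
  failure of invariance. Suppose that their sum is at least \<open>e\<close> for all \<open>\<phi> \<ge> 0\<close>. Each summand is a sublinear functional of
  an affine function of \<open>\<phi>\<close>, so Mazur--Orlicz replaces them by linear functionals \<open>\<beta>\<close>, \<open>\<alpha>\<close> and \<open>\<nu> h\<close>. Scaling \<open>\<phi>\<close> shows
  that the part \<open>N\<close> that is linear in \<open>\<phi>\<close> is positive, and \<open>\<phi> = 0\<close> shows that the constant part
  \<open>\<alpha>(1) - \<beta>(1)\<close> is at least \<open>e\<close>. As \<open>N\<close> is positive, the mean is nonnegative on it. As the mean is invariant, the summands
  \<open>\<nu> h (defect h \<phi>)\<close> contribute nothing, and what is left is \<open>b - a\<close>, the difference of the total masses of the measures
  representing \<open>\<beta>\<close> and \<open>\<alpha>\<close>, which is at most \<open>\<beta>(1) - \<alpha>(1) < 0\<close>.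
\<close>

lemma approximate_invariance_core:
  fixes K :: "'a set" and Hs :: "('a \<Rightarrow> real) set" and e :: real
  assumes m: "topological_invariant_mean G lam H mu m"
    and K: "compactin (unit_top G) K" "K \<noteq> {}" and Hs: "finite Hs" "Hs \<subseteq> Cc (top_of G)" and e: "0 < e"
  shows "\<exists>\<phi>\<in>Cc (quot_top G H). (\<forall>w. 0 \<le> \<phi> w) \<and>
     sup_pos (units G) (\<lambda>u. (LINT w|mu u. \<phi> w) - 1) + sup_pos K (\<lambda>u. 1 - (LINT w|mu u. \<phi> w))
       + (\<Sum>h\<in>Hs. mu_norm G mu (cplx (defect h \<phi>))) < e"
proof (rule ccontr)
  assume neg: "\<not> ?thesis"
  let ?X = "quot_top G H" and ?U = "units G" and ?E = "E_dual G H mu"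
  define A where "A = {\<phi> \<in> Cc ?X. \<forall>w. (0::real) \<le> \<phi> w}"
  define I where "I = (\<lambda>\<phi> u. if u \<in> ?U then (LINT w|mu u. (\<phi> w :: real)) else 0)"
  define P where "P = (\<lambda>\<psi>. mu_norm G mu (cplx \<psi>))"
  define p1 where "p1 = (\<lambda>\<phi> u. I \<phi> u - 1)"
  define p2 where "p2 = (\<lambda>\<phi> u. 1 - I \<phi> u)"
  let ?B = "bounded_fun_on ?U"
  have KU: "K \<subseteq> ?U" using compactin_subset_topspace[OF K(1)] by (simp add: topspace_unit)
  note BD = fun_subspaceD[OF fun_subspace_bounded[of ?U]]
  have ICc: "I \<phi> \<in> Cc (unit_top G)" if "\<phi> \<in> Cc ?X" for \<phi>
    using Q.integral_Cc_real[OF that] by (simp add: I_def topspace_unit)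
  have CcB: "k \<in> ?B" if k: "k \<in> Cc (unit_top G)" for k :: "'a \<Rightarrow> real"
  proof -
    obtain C where "\<And>x. norm (k x) \<le> C" using Cc_bounded[OF UX.Haus k] by metis
    then show ?thesis by (auto simp: bounded_fun_on_def)
  qed
  have oneB: "(\<lambda>u. 1) \<in> ?B" by (auto simp: bounded_fun_on_def)
  have IB: "I \<phi> \<in> ?B" if "\<phi> \<in> Cc ?X" for \<phi> by (rule CcB[OF ICc[OF that]])
  have Ilin: "I (\<lambda>w. u * \<phi> w + v * \<psi> w) = (\<lambda>x. u * I \<phi> x + v * I \<psi> x)"
    if "\<phi> \<in> Cc ?X" "\<psi> \<in> Cc ?X" for u v \<phi> \<psi>
  proof
    fix x show "I (\<lambda>w. u * \<phi> w + v * \<psi> w) x = u * I \<phi> x + v * I \<psi> x"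
      using quot_fib(5)[OF _ that(1), of x] quot_fib(5)[OF _ that(2), of x] by (simp add: I_def)
  qed
  have ACc: "\<phi> \<in> Cc ?X" if "\<phi> \<in> A" for \<phi> using that by (simp add: A_def)
  have Ane: "A \<noteq> {}" using Cc_zero[OF QX.Haus] by (auto simp: A_def)
  have Aconv: "(\<lambda>w. u * \<phi> w + v * \<psi> w) \<in> A" if "\<phi> \<in> A" "\<psi> \<in> A" "0 \<le> u" "0 \<le> v" for \<phi> \<psi> u v
    using that by (auto simp: A_def intro!: Cc_add Cc_scale QX.Haus)
  have p1B: "p1 \<phi> \<in> ?B" "p2 \<phi> \<in> ?B" if "\<phi> \<in> A" for \<phi>
    unfolding p1_def p2_def by (intro BD(5) IB ACc that oneB)+
  have p1lin: "p1 (\<lambda>w. u * \<phi> w + v * \<psi> w) = (\<lambda>x. u * p1 \<phi> x + v * p1 \<psi> x)"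
    and p2lin: "p2 (\<lambda>w. u * \<phi> w + v * \<psi> w) = (\<lambda>x. u * p2 \<phi> x + v * p2 \<psi> x)"
    if "\<phi> \<in> A" "\<psi> \<in> A" "0 \<le> u" "0 \<le> v" "u + v = 1" for \<phi> \<psi> u v
  proof -
    have one: "(1::real) = u + v" using that by simp
    show "p1 (\<lambda>w. u * \<phi> w + v * \<psi> w) = (\<lambda>x. u * p1 \<phi> x + v * p1 \<psi> x)"
      and "p2 (\<lambda>w. u * \<phi> w + v * \<psi> w) = (\<lambda>x. u * p2 \<phi> x + v * p2 \<psi> x)"
      unfolding p1_def p2_def Ilin[OF ACc[OF that(1)] ACc[OF that(2)]] by (subst one, simp add: algebra_simps fun_eq_iff)+
  qed
  have sub1: "sublinear_on ?B (sup_pos ?U)" using units_nonempty by (intro sublinear_sup_pos) auto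
  have sub2: "sublinear_on ?B (sup_pos K)" using K(2) KU by (intro sublinear_sup_pos) auto
  have subP: "sublinear_on (Cc ?X) P" unfolding P_def by (rule sublinear_mu_norm)
  have low0: "e \<le> sup_pos ?U (p1 \<phi>) + (sup_pos K (p2 \<phi>) + (\<Sum>h\<in>Hs. P (defect h \<phi>)))" if \<phi>: "\<phi> \<in> A" for \<phi>
  proof -
    have "sup_pos ?U (p1 \<phi>) = sup_pos ?U (\<lambda>u. (LINT w|mu u. \<phi> w) - 1)"
      "sup_pos K (p2 \<phi>) = sup_pos K (\<lambda>u. 1 - (LINT w|mu u. \<phi> w))"
      using KU unfolding sup_pos_def p1_def p2_def I_def by (intro SUP_cong; auto)+
    then show ?thesis using neg \<phi> by (force simp: A_def P_def not_less)
  qed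
  have convS: "(\<Sum>h\<in>Hs. P (defect h (\<lambda>w. u * \<phi> w + v * \<psi> w))) \<le> u * (\<Sum>h\<in>Hs. P (defect h \<phi>)) + v * (\<Sum>h\<in>Hs. P (defect h \<psi>))"
    if "\<phi> \<in> A" "\<psi> \<in> A" "0 \<le> u" "0 \<le> v" for \<phi> \<psi> u v
  proof -
    have "(\<Sum>h\<in>Hs. P (defect h (\<lambda>w. u * \<phi> w + v * \<psi> w))) \<le> (\<Sum>h\<in>Hs. u * P (defect h \<phi>) + v * P (defect h \<psi>))"
    proof (rule sum_mono)
      fix h assume "h \<in> Hs"
      then have h: "h \<in> Cc (top_of G)" using Hs by auto
      have "P (defect h (\<lambda>w. u * \<phi> w + v * \<psi> w)) = P (\<lambda>w. u * defect h \<phi> w + v * defect h \<psi> w)"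
        using defect_linear[OF h ACc[OF that(1)] ACc[OF that(2)]] by simp
      also have "\<dots> \<le> P (\<lambda>w. u * defect h \<phi> w) + P (\<lambda>w. v * defect h \<psi> w)"
        by (intro sublinear_onD(1)[OF subP] Cc_scale QX.Haus defect_Cc h ACc that)
      also have "\<dots> \<le> u * P (defect h \<phi>) + v * P (defect h \<psi>)"
        by (intro add_mono sublinear_onD(2)[OF subP] defect_Cc h ACc that)
      finally show "P (defect h (\<lambda>w. u * \<phi> w + v * \<psi> w)) \<le> u * P (defect h \<phi>) + v * P (defect h \<psi>)" .
    qed
    then show ?thesis by (simp add: sum.distrib sum_distrib_left)
  qed
  have conv2: "sup_pos K (p2 (\<lambda>w. u * \<phi> w + v * \<psi> w)) \<le> u * sup_pos K (p2 \<phi>) + v * sup_pos K (p2 \<psi>)"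
    if "\<phi> \<in> A" "\<psi> \<in> A" "0 \<le> u" "0 \<le> v" "u + v = 1" for \<phi> \<psi> u v
  proof -
    have "sup_pos K (\<lambda>x. u * p2 \<phi> x + v * p2 \<psi> x) \<le> sup_pos K (\<lambda>x. u * p2 \<phi> x) + sup_pos K (\<lambda>x. v * p2 \<psi> x)"
      by (intro sublinear_onD(1)[OF sub2] BD(3) p1B that)
    also have "\<dots> \<le> u * sup_pos K (p2 \<phi>) + v * sup_pos K (p2 \<psi>)"
      by (intro add_mono sublinear_onD(2)[OF sub2] p1B that)
    finally show ?thesis unfolding p2lin[OF that] .
  qed
  \<comment> \<open>First the excess, then the deficit, then the terms measuring invariance are made linear.\<close>
  obtain \<beta> where \<beta>: "linear_fun_on ?B \<beta>" "\<And>k. k \<in> ?B \<Longrightarrow> \<beta> k \<le> sup_pos ?U k"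
    and low1: "\<And>\<phi>. \<phi> \<in> A \<Longrightarrow> e \<le> \<beta> (p1 \<phi>) + (sup_pos K (p2 \<phi>) + (\<Sum>h\<in>Hs. P (defect h \<phi>)))"
  proof (rule mazur_orlicz[OF fun_subspace_bounded sub1 Ane, where T = p1
       and R = "\<lambda>\<phi>. sup_pos K (p2 \<phi>) + (\<Sum>h\<in>Hs. P (defect h \<phi>))" and e = e])
    show "sup_pos K (p2 (\<lambda>w. u * \<phi> w + v * \<psi> w)) + (\<Sum>h\<in>Hs. P (defect h (\<lambda>w. u * \<phi> w + v * \<psi> w)))
      \<le> u * (sup_pos K (p2 \<phi>) + (\<Sum>h\<in>Hs. P (defect h \<phi>))) + v * (sup_pos K (p2 \<psi>) + (\<Sum>h\<in>Hs. P (defect h \<psi>)))"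
      if "\<phi> \<in> A" "\<psi> \<in> A" "0 \<le> u" "0 \<le> v" "u + v = 1" for \<phi> \<psi> u v
      using conv2[OF that] convS[OF that(1-4)] by (simp add: distrib_left)
  qed (auto intro: Aconv p1B p1lin low0)
  have \<beta>lin: "\<beta> (\<lambda>x. u * k x + v * k' x) = u * \<beta> k + v * \<beta> k'" if "k \<in> ?B" "k' \<in> ?B" for u v k k'
    by (rule linear_fun_on_combination[OF fun_subspace_bounded \<beta>(1) that])
  obtain \<alpha> where \<alpha>: "linear_fun_on ?B \<alpha>" "\<And>k. k \<in> ?B \<Longrightarrow> \<alpha> k \<le> sup_pos K k"
    and low2: "\<And>\<phi>. \<phi> \<in> A \<Longrightarrow> e \<le> \<alpha> (p2 \<phi>) + (\<beta> (p1 \<phi>) + (\<Sum>h\<in>Hs. P (defect h \<phi>)))"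
  proof (rule mazur_orlicz[OF fun_subspace_bounded sub2 Ane, where T = p2
       and R = "\<lambda>\<phi>. \<beta> (p1 \<phi>) + (\<Sum>h\<in>Hs. P (defect h \<phi>))" and e = e])
    show "\<beta> (p1 (\<lambda>w. u * \<phi> w + v * \<psi> w)) + (\<Sum>h\<in>Hs. P (defect h (\<lambda>w. u * \<phi> w + v * \<psi> w)))
      \<le> u * (\<beta> (p1 \<phi>) + (\<Sum>h\<in>Hs. P (defect h \<phi>))) + v * (\<beta> (p1 \<psi>) + (\<Sum>h\<in>Hs. P (defect h \<psi>)))"
      if "\<phi> \<in> A" "\<psi> \<in> A" "0 \<le> u" "0 \<le> v" "u + v = 1" for \<phi> \<psi> u v
      using convS[OF that(1-4)] \<beta>lin[OF p1B(1)[OF that(1)] p1B(1)[OF that(2)]] unfolding p1lin[OF that]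
      by (simp add: distrib_left)
    show "e \<le> sup_pos K (p2 \<phi>) + (\<beta> (p1 \<phi>) + (\<Sum>h\<in>Hs. P (defect h \<phi>)))" if "\<phi> \<in> A" for \<phi>
      using low1[OF that] by simp
  qed (auto intro: Aconv p1B p2lin)
  have \<alpha>lin: "\<alpha> (\<lambda>x. u * k x + v * k' x) = u * \<alpha> k + v * \<alpha> k'" if "k \<in> ?B" "k' \<in> ?B" for u v k k'
    by (rule linear_fun_on_combination[OF fun_subspace_bounded \<alpha>(1) that])
  have "\<exists>\<nu>. (\<forall>h\<in>Hs. linear_fun_on (Cc ?X) (\<nu> h) \<and> (\<forall>f\<in>Cc ?X. \<nu> h f \<le> P f)) \<and>
      (\<forall>\<phi>\<in>A. e \<le> (\<Sum>h\<in>Hs. \<nu> h (defect h \<phi>)) + (\<alpha> (p2 \<phi>) + \<beta> (p1 \<phi>)))"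
  proof (rule mazur_orlicz_sum[OF fun_subspace_Cc subP Ane _ Hs(1)])
    show "defect h \<phi> \<in> Cc ?X" if "h \<in> Hs" "\<phi> \<in> A" for h \<phi> 
      by (rule defect_Cc[OF subsetD[OF Hs(2) that(1)] ACc[OF that(2)]])
    show "defect h (\<lambda>w. u * \<phi> w + v * \<psi> w) = (\<lambda>x. u * defect h \<phi> x + v * defect h \<psi> x)"
      if "h \<in> Hs" "\<phi> \<in> A" "\<psi> \<in> A" "0 \<le> u" "0 \<le> v" "u + v = 1" for h \<phi> \<psi> u v
      by (rule defect_linear[OF subsetD[OF Hs(2) that(1)] ACc[OF that(2)] ACc[OF that(3)]])
    show "\<alpha> (p2 (\<lambda>w. u * \<phi> w + v * \<psi> w)) + \<beta> (p1 (\<lambda>w. u * \<phi> w + v * \<psi> w))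
        \<le> u * (\<alpha> (p2 \<phi>) + \<beta> (p1 \<phi>)) + v * (\<alpha> (p2 \<psi>) + \<beta> (p1 \<psi>))"
      if "\<phi> \<in> A" "\<psi> \<in> A" "0 \<le> u" "0 \<le> v" "u + v = 1" for \<phi> \<psi> u v
      using \<beta>lin[OF p1B(1)[OF that(1)] p1B(1)[OF that(2)]] \<alpha>lin[OF p1B(2)[OF that(1)] p1B(2)[OF that(2)]]
      unfolding p1lin[OF that] p2lin[OF that] by (simp add: distrib_left)
    show "e \<le> (\<Sum>h\<in>Hs. P (defect h \<phi>)) + (\<alpha> (p2 \<phi>) + \<beta> (p1 \<phi>))" if "\<phi> \<in> A" for \<phi>
      using low2[OF that] by simp
  qed (auto intro: Aconv)
  then obtain \<nu> where \<nu>: "\<And>h. h \<in> Hs \<Longrightarrow> linear_fun_on (Cc ?X) (\<nu> h)"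
      "\<And>h f. h \<in> Hs \<Longrightarrow> f \<in> Cc ?X \<Longrightarrow> \<nu> h f \<le> P f"
    and low3: "\<And>\<phi>. \<phi> \<in> A \<Longrightarrow> e \<le> (\<Sum>h\<in>Hs. \<nu> h (defect h \<phi>)) + (\<alpha> (p2 \<phi>) + \<beta> (p1 \<phi>))" by auto
  have \<nu>lin: "\<nu> h (\<lambda>w. u * f w + v * g w) = u * \<nu> h f + v * \<nu> h g" if "h \<in> Hs" "f \<in> Cc ?X" "g \<in> Cc ?X" for h u v f g
    by (rule linear_fun_on_combination[OF fun_subspace_Cc \<nu>(1)[OF that(1)] that(2,3)])
  \<comment> \<open>the part of the linearised expression that depends on \<open>\<phi>\<close>\<close>
  define N where "N = (\<lambda>\<phi>. \<beta> (I \<phi>) - \<alpha> (I \<phi>) + (\<Sum>h\<in>Hs. \<nu> h (defect h \<phi>)))"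
  have Nlin: "N (\<lambda>w. u * \<phi> w + v * \<psi> w) = u * N \<phi> + v * N \<psi>" if "\<phi> \<in> Cc ?X" "\<psi> \<in> Cc ?X" for u v \<phi> \<psi>
  proof -
    have "(\<Sum>h\<in>Hs. \<nu> h (defect h (\<lambda>w. u * \<phi> w + v * \<psi> w))) = (\<Sum>h\<in>Hs. u * \<nu> h (defect h \<phi>) + v * \<nu> h (defect h \<psi>))"
    proof (rule sum.cong[OF refl])
      fix h assume h: "h \<in> Hs"
      then have hc: "h \<in> Cc (top_of G)" using Hs by auto
      show "\<nu> h (defect h (\<lambda>w. u * \<phi> w + v * \<psi> w)) = u * \<nu> h (defect h \<phi>) + v * \<nu> h (defect h \<psi>)"
        unfolding defect_linear[OF hc that] by (intro \<nu>lin h defect_Cc hc that)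
    qed
    then show ?thesis
      unfolding N_def Ilin[OF that] \<beta>lin[OF IB[OF that(1)] IB[OF that(2)]] \<alpha>lin[OF IB[OF that(1)] IB[OF that(2)]]
      by (simp add: sum.distrib sum_distrib_left algebra_simps)
  qed
  have split: "(\<Sum>h\<in>Hs. \<nu> h (defect h \<phi>)) + (\<alpha> (p2 \<phi>) + \<beta> (p1 \<phi>)) = N \<phi> + \<alpha> (\<lambda>u. 1) - \<beta> (\<lambda>u. 1)" if "\<phi> \<in> Cc ?X" for \<phi>
    using \<beta>lin[OF IB[OF that] oneB, of 1 "-1"] \<alpha>lin[OF oneB IB[OF that], of 1 "-1"]
    by (simp add: N_def p1_def p2_def)
  have zA: "(\<lambda>w. 0) \<in> A" using Cc_zero[OF QX.Haus] by (auto simp: A_def)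
  have N0: "N (\<lambda>w. 0) = 0" using Nlin[OF ACc[OF zA] ACc[OF zA], of 0 0] by simp
  have gap: "e \<le> \<alpha> (\<lambda>u. 1) - \<beta> (\<lambda>u. 1)" using low3[OF zA] split[OF ACc[OF zA]] N0 by simp
  have Npos: "0 \<le> N \<phi>" if "\<phi> \<in> Cc ?X" "\<And>w. 0 \<le> \<phi> w" for \<phi>
  proof (rule ccontr)
    assume "\<not> 0 \<le> N \<phi>"
    then have neg: "N \<phi> < 0" by simp
    define D where "D = \<alpha> (\<lambda>u. 1) - \<beta> (\<lambda>u. 1)"
    \<comment> \<open>for this multiple of \<open>\<phi>\<close> the linear part cancels the constant part \<open>D\<close>\<close>
    define t where "t = D / (- N \<phi>)"
    have D: "D > 0" using gap e by (simp add: D_def)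
    have t: "t > 0" using D neg by (simp add: t_def divide_pos_neg)
    have \<phi>A: "\<phi> \<in> A" using that by (simp add: A_def)
    have tA: "(\<lambda>w. t * \<phi> w + 0 * \<phi> w) \<in> A" by (rule Aconv[OF \<phi>A \<phi>A]) (use t in auto)
    have "e \<le> N (\<lambda>w. t * \<phi> w + 0 * \<phi> w) + D"
      using low3[OF tA] split[OF ACc[OF tA]] by (simp add: D_def)
    also have "N (\<lambda>w. t * \<phi> w + 0 * \<phi> w) = t * N \<phi>" using Nlin[OF that(1) that(1), of t 0] by simp
    also have "t * N \<phi> = - D" using neg by (simp add: t_def)
    finally show False using e by simp
  qed
  have \<beta>pos: "0 \<le> \<beta> k" and \<alpha>pos: "0 \<le> \<alpha> k" if k: "k \<in> ?B" "\<And>u. 0 \<le> k u" for k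
  proof -
    have kn: "(\<lambda>u. - k u) \<in> ?B" using BD(4)[OF k(1)] .
    have "\<beta> (\<lambda>u. - k u) \<le> 0" using \<beta>(2)[OF kn] sup_pos_least[OF units_nonempty, of 0 "\<lambda>u. - k u"] k(2) by auto
    then show "0 \<le> \<beta> k" using \<beta>lin[OF k(1) k(1), of "-1" 0] by simp
    have "\<alpha> (\<lambda>u. - k u) \<le> 0" using \<alpha>(2)[OF kn] sup_pos_least[OF K(2), of 0 "\<lambda>u. - k u"] k(2) by auto
    then show "0 \<le> \<alpha> k" using \<alpha>lin[OF k(1) k(1), of "-1" 0] by simp
  qed
  interpret RN: positive_functional ?X N
    using Nlin[where u = 1 and v = 1] Nlin[where v = 0] by unfold_locales (simp_all add: Npos)
  interpret RB: positive_functional "unit_top G" \<beta>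
    using \<beta>lin[OF CcB CcB, where u = 1 and v = 1] \<beta>lin[OF CcB CcB, where v = 0] by unfold_locales (simp_all add: \<beta>pos CcB)
  interpret RA: positive_functional "unit_top G" \<alpha>
    using \<alpha>lin[OF CcB CcB, where u = 1 and v = 1] \<alpha>lin[OF CcB CcB, where v = 0] by unfold_locales (simp_all add: \<alpha>pos CcB)
  define a where "a = RA.representing_measure"
  define b where "b = RB.representing_measure"
  have sa: "sets a = sets (borel_of (unit_top G))" and sb: "sets b = sets (borel_of (unit_top G))"
    by (simp_all add: a_def b_def RA.sets_representing_measure RB.sets_representing_measure)
  have spa: "space a = topspace (unit_top G)" and spb: "space b = topspace (unit_top G)"
    using sets_eq_imp_space_eq[OF sa] sets_eq_imp_space_eq[OF sb] by auto
  have le1: "\<Lambda> k \<le> \<Lambda> (\<lambda>u. 1)" if "linear_fun_on ?B \<Lambda>" "\<And>k. k \<in> ?B \<Longrightarrow> (\<And>u. 0 \<le> k u) \<Longrightarrow> 0 \<le> \<Lambda> k"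
    "k \<in> ?B" "\<And>u. k u \<le> 1" for \<Lambda> k
  proof -
    have "0 \<le> \<Lambda> (\<lambda>u. 1 + (-1) * k u)"
      using that by (intro that(2) BD(2) BD(3) oneB) auto
    also have "\<dots> = \<Lambda> (\<lambda>u. 1) + (-1) * \<Lambda> k"
      using linear_fun_on_combination[OF fun_subspace_bounded that(1) oneB that(3), of 1 "-1"] by simp
    finally show ?thesis by simp
  qed
  have b_le: "emeasure b (space b) \<le> ennreal (\<beta> (\<lambda>u. 1))"
    unfolding spb unfolding b_def by (rule RB.representing_measure_le) (rule le1[OF \<beta>(1) \<beta>pos CcB])
  have a_le: "emeasure a (space a) \<le> ennreal (\<alpha> (\<lambda>u. 1))"
    unfolding spa unfolding a_def by (rule RA.representing_measure_le) (rule le1[OF \<alpha>(1) \<alpha>pos CcB])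
  have fa: "finite_measure a" and fb: "finite_measure b"
    using a_le b_le by (auto intro!: finite_measureI simp: top_unique)
  \<comment> \<open>Mass of \<open>\<beta>\<close> may escape to infinity, which is harmless in this direction.\<close>
  have mb: "measure b (space b) \<le> \<beta> (\<lambda>u. 1)"
    using b_le \<beta>pos[OF oneB] finite_measure.emeasure_eq_measure[OF fb] by simp
  \<comment> \<open>Mass of \<open>\<alpha>\<close> cannot escape, because \<open>\<alpha>\<close> is carried by the compact set \<open>K\<close>: it has the same value on \<open>1\<close> and on a
      function with compact support that is \<open>1\<close> on \<open>K\<close>.\<close>
  have ma: "\<alpha> (\<lambda>u. 1) \<le> measure a (space a)"
  proof -
    obtain \<kappa> :: "'a \<Rightarrow> real" where \<kappa>: "\<kappa> \<in> Cc (unit_top G)" "\<And>x. 0 \<le> \<kappa> x" "\<And>x. \<kappa> x \<le> 1" "\<And>x. x \<in> K \<Longrightarrow> \<kappa> x = 1"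
      using UX.Cc_Urysohn[OF K(1) openin_topspace compactin_subset_topspace[OF K(1)]] by metis
    have "(\<lambda>u. 1 - \<kappa> u) \<in> ?B" by (intro BD(5) oneB CcB \<kappa>)
    then have "\<alpha> (\<lambda>u. 1 - \<kappa> u) \<le> sup_pos K (\<lambda>u. 1 - \<kappa> u)" by (rule \<alpha>(2))
    also have "\<dots> \<le> 0" by (rule sup_pos_least[OF K(2)]) (simp_all add: \<kappa>(4))
    finally have "\<alpha> (\<lambda>u. 1) \<le> \<alpha> \<kappa>" using \<alpha>lin[OF oneB CcB[OF \<kappa>(1)], of 1 "-1"] by simp
    also have "\<dots> = (LINT u|a. \<kappa> u)" unfolding a_def by (rule RA.functional_eq_integral[OF \<kappa>(1)])
    also have "\<dots> \<le> (LINT u|a. 1)"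
    proof (rule integral_mono)
      show "integrable a \<kappa>" unfolding a_def by (rule radon_Cc_integrable[OF RA.radon_representing_measure UX.Haus \<kappa>(1)])
      show "integrable a (\<lambda>u. 1::real)" using finite_measure.integrable_const[OF fa] by blast
    qed (rule \<kappa>(3))
    also have "\<dots> = measure a (space a)" by simp
    finally show ?thesis .
  qed
  have mE: "m \<in> E_bidual G H mu" and mpos: "\<And>\<nu>. \<nu> \<in> ?E \<Longrightarrow> positive_measure G H \<nu> \<Longrightarrow> m \<nu> \<in> \<real>\<^sub>\<ge>\<^sub>0"
    and minv: "\<And>f. f \<in> Cc (top_of G) \<Longrightarrow> conv_bidual G lam H mu f m = smult_bidual G H mu (haar_int lam f) m"
    using m unfolding topological_invariant_mean_def by auto
  define \<nu>c where "\<nu>c = (\<lambda>h. complexify (\<nu> h))"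
  have \<nu>c: "\<nu>c h \<in> ?E" "\<And>\<psi>. \<psi> \<in> Cc ?X \<Longrightarrow> \<nu>c h (cplx \<psi>) = complex_of_real (\<nu> h \<psi>)" if "h \<in> Hs" for h
    unfolding \<nu>c_def using complexify_dual[OF \<nu>(1)[OF that] \<nu>(2)[OF that, unfolded P_def]] by auto
  define tL where "tL = (\<lambda>h. transpose_on (Cc ?X) (L_op G lam H (cplx h)) (\<nu>c h))"
  define tS where "tS = (\<lambda>h. transpose_on (Cc ?X) (smult G (haar_int lam (cplx h))) (\<nu>c h))"
  have ch: "cplx h \<in> Cc (top_of G)" if "h \<in> Hs" for h using that Hs by (auto intro!: Cc_of_real GX.Haus)
  have tLE: "tL h \<in> ?E" if "h \<in> Hs" for h unfolding tL_def by (rule transpose_L_op[OF \<nu>c(1)[OF that] ch[OF that]])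
  have tSE: "tS h \<in> ?E" if h: "h \<in> Hs" for h
  proof -
    obtain B where B: "\<And>u. u \<in> ?U \<Longrightarrow> cmod (haar_int lam (cplx h) u) \<le> B" using haar_int_bound[OF ch[OF h]] by metis
    show ?thesis unfolding tS_def by (rule transpose_smult[OF \<nu>c(1)[OF h] continuous_haar_int[OF ch[OF h]] B])
  qed
  have mLS: "m (tL h) = m (tS h)" if "h \<in> Hs" for h
    using fun_cong[OF minv[OF ch[OF that]], of "\<nu>c h"] conv_bidual_apply[OF \<nu>c(1)[OF that]] smult_bidual_apply[OF \<nu>c(1)[OF that]]
    by (simp add: tL_def tS_def)
  define F where "F = (\<lambda>h \<phi>. tL h \<phi> + (-1) * tS h \<phi>)"
  have FE: "F h \<in> ?E" if "h \<in> Hs" for h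
    unfolding F_def by (rule E_dual_add[OF tLE[OF that] E_dual_scale[OF tSE[OF that]]])
  have mF: "m (F h) = 0" if "h \<in> Hs" for h
    unfolding F_def
    using mean_linear(1)[OF mE tLE[OF that] E_dual_scale[OF tSE[OF that], of "-1"]] mean_linear(2)[OF mE tSE[OF that], of "-1"] mLS[OF that]
    by simp
  let ?ca = "comp_measure G H mu a" and ?cb = "comp_measure G H mu b"
  note caE = comp_measure_dual[OF fa sa] and cbE = comp_measure_dual[OF fb sb]
  let ?D = "\<lambda>\<phi>. ?cb \<phi> + (-1) * ?ca \<phi>"
  have DE: "?D \<in> ?E" by (rule E_dual_add[OF cbE E_dual_scale[OF caE]])
  have SE: "(\<lambda>\<phi>. \<Sum>h\<in>Hs. F h \<phi>) \<in> ?E" and mS: "m (\<lambda>\<phi>. \<Sum>h\<in>Hs. F h \<phi>) = 0"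
    using mean_sum[OF mE Hs(1) FE] mF by auto
  \<comment> \<open>\<open>\<Phi>\<close> is the complexification of \<open>N\<close>, written in terms to which the mean can be applied.\<close>
  define \<Phi> where "\<Phi> = (\<lambda>\<phi>. ?D \<phi> + (\<Sum>h\<in>Hs. F h \<phi>))"
  have \<Phi>E: "\<Phi> \<in> ?E" unfolding \<Phi>_def by (rule E_dual_add[OF DE SE])
  have "m \<Phi> = m ?D + m (\<lambda>\<phi>. \<Sum>h\<in>Hs. F h \<phi>)" unfolding \<Phi>_def by (rule mean_linear(1)[OF mE DE SE])
  also have "m ?D = m ?cb + (-1) * m ?ca"
    using mean_linear(1)[OF mE cbE E_dual_scale[OF caE, of "-1"]] mean_linear(2)[OF mE caE, of "-1"] by simp
  finally have m\<Phi>: "m \<Phi> = complex_of_real (measure b (space b) - measure a (space a))"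
    using mS mean_comp_measure[OF m fa sa] mean_comp_measure[OF m fb sb] by simp
  have comp: "comp_measure G H mu M (cplx \<phi>) = complex_of_real (LINT u|M. I \<phi> u)"
    if M: "space M = ?U" and \<phi>: "\<phi> \<in> Cc ?X" for M \<phi>
  proof -
    have "(LINT u|M. LINT w|mu u. cplx \<phi> w) = (LINT u|M. complex_of_real (I \<phi> u))"
      using M by (intro Bochner_Integration.integral_cong refl) (simp add: I_def)
    then show ?thesis using Cc_of_real[OF QX.Haus \<phi>] by (simp add: comp_measure_def)
  qed
  have "\<Phi> (cplx \<phi>) = complex_of_real (LINT w|RN.representing_measure. \<phi> w)" if \<phi>: "\<phi> \<in> Cc ?X" for \<phi>
  proof -
    have c\<phi>: "cplx \<phi> \<in> Cc ?X" by (rule Cc_of_real[OF QX.Haus \<phi>])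
    have F\<phi>: "F h (cplx \<phi>) = complex_of_real (\<nu> h (defect h \<phi>))" if h: "h \<in> Hs" for h
    proof -
      have hc: "h \<in> Cc (top_of G)" using h Hs by auto
      have "F h (cplx \<phi>) = \<nu>c h (L_op G lam H (cplx h) (cplx \<phi>)) - \<nu>c h (smult G (haar_int lam (cplx h)) (cplx \<phi>))"
        using c\<phi> by (simp add: F_def tL_def tS_def transpose_on_def)
      also have "\<dots> = \<nu>c h (\<lambda>w. L_op G lam H (cplx h) (cplx \<phi>) w - smult G (haar_int lam (cplx h)) (cplx \<phi>) w)"
        by (rule E_dual_diff[OF \<nu>c(1)[OF h] L_op_Cc[OF ch[OF h] c\<phi>] smult_Cc[OF continuous_haar_int[OF ch[OF h]] c\<phi>], symmetric])
      also have "\<dots> = \<nu>c h (cplx (defect h \<phi>))" unfolding defect_complex ..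
      also have "\<dots> = complex_of_real (\<nu> h (defect h \<phi>))" by (rule \<nu>c(2)[OF h defect_Cc[OF hc \<phi>]])
      finally show ?thesis .
    qed
    have "?cb (cplx \<phi>) = complex_of_real (\<beta> (I \<phi>))"
      unfolding comp[OF spb[unfolded topspace_unit] \<phi>] unfolding b_def RB.functional_eq_integral[OF ICc[OF \<phi>]] ..
    moreover have "?ca (cplx \<phi>) = complex_of_real (\<alpha> (I \<phi>))"
      unfolding comp[OF spa[unfolded topspace_unit] \<phi>] unfolding a_def RA.functional_eq_integral[OF ICc[OF \<phi>]] ..
    ultimately have "\<Phi> (cplx \<phi>) = complex_of_real (N \<phi>)"
      unfolding \<Phi>_def N_def using F\<phi> by simp
    then show ?thesis unfolding RN.functional_eq_integral[OF \<phi>] .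
  qed
  then have "positive_measure G H \<Phi>"
    unfolding positive_measure_def
    by (intro exI[of _ "RN.representing_measure"] conjI ballI RN.radon_representing_measure
        E_dual_integral_eq[OF \<Phi>E RN.radon_representing_measure])
  then have "m \<Phi> \<in> \<real>\<^sub>\<ge>\<^sub>0" by (rule mpos[OF \<Phi>E])
  then have "0 \<le> Re (m \<Phi>)" by (simp add: complex_nonneg_Reals_iff)
  then have "measure a (space a) \<le> measure b (space b)" unfolding m\<Phi> by simp
  then show False using ma mb gap e by linarith
qed

text \<open>
  The smallness of the sum in \<open>approximate_invariance_core\<close> gives fibre integrals at most \<open>1 + d\<close>; dividing by \<open>1 + d\<close> makes
  them at most \<open>1\<close> and keeps the other two conditions up to a factor of two.
\<close>

lemma approximate_invariance:
  fixes K :: "'a set" and Hs :: "('a \<Rightarrow> real) set" and e :: real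
  assumes m: "topological_invariant_mean G lam H mu m"
    and K: "compactin (unit_top G) K" and Hs: "finite Hs" "Hs \<subseteq> Cc (top_of G)" and e: "0 < e"
  obtains \<phi> where "\<phi> \<in> Cc (quot_top G H)" "\<And>w. 0 \<le> \<phi> w" "\<And>u. u \<in> units G \<Longrightarrow> (LINT w|mu u. \<phi> w) \<le> 1"
    "\<And>u. u \<in> K \<Longrightarrow> 1 - e \<le> (LINT w|mu u. \<phi> w)"
    "\<And>h u. h \<in> Hs \<Longrightarrow> u \<in> units G \<Longrightarrow> (LINT w|mu u. \<bar>defect h \<phi> w\<bar>) \<le> e"
proof -
  obtain u0 where u0: "u0 \<in> units G" using units_nonempty by blast
  \<comment> \<open>The supremum over \<open>K\<close> is taken over a nonempty set.\<close>
  define K' where "K' = insert u0 K"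
  have K': "compactin (unit_top G) K'" unfolding K'_def
    using compactin_Un[OF _ K, of "{u0}"] u0 by (simp add: topspace_unit)
  have K'U: "K' \<subseteq> units G" using compactin_subset_topspace[OF K'] by (simp add: topspace_unit)
  define d where "d = e / 2"
  have d: "d > 0" using e by (simp add: d_def)
  obtain \<phi> where \<phi>: "\<phi> \<in> Cc (quot_top G H)" "\<And>w. 0 \<le> \<phi> w"
    and small: "sup_pos (units G) (\<lambda>u. (LINT w|mu u. \<phi> w) - 1) + sup_pos K' (\<lambda>u. 1 - (LINT w|mu u. \<phi> w))
       + (\<Sum>h\<in>Hs. mu_norm G mu (cplx (defect h \<phi>))) < d"
    using approximate_invariance_core[OF m K' _ Hs d] by (auto simp: K'_def)
  let ?I = "\<lambda>u. LINT w|mu u. \<phi> w"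
  have c\<phi>: "cplx \<phi> \<in> Cc (quot_top G H)" by (rule Cc_of_real[OF QX.Haus \<phi>(1)])
  have "\<bar>?I u\<bar> \<le> mu_norm G mu (cplx \<phi>)" if "u \<in> units G" for u
    using mu_norm_upper[OF c\<phi> that] \<phi>(2) by simp
  then have IB: "?I \<in> bounded_fun_on (units G)" by (auto simp: bounded_fun_on_def)
  have oneB: "(\<lambda>u. 1) \<in> bounded_fun_on (units G)" by (auto simp: bounded_fun_on_def)
  note BD = fun_subspaceD[OF fun_subspace_bounded[of "units G"]]
  let ?s1 = "sup_pos (units G) (\<lambda>u. ?I u - 1)" and ?s2 = "sup_pos K' (\<lambda>u. 1 - ?I u)"
  have s1: "max (?I u - 1) 0 \<le> ?s1" if "u \<in> units G" for u
    by (rule sup_pos_upper[OF BD(5)[OF IB oneB] _ that]) simp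
  have s2: "max (1 - ?I u) 0 \<le> ?s2" if "u \<in> K'" for u
    by (rule sup_pos_upper[OF BD(5)[OF oneB IB] K'U that])
  have s1': "0 \<le> ?s1" using s1[OF u0] by simp
  have s2': "0 \<le> ?s2" using s2[of u0] by (simp add: K'_def)
  have dC: "cplx (defect h \<phi>) \<in> Cc (quot_top G H)" if "h \<in> Hs" for h
    by (rule Cc_of_real[OF QX.Haus defect_Cc[OF subsetD[OF Hs(2) that] \<phi>(1)]])
  have n0: "0 \<le> mu_norm G mu (cplx (defect h \<phi>))" if "h \<in> Hs" for h by (rule mu_norm_nonneg[OF dC[OF that]])
  have sum0: "0 \<le> (\<Sum>h\<in>Hs. mu_norm G mu (cplx (defect h \<phi>)))" by (rule sum_nonneg[OF n0])
  have up: "?I u \<le> 1 + d" if "u \<in> units G" for u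
    using s1[OF that] s2' sum0 small by linarith
  have lo: "1 - d \<le> ?I u" if "u \<in> K" for u
    using s2[of u] s1' sum0 small that by (simp add: K'_def)
  have def: "(LINT w|mu u. \<bar>defect h \<phi> w\<bar>) \<le> d" if h: "h \<in> Hs" and u: "u \<in> units G" for h u
  proof -
    have "(LINT w|mu u. \<bar>defect h \<phi> w\<bar>) \<le> mu_norm G mu (cplx (defect h \<phi>))"
      using mu_norm_upper[OF dC[OF h] u] by simp
    also have "\<dots> \<le> (\<Sum>h\<in>Hs. mu_norm G mu (cplx (defect h \<phi>)))"
      by (rule member_le_sum[OF h _ Hs(1)]) (use n0 in auto)
    also have "\<dots> \<le> d" using s1' s2' small by linarith
    finally show ?thesis .
  qed
  define c where "c = 1 / (1 + d)"
  have c: "0 < c" "c \<le> 1" "c * (1 + d) = 1" using d by (auto simp: c_def)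
  show ?thesis
  proof (rule that)
    show "(\<lambda>w. c * \<phi> w) \<in> Cc (quot_top G H)" by (rule Cc_scale[OF QX.Haus \<phi>(1)])
    show "0 \<le> c * \<phi> w" for w using c \<phi>(2) by simp
    show "(LINT w|mu u. c * \<phi> w) \<le> 1" if "u \<in> units G" for u
      using mult_left_mono[OF up[OF that], of c] c by simp
    show "1 - e \<le> (LINT w|mu u. c * \<phi> w)" if "u \<in> K" for u
    proof -
      have "(1 - 2 * d) * (1 + d) \<le> 1 - d" using d by (simp add: algebra_simps)
      then have "1 - 2 * d \<le> c * (1 - d)" using d by (simp add: c_def field_simps)
      also have "\<dots> \<le> c * ?I u" using lo[OF that] c by simp
      finally show ?thesis by (simp add: d_def)
    qed
    show "(LINT w|mu u. \<bar>defect h (\<lambda>w. c * \<phi> w) w\<bar>) \<le> e" if h: "h \<in> Hs" and u: "u \<in> units G" for h u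
    proof -
      have "defect h (\<lambda>w. c * \<phi> w) = (\<lambda>w. c * defect h \<phi> w)"
        using defect_linear[OF subsetD[OF Hs(2) h] \<phi>(1) \<phi>(1), of c 0] by simp
      then have "(LINT w|mu u. \<bar>defect h (\<lambda>w. c * \<phi> w) w\<bar>) = c * (LINT w|mu u. \<bar>defect h \<phi> w\<bar>)"
        using c by (simp add: abs_mult)
      also have "\<dots> \<le> 1 * d" using c def[OF h u] d by (intro mult_mono) auto
      finally show ?thesis using e by (simp add: d_def)
    qed
  qed
qed

end

section \<open>Averaging over left translates\<close>

context topological_groupoid
begin

lemma compact_product:
  assumes K: "compactin (top_of G) K" and C: "compactin (top_of G) C"
  shows "compactin (top_of G) {gmult G y z | y z. y \<in> K \<and> z \<in> C \<and> src G y = rng G z}"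
proof -
  let ?P = "prod_topology (top_of G) (top_of G)"
  let ?D = "{q \<in> topspace ?P. src G (fst q) = rng G (snd q)}"
  have D: "closedin ?P ?D"
    using continuous_map_compose[OF continuous_map_fst continuous_src] continuous_map_compose[OF continuous_map_snd continuous_rng]
    by (intro closedin_continuous_maps_eq[OF Hausdorff_top]) (simp_all add: o_def)
  have "compactin ?P (?D \<inter> (K \<times> C))"
    using K C D by (intro closed_Int_compactin) (simp_all add: compactin_Times)
  then have "compactin (subtopology ?P ?D) (?D \<inter> (K \<times> C))" by (simp add: compactin_subtopology)
  moreover have "continuous_map (subtopology ?P ?D) (top_of G) (\<lambda>q. gmult G (fst q) (snd q))"
    by (intro continuous_mult' continuous_map_from_subtopology continuous_map_fst continuous_map_snd) auto
  ultimately have "compactin (top_of G) ((\<lambda>q. gmult G (fst q) (snd q)) ` (?D \<inter> (K \<times> C)))"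
    by (rule image_compactin)
  moreover have "(\<lambda>q. gmult G (fst q) (snd q)) ` (?D \<inter> (K \<times> C)) = {gmult G y z | y z. y \<in> K \<and> z \<in> C \<and> src G y = rng G z}"
    using compactin_subset_topspace[OF K] compactin_subset_topspace[OF C] by (force simp: image_iff)
  ultimately show ?thesis by simp
qed

lemma left_translate_continuous:
  assumes "continuous_map (top_of G) euclidean f" "y \<in> carr G"
  shows "continuous_map (subtopology (top_of G) (fibre G (rng G y))) euclidean (\<lambda>z. f (gmult G (ginv G y) z))"
proof -
  have "continuous_map (subtopology (top_of G) (fibre G (rng G y))) (top_of G) (\<lambda>z. gmult G (ginv G y) z)"
    using assms(2) by (intro continuous_mult' continuous_map_from_subtopology continuous_map_id[unfolded id_def])
      (auto simp: groupoid_simps fibre_def)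
  from continuous_map_compose[OF this assms(1)] show ?thesis by (simp add: o_def)
qed

text \<open>
  The left translate of \<open>f\<close> by \<open>y0\<close> extends from its fibre to \<open>h \<in> C\<^sub>c(G)\<close>. By the tube lemma \<open>h\<close> is uniformly close, on
  the respective fibre, to the translate by any \<open>y\<close> near \<open>y0\<close>, and \<open>Y\<close> is compact. The set \<open>K\<close> does not depend on \<open>\<epsilon>\<close>, so
  that uniform closeness will also give closeness of integrals.
\<close>

lemma left_translates_net:
  fixes f :: "'g \<Rightarrow> real"
  assumes f: "f \<in> Cc (top_of G)" and Y: "compactin (top_of G) Y"
  obtains K where "compactin (top_of G) K"
    "\<And>y z. y \<in> Y \<Longrightarrow> z \<in> fibre G (rng G y) \<Longrightarrow> z \<notin> K \<Longrightarrow> f (gmult G (ginv G y) z) = 0"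
    "\<And>\<epsilon>. 0 < \<epsilon> \<Longrightarrow> \<exists>Hs. finite Hs \<and> Hs \<subseteq> Cc (top_of G) \<and> (\<forall>h\<in>Hs. \<forall>z. z \<notin> K \<longrightarrow> h z = 0) \<and>
       (\<forall>y\<in>Y. \<exists>h\<in>Hs. \<forall>z\<in>fibre G (rng G y). \<bar>f (gmult G (ginv G y) z) - h z\<bar> \<le> \<epsilon>)"
proof -
  obtain K0 where K0: "compactin (top_of G) K0" "\<And>x. x \<notin> K0 \<Longrightarrow> f x = 0"
    using f unfolding Cc_iff[OF GX.Haus] by metis
  define K1 where "K1 = {gmult G y z | y z. y \<in> Y \<and> z \<in> K0 \<and> src G y = rng G z}"
  have K1: "compactin (top_of G) K1" unfolding K1_def by (rule compact_product[OF Y K0(1)])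
  have YG: "Y \<subseteq> carr G" using compactin_subset_topspace[OF Y] .
  have off: "f (gmult G (ginv G y) z) = 0" if y: "y \<in> Y" and z: "z \<in> fibre G (rng G y)" "z \<notin> K1" for y z
  proof (rule K0(2), rule notI)
    let ?x = "gmult G (ginv G y) z"
    have yz: "y \<in> carr G" "z \<in> carr G" "rng G y = rng G z" using y YG z(1) by (auto simp: fibre_def)
    assume "?x \<in> K0"
    moreover have "gmult G y ?x = z" "src G y = rng G ?x" using yz by (simp_all add: mult_inv_cancel groupoid_simps)
    ultimately have "z \<in> K1" unfolding K1_def using y by (metis (mono_tags, lifting) mem_Collect_eq)
    then show False using z(2) by simp
  qed
  obtain V K where VK: "openin (top_of G) V" "compactin (top_of G) K" "K1 \<subseteq> V" "V \<subseteq> K"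
    using GX.compact_nbhd_inside[OF K1 openin_topspace compactin_subset_topspace[OF K1]] by metis
  show ?thesis
  proof (rule that[OF VK(2)])
    show "f (gmult G (ginv G y) z) = 0" if "y \<in> Y" "z \<in> fibre G (rng G y)" "z \<notin> K" for y z
      using off[OF that(1,2)] that(3) VK(3,4) by auto
    fix \<epsilon> :: real assume \<epsilon>: "0 < \<epsilon>"
    let ?P = "prod_topology (top_of G) (top_of G)"
    let ?D = "{q \<in> topspace ?P. rng G (fst q) = rng G (snd q)}"
    have D: "closedin ?P ?D"
      using continuous_map_compose[OF continuous_map_fst continuous_rng] continuous_map_compose[OF continuous_map_snd continuous_rng]
      by (intro closedin_continuous_maps_eq[OF Hausdorff_top]) (simp_all add: o_def)
    have cF: "continuous_map (subtopology ?P ?D) euclidean (\<lambda>q. f (gmult G (ginv G (fst q)) (snd q)))"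
    proof -
      have "continuous_map (subtopology ?P ?D) (top_of G) (\<lambda>q. gmult G (ginv G (fst q)) (snd q))"
        by (intro continuous_mult' continuous_inv' continuous_map_from_subtopology continuous_map_fst continuous_map_snd)
           (auto simp: groupoid_simps)
      from continuous_map_compose[OF this Cc_continuous[OF f]] show ?thesis by (simp add: o_def)
    qed
    define near where "near = (\<lambda>y0 h W. h \<in> Cc (top_of G) \<and> (\<forall>z. z \<notin> K \<longrightarrow> h z = (0::real)) \<and> openin (top_of G) W \<and> y0 \<in> W \<and>
        (\<forall>y\<in>W. \<forall>z\<in>K. z \<in> fibre G (rng G y) \<longrightarrow> \<bar>f (gmult G (ginv G y) z) - h z\<bar> \<le> \<epsilon>))"
    have "\<exists>h W. near y0 h W" if y0: "y0 \<in> Y" for y0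
    proof -
      have y0c: "y0 \<in> carr G" using y0 YG by auto
      obtain h where h: "h \<in> Cc (top_of G)" "\<And>z. z \<in> fibre G (rng G y0) \<Longrightarrow> h z = f (gmult G (ginv G y0) z)"
         "\<And>z. z \<notin> V \<Longrightarrow> h z = 0"
        using GX.Cc_Tietze_real[OF fibre_closed[OF rng_units[OF y0c]] left_translate_continuous[OF Cc_continuous[OF f] y0c] K1 VK(1,3)]
          off[OF y0] by metis
      let ?E = "\<lambda>q. f (gmult G (ginv G (fst q)) (snd q)) - h (snd q)"
      have "continuous_map ?P euclidean (\<lambda>q. h (snd q))"
        using continuous_map_compose[OF continuous_map_snd Cc_continuous[OF h(1)]] by (simp add: o_def)
      then have "continuous_map (subtopology ?P ?D) euclidean ?E"
        by (rule continuous_map_euclidean_diff[OF cF continuous_map_from_subtopology])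
      then have "openin (subtopology ?P ?D) {q \<in> topspace (subtopology ?P ?D). ?E q \<in> ball 0 \<epsilon>}"
        by (rule openin_continuous_map_preimage) auto
      then obtain W where W: "openin ?P W" "{q \<in> topspace (subtopology ?P ?D). ?E q \<in> ball 0 \<epsilon>} = W \<inter> ?D"
        unfolding openin_subtopology by blast
      \<comment> \<open>The estimate matters only on the closed set \<open>?D\<close>, as in the continuity of parametric integrals.\<close>
      define W' where "W' = W \<union> (topspace ?P - ?D)"
      have W': "openin ?P W'" unfolding W'_def by (intro openin_Un W(1) openin_diff D openin_topspace)
      have "{y0} \<times> K \<subseteq> W'"
      proof
        fix q assume "q \<in> {y0} \<times> K"
        then obtain z where q: "q = (y0, z)" "z \<in> K" by auto
        have z: "z \<in> carr G" using q(2) compactin_subset_topspace[OF VK(2)] by auto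
        show "q \<in> W'"
        proof (cases "z \<in> fibre G (rng G y0)")
          case True
          then have "q \<in> {q \<in> topspace (subtopology ?P ?D). ?E q \<in> ball 0 \<epsilon>}"
            using q y0c z h(2)[OF True] \<epsilon> by (simp add: fibre_def)
          then show ?thesis unfolding W(2) W'_def by blast
        next
          case False
          then show ?thesis using q y0c z by (auto simp: W'_def fibre_def)
        qed
      qed
      then obtain N N' where N: "openin (top_of G) N" "y0 \<in> N" "K \<subseteq> N'" "N \<times> N' \<subseteq> W'"
        using tube_lemma_right[OF W' VK(2) y0c] by metis
      have "\<bar>f (gmult G (ginv G y) z) - h z\<bar> \<le> \<epsilon>" if "y \<in> N" "z \<in> K" "z \<in> fibre G (rng G y)" for y z
      proof -
        have "(y, z) \<in> W'" using N that by auto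
        moreover have "y \<in> carr G" using N(1) that(1) openin_subset by blast
        ultimately have "(y, z) \<in> W \<inter> ?D" using that(3) by (auto simp: W'_def fibre_def)
        then show ?thesis unfolding W(2)[symmetric] by simp
      qed
      moreover have "h z = 0" if "z \<notin> K" for z using h(3)[of z] that VK(4) by auto
      ultimately have "near y0 h N" using h(1) N(1,2) unfolding near_def by blast
      then show ?thesis by blast
    qed
    then obtain h W where "\<And>y0. y0 \<in> Y \<Longrightarrow> near y0 (h y0) (W y0)" by metis
    then have hW: "\<And>y0. y0 \<in> Y \<Longrightarrow> h y0 \<in> Cc (top_of G)" "\<And>y0 z. y0 \<in> Y \<Longrightarrow> z \<notin> K \<Longrightarrow> h y0 z = 0"
       "\<And>y0. y0 \<in> Y \<Longrightarrow> openin (top_of G) (W y0)" "\<And>y0. y0 \<in> Y \<Longrightarrow> y0 \<in> W y0"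
       "\<And>y0 y z. y0 \<in> Y \<Longrightarrow> y \<in> W y0 \<Longrightarrow> z \<in> K \<Longrightarrow> z \<in> fibre G (rng G y) \<Longrightarrow> \<bar>f (gmult G (ginv G y) z) - h y0 z\<bar> \<le> \<epsilon>"
      unfolding near_def by auto
    obtain \<F> where \<F>: "finite \<F>" "\<F> \<subseteq> W ` Y" "Y \<subseteq> \<Union>\<F>"
    proof -
      have o: "\<And>U. U \<in> W ` Y \<Longrightarrow> openin (top_of G) U" using hW(3) by auto
      have c: "Y \<subseteq> \<Union>(W ` Y)" using hW(4) by auto
      from compactinD[OF Y o c] that show ?thesis by blast
    qed
    obtain F where F: "F \<subseteq> Y" "finite F" "\<F> = W ` F" using finite_subset_image[OF \<F>(1,2)] by blast
    show "\<exists>Hs. finite Hs \<and> Hs \<subseteq> Cc (top_of G) \<and> (\<forall>h\<in>Hs. \<forall>z. z \<notin> K \<longrightarrow> h z = 0) \<and>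
       (\<forall>y\<in>Y. \<exists>h\<in>Hs. \<forall>z\<in>fibre G (rng G y). \<bar>f (gmult G (ginv G y) z) - h z\<bar> \<le> \<epsilon>)"
    proof (intro exI[of _ "h ` F"] conjI ballI)
      show "finite (h ` F)" using F by simp
      show "h ` F \<subseteq> Cc (top_of G)" using F hW(1) by auto
      show "\<forall>z. z \<notin> K \<longrightarrow> k z = 0" if "k \<in> h ` F" for k using that F hW(2) by auto
      fix y assume y: "y \<in> Y"
      then obtain y0 where y0: "y0 \<in> F" "y \<in> W y0" using \<F>(3) F(3) by auto
      have "\<bar>f (gmult G (ginv G y) z) - h y0 z\<bar> \<le> \<epsilon>" if z: "z \<in> fibre G (rng G y)" for z
      proof (cases "z \<in> K")
        case True
        then show ?thesis using hW(5)[OF subsetD[OF F(1) y0(1)] y0(2) True z] by simp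
      next
        case False
        then have "z \<notin> K1" using VK by auto
        then show ?thesis using off[OF y z] hW(2)[OF subsetD[OF F(1) y0(1)] False] \<epsilon> by simp
      qed
      then show "\<exists>h\<in>h ` F. \<forall>z\<in>fibre G (rng G y). \<bar>f (gmult G (ginv G y) z) - h z\<bar> \<le> \<epsilon>" using y0(1) by auto
    qed
  qed
qed

end

context inhabited_groupoid_quotient
begin

lemma haar_left_invariant:
  fixes k :: "'a \<Rightarrow> complex"
  assumes y: "y \<in> carr G" and k: "k \<in> Cc (top_of G)"
  shows "(LINT z:fibre G (src G y)|lam (src G y). k (gmult G y z)) = (LINT z|lam (rng G y). k z)"
proof -
  have "\<forall>x \<in> carr G. \<forall>f \<in> Cc (top_of G).
        (LINT y:fibre G (src G x)|lam (src G x). f (gmult G x y)) =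
        ((LINT y|lam (rng G x). f y) :: complex)"
    using haar unfolding haar_system_def by (elim conjE)
  from bspec[OF bspec[OF this y] k] show ?thesis .
qed

lemma integral_left_translate:
  fixes a f :: "'a \<Rightarrow> complex"
  assumes y: "y \<in> carr G" and a: "a \<in> Cc (top_of G)" "\<And>z. z \<in> fibre G (rng G y) \<Longrightarrow> a z = f (gmult G (ginv G y) z)"
    and f: "f \<in> Cc (top_of G)"
  shows "(LINT z|lam (rng G y). a z) = (LINT z|lam (src G y). f z)"
proof -
  have eq: "a (gmult G y z) = f z" if "z \<in> fibre G (src G y)" for z
  proof -
    have z: "z \<in> carr G" "src G y = rng G z" using that by (auto simp: fibre_def)
    then have "gmult G y z \<in> fibre G (rng G y)" using y by (simp add: fibre_def groupoid_simps)
    then show ?thesis using a(2) inv_mult_cancel[OF y z] by simp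
  qed
  have "(LINT z|lam (rng G y). a z) = (LINT z:fibre G (src G y)|lam (src G y). a (gmult G y z))"
    by (rule haar_left_invariant[OF y a(1), symmetric])
  also have "\<dots> = (LINT z|lam (src G y). f z)"
    by (rule haar_fib(7)[OF src_units[OF y] f]) (simp add: eq)
  finally show ?thesis .
qed

text \<open>
  Left invariance of the Haar system moves the translation from \<open>\<phi>\<close> to the averaging function.
\<close>

lemma L_op_left_translate:
  fixes a f :: "'a \<Rightarrow> complex"
  assumes y: "y \<in> carr G" and a: "a \<in> Cc (top_of G)" "\<And>z. z \<in> fibre G (rng G y) \<Longrightarrow> a z = f (gmult G (ginv G y) z)"
    and \<phi>: "\<phi> \<in> Cc (quot_top G H)" and w: "w \<in> qfibre G H (rng G y)"
  shows "L_op G lam H f \<phi> (qact G (ginv G y) w) = (LINT z:fibre G (rng G y)|lam (rng G y). a z * \<phi> (qact G (ginv G z) w))"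
proof -
  have wc: "w \<in> cosets G H" "qrng G w = rng G y" using w by (auto simp: qfibre_def)
  obtain k where k: "k \<in> Cc (top_of G)" "\<And>z. z \<in> fibre G (rng G y) \<Longrightarrow> k z = a z * \<phi> (qact G (ginv G z) w)"
    using kernel_extension[OF a(1) Cc_continuous[OF \<phi>] wc(1)] unfolding wc(2) by metis
  let ?v = "qact G (ginv G y) w"
  have v: "?v \<in> qfibre G H (src G y)" by (rule act_inv_qfibre[OF y w])
  have eq: "k (gmult G y z) = f z * \<phi> (qact G (ginv G z) ?v)" if "z \<in> fibre G (src G y)" for z
  proof -
    have z: "z \<in> carr G" "src G y = rng G z" using that by (auto simp: fibre_def)
    then have yz: "gmult G y z \<in> fibre G (rng G y)" using y by (simp add: fibre_def groupoid_simps)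
    have "qact G (ginv G (gmult G y z)) w = qact G (ginv G z) ?v"
      using y z wc by (simp add: inv_mult qact_qact groupoid_simps)
    then show ?thesis using k(2)[OF yz] a(2)[OF yz] inv_mult_cancel[OF y z] by simp
  qed
  have ind: "(\<lambda>z. indicator (fibre G (src G y)) z *\<^sub>R (f z * \<phi> (qact G (ginv G z) ?v))) =
     (\<lambda>z. indicator (fibre G (src G y)) z *\<^sub>R k (gmult G y z))"
  proof
    fix z show "indicator (fibre G (src G y)) z *\<^sub>R (f z * \<phi> (qact G (ginv G z) ?v)) =
      indicator (fibre G (src G y)) z *\<^sub>R k (gmult G y z)"
      using eq[of z] by (cases "z \<in> fibre G (src G y)") auto
  qed
  have "L_op G lam H f \<phi> ?v = (LINT z:fibre G (src G y)|lam (src G y). f z * \<phi> (qact G (ginv G z) ?v))"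
    by (rule L_op_fibre[OF v])
  also have "\<dots> = (LINT z:fibre G (src G y)|lam (src G y). k (gmult G y z))"
    unfolding set_lebesgue_integral_def ind ..
  also have "\<dots> = (LINT z|lam (rng G y). k z)" by (rule haar_left_invariant[OF y k(1)])
  also have "\<dots> = (LINT z:fibre G (rng G y)|lam (rng G y). a z * \<phi> (qact G (ginv G z) w))"
    by (rule haar_fib(7)[OF rng_units[OF y] k, symmetric])
  finally show ?thesis .
qed

text \<open>
  Let \<open>\<psi> = L(f)\<phi>\<close>, where \<open>\<lambda>(f) = 1\<close> on the units that matter and \<open>\<phi>\<close> is approximately invariant for \<open>f\<close> and for a finite net
  \<open>Hs\<close> of left translates of \<open>f\<close>. For \<open>y \<in> C\<close> let \<open>h \<in> Hs\<close> be close to the translate \<open>a\<close> of \<open>f\<close> by \<open>y\<close>. On the fibre over the range of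
  \<open>y\<close>, the translate of \<open>\<psi>\<close> is \<open>L(a)\<phi>\<close>, and passing from there through \<open>L(h)\<phi>\<close>, \<open>\<lambda>(h)\<phi>\<close> and \<open>\<phi>\<close> to \<open>\<psi>\<close> costs at most \<open>\<delta>\<close> in the
  \<open>L\<^sup>1\<close>-norm at each step.
\<close>

lemma mean_imp_almost_invariant:
  fixes \<epsilon> :: real
  assumes m: "topological_invariant_mean G lam H mu m"
    and C: "compactin (top_of G) C" and Ku: "compactin (unit_top G) Ku" and \<epsilon>: "0 < \<epsilon>"
  obtains \<psi> where "\<psi> \<in> Cc (quot_top G H)" "\<And>w. 0 \<le> \<psi> w" "\<And>u. u \<in> units G \<Longrightarrow> (LINT w|mu u. \<psi> w) \<le> 1"
    "\<And>u. u \<in> Ku \<Longrightarrow> \<bar>(LINT w|mu u. \<psi> w) - 1\<bar> \<le> \<epsilon>"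
    "\<And>y. y \<in> C \<Longrightarrow> (LINT w:qfibre G H (rng G y)|mu (rng G y). \<bar>\<psi> (qact G (ginv G y) w) - \<psi> w\<bar>) \<le> \<epsilon>"
proof -
  define C0 where "C0 = Ku \<union> (rng G ` C \<union> src G ` C)"
  have C0: "compactin (unit_top G) C0" unfolding C0_def
    by (intro compactin_Un Ku image_compactin[OF C continuous_rng_unit] image_compactin[OF C continuous_src_unit])
  have C0U: "C0 \<subseteq> units G" using compactin_subset_topspace[OF C0] by (simp add: topspace_unit)
  have CG: "C \<subseteq> carr G" by (rule compactin_subset_topspace[OF C])
  obtain f :: "'a \<Rightarrow> real" where f: "f \<in> Cc (top_of G)" "\<And>x. 0 \<le> f x"
      "\<And>u. u \<in> units G \<Longrightarrow> (LINT x|lam u. f x) \<le> 1" "\<And>u. u \<in> C0 \<Longrightarrow> (LINT x|lam u. f x) = 1"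
    using normalized_function[OF C0] by metis
  obtain K where K: "compactin (top_of G) K"
    and fK: "\<And>y z. y \<in> C \<Longrightarrow> z \<in> fibre G (rng G y) \<Longrightarrow> z \<notin> K \<Longrightarrow> f (gmult G (ginv G y) z) = 0"
    and net: "\<And>\<epsilon>. 0 < \<epsilon> \<Longrightarrow> \<exists>Hs. finite Hs \<and> Hs \<subseteq> Cc (top_of G) \<and> (\<forall>h\<in>Hs. \<forall>z. z \<notin> K \<longrightarrow> h z = 0) \<and>
       (\<forall>y\<in>C. \<exists>h\<in>Hs. \<forall>z\<in>fibre G (rng G y). \<bar>f (gmult G (ginv G y) z) - h z\<bar> \<le> \<epsilon>)"
    by (rule left_translates_net[OF f(1) C]) (rule that)
  \<comment> \<open>\<open>B\<close> bounds the mass of \<open>K\<close> in all fibres, so functions that vanish off \<open>K\<close> and are \<open>\<delta> / B\<close> close are \<open>\<delta>\<close> close in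
      \<open>L\<^sup>1\<close>.\<close>
  obtain \<kappa> :: "'a \<Rightarrow> real" where \<kappa>: "\<kappa> \<in> Cc (top_of G)" "\<And>z. 0 \<le> \<kappa> z" "\<And>z. z \<in> K \<Longrightarrow> \<kappa> z = 1"
    using GX.Cc_Urysohn[OF K openin_topspace compactin_subset_topspace[OF K]] by metis
  obtain B where B: "B > 0" "\<And>u. u \<in> units G \<Longrightarrow> (LINT z|lam u. \<kappa> z) \<le> B"
  proof -
    obtain B where B: "B > 0" "\<And>u. u \<in> topspace (unit_top G) \<Longrightarrow> (LINT z|lam u. norm (\<kappa> z)) \<le> B"
      using L.integral_norm_bounded[OF \<kappa>(1)] by metis
    have "(LINT z|lam u. \<kappa> z) \<le> B" if "u \<in> units G" for u using B(2)[of u] that \<kappa>(2) by (simp add: topspace_unit)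
    then show ?thesis using that B(1) by blast
  qed
  \<comment> \<open>Four errors of size \<open>\<delta>\<close> will add up to at most \<open>\<epsilon>\<close>.\<close>
  define \<delta> where "\<delta> = \<epsilon> / 8"
  have \<delta>: "\<delta> > 0" using \<epsilon> by (simp add: \<delta>_def)
  have \<delta>B: "0 < \<delta> / B" using \<delta> B(1) by simp
  obtain Hs where H: "finite Hs \<and> Hs \<subseteq> Cc (top_of G) \<and> (\<forall>h\<in>Hs. \<forall>z. z \<notin> K \<longrightarrow> h z = 0) \<and>
       (\<forall>y\<in>C. \<exists>h\<in>Hs. \<forall>z\<in>fibre G (rng G y). \<bar>f (gmult G (ginv G y) z) - h z\<bar> \<le> \<delta> / B)"
    by (rule exE[OF net[OF \<delta>B]])
  have Hs: "finite Hs" "Hs \<subseteq> Cc (top_of G)" by (rule conjunct1[OF H], rule conjunct1[OF conjunct2[OF H]])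
  have HsK: "h z = 0" if "h \<in> Hs" "z \<notin> K" for h z using conjunct1[OF conjunct2[OF conjunct2[OF H]]] that by simp
  have near: "\<exists>h\<in>Hs. \<forall>z\<in>fibre G (rng G y). \<bar>f (gmult G (ginv G y) z) - h z\<bar> \<le> \<delta> / B" if "y \<in> C" for y
    by (rule bspec[OF conjunct2[OF conjunct2[OF conjunct2[OF H]]] that])
  have Hs': "finite (insert f Hs)" "insert f Hs \<subseteq> Cc (top_of G)" using Hs(1,2) f(1) by auto
  obtain \<phi> where \<phi>: "\<phi> \<in> Cc (quot_top G H)" "\<And>w. 0 \<le> \<phi> w" "\<And>u. u \<in> units G \<Longrightarrow> (LINT w|mu u. \<phi> w) \<le> 1"
      "\<And>u. u \<in> C0 \<Longrightarrow> 1 - \<delta> \<le> (LINT w|mu u. \<phi> w)"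
    and def: "\<And>h u. h \<in> insert f Hs \<Longrightarrow> u \<in> units G \<Longrightarrow> (LINT w|mu u. \<bar>defect h \<phi> w\<bar>) \<le> \<delta>"
    by (rule approximate_invariance[OF m C0 Hs' \<delta>]) (rule that)
  have cf: "cplx f \<in> Cc (top_of G)" by (rule Cc_of_real[OF GX.Haus f(1)])
  have c\<phi>: "cplx \<phi> \<in> Cc (quot_top G H)" by (rule Cc_of_real[OF QX.Haus \<phi>(1)])
  have n\<phi>: "mu_norm G mu (cplx \<phi>) \<le> 1" by (rule mu_norm_least) (use \<phi>(2,3) in simp)
  define \<psi> where "\<psi> = (\<lambda>w. Re (L_op G lam H (cplx f) (cplx \<phi>) w))"
  have c\<psi>: "cplx \<psi> = L_op G lam H (cplx f) (cplx \<phi>)" unfolding \<psi>_def by (rule ext) (rule L_op_real[symmetric])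
  have LC: "L_op G lam H (cplx f) (cplx \<phi>) \<in> Cc (quot_top G H)" by (rule L_op_Cc[OF cf c\<phi>])
  have \<psi>C: "\<psi> \<in> Cc (quot_top G H)" unfolding \<psi>_def by (rule Cc_Re[OF QX.Haus LC])
  have \<psi>pos: "0 \<le> \<psi> w" for w
  proof (cases "w \<in> cosets G H")
    case True
    have "L_op G lam H (cplx f) (cplx \<phi>) w =
      complex_of_real (LINT y:fibre G (qrng G w)|lam (qrng G w). f y * \<phi> (qact G (ginv G y) w))"
      using True by (simp add: L_op_def flip: set_integral_complex_of_real)
    then have "\<psi> w = (LINT y:fibre G (qrng G w)|lam (qrng G w). f y * \<phi> (qact G (ginv G y) w))" by (simp add: \<psi>_def)
    also have "0 \<le> \<dots>" unfolding set_lebesgue_integral_def using f(2) \<phi>(2) by (intro integral_nonneg_AE) auto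
    finally show ?thesis .
  qed (simp add: \<psi>_def L_op_def)
  have \<psi>le: "(LINT w|mu u. \<psi> w) \<le> 1" if u: "u \<in> units G" for u
  proof -
    have "(LINT w|mu u. \<psi> w) = (LINT w|mu u. cmod (L_op G lam H (cplx f) (cplx \<phi>) w))"
      unfolding c\<psi>[symmetric] using \<psi>pos by simp
    also have "\<dots> \<le> mu_norm G mu (cplx \<phi>) * (LINT y|lam u. cmod (cplx f y))" by (rule L_op_bound[OF u cf c\<phi>])
    also have "(LINT y|lam u. cmod (cplx f y)) = (LINT y|lam u. f y)" using f(2) by simp
    also have "mu_norm G mu (cplx \<phi>) * (LINT y|lam u. f y) \<le> 1 * 1"
      using n\<phi> f(2) f(3)[OF u] by (intro mult_mono integral_nonneg_AE) auto
    finally show ?thesis by simp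
  qed
  have diff: "\<psi> w - \<phi> w = defect f \<phi> w" if "w \<in> qfibre G H u" "u \<in> C0" for u w
  proof -
    have "haar_int lam (cplx f) u = 1" using f(4)[OF that(2)] by (simp add: haar_int_def)
    then show ?thesis using that(1) by (simp add: defect_def \<psi>_def smult_def qfibre_def)
  qed
  have iC: "integrable (mu u) (\<lambda>w. \<bar>g w\<bar>)" if "u \<in> units G" "g \<in> Cc (quot_top G H)" for u and g :: "'a set \<Rightarrow> real"
    by (rule quot_fib(5)[OF that(1) Cc_abs[OF QX.Haus that(2)]])
  have dC: "defect h \<phi> \<in> Cc (quot_top G H)" if "h \<in> insert f Hs" for h
    by (rule defect_Cc[OF subsetD[OF Hs'(2) that] \<phi>(1)])
  show ?thesis
  proof (rule that[OF \<psi>C \<psi>pos \<psi>le])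
    fix u assume "u \<in> Ku"
    then have u: "u \<in> C0" "u \<in> units G" using C0U by (auto simp: C0_def)
    have "(LINT w|mu u. \<psi> w) - (LINT w|mu u. \<phi> w) = (LINT w|mu u. \<psi> w - \<phi> w)"
      using quot_fib(5)[OF u(2) \<psi>C] quot_fib(5)[OF u(2) \<phi>(1)] by simp
    also have "\<dots> = (LINT w|mu u. defect f \<phi> w)"
    proof (rule integral_cong_AE)
      show "AE w in mu u. \<psi> w - \<phi> w = defect f \<phi> w"
        using quot_fib(3)[OF u(2)] by eventually_elim (rule diff[OF _ u(1)])
      show "(\<lambda>w. \<psi> w - \<phi> w) \<in> borel_measurable (mu u)"
        by (rule borel_measurable_integrable[OF quot_fib(5)[OF u(2) Cc_diff[OF QX.Haus \<psi>C \<phi>(1)]]])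
      show "defect f \<phi> \<in> borel_measurable (mu u)"
        by (rule borel_measurable_integrable[OF quot_fib(5)[OF u(2) dC[OF insertI1]]])
    qed
    finally have "\<bar>(LINT w|mu u. \<psi> w) - (LINT w|mu u. \<phi> w)\<bar> \<le> \<delta>"
      using def[OF insertI1 u(2)] integral_abs_bound[of "mu u" "defect f \<phi>"] by linarith
    then show "\<bar>(LINT w|mu u. \<psi> w) - 1\<bar> \<le> \<epsilon>"
      using \<phi>(3)[OF u(2)] \<phi>(4)[OF u(1)] \<epsilon> unfolding \<delta>_def by linarith
  next
    fix y assume y: "y \<in> C"
    let ?u = "rng G y" and ?S = "qfibre G H (rng G y)"
    have yc: "y \<in> carr G" using y CG by auto
    have u: "?u \<in> units G" "?u \<in> C0" "src G y \<in> C0" using rng_units[OF yc] y by (auto simp: C0_def)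
    obtain h where h: "h \<in> Hs" "\<And>z. z \<in> fibre G ?u \<Longrightarrow> \<bar>f (gmult G (ginv G y) z) - h z\<bar> \<le> \<delta> / B"
      using near[OF y] by blast
    have hC: "h \<in> Cc (top_of G)" using h(1) Hs(2) by auto
    have ch: "cplx h \<in> Cc (top_of G)" by (rule Cc_of_real[OF GX.Haus hC])
    obtain a where a: "a \<in> Cc (top_of G)" "\<And>z. z \<in> fibre G ?u \<Longrightarrow> a z = cplx f (gmult G (ginv G y) z)"
    proof (rule haar_fib(6)[OF u(1) left_translate_continuous[OF Cc_continuous[OF cf] yc] K])
      show "cplx f (gmult G (ginv G y) z) = 0" if "z \<in> fibre G ?u" "z \<notin> K" for z using fK[OF y that] by simp
    qed (rule that)
    have ah: "(\<lambda>z. a z - cplx h z) \<in> Cc (top_of G)" by (rule Cc_diff[OF GX.Haus a(1) ch])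
    have dist: "(LINT z|lam ?u. cmod (a z - cplx h z)) \<le> \<delta>"
    proof -
      have "(LINT z|lam ?u. cmod (a z - cplx h z)) \<le> (LINT z|lam ?u. \<delta> / B * \<kappa> z)"
      proof (rule integral_mono_AE)
        show "integrable (lam ?u) (\<lambda>z. cmod (a z - cplx h z))" by (rule haar_fib(5)[OF u(1) Cc_norm[OF GX.Haus ah]])
        show "integrable (lam ?u) (\<lambda>z. \<delta> / B * \<kappa> z)" by (rule haar_fib(5)[OF u(1) Cc_scale[OF GX.Haus \<kappa>(1)]])
        show "AE z in lam ?u. cmod (a z - cplx h z) \<le> \<delta> / B * \<kappa> z"
          using haar_fib(3)[OF u(1)]
        proof eventually_elim
          case (elim z)
          have e: "cmod (a z - cplx h z) = \<bar>f (gmult G (ginv G y) z) - h z\<bar>"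
            unfolding a(2)[OF elim] by (simp flip: of_real_diff)
          show ?case
          proof (cases "z \<in> K")
            case True
            then show ?thesis unfolding e using h(2)[OF elim] \<kappa>(3)[OF True] by simp
          next
            case False
            then show ?thesis unfolding e using fK[OF y elim False] HsK[OF h(1) False] mult_nonneg_nonneg[OF less_imp_le[OF \<delta>B] \<kappa>(2)[of z]] by simp
          qed
        qed
      qed
      also have "\<dots> = \<delta> / B * (LINT z|lam ?u. \<kappa> z)" by simp
      also have "\<dots> \<le> \<delta> / B * B" using B(2)[OF u(1)] \<delta>B by (intro mult_left_mono) auto
      finally show ?thesis using B(1) by simp
    qed
    have a1: "(LINT z|lam ?u. a z) = 1"
      using integral_left_translate[OF yc a cf] f(4)[OF u(3)] by simp
    \<comment> \<open>\<open>\<lambda>(h)\<close> at this unit, close to \<open>1\<close> because the translate \<open>a\<close> has the same integral as \<open>f\<close>\<close>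
    define t where "t = (LINT z|lam ?u. h z)"
    have t1: "\<bar>t - 1\<bar> \<le> \<delta>"
    proof -
      have "complex_of_real (t - 1) = - (LINT z|lam ?u. a z - cplx h z)"
        using haar_fib(5)[OF u(1) a(1)] haar_fib(5)[OF u(1) ch] a1 by (simp add: t_def)
      then have "\<bar>t - 1\<bar> = cmod (LINT z|lam ?u. a z - cplx h z)" by (metis norm_minus_cancel norm_of_real real_norm_def)
      also have "\<dots> \<le> (LINT z|lam ?u. cmod (a z - cplx h z))" by (rule integral_norm_bound)
      finally show ?thesis using dist by simp
    qed
    obtain g where g: "g \<in> Cc (quot_top G H)" "\<And>w. w \<in> ?S \<Longrightarrow> g w = cplx \<psi> (qact G (ginv G y) w)"
      using translate_extension[OF yc Cc_of_real[OF QX.Haus \<psi>C]] by metis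
    let ?Lh = "L_op G lam H (cplx h) (cplx \<phi>)"
    \<comment> \<open>the error of replacing \<open>a\<close> by \<open>h\<close>\<close>
    define \<theta> where "\<theta> = (\<lambda>w. g w - ?Lh w)"
    have \<theta>C: "\<theta> \<in> Cc (quot_top G H)" unfolding \<theta>_def by (rule Cc_diff[OF QX.Haus g(1) L_op_Cc[OF ch c\<phi>]])
    have "(LINT w|mu ?u. cmod (\<theta> w)) \<le> mu_norm G mu (cplx \<phi>) * (LINT z|lam ?u. cmod (a z - cplx h z))"
    proof (rule kernel_bound[OF u(1) ah c\<phi> \<theta>C])
      fix w assume w: "w \<in> ?S"
      then have wc: "w \<in> cosets G H" "qrng G w = ?u" by (auto simp: qfibre_def)
      have i: "set_integrable (lam ?u) (fibre G ?u) (\<lambda>z. a z * cplx \<phi> (qact G (ginv G z) w))"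
        "set_integrable (lam ?u) (fibre G ?u) (\<lambda>z. cplx h z * cplx \<phi> (qact G (ginv G z) w))"
        using kernel_integrable[OF a(1) Cc_continuous[OF c\<phi>] wc(1)] kernel_integrable[OF ch Cc_continuous[OF c\<phi>] wc(1)] wc(2)
        by simp_all
      have "g w = (LINT z:fibre G ?u|lam ?u. a z * cplx \<phi> (qact G (ginv G z) w))"
        unfolding g(2)[OF w] using fun_cong[OF c\<psi>] L_op_left_translate[OF yc a c\<phi> w] by simp
      then show "\<theta> w = (LINT z:fibre G ?u|lam ?u. (a z - cplx h z) * cplx \<phi> (qact G (ginv G z) w))"
        using i L_op_fibre[OF w, of "cplx h" "cplx \<phi>"] by (simp add: \<theta>_def left_diff_distrib set_integral_diff)
    qed
    also have "\<dots> \<le> 1 * \<delta>" using n\<phi> dist by (intro mult_mono) auto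
    finally have \<theta>le: "(LINT w|mu ?u. cmod (\<theta> w)) \<le> \<delta>" by simp
    have ineq: "\<bar>\<psi> (qact G (ginv G y) w) - \<psi> w\<bar> \<le> cmod (\<theta> w) + \<bar>defect h \<phi> w\<bar> + \<delta> * \<bar>\<phi> w\<bar> + \<bar>defect f \<phi> w\<bar>"
      if w: "w \<in> ?S" for w
    proof -
      have "haar_int lam (cplx h) ?u = complex_of_real t" by (simp add: haar_int_def t_def)
      then have dh: "complex_of_real (defect h \<phi> w) = ?Lh w - complex_of_real (t * \<phi> w)"
        using w defect_complex[of h \<phi> w] by (simp add: smult_def qfibre_def)
      have "complex_of_real (\<psi> (qact G (ginv G y) w) - \<psi> w) =
         \<theta> w + complex_of_real (defect h \<phi> w) + complex_of_real ((t - 1) * \<phi> w) - complex_of_real (defect f \<phi> w)"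
        unfolding dh diff[OF w u(2), symmetric] \<theta>_def g(2)[OF w] by (simp add: algebra_simps)
      then have "\<bar>\<psi> (qact G (ginv G y) w) - \<psi> w\<bar> =
         cmod (\<theta> w + complex_of_real (defect h \<phi> w) + complex_of_real ((t - 1) * \<phi> w) - complex_of_real (defect f \<phi> w))"
        by (metis norm_of_real real_norm_def)
      also have "\<dots> \<le> cmod (\<theta> w) + cmod (complex_of_real (defect h \<phi> w)) + cmod (complex_of_real ((t - 1) * \<phi> w)) + cmod (complex_of_real (defect f \<phi> w))"
        by (intro order_trans[OF norm_triangle_ineq4] add_right_mono order_trans[OF norm_triangle_ineq] order_refl)
      also have "\<dots> \<le> cmod (\<theta> w) + \<bar>defect h \<phi> w\<bar> + \<delta> * \<bar>\<phi> w\<bar> + \<bar>defect f \<phi> w\<bar>"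
        using mult_right_mono[OF t1, of "\<bar>\<phi> w\<bar>"] by (simp only: norm_of_real abs_mult) simp
      finally show ?thesis .
    qed
    have kC: "(\<lambda>w. cmod (g w - cplx \<psi> w)) \<in> Cc (quot_top G H)"
      by (intro Cc_norm Cc_diff Cc_of_real QX.Haus g(1) \<psi>C)
    have ke: "cmod (g w - cplx \<psi> w) = \<bar>\<psi> (qact G (ginv G y) w) - \<psi> w\<bar>" if "w \<in> ?S" for w
      unfolding g(2)[OF that] by (simp flip: of_real_diff)
    have i1: "integrable (mu ?u) (\<lambda>w. cmod (\<theta> w))" by (rule quot_fib(5)[OF u(1) Cc_norm[OF QX.Haus \<theta>C]])
    have i2: "integrable (mu ?u) (\<lambda>w. \<bar>defect h \<phi> w\<bar>)" by (rule iC[OF u(1) dC]) (simp add: h(1))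
    have i3: "integrable (mu ?u) (\<lambda>w. \<delta> * \<bar>\<phi> w\<bar>)" using iC[OF u(1) \<phi>(1)] by simp
    have i4: "integrable (mu ?u) (\<lambda>w. \<bar>defect f \<phi> w\<bar>)" by (rule iC[OF u(1) dC]) simp
    have "(LINT w:?S|mu ?u. \<bar>\<psi> (qact G (ginv G y) w) - \<psi> w\<bar>) = (LINT w|mu ?u. cmod (g w - cplx \<psi> w))"
      by (rule quot_fib(7)[OF u(1) kC ke])
    also have "\<dots> \<le> (LINT w|mu ?u. cmod (\<theta> w) + \<bar>defect h \<phi> w\<bar> + \<delta> * \<bar>\<phi> w\<bar> + \<bar>defect f \<phi> w\<bar>)"
    proof (rule integral_mono_AE[OF quot_fib(5)[OF u(1) kC]])
      show "AE w in mu ?u. cmod (g w - cplx \<psi> w) \<le> cmod (\<theta> w) + \<bar>defect h \<phi> w\<bar> + \<delta> * \<bar>\<phi> w\<bar> + \<bar>defect f \<phi> w\<bar>"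
        using quot_fib(3)[OF u(1)]
      proof eventually_elim
        case (elim w)
        then show ?case using ineq[OF elim] ke[OF elim] by simp
      qed
    qed (intro Bochner_Integration.integrable_add i1 i2 i3 i4)
    also have "\<dots> = (LINT w|mu ?u. cmod (\<theta> w)) + (LINT w|mu ?u. \<bar>defect h \<phi> w\<bar>) + \<delta> * (LINT w|mu ?u. \<bar>\<phi> w\<bar>) + (LINT w|mu ?u. \<bar>defect f \<phi> w\<bar>)"
      using i1 i2 i3 i4 by simp
    also have "\<dots> \<le> \<delta> + \<delta> + \<delta> * 1 + \<delta>"
      using \<theta>le def[OF insertI2[OF h(1)] u(1)] def[OF insertI1 u(1)] \<phi>(2) \<phi>(3)[OF u(1)] \<delta>
      by (intro add_mono mult_left_mono) auto
    also have "\<dots> \<le> \<epsilon>" using \<epsilon> by (simp add: \<delta>_def)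
    finally show "(LINT w:?S|mu ?u. \<bar>\<psi> (qact G (ginv G y) w) - \<psi> w\<bar>) \<le> \<epsilon>" .
  qed
qed

lemma mean_imp_density:
  assumes m: "topological_invariant_mean G lam H mu m"
  shows "\<exists>f. topological_approximate_invariant_density G H mu f"
proof -
  have sc: "second_countable (unit_top G)" unfolding unit_top_def by (rule second_countable_subtopology[OF second_countable_top])
  obtain D where D: "(\<forall>n. compactin (unit_top G) (D n)) \<and> (\<forall>K. compactin (unit_top G) K \<longrightarrow> (\<exists>n. \<forall>i\<ge>n. K \<subseteq> D (i::nat)))"
    by (rule exE[OF UX.compact_exhaustion[OF sc]])
  obtain C where C: "(\<forall>n. compactin (top_of G) (C n)) \<and> (\<forall>K. compactin (top_of G) K \<longrightarrow> (\<exists>n. \<forall>i\<ge>n. K \<subseteq> C (i::nat)))"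
    by (rule exE[OF GX.compact_exhaustion[OF second_countable_top]])
  define good where "good = (\<lambda>n::nat. \<lambda>\<psi>. \<psi> \<in> Cc (quot_top G H) \<and> (\<forall>w. 0 \<le> \<psi> w) \<and> (\<forall>u\<in>units G. (LINT w|mu u. \<psi> w) \<le> 1) \<and>
    (\<forall>u\<in>D n. \<bar>(LINT w|mu u. \<psi> w) - 1\<bar> \<le> 1 / real (Suc n)) \<and>
    (\<forall>y\<in>C n. (LINT w:qfibre G H (rng G y)|mu (rng G y). \<bar>\<psi> (qact G (ginv G y) w) - \<psi> w\<bar>) \<le> 1 / real (Suc n)))"
  have "\<exists>\<psi>. good n \<psi>" for n
  proof -
    have n: "0 < 1 / real (Suc n)" by simp
    show ?thesis
    proof (rule mean_imp_almost_invariant[OF m spec[OF conjunct1[OF C], of n] spec[OF conjunct1[OF D], of n] n])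
      fix \<psi> :: "'a set \<Rightarrow> real"
      assume "\<psi> \<in> Cc (quot_top G H)" "\<And>w. 0 \<le> \<psi> w" "\<And>u. u \<in> units G \<Longrightarrow> (LINT w|mu u. \<psi> w) \<le> 1"
        "\<And>u. u \<in> D n \<Longrightarrow> \<bar>(LINT w|mu u. \<psi> w) - 1\<bar> \<le> 1 / real (Suc n)"
        "\<And>y. y \<in> C n \<Longrightarrow> (LINT w:qfibre G H (rng G y)|mu (rng G y). \<bar>\<psi> (qact G (ginv G y) w) - \<psi> w\<bar>) \<le> 1 / real (Suc n)"
      then have "good n \<psi>" unfolding good_def by (intro conjI ballI allI)
      then show ?thesis by (rule exI[of "good n"])
    qed
  qed
  then obtain \<psi> where \<psi>: "\<And>n. good n (\<psi> n)" by metis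
  have small: "\<exists>N. \<forall>n\<ge>N. 1 / real (Suc n) < e" if e: "0 < e" for e :: real
  proof -
    obtain N where N: "inverse (real (Suc N)) < e" using reals_Archimedean[OF e] by blast
    have "1 / real (Suc n) < e" if "n \<ge> N" for n
    proof -
      have "1 / real (Suc n) \<le> 1 / real (Suc N)" using that by (simp add: field_simps)
      then show ?thesis using N by (simp add: inverse_eq_divide)
    qed
    then show ?thesis by blast
  qed
  have "topological_approximate_invariant_density G H mu \<psi>"
    unfolding topological_approximate_invariant_density_def
  proof (intro conjI allI impI ballI)
    show "\<psi> n \<in> Cc (quot_top G H)" "0 \<le> \<psi> n w" for n w using \<psi>[of n] by (auto simp: good_def)
    show "(LINT w|mu u. \<psi> n w) \<le> 1" if "u \<in> units G" for n u using \<psi>[of n] that by (auto simp: good_def)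
    show "uniform_limit K (\<lambda>i u. LINT w|mu u. \<psi> i w) (\<lambda>u. 1) sequentially" if "compactin (unit_top G) K" for K
    proof (rule uniform_limitI)
      fix e :: real assume e: "0 < e"
      obtain N where N: "\<And>n. n \<ge> N \<Longrightarrow> 1 / real (Suc n) < e" using small[OF e] by blast
      obtain N' where N': "\<And>n. n \<ge> N' \<Longrightarrow> K \<subseteq> D n" using mp[OF spec[OF conjunct2[OF D]] \<open>compactin (unit_top G) K\<close>] by blast
      have "dist (LINT w|mu u. \<psi> n w) 1 < e" if "n \<ge> max N N'" "u \<in> K" for n u
      proof -
        have "\<bar>(LINT w|mu u. \<psi> n w) - 1\<bar> \<le> 1 / real (Suc n)" using \<psi>[of n] N'[of n] that by (auto simp: good_def)
        then show ?thesis using N[of n] that by (simp add: dist_real_def)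
      qed
      then show "\<forall>\<^sub>F n in sequentially. \<forall>u\<in>K. dist (LINT w|mu u. \<psi> n w) 1 < e"
        unfolding eventually_sequentially by blast
    qed
    show "uniform_limit K (\<lambda>i y. LINT w:qfibre G H (rng G y)|mu (rng G y). \<bar>\<psi> i (qact G (ginv G y) w) - \<psi> i w\<bar>) (\<lambda>y. 0) sequentially"
      if "compactin (top_of G) K" for K
    proof (rule uniform_limitI)
      fix e :: real assume e: "0 < e"
      obtain N where N: "\<And>n. n \<ge> N \<Longrightarrow> 1 / real (Suc n) < e" using small[OF e] by blast
      obtain N' where N': "\<And>n. n \<ge> N' \<Longrightarrow> K \<subseteq> C n" using mp[OF spec[OF conjunct2[OF C]] \<open>compactin (top_of G) K\<close>] by blast
      have "dist (LINT w:qfibre G H (rng G y)|mu (rng G y). \<bar>\<psi> n (qact G (ginv G y) w) - \<psi> n w\<bar>) 0 < e" (is "dist ?J 0 < e")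
        if "n \<ge> max N N'" "y \<in> K" for n y
      proof -
        have "?J \<le> 1 / real (Suc n)" using \<psi>[of n] N'[of n] that unfolding good_def by fastforce
        moreover have "0 \<le> ?J" unfolding set_lebesgue_integral_def by (intro integral_nonneg_AE) auto
        ultimately show ?thesis using N[of n] that by (simp add: dist_real_def)
      qed
      then show "\<forall>\<^sub>F n in sequentially. \<forall>y\<in>K. dist (LINT w:qfibre G H (rng G y)|mu (rng G y). \<bar>\<psi> n (qact G (ginv G y) w) - \<psi> n w\<bar>) 0 < e"
        unfolding eventually_sequentially by blast
    qed
  qed
  then show ?thesis by blast
qed

end

text \<open>
  Over an empty unit space there is no probability measure, so the normalisation of a mean is vacuous, and the
  conditions on a density concern empty sets only.
\<close>

lemma (in groupoid_quotient) empty_mean_and_density: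
  assumes U: "units G = {}"
  shows "topological_invariant_mean G lam H mu (\<lambda>\<nu>. 0)"
    and "topological_approximate_invariant_density G H mu (\<lambda>i w. 0)"
proof -
  have ut: "topspace (unit_top G) = {}" using topspace_unit U by simp
  have ct: "carr G = {}" using U unfolding units_def by simp
  show "topological_invariant_mean G lam H mu (\<lambda>\<nu>. 0)"
    unfolding topological_invariant_mean_def
  proof (intro conjI ballI allI impI)
    show "(\<lambda>\<nu>. 0) \<in> E_bidual G H mu" unfolding E_bidual_def dual_def by (auto intro!: exI[of _ 0])
    fix eta assume "unit_prob G eta"
    then have "sets eta = sets (borel_of (unit_top G))" "emeasure eta (space eta) = 1" by (auto simp: unit_prob_def)
    moreover then have "space eta = {}" using sets_eq_imp_space_eq[of eta "borel_of (unit_top G)"] ut by simp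
    ultimately show "(0::complex) = 1" by simp
  next
    fix f :: "'g \<Rightarrow> complex"
    show "conv_bidual G lam H mu f (\<lambda>\<nu>. 0) = smult_bidual G H mu (haar_int lam f) (\<lambda>\<nu>. 0)"
      by (simp add: conv_bidual_def smult_bidual_def transpose_on_def)
  qed simp
  show "topological_approximate_invariant_density G H mu (\<lambda>i w. 0)"
    unfolding topological_approximate_invariant_density_def
  proof (intro conjI allI impI ballI)
    show "(\<lambda>w. 0::real) \<in> Cc (quot_top G H)" by (rule Cc_zero[OF QX.Haus])
    show "uniform_limit K (\<lambda>i u. LINT w|mu u. (0::real)) (\<lambda>u. 1) sequentially" if "compactin (unit_top G) K" for K
    proof -
      have "K = {}" using compactin_subset_topspace[OF that] ut by simp
      then show ?thesis by simp
    qed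
    show "uniform_limit K (\<lambda>i y. LINT w:qfibre G H (rng G y)|mu (rng G y). \<bar>(0::real) - 0\<bar>) (\<lambda>y. 0) sequentially" for K
      by (simp add: set_lebesgue_integral_def uniform_limit_const)
  qed auto
qed

section \<open>The equivalence\<close>

theorem theorem4p2:
  fixes G :: "'g groupoid"
    and H :: "'g set"
    and lam lamH :: "'g \<Rightarrow> 'g measure"
    and mu :: "'g \<Rightarrow> 'g set measure"
  assumes "topological_groupoid G"
    and "haar_system G lam"
    and "closed_wide_subgroupoid G H"
    and "haar_system (subgroupoid G H) lamH"
    and "full_equivariant_measure_system G H mu"
  shows "(\<exists>m. topological_invariant_mean G lam H mu m) \<longleftrightarrow>
         (\<exists>f. topological_approximate_invariant_density G H mu f)"
proof -
  interpret topological_groupoid G by (rule assms)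
  interpret groupoid_quotient G H lam lamH mu by unfold_locales (rule assms)+
  show ?thesis
  proof (cases "units G = {}")
    case True
    then show ?thesis using empty_mean_and_density by blast
  next
    case False
    then interpret inhabited_groupoid_quotient G H lam lamH mu by unfold_locales
    show ?thesis using density_imp_mean mean_imp_density by blast
  qed
qed

end
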